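(* Let $A$ be a dilation on $\mathbb{R}^n$ and $p(\cdot)\in C^{\log}(\mathbb{R}^n)$. If $p_-\in(1,\infty)$ and $q\in(0,\infty]$, then $H_A^{p(\cdot),q}(\mathbb{R}^n)=L^{p(\cdot),q}(\mathbb{R}^n)$ with equivalent quasi-norms.
   Context: Dilations. A dilation (expansive matrix) is a real $n\times n$ matrix $A$ all of whose eigenvalues $\lambda\in\sigma(A)$ satisfy $|\lambda|>1$; put $b:=|\det A|>1$. Fix $\lambda_-$ with $1<\lambda_-<\min\{|\lambda|:\lambda\in\sigma(A)\}$ (if $A$ is diagonalizable over $\mathbb{C}$ one may take $\lambda_-=\min\{|\lambda|:\lambda\in\sigma(A)\}$). Fix an open ellipsoid $\Delta$ (centred at the origin) and $r\in(1,\infty)$ with $|\Delta|=1$ and $\Delta\subset r\Delta\subset A\Delta$; for $k\in\mathbb{Z}$ let $B_k:=A^k\Delta$, so $|B_k|=b^k$. The step homogeneous quasi-norm is $\rho(x):=\sum_{j\in\mathbb{Z}}b^j\chi_{B_{j+1}\setminus B_j}(x)$ for $x\ne 0$, and $\rho(0):=0$. Variable exponents. For a measurable $p(\cdot):\mathbb{R}^n\to(0,\infty)$ let $p_-:=\operatorname{ess\,inf}p$, $p_+:=\operatorname{ess\,sup}p$, $\underline{p}:=\min\{p_-,1\}$. $\mathcal{P}(\mathbb{R}^n)$ is the set of such $p(\cdot)$ with $0<p_-\le p_+<\infty$. $\|f\|_{L^{p(\cdot)}(\mathbb{R}^n)}:=\inf\{\lambda>0:\int_{\mathbb{R}^n}(|f(x)|/\lambda)^{p(x)}dx\le1\}$.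 $C^{\log}(\mathbb{R}^n)$ is the set of $p(\cdot)\in\mathcal{P}(\mathbb{R}^n)$ for which there are constants $C_{\log}(p),C_\infty>0$ and $p_\infty\in\mathbb{R}$ such that, for all $x,y$, $|p(x)-p(y)|\le C_{\log}(p)/\log(e+1/\rho(x-y))$ and $|p(x)-p_\infty|\le C_\infty/\log(e+\rho(x))$. Variable Lorentz space. $L^{p(\cdot),q}(\mathbb{R}^n)$ is the set of measurable $f$ with finite $\|f\|_{L^{p(\cdot),q}(\mathbb{R}^n)}:=\left[\int_0^\infty\lambda^q\|\chi_{\{x:|f(x)|>\lambda\}}\|_{L^{p(\cdot)}(\mathbb{R}^n)}^q\frac{d\lambda}{\lambda}\right]^{1/q}$ if $q<\infty$, and $\sup_{\lambda>0}\lambda\|\chi_{\{x:|f(x)|>\lambda\}}\|_{L^{p(\cdot)}(\mathbb{R}^n)}$ if $q=\infty$. Functions are identified with the tempered distributions they define. Anisotropic variable Hardy-Lorentz space. For $\varphi\in\mathcal{S}(\mathbb{R}^n)$ and $k\in\mathbb{Z}$, $\varphi_k(x):=b^{-k}\varphi(A^{-k}x)$. For $N\in\mathbb{N}$, $\mathcal{S}_N(\mathbb{R}^n):=\{\varphi\in\mathcal{S}(\mathbb{R}^n):\sup_x[\rho(x)]^\ell|\partial^\alpha\varphi(x)|\le1\text{ for all }|\alpha|\le N,\ 0\le\ell\le N\}$, and for $f\in\mathcal{S}'(\mathbb{R}^n)$ the radial grand maximal function is $M_N^0(f)(x):=\sup_{\varphi\in\mathcal{S}_N(\mathbb{R}^n)}\sup_{k\in\mathbb{Z}}|f*\varphi_k(x)|$.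 For a fixed integer $N\ge\lfloor(\frac1{\underline{p}}-1)\frac{\ln b}{\ln\lambda_-}\rfloor+2$, $H_A^{p(\cdot),q}(\mathbb{R}^n):=\{f\in\mathcal{S}'(\mathbb{R}^n):M_N^0(f)\in L^{p(\cdot),q}(\mathbb{R}^n)\}$ with $\|f\|_{H_A^{p(\cdot),q}(\mathbb{R}^n)}:=\|M_N^0(f)\|_{L^{p(\cdot),q}(\mathbb{R}^n)}$. *)

theory Defs
  imports "HOL-Analysis.Analysis" "HOL-Probability.Essential_Supremum"
begin

section \<open>Dilations and the step homogeneous quasi-norm\<close>

definition complex_spectrum :: "real^'n^'n \<Rightarrow> complex set" where
  "complex_spectrum A = {z. \<exists>v::complex^'n. v \<noteq> 0 \<and> map_matrix complex_of_real A *v v = z *s v}"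

definition dilation :: "real^'n^'n \<Rightarrow> bool" where
  "dilation A \<longleftrightarrow> (\<forall>z\<in>complex_spectrum A. 1 < cmod z)"

definition complex_diagonalizable :: "real^'n^'n \<Rightarrow> bool" where
  "complex_diagonalizable A \<longleftrightarrow>
     (\<exists>P D::complex^'n^'n. invertible P \<and> (\<forall>i j. i \<noteq> j \<longrightarrow> D $ i $ j = 0) \<and>
        map_matrix complex_of_real A = P ** D ** matrix_inv P)"

text \<open>Strictly below the minimal modulus of the eigenvalues; equality with the minimum
  is also allowed if the matrix is diagonalizable over the complex numbers.\<close>

definition admissible_lambda_minus :: "real^'n^'n \<Rightarrow> real \<Rightarrow> bool" where
  "admissible_lambda_minus A lm \<longleftrightarrow> 1 < lm \<and>
     ((\<forall>z\<in>complex_spectrum A. lm < cmod z) \<or>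
      (complex_diagonalizable A \<and> (\<forall>z\<in>complex_spectrum A. lm \<le> cmod z)))"

definition open_ellipsoid :: "(real^'n) set \<Rightarrow> bool" where
  "open_ellipsoid E \<longleftrightarrow> (\<exists>P::real^'n^'n. invertible P \<and> E = {x. norm (P *v x) < 1})"

definition dilation_ellipsoid :: "real^'n^'n \<Rightarrow> (real^'n) set \<Rightarrow> real \<Rightarrow> bool" where
  "dilation_ellipsoid A \<Delta> r \<longleftrightarrow> open_ellipsoid \<Delta> \<and> 1 < r \<and> emeasure lebesgue \<Delta> = 1 \<and>
     \<Delta> \<subseteq> (*\<^sub>R) r ` \<Delta> \<and> (*\<^sub>R) r ` \<Delta> \<subseteq> (*v) A ` \<Delta>"

definition dilation_factor :: "real^'n^'n \<Rightarrow> real" where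
  "dilation_factor A = \<bar>det A\<bar>"

text \<open>The action of the integer matrix power \<open>A\<^sup>k\<close>; the operator \<open>^\<close> on the vector type would be
  taken componentwise.\<close>

definition matrix_powi_apply :: "real^'n^'n \<Rightarrow> int \<Rightarrow> real^'n \<Rightarrow> real^'n" where
  "matrix_powi_apply A k =
     (if 0 \<le> k then ((*v) A) ^^ nat k else ((*v) (matrix_inv A)) ^^ nat (- k))"

definition dilated_ball :: "real^'n^'n \<Rightarrow> (real^'n) set \<Rightarrow> int \<Rightarrow> (real^'n) set" where
  "dilated_ball A \<Delta> k = matrix_powi_apply A k ` \<Delta>"

definition step_norm :: "real^'n^'n \<Rightarrow> (real^'n) set \<Rightarrow> real^'n \<Rightarrow> real" where
  "step_norm A \<Delta> x =
     (if x = 0 then 0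
      else \<Sum>\<^sub>\<infinity>j\<in>(UNIV::int set). dilation_factor A powi j *
             indicator (dilated_ball A \<Delta> (j + 1) - dilated_ball A \<Delta> j) x)"


section \<open>Variable exponents\<close>

definition p_plus :: "(real^'n \<Rightarrow> real) \<Rightarrow> ereal" where
  "p_plus p = esssup lebesgue (\<lambda>x. ereal (p x))"

text \<open>The essential infimum of \<open>p\<close>.\<close>

definition p_minus :: "(real^'n \<Rightarrow> real) \<Rightarrow> ereal" where
  "p_minus p = - esssup lebesgue (\<lambda>x. - ereal (p x))"

definition p_underline :: "(real^'n \<Rightarrow> real) \<Rightarrow> real" where
  "p_underline p = real_of_ereal (min (p_minus p) 1)"

definition variable_exponents :: "(real^'n \<Rightarrow> real) set" where
  "variable_exponents = {p. p \<in> borel_measurable lebesgue \<and> (\<forall>x. 0 < p x) \<and>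
     0 < p_minus p \<and> p_minus p \<le> p_plus p \<and> p_plus p < \<infinity>}"

text \<open>For \<open>x = y\<close> the convention \<open>1 / 0 = 0\<close> makes the first condition trivially true.\<close>

definition C_log :: "real^'n^'n \<Rightarrow> (real^'n) set \<Rightarrow> (real^'n \<Rightarrow> real) set" where
  "C_log A \<Delta> = {p \<in> variable_exponents.
     \<exists>Clog Cinf pinf. 0 < Clog \<and> 0 < Cinf \<and>
       (\<forall>x y. \<bar>p x - p y\<bar> \<le> Clog / ln (exp 1 + 1 / step_norm A \<Delta> (x - y))) \<and>
       (\<forall>x. \<bar>p x - pinf\<bar> \<le> Cinf / ln (exp 1 + step_norm A \<Delta> x))}"

definition var_Lebesgue_norm ::
    "(real^'n \<Rightarrow> real) \<Rightarrow> (real^'n \<Rightarrow> 'b::real_normed_vector) \<Rightarrow> ennreal" where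
  "var_Lebesgue_norm p f =
     Inf {ennreal l | l. 0 < l \<and> (\<integral>\<^sup>+x. ennreal ((norm (f x) / l) powr p x) \<partial>lebesgue) \<le> 1}"


section \<open>Variable Lorentz spaces\<close>

text \<open>Powers with a positive real exponent on \<open>[0,\<infinity>]\<close>.\<close>

definition ennreal_powr :: "ennreal \<Rightarrow> real \<Rightarrow> ennreal" where
  "ennreal_powr x a = (if x = \<infinity> then \<infinity> else ennreal (enn2real x powr a))"

text \<open>The quasi-norm only depends on the absolute value of a function; it is defined on
  \<open>[0,\<infinity>]\<close>-valued functions so that it also applies to maximal functions.\<close>

definition var_Lorentz_qnorm ::
    "(real^'n \<Rightarrow> real) \<Rightarrow> ennreal \<Rightarrow> (real^'n \<Rightarrow> ennreal) \<Rightarrow> ennreal" where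
  "var_Lorentz_qnorm p q F =
     (let level = (\<lambda>l::real. var_Lebesgue_norm p (indicator {x. ennreal l < F x} :: real^'n \<Rightarrow> real))
      in if q = \<infinity> then (SUP l\<in>{0<..}. ennreal l * level l)
         else ennreal_powr
           (\<integral>\<^sup>+l\<in>{0<..}. (ennreal (l powr enn2real q) * ennreal_powr (level l) (enn2real q) / ennreal l) \<partial>lborel)
           (1 / enn2real q))"

definition var_Lorentz_finite ::
    "(real^'n \<Rightarrow> real) \<Rightarrow> ennreal \<Rightarrow> (real^'n \<Rightarrow> ennreal) \<Rightarrow> bool" where
  "var_Lorentz_finite p q F \<longleftrightarrow> F \<in> borel_measurable lebesgue \<and> var_Lorentz_qnorm p q F < \<infinity>"

definition var_Lorentz_norm ::
    "(real^'n \<Rightarrow> real) \<Rightarrow> ennreal \<Rightarrow> (real^'n \<Rightarrow> complex) \<Rightarrow> ennreal" where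
  "var_Lorentz_norm p q f = var_Lorentz_qnorm p q (\<lambda>x. ennreal (cmod (f x)))"

definition var_Lorentz ::
    "(real^'n \<Rightarrow> real) \<Rightarrow> ennreal \<Rightarrow> (real^'n \<Rightarrow> complex) set" where
  "var_Lorentz p q = {f \<in> borel_measurable lebesgue. var_Lorentz_norm p q f < \<infinity>}"


section \<open>Schwartz functions and tempered distributions\<close>

definition partial_deriv :: "'n \<Rightarrow> (real^'n \<Rightarrow> complex) \<Rightarrow> real^'n \<Rightarrow> complex" where
  "partial_deriv i f x = frechet_derivative f (at x) (axis i 1)"

text \<open>A multi-index \<open>\<alpha>\<close> is represented by a list of coordinate directions in which the \<open>i\<close>-th one
  occurs \<open>\<alpha>\<^sub>i\<close> times, so \<open>|\<alpha>|\<close> is the length of the list. The order of the list is immaterial for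
  smooth functions.\<close>

definition iter_partial :: "'n list \<Rightarrow> (real^'n \<Rightarrow> complex) \<Rightarrow> real^'n \<Rightarrow> complex" where
  "iter_partial is f = foldr partial_deriv is f"

definition smooth :: "(real^'n \<Rightarrow> complex) \<Rightarrow> bool" where
  "smooth f \<longleftrightarrow> (\<forall>is x. iter_partial is f differentiable (at x))"

definition Schwartz :: "(real^'n \<Rightarrow> complex) set" where
  "Schwartz = {f. smooth f \<and>
     (\<forall>is m. bdd_above (range (\<lambda>x. (1 + norm x) ^ m * cmod (iter_partial is f x))))}"

definition Schwartz_seminorm :: "nat \<Rightarrow> 'n list \<Rightarrow> (real^'n \<Rightarrow> complex) \<Rightarrow> real" where
  "Schwartz_seminorm m is f = (SUP x. (1 + norm x) ^ m * cmod (iter_partial is f x))"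

definition Schwartz_topology :: "(real^'n \<Rightarrow> complex) topology" where
  "Schwartz_topology = topology_generated_by
     {{g \<in> Schwartz. Schwartz_seminorm m is (\<lambda>x. g x - f x) < e} | f m is e. f \<in> Schwartz \<and> 0 < e}"

text \<open>Functionals are \<open>undefined\<close> off the Schwartz space, so that equality of functionals is
  equality on Schwartz functions.\<close>

definition tempered_distributions :: "((real^'n \<Rightarrow> complex) \<Rightarrow> complex) set" where
  "tempered_distributions = {u \<in> extensional Schwartz.
     (\<forall>f\<in>Schwartz. \<forall>g\<in>Schwartz. u (\<lambda>x. f x + g x) = u f + u g) \<and>
     (\<forall>c. \<forall>f\<in>Schwartz. u (\<lambda>x. c * f x) = c * u f) \<and>
     continuous_map Schwartz_topology euclidean u}"

definition distribution_of :: "(real^'n \<Rightarrow> complex) \<Rightarrow> (real^'n \<Rightarrow> complex) \<Rightarrow> complex" where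
  "distribution_of f = (\<lambda>\<phi>\<in>Schwartz. \<integral>x. f x * \<phi> x \<partial>lebesgue)"

text \<open>The integrability clause is needed since the Bochner integral of a non-integrable function
  is \<open>0\<close>.\<close>

definition defines_tempered_distribution :: "(real^'n \<Rightarrow> complex) \<Rightarrow> bool" where
  "defines_tempered_distribution f \<longleftrightarrow>
     (\<forall>\<phi>\<in>Schwartz. integrable lebesgue (\<lambda>x. f x * \<phi> x)) \<and>
     distribution_of f \<in> tempered_distributions"


section \<open>Anisotropic variable Hardy-Lorentz spaces\<close>

definition dilate_fun :: "real^'n^'n \<Rightarrow> int \<Rightarrow> (real^'n \<Rightarrow> complex) \<Rightarrow> real^'n \<Rightarrow> complex" where
  "dilate_fun A k \<phi> x =
     complex_of_real (dilation_factor A powi (- k)) * \<phi> (matrix_powi_apply A (- k) x)"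

definition convolve_distribution ::
    "((real^'n \<Rightarrow> complex) \<Rightarrow> complex) \<Rightarrow> (real^'n \<Rightarrow> complex) \<Rightarrow> real^'n \<Rightarrow> complex" where
  "convolve_distribution u \<phi> x = u (\<lambda>y. \<phi> (x - y))"

definition Schwartz_N :: "real^'n^'n \<Rightarrow> (real^'n) set \<Rightarrow> nat \<Rightarrow> (real^'n \<Rightarrow> complex) set" where
  "Schwartz_N A \<Delta> N = {\<phi> \<in> Schwartz. \<forall>is l x. length is \<le> N \<longrightarrow> l \<le> N \<longrightarrow>
     step_norm A \<Delta> x ^ l * cmod (iter_partial is \<phi> x) \<le> 1}"

definition radial_grand_maximal ::
    "real^'n^'n \<Rightarrow> (real^'n) set \<Rightarrow> nat \<Rightarrow> ((real^'n \<Rightarrow> complex) \<Rightarrow> complex) \<Rightarrow> real^'n \<Rightarrow> ennreal" where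
  "radial_grand_maximal A \<Delta> N u x =
     (SUP \<phi>\<in>Schwartz_N A \<Delta> N. SUP k::int.
        ennreal (cmod (convolve_distribution u (dilate_fun A k \<phi>) x)))"

definition Hardy_Lorentz_norm ::
    "real^'n^'n \<Rightarrow> (real^'n) set \<Rightarrow> nat \<Rightarrow> (real^'n \<Rightarrow> real) \<Rightarrow> ennreal \<Rightarrow>
     ((real^'n \<Rightarrow> complex) \<Rightarrow> complex) \<Rightarrow> ennreal" where
  "Hardy_Lorentz_norm A \<Delta> N p q u = var_Lorentz_qnorm p q (radial_grand_maximal A \<Delta> N u)"

definition Hardy_Lorentz ::
    "real^'n^'n \<Rightarrow> (real^'n) set \<Rightarrow> nat \<Rightarrow> (real^'n \<Rightarrow> real) \<Rightarrow> ennreal \<Rightarrow>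
     ((real^'n \<Rightarrow> complex) \<Rightarrow> complex) set" where
  "Hardy_Lorentz A \<Delta> N p q =
     {u \<in> tempered_distributions. var_Lorentz_finite p q (radial_grand_maximal A \<Delta> N u)}"

end

theory Submission
  imports Defs
begin

text \<open>Let \<open>1 < s < p\<^sub>-\<close>. The radial grand maximal function of \<open>f\<close> is dominated by the maximal operator
  over the dilated ellipsoids. A Vitali covering argument together with the log-Hoelder condition
  gives a weak type estimate for the exponent \<open>p / s\<close>, and splitting \<open>f\<close> at each height bounds the
  level sets of the maximal function in \<open>L\<^bsup>p\<^esup>\<close> by those of \<open>f\<close>, which yields one inequality for
  every \<open>q\<close>. Conversely, the smooth approximations \<open>u * \<phi>\<^sub>k\<close> of a distribution \<open>u\<close> are dominated by
  its grand maximal function, which is locally integrable because \<open>1 < p\<^sub>-\<close>; a weak compactness argument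
  then represents \<open>u\<close> by a function that is pointwise dominated by the grand maximal function.\<close>

section \<open>Schwartz functions\<close>

text \<open>For p_- > 1 the number \<open>p_underline p\<close> is 1, so the condition on
  \<open>N\<close> becomes N >= 2; decay of order rho^-2 is what turns the dilates of a test
  function into averages over balls with geometric weights. The obstacle is that q ranges over all
  of (0, \<infinity>]: for q < 1 neither duality nor convexity is at hand. The estimate therefore
  stays at the level of distribution functions: if 2^(k theta) times the norm of {|f| > 2^k l} is at
  most t for all k, then the norm of {Mf > 2 l} is at most K t. Here theta lies strictly between 1/s
  and 1: theta s > 1 sums the modular of the part of f above l, and theta < 1 sums the resulting
  powers over k for every q. Changing the exponent costs bounded factors only, locally since a power
  of b^-k is compared over a ball of scale k, and at infinity up to an integrable error
  \<open>wt\<close>. The lower norm estimate for a given f needs one more fact: the function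
  produced from \<open>distribution_of f\<close> agrees with f almost everywhere; hence the section
  on uniqueness.\<close>

lemma iter_partial_Nil [simp]: "iter_partial [] f = f"
  by (simp add: iter_partial_def)

lemma iter_partial_Cons: "iter_partial (i # js) f = partial_deriv i (iter_partial js f)"
  by (simp add: iter_partial_def)

lemma iter_partial_append: "iter_partial (ks @ js) f = iter_partial ks (iter_partial js f)"
  by (simp add: iter_partial_def)

lemma partial_deriv_eqI: "(f has_derivative D) (at x) \<Longrightarrow> partial_deriv i f x = D (axis i 1)"
  unfolding partial_deriv_def by (metis frechet_derivative_at)

text \<open>Decay of the function alone, separated from smoothness: derivatives are handled by
  \<open>Schwartz_coinduct\<close>, so closure proofs need decay for one function at a time
  only.\<close>

definition rapidly_decreasing :: "(real^'n \<Rightarrow> complex) \<Rightarrow> bool" where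
  "rapidly_decreasing f \<longleftrightarrow> (\<forall>m. \<exists>C. \<forall>x. (1 + norm x) ^ m * cmod (f x) \<le> C)"

text \<open>Induction on the list of directions keeps every iterated partial derivative inside
  \<open>X\<close>. A closure property thus needs only first derivatives that stay in a suitable
  class, not a formula for the higher ones.\<close>

lemma Schwartz_coinduct:
  assumes "f \<in> X"
    and diff: "\<And>g x. g \<in> X \<Longrightarrow> g differentiable (at x)"
    and dec: "\<And>g. g \<in> X \<Longrightarrow> rapidly_decreasing g"
    and part: "\<And>g i. g \<in> X \<Longrightarrow> partial_deriv i g \<in> X"
  shows "f \<in> Schwartz"
proof -
  have X: "iter_partial js f \<in> X" for js
    by (induction js) (auto simp: iter_partial_Cons assms)
  show ?thesis
    using diff[OF X] dec[OF X]
    by (auto simp: Schwartz_def smooth_def rapidly_decreasing_def bdd_above_def)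
qed

lemma Schwartz_differentiable: "f \<in> Schwartz \<Longrightarrow> f differentiable (at x)"
  unfolding Schwartz_def smooth_def using iter_partial_Nil by (metis (mono_tags, lifting) mem_Collect_eq)

lemma Schwartz_iter_partial:
  assumes "f \<in> Schwartz" shows "iter_partial js f \<in> Schwartz"
  using assms unfolding Schwartz_def smooth_def by (auto simp flip: iter_partial_append)

lemma Schwartz_partial_deriv: "f \<in> Schwartz \<Longrightarrow> partial_deriv i f \<in> Schwartz"
  using Schwartz_iter_partial[of f "[i]"] by (simp add: iter_partial_Cons)

lemma Schwartz_bdd:
  "f \<in> Schwartz \<Longrightarrow> bdd_above (range (\<lambda>x. (1 + norm x) ^ m * cmod (iter_partial js f x)))"
  by (simp add: Schwartz_def)

lemma Schwartz_seminorm_ge: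
  "f \<in> Schwartz \<Longrightarrow> (1 + norm x) ^ m * cmod (iter_partial js f x) \<le> Schwartz_seminorm m js f"
  unfolding Schwartz_seminorm_def by (rule cSUP_upper[OF _ Schwartz_bdd]) auto

lemma Schwartz_seminorm_leI:
  "(\<And>x. (1 + norm x) ^ m * cmod (iter_partial js f x) \<le> C) \<Longrightarrow> Schwartz_seminorm m js f \<le> C"
  unfolding Schwartz_seminorm_def by (rule cSUP_least) auto

lemma Schwartz_seminorm_nonneg:
  assumes "f \<in> Schwartz" shows "0 \<le> Schwartz_seminorm m js f"
  by (rule order_trans[OF _ Schwartz_seminorm_ge[OF assms, of 0]]) simp

lemma Schwartz_rapidly_decreasing: "f \<in> Schwartz \<Longrightarrow> rapidly_decreasing f"
  unfolding rapidly_decreasing_def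
  using Schwartz_seminorm_ge[of f _ _ "[]"] by auto

lemma rapidly_decreasing_bound:
  assumes "rapidly_decreasing f"
  obtains C where "0 < C" "\<And>x. (1 + norm x) ^ m * cmod (f x) \<le> C"
proof -
  obtain C where C: "(1 + norm x) ^ m * cmod (f x) \<le> C" for x
    using assms unfolding rapidly_decreasing_def by blast
  show ?thesis
    by (rule that[of "max C 1"]) (use C le_max_iff_disj in auto)
qed

lemma Schwartz_continuous: "f \<in> Schwartz \<Longrightarrow> continuous_on S f"
  by (meson Schwartz_differentiable continuous_at_imp_continuous_on differentiable_imp_continuous_within)

lemma Schwartz_borel: "f \<in> Schwartz \<Longrightarrow> f \<in> borel_measurable borel"
  by (simp add: Schwartz_continuous borel_measurable_continuous_onI)

lemma Schwartz_lebesgue: "f \<in> Schwartz \<Longrightarrow> f \<in> borel_measurable lebesgue"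
  by (rule measurable_completion) (use Schwartz_borel in auto)

lemma has_derivative_partials:
  fixes f :: "real^'n \<Rightarrow> complex"
  assumes "f differentiable (at x)"
  shows "(f has_derivative (\<lambda>h. \<Sum>i\<in>UNIV. complex_of_real (h $ i) * partial_deriv i f x)) (at x)"
proof -
  let ?D = "frechet_derivative f (at x)"
  have D: "(f has_derivative ?D) (at x)"
    using assms frechet_derivative_works by blast
  then interpret linear ?D
    by (rule has_derivative_linear)
  have "?D h = (\<Sum>i\<in>UNIV. complex_of_real (h $ i) * partial_deriv i f x)" for h
  proof -
    have "?D h = ?D (\<Sum>i\<in>UNIV. (h $ i) *\<^sub>R axis i 1)"
      by (subst basis_expansion[of h, symmetric]) (simp add: scalar_mult_eq_scaleR)
    also have "\<dots> = (\<Sum>i\<in>UNIV. (h $ i) *\<^sub>R ?D (axis i 1))"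
      by (simp add: sum scale)
    finally show ?thesis
      by (simp add: partial_deriv_def scaleR_conv_of_real)
  qed
  then have "?D = (\<lambda>h. \<Sum>i\<in>UNIV. complex_of_real (h $ i) * partial_deriv i f x)"
    by blast
  with D show ?thesis by (rule has_derivative_eq_rhs)
qed

section \<open>Linear combinations of Schwartz functions\<close>

lemma partial_deriv_lin:
  assumes "f differentiable (at x)" "g differentiable (at x)"
  shows "partial_deriv i (\<lambda>x. a * f x + b * g x) x = a * partial_deriv i f x + b * partial_deriv i g x"
proof -
  have "((\<lambda>x. a * f x + b * g x) has_derivative
      (\<lambda>h. a * frechet_derivative f (at x) h + b * frechet_derivative g (at x) h)) (at x)"
    using assms by (intro derivative_intros) (auto simp: frechet_derivative_works)
  from partial_deriv_eqI[OF this] show ?thesis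
    by (simp add: partial_deriv_def)
qed

lemma iter_partial_lin:
  assumes "f \<in> Schwartz" "g \<in> Schwartz"
  shows "iter_partial js (\<lambda>x. a * f x + b * g x) = (\<lambda>x. a * iter_partial js f x + b * iter_partial js g x)"
proof (induction js)
  case (Cons i js)
  show ?case
    unfolding iter_partial_Cons Cons
    by (rule ext, rule partial_deriv_lin)
      (use assms Schwartz_iter_partial Schwartz_differentiable in blast)+
qed simp

lemma rapidly_decreasing_lin:
  assumes "rapidly_decreasing f" "rapidly_decreasing g"
  shows "rapidly_decreasing (\<lambda>x. a * f x + b * g x)"
  unfolding rapidly_decreasing_def
proof
  fix m
  obtain C where C: "\<And>x. (1 + norm x) ^ m * cmod (f x) \<le> C"
    using assms(1) unfolding rapidly_decreasing_def by blast
  obtain D where D: "\<And>x. (1 + norm x) ^ m * cmod (g x) \<le> D"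
    using assms(2) unfolding rapidly_decreasing_def by blast
  have "(1 + norm x) ^ m * cmod (a * f x + b * g x) \<le> cmod a * C + cmod b * D" for x
  proof -
    have "(1 + norm x) ^ m * cmod (a * f x + b * g x) \<le>
        (1 + norm x) ^ m * (cmod a * cmod (f x) + cmod b * cmod (g x))"
      by (intro mult_left_mono order_trans[OF norm_triangle_ineq]) (auto simp: norm_mult)
    also have "\<dots> = cmod a * ((1 + norm x) ^ m * cmod (f x)) + cmod b * ((1 + norm x) ^ m * cmod (g x))"
      by (simp add: algebra_simps)
    also have "\<dots> \<le> cmod a * C + cmod b * D"
      by (intro add_mono mult_left_mono C D) auto
    finally show ?thesis .
  qed
  then show "\<exists>C. \<forall>x. (1 + norm x) ^ m * cmod (a * f x + b * g x) \<le> C" by blast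
qed

lemma Schwartz_lin:
  fixes f :: "real^'n \<Rightarrow> complex"
  assumes "f \<in> Schwartz" "g \<in> Schwartz"
  shows "(\<lambda>x. a * f x + b * g x) \<in> Schwartz"
proof (rule Schwartz_coinduct[of _ "{\<lambda>x. a * f x + b * g x |f g. f \<in> Schwartz \<and> g \<in> Schwartz}"])
  show "(\<lambda>x. a * f x + b * g x) \<in> {\<lambda>x. a * f x + b * g x |f g. f \<in> Schwartz \<and> g \<in> Schwartz}"
    using assms by blast
  fix h :: "real^'n \<Rightarrow> complex" and x i
  assume "h \<in> {\<lambda>x. a * f x + b * g x |f g. f \<in> Schwartz \<and> g \<in> Schwartz}"
  then obtain f g where h: "h = (\<lambda>x. a * f x + b * g x)" and S: "f \<in> Schwartz" "g \<in> Schwartz"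
    by blast
  have d: "f differentiable (at y)" "g differentiable (at y)" for y
    using S by (auto intro: Schwartz_differentiable)
  show "h differentiable (at x)"
    unfolding h by (intro derivative_intros d)
  show "rapidly_decreasing h"
    unfolding h by (intro rapidly_decreasing_lin Schwartz_rapidly_decreasing S)
  have "partial_deriv i h = (\<lambda>x. a * partial_deriv i f x + b * partial_deriv i g x)"
    unfolding h by (rule ext, rule partial_deriv_lin[OF d])
  then show "partial_deriv i h \<in> {\<lambda>x. a * f x + b * g x |f g. f \<in> Schwartz \<and> g \<in> Schwartz}"
    using Schwartz_partial_deriv S by blast
qed

lemma Schwartz_cmult: "f \<in> Schwartz \<Longrightarrow> (\<lambda>x. a * f x) \<in> Schwartz"
  using Schwartz_lin[of f f a 0] by simp

lemma Schwartz_add: "f \<in> Schwartz \<Longrightarrow> g \<in> Schwartz \<Longrightarrow> (\<lambda>x. f x + g x) \<in> Schwartz"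
  using Schwartz_lin[of f g 1 1] by simp

lemma Schwartz_diff: "f \<in> Schwartz \<Longrightarrow> g \<in> Schwartz \<Longrightarrow> (\<lambda>x. f x - g x) \<in> Schwartz"
  using Schwartz_lin[of f g 1 "-1"] by simp

lemma iter_partial_diff:
  "f \<in> Schwartz \<Longrightarrow> g \<in> Schwartz \<Longrightarrow>
    iter_partial js (\<lambda>x. f x - g x) = (\<lambda>x. iter_partial js f x - iter_partial js g x)"
  using iter_partial_lin[of f g js 1 "-1"] by simp

lemma iter_partial_cmult:
  "f \<in> Schwartz \<Longrightarrow> iter_partial js (\<lambda>x. a * f x) = (\<lambda>x. a * iter_partial js f x)"
  using iter_partial_lin[of f f js a 0] by simp

lemma Schwartz_sum:
  assumes "finite I" "I \<noteq> {}" "\<And>i. i \<in> I \<Longrightarrow> f i \<in> Schwartz"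
  shows "(\<lambda>x. \<Sum>i\<in>I. c i * f i x) \<in> Schwartz \<and>
    iter_partial js (\<lambda>x. \<Sum>i\<in>I. c i * f i x) = (\<lambda>x. \<Sum>i\<in>I. c i * iter_partial js (f i) x)"
  using assms
proof (induction I rule: finite_ne_induct)
  case (singleton i)
  then show ?case by (simp add: Schwartz_cmult iter_partial_cmult)
next
  case (insert i I)
  then have 1: "(\<lambda>x. \<Sum>i\<in>I. c i * f i x) \<in> Schwartz"
    "iter_partial js (\<lambda>x. \<Sum>i\<in>I. c i * f i x) = (\<lambda>x. \<Sum>i\<in>I. c i * iter_partial js (f i) x)"
    and 2: "f i \<in> Schwartz" by auto
  have eq: "(\<lambda>x. \<Sum>i\<in>insert i I. c i * f i x) = (\<lambda>x. c i * f i x + 1 * (\<Sum>i\<in>I. c i * f i x))"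
    using insert by simp
  show ?case
    unfolding eq iter_partial_lin[OF 2 1(1)] using Schwartz_lin[OF 2 1(1), of "c i" 1] 1(2) insert by simp
qed

section \<open>Polynomial weights, increments and Taylor remainders\<close>

lemma one_plus_norm_mult: "1 + norm (x + y) \<le> (1 + norm x) * (1 + norm (y::'a::real_normed_vector))"
proof -
  have "0 \<le> norm x * norm y" by simp
  with norm_triangle_ineq[of x y] have "norm (x + y) \<le> norm x + norm y + norm x * norm y" by linarith
  then show ?thesis by (simp add: algebra_simps)
qed

text \<open>Submultiplicativity of the weight is what trades a weight in y for weights in x and in x
  - y in the convolution estimates.\<close>

lemma one_plus_norm_power:
  "(1 + norm (x + y)) ^ m \<le> (1 + norm x) ^ m * (1 + norm (y::'a::real_normed_vector)) ^ m"
  unfolding power_mult_distrib[symmetric] by (intro power_mono one_plus_norm_mult) auto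

text \<open>Mean value inequality on the segment from y to y + h. The weight at y is compared with
  the weight at a point of the segment, which costs one factor (1 + norm h)^m.\<close>

lemma Schwartz_Lipschitz:
  fixes f :: "real^'n \<Rightarrow> complex"
  assumes "f \<in> Schwartz"
  obtains C where "0 < C" "\<And>y h. (1 + norm y) ^ m * cmod (f (y + h) - f y) \<le> C * (norm h * (1 + norm h) ^ m)"
proof -
  have "\<exists>C>0. \<forall>x. (1 + norm x) ^ m * cmod (partial_deriv i f x) \<le> C" for i
    using rapidly_decreasing_bound[OF Schwartz_rapidly_decreasing[OF Schwartz_partial_deriv[OF assms]]]
    by metis
  then obtain c where c: "\<And>i. 0 < c i" "\<And>i x. (1 + norm x) ^ m * cmod (partial_deriv i f x) \<le> c i"
    by metis
  define C where "C = (\<Sum>i\<in>UNIV. c i)"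
  have "0 < C" unfolding C_def by (intro sum_pos c) auto
  moreover have "(1 + norm y) ^ m * cmod (f (y + h) - f y) \<le> C * (norm h * (1 + norm h) ^ m)" for y h
  proof -
    define B where "B = C * (1 + norm h) ^ m / (1 + norm y) ^ m"
    have pos: "0 < (1 + norm y) ^ m" by (simp add: add_pos_nonneg)
    have D: "(f has_derivative (\<lambda>h. \<Sum>i\<in>UNIV. complex_of_real (h $ i) * partial_deriv i f x)) (at x within S)" for x S
      by (rule has_derivative_at_withinI[OF has_derivative_partials[OF Schwartz_differentiable[OF assms]]])
    have "cmod (f (y + h) - f y) \<le> B * norm (y + h - y)"
    proof (rule differentiable_bound[OF _ D])
      fix x assume x: "x \<in> closed_segment y (y + h)"
      then obtain t where t: "0 \<le> t" "t \<le> 1" "x = y + t *\<^sub>R h"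
        by (auto simp: in_segment algebra_simps)
      have yx: "y = x + (- t) *\<^sub>R h" using t by simp
      have "norm ((- t) *\<^sub>R h) \<le> norm h" using t by (simp add: mult_left_le_one_le)
      then have *: "(1 + norm y) ^ m \<le> (1 + norm x) ^ m * (1 + norm h) ^ m"
        unfolding yx by (intro order_trans[OF one_plus_norm_power] mult_left_mono power_mono) auto
      show "onorm (\<lambda>h. \<Sum>i\<in>UNIV. complex_of_real (h $ i) * partial_deriv i f x) \<le> B"
      proof (rule onorm_bound)
        show "0 \<le> B" unfolding B_def using \<open>0 < C\<close> by simp
        fix v :: "real^'n"
        have "norm (\<Sum>i\<in>UNIV. complex_of_real (v $ i) * partial_deriv i f x) \<le>
            (\<Sum>i\<in>UNIV. norm v * cmod (partial_deriv i f x))"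
          by (rule sum_norm_le) (simp add: norm_mult component_le_norm_cart mult_right_mono)
        also have "\<dots> \<le> (\<Sum>i\<in>UNIV. norm v * (c i * (1 + norm h) ^ m / (1 + norm y) ^ m))"
        proof (intro sum_mono mult_left_mono)
          fix i
          have "(1 + norm y) ^ m * cmod (partial_deriv i f x) \<le>
            ((1 + norm x) ^ m * (1 + norm h) ^ m) * cmod (partial_deriv i f x)"
            by (intro mult_right_mono *) auto
          also have "\<dots> \<le> (1 + norm h) ^ m * c i"
            using mult_left_mono[OF c(2)[of x i], of "(1 + norm h) ^ m"] by (simp add: mult_ac)
          finally show "cmod (partial_deriv i f x) \<le> c i * (1 + norm h) ^ m / (1 + norm y) ^ m"
            using pos by (simp add: field_simps)
        qed auto
        also have "\<dots> = B * norm v"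
          unfolding B_def C_def by (simp add: sum_distrib_left sum_distrib_right sum_divide_distrib mult_ac)
        finally show "norm (\<Sum>i\<in>UNIV. complex_of_real (v $ i) * partial_deriv i f x) \<le> B * norm v" .
      qed
    qed auto
    then show ?thesis
      unfolding B_def using pos by (simp add: field_simps)
  qed
  ultimately show ?thesis by (rule that)
qed

text \<open>The remainder is quadratic because the partial derivatives are themselves Lipschitz, by
  \<open>Schwartz_Lipschitz\<close> with m = 0. It is uniform in y, which later permits
  differentiation under an integral.\<close>

lemma Schwartz_Taylor:
  fixes f :: "real^'n \<Rightarrow> complex"
  assumes "f \<in> Schwartz"
  obtains C where "0 < C" "\<And>y h. cmod (f (y + h) - f y - (\<Sum>i\<in>UNIV. complex_of_real (h $ i) * partial_deriv i f y))
    \<le> C * (norm h)\<^sup>2"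
proof -
  have "\<exists>C>0. \<forall>y h. (1 + norm y) ^ 0 * cmod (partial_deriv i f (y + h) - partial_deriv i f y) \<le> C * (norm h * (1 + norm h) ^ 0)" for i
    using Schwartz_Lipschitz[OF Schwartz_partial_deriv[OF assms]] by metis
  then obtain c where c: "\<And>i. 0 < c i"
    "\<And>i y h. cmod (partial_deriv i f (y + h) - partial_deriv i f y) \<le> c i * norm h"
    by simp metis
  define C where "C = (\<Sum>i\<in>UNIV. c i)"
  have "0 < C" unfolding C_def by (intro sum_pos c) auto
  moreover have "cmod (f (y + h) - f y - (\<Sum>i\<in>UNIV. complex_of_real (h $ i) * partial_deriv i f y))
      \<le> C * (norm h)\<^sup>2" for y h
  proof -
    let ?D = "\<lambda>x h. \<Sum>i\<in>UNIV. complex_of_real (h $ i) * partial_deriv i f x"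
    have "cmod (f (y + h) - f y - ?D y (y + h - y)) \<le> norm (y + h - y) * (C * norm h)"
    proof (rule differentiable_bound_linearization[where S = "closed_segment y (y + h)"])
      show "(f has_derivative ?D x) (at x within closed_segment y (y + h))" for x
        by (rule has_derivative_at_withinI[OF has_derivative_partials[OF Schwartz_differentiable[OF assms]]])
      fix t :: real assume "t \<in> {0..1}"
      then show "y + t *\<^sub>R (y + h - y) \<in> closed_segment y (y + h)"
        by (auto simp: in_segment algebra_simps intro!: exI[of _ t])
    next
      fix x assume x: "x \<in> closed_segment y (y + h)"
      then obtain t where t: "0 \<le> t" "t \<le> 1" "x = y + t *\<^sub>R h"
        by (auto simp: in_segment algebra_simps)
      show "onorm (?D x - ?D y) \<le> C * norm h"
      proof (rule onorm_bound)
        show "0 \<le> C * norm h" using \<open>0 < C\<close> by simp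
        fix v :: "real^'n"
        have "norm ((?D x - ?D y) v) = norm (\<Sum>i\<in>UNIV. complex_of_real (v $ i) * (partial_deriv i f x - partial_deriv i f y))"
          by (simp add: sum_subtractf algebra_simps)
        also have "\<dots> \<le> (\<Sum>i\<in>UNIV. norm v * (c i * norm h))"
        proof (rule sum_norm_le)
          fix i
          have "norm (t *\<^sub>R h) \<le> norm h" using t by (simp add: mult_left_le_one_le)
          then have "cmod (partial_deriv i f x - partial_deriv i f y) \<le> c i * norm h"
            unfolding t(3) using c(1)[of i] by (intro order_trans[OF c(2)] mult_left_mono) auto
          then show "norm (complex_of_real (v $ i) * (partial_deriv i f x - partial_deriv i f y)) \<le> norm v * (c i * norm h)"
            unfolding norm_mult by (intro mult_mono) (auto simp: component_le_norm_cart)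
        qed
        also have "\<dots> = C * norm h * norm v"
          unfolding C_def by (simp add: sum_distrib_left sum_distrib_right mult_ac)
        finally show "norm ((?D x - ?D y) v) \<le> C * norm h * norm v" .
      qed
    qed auto
    then show ?thesis by (simp add: power2_eq_square mult_ac)
  qed
  ultimately show ?thesis by (rule that)
qed

section \<open>Affine and linear changes of variable\<close>

lemma iter_partial_affine:
  fixes f :: "real^'n \<Rightarrow> complex"
  assumes "f \<in> Schwartz"
  shows "iter_partial js (\<lambda>y. f (x + e *\<^sub>R y)) = (\<lambda>y. complex_of_real (e ^ length js) * iter_partial js f (x + e *\<^sub>R y))"
proof (induction js)
  case (Cons i js)
  let ?k = "iter_partial js f"
  show ?case
    unfolding iter_partial_Cons Cons
  proof
    fix y
    have k: "(?k has_derivative (\<lambda>h. \<Sum>i\<in>UNIV. complex_of_real (h $ i) * partial_deriv i ?k (x + e *\<^sub>R y))) (at (x + e *\<^sub>R y))"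
      by (rule has_derivative_partials[OF Schwartz_differentiable[OF Schwartz_iter_partial[OF assms]]])
    have "((\<lambda>y. ?k (x + e *\<^sub>R y)) has_derivative (\<lambda>h. \<Sum>i\<in>UNIV. complex_of_real ((e *\<^sub>R h) $ i) * partial_deriv i ?k (x + e *\<^sub>R y))) (at y)"
      by (rule has_derivative_compose[where f = "\<lambda>y. x + e *\<^sub>R y" and g = ?k, OF _ k]) (auto intro!: derivative_eq_intros)
    then have "((\<lambda>y. complex_of_real (e ^ length js) * ?k (x + e *\<^sub>R y)) has_derivative
        (\<lambda>h. complex_of_real (e ^ length js) * (\<Sum>i\<in>UNIV. complex_of_real ((e *\<^sub>R h) $ i) * partial_deriv i ?k (x + e *\<^sub>R y)))) (at y)"
      by (rule has_derivative_mult_right)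
    moreover have "complex_of_real ((e *\<^sub>R axis i 1) $ k) * c = (if k = i then complex_of_real e * c else 0)" for k c
      by (simp add: axis_def)
    ultimately show "partial_deriv i (\<lambda>y. complex_of_real (e ^ length js) * ?k (x + e *\<^sub>R y)) y =
      complex_of_real (e ^ length (i # js)) * partial_deriv i ?k (x + e *\<^sub>R y)"
      by (subst partial_deriv_eqI) (assumption, simp add: sum.delta)
  qed
qed simp

lemma rapidly_decreasing_compose:
  fixes f :: "real^'n \<Rightarrow> complex"
  assumes "rapidly_decreasing f" and K: "\<And>x. 1 + norm x \<le> K * (1 + norm (T x))"
  shows "rapidly_decreasing (\<lambda>x. f (T x))"
  unfolding rapidly_decreasing_def
proof
  fix m
  obtain C where C: "\<And>x. (1 + norm x) ^ m * cmod (f x) \<le> C"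
    using assms(1) unfolding rapidly_decreasing_def by blast
  have "0 \<le> K" using K[of 0] by (smt (verit) mult_less_0_iff norm_ge_zero)
  have "(1 + norm x) ^ m * cmod (f (T x)) \<le> K ^ m * C" for x
  proof -
    have "(1 + norm x) ^ m * cmod (f (T x)) \<le> (K * (1 + norm (T x))) ^ m * cmod (f (T x))"
      by (intro mult_right_mono power_mono K) auto
    also have "\<dots> = K ^ m * ((1 + norm (T x)) ^ m * cmod (f (T x)))"
      by (simp add: power_mult_distrib)
    also have "\<dots> \<le> K ^ m * C"
      by (intro mult_left_mono C) (use \<open>0 \<le> K\<close> in auto)
    finally show ?thesis .
  qed
  then show "\<exists>C. \<forall>x. (1 + norm x) ^ m * cmod (f (T x)) \<le> C" by blast
qed

text \<open>Both signs of \<open>e\<close> are wanted: e = 1 gives translations, e = -1 the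
  reflections in convolutions.\<close>

lemma Schwartz_affine:
  fixes f :: "real^'n \<Rightarrow> complex"
  assumes "f \<in> Schwartz" "\<bar>e\<bar> = 1"
  shows "(\<lambda>y. f (x + e *\<^sub>R y)) \<in> Schwartz"
proof -
  have rd: "rapidly_decreasing (\<lambda>y. k (x + e *\<^sub>R y))" if "k \<in> Schwartz" for k
  proof (rule rapidly_decreasing_compose[OF Schwartz_rapidly_decreasing[OF that], of "1 + norm x"])
    fix y
    have "1 + norm y = 1 + norm ((x + e *\<^sub>R y) + (- x))" using assms(2) by simp
    also have "\<dots> \<le> (1 + norm (x + e *\<^sub>R y)) * (1 + norm (- x))" by (rule one_plus_norm_mult)
    finally show "1 + norm y \<le> (1 + norm x) * (1 + norm (x + e *\<^sub>R y))" by (simp add: mult_ac)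
  qed
  show ?thesis
  proof (rule Schwartz_coinduct[of _ "{\<lambda>y. k (x + e *\<^sub>R y) |k. k \<in> Schwartz}"])
    fix g :: "real^'n \<Rightarrow> complex" and z i assume "g \<in> {\<lambda>y. k (x + e *\<^sub>R y) |k. k \<in> Schwartz}"
    then obtain k where k: "k \<in> Schwartz" "g = (\<lambda>y. k (x + e *\<^sub>R y))" by blast
    show "rapidly_decreasing g" unfolding k by (rule rd[OF k(1)])
    show "g differentiable (at z)" unfolding k
      by (rule differentiable_compose[OF Schwartz_differentiable[OF k(1)]]) (auto intro!: derivative_intros)
    have "partial_deriv i g = (\<lambda>y. of_real e * partial_deriv i k (x + e *\<^sub>R y))"
      using iter_partial_affine[OF k(1), of "[i]" x e] by (simp add: k iter_partial_Cons)
    then show "partial_deriv i g \<in> {\<lambda>y. k (x + e *\<^sub>R y) |k. k \<in> Schwartz}"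
      using Schwartz_cmult[OF Schwartz_partial_deriv[OF k(1)], of "of_real e" i]
      by (intro CollectI exI[of _ "\<lambda>y. of_real e * partial_deriv i k y"]) auto
  qed (use assms in blast)
qed

lemma Schwartz_reflect: "f \<in> Schwartz \<Longrightarrow> (\<lambda>y. f (x - y)) \<in> Schwartz"
  using Schwartz_affine[of f "-1" x] by simp

lemma iter_partial_reflect:
  "f \<in> Schwartz \<Longrightarrow> iter_partial js (\<lambda>y. f (x - y)) = (\<lambda>y. (-1) ^ length js * iter_partial js f (x - y))"
  using iter_partial_affine[of f js x "-1"] by simp

text \<open>The chain rule turns a derivative of the composite into a sum of composites with
  \<open>L\<close>, so the invariant class consists of finite sums. Injectivity bounds norm (L x)
  from below, which preserves the decay.\<close>

lemma Schwartz_linear_compose: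
  fixes f :: "real^'n \<Rightarrow> complex" and L :: "real^'n \<Rightarrow> real^'n"
  assumes "f \<in> Schwartz" "linear L" "inj L"
  shows "(\<lambda>x. f (L x)) \<in> Schwartz"
proof -
  obtain B where B: "B > 0" "\<And>x. norm (L x) \<ge> B * norm x"
    using linear_inj_bounded_below_pos[OF assms(2,3)] by metis
  define K where "K = max 1 (1 / B)"
  have K: "1 + norm x \<le> K * (1 + norm (L x))" for x
  proof -
    have "norm x = 1 / B * (B * norm x)" using B by simp
    also have "\<dots> \<le> K * norm (L x)"
      unfolding K_def by (intro mult_mono B) (use B in auto)
    moreover have "1 \<le> K" by (simp add: K_def)
    ultimately show ?thesis by (simp add: algebra_simps)
  qed
  \<comment> \<open>Each derivative multiplies the number of summands by the dimension. The index
    sets live in \<open>nat\<close> to stay in one type; pairs of an old index and a direction are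
    re-encoded below.\<close>
  let ?X = "{\<lambda>x. \<Sum>i\<in>I. g i (L x) |g (I :: nat set). finite I \<and> (\<forall>i. g i \<in> Schwartz)}"
  interpret L: bounded_linear L using assms(2) by (simp add: linear_conv_bounded_linear)
  show ?thesis
  proof (rule Schwartz_coinduct[of _ ?X])
    show "(\<lambda>x. f (L x)) \<in> ?X" using assms(1)
      by (intro CollectI exI[of _ "\<lambda>_. f"] exI[of _ "{0}"]) auto
  next
    fix h :: "real^'n \<Rightarrow> complex" and z and i assume "h \<in> ?X"
    then obtain g and I :: "nat set" where I: "finite I" and g: "\<And>i. g i \<in> Schwartz" and h: "h = (\<lambda>x. \<Sum>i\<in>I. g i (L x))"
      by blast
    have rd1: "rapidly_decreasing (\<lambda>x. g j (L x))" for j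
      by (rule rapidly_decreasing_compose[OF Schwartz_rapidly_decreasing[OF g] K])
    show "rapidly_decreasing h" unfolding h using I
    proof (induction I rule: finite_induct)
      case empty then show ?case by (auto simp: rapidly_decreasing_def)
    next
      case (insert j I)
      have "rapidly_decreasing (\<lambda>x. 1 * g j (L x) + 1 * (\<Sum>i\<in>I. g i (L x)))"
        by (rule rapidly_decreasing_lin[OF rd1 insert.IH])
      then show ?case using insert by simp
    qed
    have D: "((\<lambda>x. \<Sum>j\<in>I. g j (L x)) has_derivative
       (\<lambda>v. \<Sum>j\<in>I. \<Sum>k\<in>UNIV. complex_of_real (L v $ k) * partial_deriv k (g j) (L x))) (at x)" for x
      by (intro has_derivative_sum has_derivative_compose[OF L.has_derivative[OF has_derivative_ident] has_derivative_partials[OF Schwartz_differentiable[OF g]]])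
    show "h differentiable (at z)" using D unfolding h differentiable_def by blast
    obtain b :: "'n \<Rightarrow> nat" where b: "inj b"
      using finite_imp_inj_to_nat_seg[of "UNIV :: 'n set"] by auto
    let ?J = "(\<lambda>(j,k). prod_encode (j, b k)) ` (I \<times> UNIV)"
    define G where "G n = (\<lambda>x. complex_of_real (L (axis i 1) $ (inv b (snd (prod_decode n)))) *
       partial_deriv (inv b (snd (prod_decode n))) (g (fst (prod_decode n))) x)" for n
    have "partial_deriv i h = (\<lambda>x. \<Sum>n\<in>?J. G n (L x))"
    proof
      fix x
      have inj: "inj_on (\<lambda>(j,k). prod_encode (j, b k)) (I \<times> UNIV)"
        using b by (auto simp: inj_on_def)
      have "partial_deriv i h x = (\<Sum>j\<in>I. \<Sum>k\<in>UNIV. complex_of_real (L (axis i 1) $ k) * partial_deriv k (g j) (L x))"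
        unfolding h by (rule partial_deriv_eqI[OF D])
      also have "\<dots> = (\<Sum>n\<in>?J. G n (L x))"
        by (subst sum.reindex[OF inj]) (simp add: sum.cartesian_product G_def inv_f_f[OF b] split_def)
      finally show "partial_deriv i h x = (\<Sum>n\<in>?J. G n (L x))" .
    qed
    moreover have "finite ?J" using I by simp
    moreover have "G n \<in> Schwartz" for n unfolding G_def by (intro Schwartz_cmult Schwartz_partial_deriv g)
    ultimately show "partial_deriv i h \<in> ?X" by blast
  qed
qed

section \<open>Integrability\<close>

text \<open>Dyadic decomposition: with 2^j <= 1 + norm x < 2^(j+1) and d the dimension, the
  integrand is at most 2^(-j(d+1)), and the volume of order 2^((j+1)d) of the ball leaves a
  geometric series.\<close>

lemma nn_integral_inverse_norm_power:
  "(\<integral>\<^sup>+x. ennreal (1 / (1 + norm (x::'a::euclidean_space)) ^ (DIM('a) + 1)) \<partial>lborel) < \<infinity>"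
proof -
  let ?d = "DIM('a)"
  define V where "V = unit_ball_vol (real ?d)"
  have "1 / (1 + norm x) ^ (?d + 1) \<le> (\<Sum>j. ennreal (1 / 2 ^ (j * (?d + 1))) * indicator (cball 0 (2 ^ (j + 1))) x)" for x :: 'a
  proof -
    define n where "n = (LEAST n. 1 + norm x < 2 ^ n)"
    have ex: "\<exists>n. 1 + norm x < 2 ^ n" by (rule real_arch_pow) simp
    have n: "1 + norm x < 2 ^ n" unfolding n_def by (rule LeastI_ex[OF ex])
    then have "n \<noteq> 0" by (intro notI) simp
    then obtain j where j: "n = Suc j" using not0_implies_Suc by blast
    have "\<not> 1 + norm x < 2 ^ j" using not_less_Least[of j "\<lambda>n. 1 + norm x < 2 ^ n"] j unfolding n_def by simp
    then have "(2 ^ j) ^ (?d + 1) \<le> (1 + norm x) ^ (?d + 1)" by (intro power_mono) auto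
    then have "1 / (1 + norm x) ^ (?d + 1) \<le> 1 / 2 ^ (j * (?d + 1))"
      unfolding power_mult by (intro divide_left_mono) (auto simp: add_pos_nonneg)
    moreover have "x \<in> cball 0 (2 ^ (j + 1))" using n j by auto
    ultimately have "ennreal (1 / (1 + norm x) ^ (?d + 1)) \<le>
        (\<Sum>i\<in>{j}. ennreal (1 / 2 ^ (i * (?d + 1))) * indicator (cball 0 (2 ^ (i + 1))) x)"
      by (simp add: ennreal_leI del: power_Suc)
    also have "\<dots> \<le> (\<Sum>j. ennreal (1 / 2 ^ (j * (?d + 1))) * indicator (cball 0 (2 ^ (j + 1))) x)"
      by (rule sum_le_suminf) auto
    finally show ?thesis .
  qed
  then have "(\<integral>\<^sup>+x. ennreal (1 / (1 + norm (x::'a)) ^ (?d + 1)) \<partial>lborel) \<le>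
      (\<integral>\<^sup>+x. (\<Sum>j. ennreal (1 / 2 ^ (j * (?d + 1))) * indicator (cball 0 (2 ^ (j + 1))) (x::'a)) \<partial>lborel)"
    by (intro nn_integral_mono) auto
  also have "\<dots> = (\<Sum>j. \<integral>\<^sup>+x. ennreal (1 / 2 ^ (j * (?d + 1))) * indicator (cball 0 (2 ^ (j + 1))) (x::'a) \<partial>lborel)"
  proof (rule nn_integral_suminf)
    have [measurable]: "cball (0::'a) r \<in> sets borel" for r by simp
    show "(\<lambda>x::'a. ennreal (1 / 2 ^ (j * (?d + 1))) * indicator (cball 0 (2 ^ (j + 1))) x) \<in> borel_measurable lborel" for j
      by measurable
  qed
  also have "\<dots> = (\<Sum>j. ennreal (1 / 2 ^ (j * (?d + 1))) * emeasure lborel (cball (0::'a) (2 ^ (j + 1))))"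
    by (intro suminf_cong nn_integral_cmult_indicator) auto
  also have "\<dots> = (\<Sum>j. ennreal (V * 2 ^ ?d * (1 / 2) ^ j))"
  proof (intro suminf_cong)
    fix j
    have "1 / 2 ^ (j * (?d + 1)) * (V * (2 ^ (j + 1)) ^ ?d) = V * 2 ^ ?d * (1 / 2) ^ j"
    proof -
      have "(2::real) ^ (j * (?d + 1)) = 2 ^ (j * ?d) * 2 ^ j" by (simp add: power_add)
      moreover have "((2::real) ^ (j + 1)) ^ ?d = 2 ^ (j * ?d) * 2 ^ ?d"
        by (simp only: power_mult[symmetric] power_add[symmetric]) (simp add: algebra_simps)
      ultimately show ?thesis by (simp add: power_one_over)
    qed
    moreover have "emeasure lborel (cball (0::'a) (2 ^ (j + 1))) = ennreal (V * (2 ^ (j + 1)) ^ ?d)"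
      unfolding V_def by (rule emeasure_cball) simp
    moreover have "ennreal (1 / 2 ^ (j * (?d + 1))) * ennreal b = ennreal (1 / 2 ^ (j * (?d + 1)) * b)" for b
      by (rule ennreal_mult'[symmetric]) simp
    ultimately show "ennreal (1 / 2 ^ (j * (?d + 1))) * emeasure lborel (cball (0::'a) (2 ^ (j + 1))) = ennreal (V * 2 ^ ?d * (1 / 2) ^ j)"
      by presburger
  qed
  also have "\<dots> < \<infinity>"
  proof -
    have "summable (\<lambda>j. V * 2 ^ ?d * (1 / 2) ^ j)" by (intro summable_mult summable_geometric) simp
    moreover have "0 \<le> V * 2 ^ ?d * (1 / 2) ^ j" for j :: nat by (simp add: V_def)
    ultimately have "(\<Sum>j. ennreal (V * 2 ^ ?d * (1 / 2) ^ j)) = ennreal (\<Sum>j. V * 2 ^ ?d * (1 / 2) ^ j)"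
      by (intro suminf_ennreal2)
    then show ?thesis by (simp only: ennreal_less_top infinity_ennreal_def)
  qed
  finally show ?thesis .
qed

lemma rapidly_decreasing_integrable:
  fixes f :: "real^'n \<Rightarrow> complex"
  assumes "rapidly_decreasing f" "f \<in> borel_measurable borel"
  shows "integrable lborel (\<lambda>x. (1 + norm x) ^ m * cmod (f x))"
proof -
  let ?d = "DIM(real^'n) + 1"
  obtain C where C: "0 < C" "\<And>x. (1 + norm x) ^ (m + ?d) * cmod (f x) \<le> C"
    using rapidly_decreasing_bound[OF assms(1)] by blast
  have *: "integrable lborel (\<lambda>x::real^'n. C * (1 / (1 + norm x) ^ ?d))"
  proof (intro integrable_mult_right integrableI_nonneg)
    show "(\<integral>\<^sup>+x. ennreal (1 / (1 + norm (x::real^'n)) ^ ?d) \<partial>lborel) < \<infinity>"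
      by (rule nn_integral_inverse_norm_power)
  qed auto
  show ?thesis
  proof (rule Bochner_Integration.integrable_bound[OF *])
    show "(\<lambda>x. (1 + norm x) ^ m * cmod (f x)) \<in> borel_measurable lborel"
      using assms(2) by measurable
    show "AE x in lborel. norm ((1 + norm x) ^ m * cmod (f x)) \<le> norm (C * (1 / (1 + norm x) ^ ?d))"
    proof (intro AE_I2)
      fix x :: "real^'n"
      have "(1 + norm x) ^ m * cmod (f x) \<le> C / (1 + norm x) ^ ?d"
      proof (subst pos_le_divide_eq)
        show "0 < (1 + norm x) ^ ?d" by (intro zero_less_power add_pos_nonneg) auto
        show "(1 + norm x) ^ m * cmod (f x) * (1 + norm x) ^ ?d \<le> C"
          using C(2)[of x] unfolding power_add[of _ m] by (simp only: mult_ac)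
      qed
      then show "norm ((1 + norm x) ^ m * cmod (f x)) \<le> norm (C * (1 / (1 + norm x) ^ ?d))"
        using C(1) by (simp add: abs_mult)
    qed
  qed
qed

lemma Schwartz_integrable_weight:
  "f \<in> Schwartz \<Longrightarrow> integrable lborel (\<lambda>x. (1 + norm x) ^ m * cmod (f x))"
  by (intro rapidly_decreasing_integrable Schwartz_rapidly_decreasing Schwartz_borel)

lemma Schwartz_integrable: "f \<in> Schwartz \<Longrightarrow> integrable lborel f"
  by (rule integrable_norm_cancel) (use Schwartz_integrable_weight[of f 0] Schwartz_borel[of f] in simp_all)

section \<open>A supply of Schwartz functions\<close>

definition logistic :: "real \<Rightarrow> real" where
  "logistic t = 1 / (1 + exp (- t))"

lemma logistic_bounds: "0 < logistic t" "logistic t < 1"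
  by (auto simp: logistic_def add_pos_pos)

text \<open>The derivative is a polynomial in the function itself; this keeps the class generated
  below closed under differentiation.\<close>

lemma logistic_has_derivative:
  "(logistic has_field_derivative logistic t * (1 - logistic t)) (at t)"
proof -
  have "1 + exp (- t) \<noteq> 0" by (smt (verit) exp_gt_zero)
  then show ?thesis unfolding logistic_def[abs_def]
    by (auto intro!: derivative_eq_intros simp: field_simps power2_eq_square)
qed

lemma logistic_minus: "logistic (- t) = 1 - logistic t"
proof -
  have "1 + exp t \<noteq> 0" by (smt (verit) exp_gt_zero)
  then show ?thesis by (simp add: logistic_def exp_minus field_simps)
qed

lemma logistic_tendsto:
  "(\<lambda>k. logistic (real k * t)) \<longlonglongrightarrow> (if 0 < t then 1 else if t = 0 then 1 / 2 else 0)"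
proof -
  have pos: "(\<lambda>k. logistic (real k * s)) \<longlonglongrightarrow> 1" if "0 < s" for s
  proof -
    have "(\<lambda>k. exp (- s) ^ k) \<longlonglongrightarrow> 0" using that by (intro LIMSEQ_power_zero) simp
    then have "(\<lambda>k. 1 / (1 + exp (- s) ^ k)) \<longlonglongrightarrow> 1 / (1 + 0)"
      by (intro tendsto_divide tendsto_const tendsto_add) auto
    then show ?thesis by (simp add: logistic_def exp_of_nat_mult[symmetric])
  qed
  show ?thesis
  proof (cases t "0 :: real" rule: linorder_cases)
    case less
    have "(\<lambda>k. 1 - logistic (real k * (- t))) \<longlonglongrightarrow> 1 - 1"
      using less by (intro tendsto_diff pos) auto
    then show ?thesis using less by (simp add: logistic_minus)
  qed (use pos in \<open>auto simp: logistic_def\<close>)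
qed

text \<open>Products of a Gaussian with polynomials and logistic functions of the coordinates form a
  class that is closed under partial derivatives and hence consists of Schwartz functions. The
  logistic factors make it possible to approximate indicators of boxes.\<close>

inductive_set gauss_class :: "(real^'n \<Rightarrow> real) set" where
  gauss: "(\<lambda>x. exp (- (x \<bullet> x))) \<in> gauss_class"
| coord: "f \<in> gauss_class \<Longrightarrow> (\<lambda>x. x $ i * f x) \<in> gauss_class"
| logistic: "f \<in> gauss_class \<Longrightarrow> (\<lambda>x. logistic (c * x $ i + d) * f x) \<in> gauss_class"
| lin: "f \<in> gauss_class \<Longrightarrow> g \<in> gauss_class \<Longrightarrow> (\<lambda>x. a * f x + g x) \<in> gauss_class"

lemma gauss_class_cmult: "f \<in> gauss_class \<Longrightarrow> (\<lambda>x. a * f x) \<in> gauss_class"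
  using gauss_class.lin[of f f "a - 1"] by (simp add: algebra_simps)

lemma gauss_class_derivative:
  fixes f :: "real^'n \<Rightarrow> real"
  assumes "f \<in> gauss_class"
  shows "\<exists>D. (\<forall>j. D j \<in> gauss_class) \<and> (\<forall>x. (f has_derivative (\<lambda>h. \<Sum>j\<in>UNIV. h $ j * D j x)) (at x))"
  using assms
proof induction
  case gauss
  show ?case
  proof (intro exI conjI allI)
    show "(\<lambda>x. (- 2) * (x $ j * exp (- (x \<bullet> x)))) \<in> gauss_class" for j :: 'n
      by (intro gauss_class_cmult gauss_class.coord gauss_class.gauss)
    have "((\<lambda>x. exp (- (x \<bullet> x))) has_derivative (\<lambda>h. exp (- (x \<bullet> x)) * - (x \<bullet> h + h \<bullet> x))) (at x)" for x :: "real^'n"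
      by (auto intro!: derivative_eq_intros)
    moreover have "exp (- (x \<bullet> x)) * - (x \<bullet> h + h \<bullet> x) = (\<Sum>j\<in>UNIV. h $ j * ((- 2) * (x $ j * exp (- (x \<bullet> x)))))" for x h :: "real^'n"
      unfolding inner_commute[of x h] inner_vec_def[of h x] by (simp add: sum_distrib_left mult_ac sum_negf)
    ultimately show "((\<lambda>x. exp (- (x \<bullet> x))) has_derivative (\<lambda>h. \<Sum>j\<in>UNIV. h $ j * ((- 2) * (x $ j * exp (- (x \<bullet> x)))))) (at x)" for x :: "real^'n"
      by simp
  qed
next
  case (coord f i)
  then obtain D where D: "\<And>j. D j \<in> gauss_class" "\<And>x. (f has_derivative (\<lambda>h. \<Sum>j\<in>UNIV. h $ j * D j x)) (at x)"
    by blast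
  show ?case
  proof (intro exI conjI allI)
    show "(\<lambda>x. (if j = i then 1 else 0) * f x + x $ i * D j x) \<in> gauss_class" for j
      by (intro gauss_class.lin gauss_class.coord D coord)
    fix x
    have "((\<lambda>x. x $ i * f x) has_derivative (\<lambda>h. x $ i * (\<Sum>j\<in>UNIV. h $ j * D j x) + h $ i * f x)) (at x)"
      by (intro has_derivative_mult D bounded_linear_imp_has_derivative bounded_linear_vec_nth)
    moreover have "x $ i * (\<Sum>j\<in>UNIV. h $ j * D j x) + h $ i * f x =
       (\<Sum>j\<in>UNIV. h $ j * ((if j = i then 1 else 0) * f x + x $ i * D j x))" for h
      by (simp add: algebra_simps sum.distrib sum_distrib_left if_distrib[of "\<lambda>t. _ * t"] sum.delta cong: if_cong)
    ultimately show "((\<lambda>x. x $ i * f x) has_derivative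
       (\<lambda>h. \<Sum>j\<in>UNIV. h $ j * ((if j = i then 1 else 0) * f x + x $ i * D j x))) (at x)"
      by simp
  qed
next
  case (logistic f c i d)
  then obtain D where D: "\<And>j. D j \<in> gauss_class" "\<And>x. (f has_derivative (\<lambda>h. \<Sum>j\<in>UNIV. h $ j * D j x)) (at x)"
    by blast
  let ?l = "\<lambda>x. logistic (c * x $ i + d)"
  let ?E = "\<lambda>j x. (if j = i then c else 0) * (?l x * f x) + ((if j = i then - c else 0) * (?l x * (?l x * f x)) + ?l x * D j x)"
  show ?case
  proof (intro exI conjI allI)
    show "?E j \<in> gauss_class" for j
      by (intro gauss_class.lin gauss_class.logistic D logistic)
    fix x
    have "((\<lambda>x. c * x $ i + d) has_derivative (\<lambda>h. c * h $ i)) (at x)"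
      by (auto intro!: derivative_eq_intros bounded_linear_imp_has_derivative bounded_linear_vec_nth)
    from has_derivative_compose[OF this logistic_has_derivative[THEN has_field_derivative_imp_has_derivative]]
    have "(?l has_derivative (\<lambda>h. ?l x * (1 - ?l x) * (c * h $ i))) (at x)" .
    then have "((\<lambda>x. ?l x * f x) has_derivative
       (\<lambda>h. ?l x * (\<Sum>j\<in>UNIV. h $ j * D j x) + ?l x * (1 - ?l x) * (c * h $ i) * f x)) (at x)"
      by (intro has_derivative_mult D)
    moreover have "?l x * (\<Sum>j\<in>UNIV. h $ j * D j x) + ?l x * (1 - ?l x) * (c * h $ i) * f x =
       (\<Sum>j\<in>UNIV. h $ j * ?E j x)" for h
      by (simp add: algebra_simps sum.distrib sum_distrib_left if_distrib[of "\<lambda>t. _ * t"] if_distrib[of "\<lambda>t. t * _"] sum.delta cong: if_cong)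
    ultimately show "((\<lambda>x. ?l x * f x) has_derivative (\<lambda>h. \<Sum>j\<in>UNIV. h $ j * ?E j x)) (at x)"
      by simp
  qed
next
  case (lin f g a)
  then obtain D E where D: "\<And>j. D j \<in> gauss_class" "\<And>x. (f has_derivative (\<lambda>h. \<Sum>j\<in>UNIV. h $ j * D j x)) (at x)"
    and E: "\<And>j. E j \<in> gauss_class" "\<And>x. (g has_derivative (\<lambda>h. \<Sum>j\<in>UNIV. h $ j * E j x)) (at x)"
    by blast
  show ?case
  proof (intro exI conjI allI)
    show "(\<lambda>x. a * D j x + E j x) \<in> gauss_class" for j
      by (intro gauss_class.lin D E)
    have "((\<lambda>x. a * f x + g x) has_derivative (\<lambda>h. a * (\<Sum>j\<in>UNIV. h $ j * D j x) + (\<Sum>j\<in>UNIV. h $ j * E j x))) (at x)" for x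
      by (intro has_derivative_add has_derivative_mult_right D E)
    then show "((\<lambda>x. a * f x + g x) has_derivative (\<lambda>h. \<Sum>j\<in>UNIV. h $ j * (a * D j x + E j x))) (at x)" for x
      by (simp add: sum.distrib sum_distrib_left algebra_simps)
  qed
qed

text \<open>The power \<open>m\<close> stays arbitrary in the induction because a coordinate factor
  consumes one power of the weight.\<close>

lemma gauss_class_decay:
  fixes f :: "real^'n \<Rightarrow> real"
  assumes "f \<in> gauss_class"
  shows "\<exists>C. \<forall>x. (1 + norm x) ^ m * \<bar>f x\<bar> \<le> C"
  using assms
proof (induction arbitrary: m)
  case gauss
  have "(1 + norm x) ^ m * \<bar>exp (- (x \<bullet> x))\<bar> \<le> fact m * exp 2" for x :: "real^'n"
  proof -
    let ?t = "norm x"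
    \<comment> \<open>A single term of the exponential series bounds the power.\<close>
    have "(1 + ?t) ^ m / fact m \<le> exp (1 + ?t)"
      using sum_le_suminf[of "\<lambda>n. (1 + ?t) ^ n /\<^sub>R fact n" "{m}"] exp_converges[of "1 + ?t"]
      by (auto simp: sums_iff divide_inverse mult.commute)
    then have "(1 + ?t) ^ m \<le> fact m * exp (1 + ?t)" by (simp add: field_simps)
    then have "(1 + norm x) ^ m * exp (- (x \<bullet> x)) \<le> fact m * exp (1 + ?t) * exp (- (x \<bullet> x))"
      by (intro mult_right_mono) auto
    also have "\<dots> = fact m * exp (1 + ?t - ?t\<^sup>2)"
      by (simp add: power2_norm_eq_inner exp_diff exp_minus divide_inverse)
    also have "\<dots> \<le> fact m * exp 2"
    proof -
      \<comment> \<open>Completing the square gives 1 + t - t^2 <= 5/4.\<close>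
      have "0 \<le> (?t - 1 / 2)\<^sup>2" by simp
      then have "1 + ?t - ?t\<^sup>2 \<le> 2" unfolding power2_diff by (simp add: power2_eq_square)
      then show ?thesis by simp
    qed
    finally show ?thesis by simp
  qed
  then show ?case by blast
next
  case (coord f i)
  obtain C where C: "\<And>x. (1 + norm x) ^ Suc m * \<bar>f x\<bar> \<le> C" using coord.IH by blast
  have "(1 + norm x) ^ m * \<bar>x $ i * f x\<bar> \<le> C" for x
  proof -
    have "(1 + norm x) ^ m * \<bar>x $ i * f x\<bar> = (1 + norm x) ^ m * (\<bar>x $ i\<bar> * \<bar>f x\<bar>)" by (simp add: abs_mult)
    also have "\<dots> \<le> (1 + norm x) ^ m * ((1 + norm x) * \<bar>f x\<bar>)"
      by (intro mult_left_mono mult_right_mono order_trans[OF component_le_norm_cart]) auto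
    also have "\<dots> \<le> C" using C[of x] by (simp add: mult_ac)
    finally show ?thesis .
  qed
  then show ?case by blast
next
  case (logistic f c i d)
  obtain C where C: "\<And>x. (1 + norm x) ^ m * \<bar>f x\<bar> \<le> C" using logistic.IH by blast
  have "(1 + norm x) ^ m * \<bar>logistic (c * x $ i + d) * f x\<bar> \<le> C" for x
  proof -
    have "(1 + norm x) ^ m * \<bar>logistic (c * x $ i + d) * f x\<bar> \<le> (1 + norm x) ^ m * (1 * \<bar>f x\<bar>)"
      unfolding abs_mult using logistic_bounds[of "c * x $ i + d"]
      by (intro mult_left_mono mult_right_mono) auto
    also have "\<dots> \<le> C" using C[of x] by simp
    finally show ?thesis .
  qed
  then show ?case by blast
next
  case (lin f g a)
  obtain C D where C: "\<And>x. (1 + norm x) ^ m * \<bar>f x\<bar> \<le> C" and D: "\<And>x. (1 + norm x) ^ m * \<bar>g x\<bar> \<le> D"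
    using lin.IH by meson
  have "(1 + norm x) ^ m * \<bar>a * f x + g x\<bar> \<le> \<bar>a\<bar> * C + D" for x
  proof -
    have "(1 + norm x) ^ m * \<bar>a * f x + g x\<bar> \<le> (1 + norm x) ^ m * (\<bar>a\<bar> * \<bar>f x\<bar> + \<bar>g x\<bar>)"
      by (intro mult_left_mono order_trans[OF abs_triangle_ineq]) (auto simp: abs_mult)
    also have "\<dots> = \<bar>a\<bar> * ((1 + norm x) ^ m * \<bar>f x\<bar>) + (1 + norm x) ^ m * \<bar>g x\<bar>"
      by (simp add: algebra_simps)
    also have "\<dots> \<le> \<bar>a\<bar> * C + D" by (intro add_mono mult_left_mono C D) auto
    finally show ?thesis .
  qed
  then show ?case by blast
qed

lemma gauss_class_Schwartz:
  fixes f :: "real^'n \<Rightarrow> real"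
  assumes "f \<in> gauss_class"
  shows "(\<lambda>x. complex_of_real (f x)) \<in> Schwartz"
proof (rule Schwartz_coinduct[of _ "{\<lambda>x. complex_of_real (f x) |f. f \<in> gauss_class}"])
  fix g :: "real^'n \<Rightarrow> complex" and x i assume "g \<in> {\<lambda>x. complex_of_real (f x) |f. f \<in> gauss_class}"
  then obtain f where f: "f \<in> gauss_class" and g: "g = (\<lambda>x. complex_of_real (f x))" by blast
  obtain D where D: "\<And>j. D j \<in> gauss_class" "\<And>x. (f has_derivative (\<lambda>h. \<Sum>j\<in>UNIV. h $ j * D j x)) (at x)"
    using gauss_class_derivative[OF f] by blast
  have D': "(g has_derivative (\<lambda>h. complex_of_real (\<Sum>j\<in>UNIV. h $ j * D j x))) (at x)" for x
    unfolding g by (rule has_derivative_of_real[OF D(2)])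
  show "g differentiable (at x)" using D' differentiable_def by blast
  show "rapidly_decreasing g" unfolding rapidly_decreasing_def g using gauss_class_decay[OF f] by simp
  have "partial_deriv i g = (\<lambda>x. complex_of_real (D i x))"
  proof
    fix x
    have "(\<Sum>j\<in>UNIV. axis i 1 $ j * D j x) = D i x"
      by (simp add: axis_def if_distrib[of "\<lambda>t. t * _"] sum.delta cong: if_cong)
    then show "partial_deriv i g x = complex_of_real (D i x)"
      by (subst partial_deriv_eqI[OF D']) simp
  qed
  then show "partial_deriv i g \<in> {\<lambda>x. complex_of_real (f x) |f. f \<in> gauss_class}" using D(1) by blast
qed (use assms in blast)

section \<open>Convolutions\<close>

lemma integrable_mult_bounded:
  fixes w g :: "'a \<Rightarrow> complex"
  assumes "integrable M w" "g \<in> borel_measurable M" "\<And>x. cmod (g x) \<le> C"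
  shows "integrable M (\<lambda>x. w x * g x)"
proof (rule Bochner_Integration.integrable_bound[where f = "\<lambda>x. C * cmod (w x)"])
  show "integrable M (\<lambda>x. C * cmod (w x))" using assms(1) by simp
  show "(\<lambda>x. w x * g x) \<in> borel_measurable M" using assms by measurable
  show "AE x in M. norm (w x * g x) \<le> norm (C * cmod (w x))"
  proof (intro AE_I2)
    fix x
    have "0 \<le> C" using assms(3)[of x] norm_ge_zero order_trans by blast
    then show "norm (w x * g x) \<le> norm (C * cmod (w x))"
      using assms(3)[of x] by (simp add: norm_mult mult.commute mult_right_mono)
  qed
qed

lemma Schwartz_conv_integrable:
  fixes f :: "real^'n \<Rightarrow> complex"
  assumes "integrable lborel w" "f \<in> Schwartz"
  shows "integrable lborel (\<lambda>x. w x * f (x + e *\<^sub>R y))"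
proof -
  obtain C where "\<And>x. (1 + norm x) ^ 0 * cmod (f x) \<le> C"
    using rapidly_decreasing_bound[OF Schwartz_rapidly_decreasing[OF assms(2)]] by metis
  moreover have [measurable]: "f \<in> borel_measurable borel" by (rule Schwartz_borel[OF assms(2)])
  ultimately show ?thesis by (intro integrable_mult_bounded[OF assms(1)]) auto
qed

text \<open>The uniform quadratic Taylor remainder, integrated against the modulus of
  \<open>w\<close>, is of order (norm h)^2. So differentiation under the integral sign requires no
  exchange of a limit with an integral.\<close>

lemma Schwartz_conv_derivative:
  fixes f :: "real^'n \<Rightarrow> complex"
  assumes w: "integrable lborel w" and f: "f \<in> Schwartz"
  shows "((\<lambda>y. \<integral>x. w x * f (x + e *\<^sub>R y) \<partial>lborel) has_derivative
    (\<lambda>h. \<Sum>i\<in>UNIV. complex_of_real (h $ i) * (\<integral>x. w x * (complex_of_real e * partial_deriv i f (x + e *\<^sub>R y)) \<partial>lborel))) (at y)"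
proof -
  obtain C where C: "0 < C" "\<And>y h. cmod (f (y + h) - f y - (\<Sum>i\<in>UNIV. complex_of_real (h $ i) * partial_deriv i f y)) \<le> C * (norm h)\<^sup>2"
    using Schwartz_Taylor[OF f] by metis
  let ?G = "\<lambda>y. \<integral>x. w x * f (x + e *\<^sub>R y) \<partial>lborel"
  let ?P = "\<lambda>i. \<integral>x. w x * (complex_of_real e * partial_deriv i f (x + e *\<^sub>R y)) \<partial>lborel"
  define K where "K = C * e\<^sup>2 * (\<integral>x. cmod (w x) \<partial>lborel)"
  have i1: "integrable lborel (\<lambda>x. w x * f (x + e *\<^sub>R y))" for y
    by (rule Schwartz_conv_integrable[OF w f])
  have i2: "integrable lborel (\<lambda>x. w x * (complex_of_real e * partial_deriv i f (x + e *\<^sub>R y)))" for i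
    using Schwartz_conv_integrable[OF w Schwartz_cmult[OF Schwartz_partial_deriv[OF f]]] by blast
  have est: "cmod (?G (y + h) - ?G y - (\<Sum>i\<in>UNIV. complex_of_real (h $ i) * ?P i)) \<le> K * (norm h)\<^sup>2" for h
  proof -
    let ?r = "\<lambda>x. f (x + e *\<^sub>R y + e *\<^sub>R h) - f (x + e *\<^sub>R y) - (\<Sum>i\<in>UNIV. complex_of_real ((e *\<^sub>R h) $ i) * partial_deriv i f (x + e *\<^sub>R y))"
    have eq: "w x * ?r x = w x * f (x + e *\<^sub>R (y + h)) - w x * f (x + e *\<^sub>R y) -
        (\<Sum>i\<in>UNIV. complex_of_real (h $ i) * (w x * (complex_of_real e * partial_deriv i f (x + e *\<^sub>R y))))" for x
      by (simp add: algebra_simps sum_distrib_left)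
    have i3: "integrable lborel (\<lambda>x. w x * ?r x)"
      unfolding eq by (intro Bochner_Integration.integrable_diff Bochner_Integration.integrable_sum integrable_mult_right i1 i2)
    let ?S = "\<lambda>x. \<Sum>i\<in>UNIV. complex_of_real (h $ i) * (w x * (complex_of_real e * partial_deriv i f (x + e *\<^sub>R y)))"
    have "(\<integral>x. w x * ?r x \<partial>lborel) =
        (\<integral>x. w x * f (x + e *\<^sub>R (y + h)) - w x * f (x + e *\<^sub>R y) \<partial>lborel) - (\<integral>x. ?S x \<partial>lborel)"
      unfolding eq by (rule Bochner_Integration.integral_diff)
        (intro Bochner_Integration.integrable_diff Bochner_Integration.integrable_sum integrable_mult_right i1 i2)+
    also have "(\<integral>x. w x * f (x + e *\<^sub>R (y + h)) - w x * f (x + e *\<^sub>R y) \<partial>lborel) = ?G (y + h) - ?G y"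
      by (rule Bochner_Integration.integral_diff[OF i1 i1])
    also have "(\<integral>x. ?S x \<partial>lborel) = (\<Sum>i\<in>UNIV. \<integral>x. complex_of_real (h $ i) * (w x * (complex_of_real e * partial_deriv i f (x + e *\<^sub>R y))) \<partial>lborel)"
      by (intro Bochner_Integration.integral_sum integrable_mult_right i2)
    also have "\<dots> = (\<Sum>i\<in>UNIV. complex_of_real (h $ i) * ?P i)"
      by (intro sum.cong refl Bochner_Integration.integral_mult_right_zero)
    finally have "cmod (?G (y + h) - ?G y - (\<Sum>i\<in>UNIV. complex_of_real (h $ i) * ?P i)) = cmod (\<integral>x. w x * ?r x \<partial>lborel)"
      by simp
    also have "\<dots> \<le> (\<integral>x. cmod (w x * ?r x) \<partial>lborel)" by (rule integral_norm_bound)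
    also have "\<dots> \<le> (\<integral>x. (C * (norm (e *\<^sub>R h))\<^sup>2) * cmod (w x) \<partial>lborel)"
    proof (intro integral_mono integrable_norm integrable_mult_right i3 w)
      fix x show "cmod (w x * ?r x) \<le> (C * (norm (e *\<^sub>R h))\<^sup>2) * cmod (w x)"
        unfolding norm_mult using C(2)[of "x + e *\<^sub>R y" "e *\<^sub>R h"] by (simp only: mult.commute mult_left_mono norm_ge_zero)
    qed
    also have "\<dots> = K * (norm h)\<^sup>2" by (simp add: K_def power_mult_distrib)
    finally show ?thesis .
  qed
  have bl: "bounded_linear (\<lambda>h. \<Sum>i\<in>UNIV. complex_of_real (h $ i) * ?P i)"
    by (intro bounded_linear_sum bounded_linear_mult_const bounded_linear_compose[OF bounded_linear_of_real bounded_linear_vec_nth])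
  show ?thesis unfolding has_derivative_at
  proof (intro conjI bl)
    show "(\<lambda>h. norm (?G (y + h) - ?G y - (\<Sum>i\<in>UNIV. complex_of_real (h $ i) * ?P i)) / norm h) \<midarrow>0\<rightarrow> 0"
    proof (rule Lim_null_comparison)
      show "(\<lambda>h. K * norm h) \<midarrow>0\<rightarrow> 0" by (auto intro!: tendsto_eq_intros)
      show "\<forall>\<^sub>F h in at 0. norm (norm (?G (y + h) - ?G y - (\<Sum>i\<in>UNIV. complex_of_real (h $ i) * ?P i)) / norm h) \<le> K * norm h"
        unfolding eventually_at_filter
      proof (intro always_eventually allI impI)
        fix h :: "real^'n" assume "h \<noteq> 0"
        then show "norm (norm (?G (y + h) - ?G y - (\<Sum>i\<in>UNIV. complex_of_real (h $ i) * ?P i)) / norm h) \<le> K * norm h"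
          using est[of h] by (simp add: divide_le_eq power2_eq_square mult_ac)
      qed
    qed
  qed
qed

lemma Schwartz_conv_bound:
  fixes f :: "real^'n \<Rightarrow> complex"
  assumes "f \<in> Schwartz" "\<bar>e\<bar> = 1"
  obtains C where "0 < C" "\<And>x y. (1 + norm y) ^ m * cmod (f (x + e *\<^sub>R y)) \<le> C * (1 + norm x) ^ m"
proof -
  obtain C where C: "0 < C" "\<And>x. (1 + norm x) ^ m * cmod (f x) \<le> C"
    using rapidly_decreasing_bound[OF Schwartz_rapidly_decreasing[OF assms(1)]] by metis
  have "(1 + norm y) ^ m * cmod (f (x + e *\<^sub>R y)) \<le> C * (1 + norm x) ^ m" for x y
  proof -
    have "norm y = norm ((x + e *\<^sub>R y) + (- x))" using assms(2) by simp
    then have "(1 + norm y) ^ m \<le> (1 + norm (x + e *\<^sub>R y)) ^ m * (1 + norm x) ^ m"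
      using one_plus_norm_power[of "x + e *\<^sub>R y" "- x" m] by (simp only: norm_minus_cancel)
    then have "(1 + norm y) ^ m * cmod (f (x + e *\<^sub>R y)) \<le> ((1 + norm (x + e *\<^sub>R y)) ^ m * (1 + norm x) ^ m) * cmod (f (x + e *\<^sub>R y))"
      by (intro mult_right_mono) auto
    also have "\<dots> \<le> C * (1 + norm x) ^ m"
      using mult_right_mono[OF C(2)[of "x + e *\<^sub>R y"], of "(1 + norm x) ^ m"] by (simp only: mult_ac) simp
    finally show ?thesis .
  qed
  with C(1) show ?thesis by (rule that)
qed

text \<open>With e = 1 this is the correlation that appears for approximate identities, with e = -1
  the integral against the reflected kernel. All derivatives fall on f, and decay follows by
  splitting the weight between x and x + e y.\<close>

lemma Schwartz_conv:
  fixes f :: "real^'n \<Rightarrow> complex"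
  assumes w: "w \<in> Schwartz" and f: "f \<in> Schwartz" and e: "\<bar>e\<bar> = 1"
  shows "(\<lambda>y. \<integral>x. w x * f (x + e *\<^sub>R y) \<partial>lborel) \<in> Schwartz" (is "?G f \<in> _")
    and "iter_partial js (\<lambda>y. \<integral>x. w x * f (x + e *\<^sub>R y) \<partial>lborel) =
      (\<lambda>y. complex_of_real (e ^ length js) * (\<integral>x. w x * iter_partial js f (x + e *\<^sub>R y) \<partial>lborel))"
proof -
  have wi: "integrable lborel w" by (rule Schwartz_integrable[OF w])
  have part: "partial_deriv i (?G g) = (\<lambda>y. \<integral>x. w x * (complex_of_real e * partial_deriv i g (x + e *\<^sub>R y)) \<partial>lborel)"
    if "g \<in> Schwartz" for g i
  proof
    fix y
    have *: "complex_of_real (axis i 1 $ k) * c = (if k = i then c else 0)" for k c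
      by (simp add: axis_def)
    show "partial_deriv i (?G g) y = (\<integral>x. w x * (complex_of_real e * partial_deriv i g (x + e *\<^sub>R y)) \<partial>lborel)"
      by (subst partial_deriv_eqI[OF Schwartz_conv_derivative[OF wi that]]) (simp add: * sum.delta)
  qed
  show "?G f \<in> Schwartz"
  proof (rule Schwartz_coinduct[of _ "?G ` Schwartz"])
    fix h :: "real^'n \<Rightarrow> complex" and z i assume "h \<in> ?G ` Schwartz"
    then obtain g where g: "g \<in> Schwartz" and h: "h = ?G g" by blast
    show "h differentiable (at z)" unfolding h
      using Schwartz_conv_derivative[OF wi g] differentiable_def by blast
    have "partial_deriv i h = ?G (\<lambda>x. complex_of_real e * partial_deriv i g x)"
      unfolding h part[OF g] ..
    then show "partial_deriv i h \<in> ?G ` Schwartz"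
      by (rule image_eqI[where x = "\<lambda>x. complex_of_real e * partial_deriv i g x"]) (intro Schwartz_cmult Schwartz_partial_deriv g)
    show "rapidly_decreasing h" unfolding rapidly_decreasing_def
    proof
      fix m
      obtain C where C: "0 < C" "\<And>x y. (1 + norm y) ^ m * cmod (g (x + e *\<^sub>R y)) \<le> C * (1 + norm x) ^ m"
        using Schwartz_conv_bound[OF g e] by metis
      have "(1 + norm y) ^ m * cmod (h y) \<le> (\<integral>x. C * ((1 + norm x) ^ m * cmod (w x)) \<partial>lborel)" for y
      proof -
        have "(1 + norm y) ^ m * cmod (h y) \<le> (1 + norm y) ^ m * (\<integral>x. cmod (w x * g (x + e *\<^sub>R y)) \<partial>lborel)"
          unfolding h by (intro mult_left_mono integral_norm_bound) auto
        also have "\<dots> = (\<integral>x. (1 + norm y) ^ m * cmod (w x * g (x + e *\<^sub>R y)) \<partial>lborel)" by simp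
        also have "\<dots> \<le> (\<integral>x. C * ((1 + norm x) ^ m * cmod (w x)) \<partial>lborel)"
        proof (intro integral_mono integrable_mult_right integrable_norm Schwartz_conv_integrable[OF wi g] Schwartz_integrable_weight[OF w])
          fix x show "(1 + norm y) ^ m * cmod (w x * g (x + e *\<^sub>R y)) \<le> C * ((1 + norm x) ^ m * cmod (w x))"
            using mult_right_mono[OF C(2)[of y x], of "cmod (w x)"] by (simp add: norm_mult mult_ac)
        qed
        finally show ?thesis .
      qed
      then show "\<exists>C. \<forall>x. (1 + norm x) ^ m * cmod (h x) \<le> C" by blast
    qed
  qed (use f in blast)
  show "iter_partial js (?G f) = (\<lambda>y. complex_of_real (e ^ length js) * (\<integral>x. w x * iter_partial js f (x + e *\<^sub>R y) \<partial>lborel))"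
  proof (induction js)
    case (Cons i js)
    have S: "iter_partial js f \<in> Schwartz" by (rule Schwartz_iter_partial[OF f])
    have d: "?G (iter_partial js f) differentiable (at y)" for y
      using Schwartz_conv_derivative[OF wi S] differentiable_def by blast
    show ?case unfolding iter_partial_Cons Cons
    proof
      fix y
      have "partial_deriv i (\<lambda>y. complex_of_real (e ^ length js) * ?G (iter_partial js f) y) y =
         complex_of_real (e ^ length js) * partial_deriv i (?G (iter_partial js f)) y"
        using partial_deriv_lin[OF d d, of i "complex_of_real (e ^ length js)" 0 y] by simp
      then show "partial_deriv i (\<lambda>y. complex_of_real (e ^ length js) * ?G (iter_partial js f) y) y =
        complex_of_real (e ^ length (i # js)) * ?G (partial_deriv i (iter_partial js f)) y"
        unfolding part[OF S] by (simp add: mult_ac Bochner_Integration.integral_mult_right_zero)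
    qed
  qed simp
qed

section \<open>Tempered distributions\<close>

lemma Schwartz_seminorm_cmult_le:
  assumes "f \<in> Schwartz"
  shows "Schwartz_seminorm m js (\<lambda>x. c * f x) \<le> cmod c * Schwartz_seminorm m js f"
proof (rule Schwartz_seminorm_leI)
  fix x
  show "(1 + norm x) ^ m * cmod (iter_partial js (\<lambda>x. c * f x) x) \<le> cmod c * Schwartz_seminorm m js f"
    using mult_left_mono[OF Schwartz_seminorm_ge[OF assms, of x m js], of "cmod c"]
    by (simp add: iter_partial_cmult[OF assms] norm_mult mult_ac)
qed

lemma Schwartz_seminorm_diff_le:
  assumes f: "f \<in> Schwartz" and g: "g \<in> Schwartz" and h: "h \<in> Schwartz"
  shows "Schwartz_seminorm m js (\<lambda>x. f x - h x) \<le>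
    Schwartz_seminorm m js (\<lambda>x. f x - g x) + Schwartz_seminorm m js (\<lambda>x. g x - h x)"
proof (rule Schwartz_seminorm_leI)
  fix x
  let ?f = "iter_partial js f x" and ?g = "iter_partial js g x" and ?h = "iter_partial js h x"
  have "(1 + norm x) ^ m * cmod (?f - ?h) \<le> (1 + norm x) ^ m * (cmod (?f - ?g) + cmod (?g - ?h))"
    by (intro mult_left_mono norm_diff_triangle_ineq[THEN order_trans] order_refl) (use norm_triangle_ineq[of "?f - ?g" "?g - ?h"] in auto)
  also have "\<dots> = (1 + norm x) ^ m * cmod (?f - ?g) + (1 + norm x) ^ m * cmod (?g - ?h)"
    by (simp add: algebra_simps)
  also have "\<dots> \<le> Schwartz_seminorm m js (\<lambda>x. f x - g x) + Schwartz_seminorm m js (\<lambda>x. g x - h x)"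
    using Schwartz_seminorm_ge[OF Schwartz_diff[OF f g], of x m js] Schwartz_seminorm_ge[OF Schwartz_diff[OF g h], of x m js]
    by (simp add: iter_partial_diff f g h)
  finally show "(1 + norm x) ^ m * cmod (iter_partial js (\<lambda>x. f x - h x) x) \<le>
    Schwartz_seminorm m js (\<lambda>x. f x - g x) + Schwartz_seminorm m js (\<lambda>x. g x - h x)"
    by (simp add: iter_partial_diff f h)
qed

lemma zero_Schwartz: "(\<lambda>x :: real^'n. 0) \<in> Schwartz"
  using Schwartz_cmult[OF gauss_class_Schwartz[OF gauss_class.gauss], of 0] by simp

lemma topspace_Schwartz_topology: "topspace Schwartz_topology = (Schwartz :: (real^'n \<Rightarrow> complex) set)"
proof -
  have "\<exists>B\<in>{{g \<in> Schwartz. Schwartz_seminorm m js (\<lambda>x. g x - f x) < e} | f m js e. f \<in> Schwartz \<and> 0 < e}. f \<in> B"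
    if f: "f \<in> Schwartz" for f :: "real^'n \<Rightarrow> complex"
  proof
    have "Schwartz_seminorm 0 [] (\<lambda>x. f x - f x) \<le> 0" by (rule Schwartz_seminorm_leI) simp
    then show "f \<in> {g \<in> Schwartz. Schwartz_seminorm 0 [] (\<lambda>x. g x - f x) < 1}" using f by simp
    show "{g \<in> Schwartz. Schwartz_seminorm 0 [] (\<lambda>x. g x - f x) < 1} \<in> {{g \<in> Schwartz. Schwartz_seminorm m js (\<lambda>x. g x - f x) < e} | f m js e. f \<in> Schwartz \<and> 0 < e}"
      using f by (intro CollectI exI[of _ f] exI[of _ 0] exI[of _ "[]"] exI[of _ "1::real"]) auto
  qed
  then have "(Schwartz :: (real^'n \<Rightarrow> complex) set) \<subseteq> \<Union> {{g \<in> Schwartz. Schwartz_seminorm m js (\<lambda>x. g x - f x) < e} | f m js e. f \<in> Schwartz \<and> 0 < e}"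
    by (intro subsetI) (simp only: Union_iff)
  moreover have "\<Union> {{g \<in> Schwartz. Schwartz_seminorm m js (\<lambda>x. g x - f x) < e} | f m js e. f \<in> Schwartz \<and> 0 < e} \<subseteq> (Schwartz :: (real^'n \<Rightarrow> complex) set)"
    by (intro Union_least) (elim CollectE exE conjE, simp)
  ultimately show ?thesis
    unfolding Schwartz_topology_def topology_generated_by_topspace by (rule equalityI[rotated])
qed

text \<open>Induction over the generated topology. Membership of 0 is a premise inside the induction
  statement, so that intersections and unions pass through. For a subbasic set centred at f, the
  triangle inequality provides a seminorm ball around 0 inside it.\<close>

lemma Schwartz_topology_nhds_zero:
  fixes W :: "(real^'n \<Rightarrow> complex) set"
  assumes "openin Schwartz_topology W" "(\<lambda>x. 0) \<in> W"
  obtains M e where "finite M" "0 < e"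
    "\<And>g. g \<in> Schwartz \<Longrightarrow> (\<And>m js. (m, js) \<in> M \<Longrightarrow> Schwartz_seminorm m js g < e) \<Longrightarrow> g \<in> W"
proof -
  let ?P = "\<lambda>W. (\<lambda>x. 0) \<in> W \<longrightarrow> (\<exists>M e. finite M \<and> 0 < e \<and>
    (\<forall>g\<in>Schwartz. (\<forall>m js. (m, js) \<in> M \<longrightarrow> Schwartz_seminorm m js g < e) \<longrightarrow> g \<in> W))"
  have "generate_topology_on
     {{g \<in> Schwartz. Schwartz_seminorm m js (\<lambda>x. g x - f x) < e} | f m js e. f \<in> Schwartz \<and> 0 < e} W"
    using assms(1) unfolding Schwartz_topology_def by (rule openin_topology_generated_by)
  then have "?P W"
  proof induction
    case Empty then show ?case by simp
  next
    case (Int a b)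
    show ?case
    proof
      assume 0: "(\<lambda>x. 0) \<in> a \<inter> b"
      obtain M e where M: "finite M" "0 < e"
        "\<forall>g\<in>Schwartz. (\<forall>m js. (m, js) \<in> M \<longrightarrow> Schwartz_seminorm m js g < e) \<longrightarrow> g \<in> a"
        using Int.IH(1) 0 by auto
      obtain N d where N: "finite N" "0 < d"
        "\<forall>g\<in>Schwartz. (\<forall>m js. (m, js) \<in> N \<longrightarrow> Schwartz_seminorm m js g < d) \<longrightarrow> g \<in> b"
        using Int.IH(2) 0 by auto
      note M N
      then show "\<exists>M e. finite M \<and> 0 < e \<and>
        (\<forall>g\<in>Schwartz. (\<forall>m js. (m, js) \<in> M \<longrightarrow> Schwartz_seminorm m js g < e) \<longrightarrow> g \<in> a \<inter> b)"
        by (intro exI[of _ "M \<union> N"] exI[of _ "min e d"]) auto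
    qed
  next
    case (UN K)
    show ?case
    proof
      assume "(\<lambda>x. 0) \<in> \<Union> K"
      then obtain k where k: "k \<in> K" "(\<lambda>x. 0) \<in> k" by (rule UnionE)
      then obtain M e where "finite M" "0 < e"
        "\<forall>g\<in>Schwartz. (\<forall>m js. (m, js) \<in> M \<longrightarrow> Schwartz_seminorm m js g < e) \<longrightarrow> g \<in> k"
        using UN by meson
      then show "\<exists>M e. finite M \<and> 0 < e \<and>
        (\<forall>g\<in>Schwartz. (\<forall>m js. (m, js) \<in> M \<longrightarrow> Schwartz_seminorm m js g < e) \<longrightarrow> g \<in> \<Union> K)"
        using k(1) by (intro exI[of _ M] exI[of _ e]) auto
    qed
  next
    case (Basis s)
    then obtain f m js e where s: "s = {g \<in> Schwartz. Schwartz_seminorm m js (\<lambda>x. g x - f x) < e}"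
      and f: "f \<in> Schwartz" by blast
    show ?case
    proof
      assume "(\<lambda>x. 0) \<in> s"
      then have d: "0 < e - Schwartz_seminorm m js (\<lambda>x. 0 - f x)" using s by simp
      have "g \<in> s" if g: "g \<in> Schwartz" and "Schwartz_seminorm m js g < e - Schwartz_seminorm m js (\<lambda>x. 0 - f x)" for g
        using Schwartz_seminorm_diff_le[OF g zero_Schwartz f, of m js] that by (simp add: s)
      then show "\<exists>M e. finite M \<and> 0 < e \<and>
        (\<forall>g\<in>Schwartz. (\<forall>m js. (m, js) \<in> M \<longrightarrow> Schwartz_seminorm m js g < e) \<longrightarrow> g \<in> s)"
        using d by (intro exI[of _ "{(m, js)}"] exI[of _ "e - Schwartz_seminorm m js (\<lambda>x. 0 - f x)"]) auto
    qed
  qed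
  then show ?thesis using assms(2) that by metis
qed

section \<open>Linearity and seminorm bounds of tempered distributions\<close>

lemma tempered_add: "u \<in> tempered_distributions \<Longrightarrow> f \<in> Schwartz \<Longrightarrow> g \<in> Schwartz \<Longrightarrow>
    u (\<lambda>x. f x + g x) = u f + u g"
  and tempered_cmult: "u \<in> tempered_distributions \<Longrightarrow> f \<in> Schwartz \<Longrightarrow> u (\<lambda>x. c * f x) = c * u f"
  by (auto simp: tempered_distributions_def)

lemma tempered_diff: "u \<in> tempered_distributions \<Longrightarrow> f \<in> Schwartz \<Longrightarrow> g \<in> Schwartz \<Longrightarrow>
    u (\<lambda>x. f x - g x) = u f - u g"
  using tempered_add[of u f "\<lambda>x. (-1) * g x"] tempered_cmult[of u g "-1"] Schwartz_cmult[of g "-1"] by simp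

lemma tempered_sum:
  assumes u: "u \<in> tempered_distributions" and "finite I" "I \<noteq> {}" "\<And>i. i \<in> I \<Longrightarrow> f i \<in> Schwartz"
  shows "u (\<lambda>x. \<Sum>i\<in>I. c i * f i x) = (\<Sum>i\<in>I. c i * u (f i))"
  using assms(2-)
proof (induction I rule: finite_ne_induct)
  case (insert i I)
  then show ?case
    using tempered_add[OF u Schwartz_cmult[of "f i" "c i"]  conjunct1[OF Schwartz_sum[of I f c]]]
    by (simp add: tempered_cmult[OF u])
qed (simp add: tempered_cmult[OF u])

text \<open>Continuity at 0 gives a seminorm neighbourhood on which the modulus of u is below 1;
  homogeneity turns this into a linear bound.\<close>

lemma tempered_bound:
  fixes u :: "(real^'n \<Rightarrow> complex) \<Rightarrow> complex"
  assumes u: "u \<in> tempered_distributions"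
  obtains M C where "finite M" "0 < C"
    "\<And>f. f \<in> Schwartz \<Longrightarrow> cmod (u f) \<le> C * (\<Sum>(m, js)\<in>M. Schwartz_seminorm m js f)"
proof -
  have "continuous_map Schwartz_topology euclidean u" using u by (simp add: tempered_distributions_def)
  then have "openin Schwartz_topology {f \<in> topspace Schwartz_topology. u f \<in> ball 0 1}"
    by (rule openin_continuous_map_preimage) simp
  moreover have "u (\<lambda>x. 0) = 0"
    using tempered_cmult[OF u zero_Schwartz, of 0] by simp
  ultimately obtain M e where M: "finite M" "0 < e"
    "\<And>g. g \<in> Schwartz \<Longrightarrow> (\<And>m js. (m, js) \<in> M \<Longrightarrow> Schwartz_seminorm m js g < e) \<Longrightarrow> cmod (u g) < 1"
    using Schwartz_topology_nhds_zero[of "{f \<in> topspace Schwartz_topology. u f \<in> ball 0 1}"]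
    by (simp add: topspace_Schwartz_topology zero_Schwartz) metis
  have "cmod (u f) \<le> 2 / e * (\<Sum>(m, js)\<in>M. Schwartz_seminorm m js f)" (is "_ \<le> _ * ?S") if f: "f \<in> Schwartz" for f
  proof (rule field_le_epsilon)
    fix \<delta> :: real assume "0 < \<delta>"
    have S: "0 \<le> ?S" by (rule sum_nonneg) (auto simp: Schwartz_seminorm_nonneg[OF f])
    \<comment> \<open>The summand \<open>d\<close> allows for vanishing seminorms; with this value
      1/t is exactly the claimed bound plus \<delta>.\<close>
    define d where "d = e * \<delta> / 2"
    have d: "0 < d" using \<open>0 < \<delta>\<close> M(2) by (simp add: d_def)
    define t where "t = e / (2 * (?S + d))"
    have t: "0 < t" using M(2) S d by (simp add: t_def)
    have "cmod (u (\<lambda>x. complex_of_real t * f x)) < 1"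
    proof (rule M(3)[OF Schwartz_cmult[OF f]])
      fix m js assume "(m, js) \<in> M"
      then have "Schwartz_seminorm m js f \<le> ?S"
        using member_le_sum[OF _ _ M(1), of "(m, js)" "\<lambda>(m, js). Schwartz_seminorm m js f"] Schwartz_seminorm_nonneg[OF f]
        by auto
      then have "t * Schwartz_seminorm m js f \<le> t * (?S + d)" using t d by (intro mult_left_mono) auto
      also have "\<dots> = e / 2"
        proof -
          have "?S + d \<noteq> 0" using S d by linarith
          moreover have "e / (2 * s) * s = e / 2" if "s \<noteq> 0" for s using that by simp
          ultimately show ?thesis unfolding t_def by blast
        qed
        also have "\<dots> < e" using M(2) by simp
      finally show "Schwartz_seminorm m js (\<lambda>x. complex_of_real t * f x) < e"
        using Schwartz_seminorm_cmult_le[OF f, of m js "complex_of_real t"] t by simp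
    qed
    then have "t * cmod (u f) < 1" using t by (simp add: tempered_cmult[OF u f] norm_mult)
    then have "cmod (u f) < 1 / t" using t by (simp add: field_simps)
    also have "1 / t = 2 / e * ?S + \<delta>" using M(2) S d by (simp add: t_def d_def field_simps)
    finally show "cmod (u f) \<le> 2 / e * ?S + \<delta>" by simp
  qed
  moreover have "0 < 2 / e" using M(2) by simp
  ultimately show ?thesis using M(1) that by blast
qed

text \<open>A criterion in terms of one seminorm, the form in which functions satisfy it in
  \<open>defines_tempered_distributionI\<close>.\<close>

lemma tempered_distributionI:
  fixes u :: "(real^'n \<Rightarrow> complex) \<Rightarrow> complex"
  assumes "u \<in> extensional Schwartz"
    and add: "\<And>f g. f \<in> Schwartz \<Longrightarrow> g \<in> Schwartz \<Longrightarrow> u (\<lambda>x. f x + g x) = u f + u g"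
    and cmult: "\<And>c f. f \<in> Schwartz \<Longrightarrow> u (\<lambda>x. c * f x) = c * u f"
    and C: "\<And>f. f \<in> Schwartz \<Longrightarrow> cmod (u f) \<le> C * Schwartz_seminorm m js f"
  shows "u \<in> tempered_distributions"
proof -
  have diff: "u f - u g = u (\<lambda>x. f x - g x)" if "f \<in> Schwartz" "g \<in> Schwartz" for f g
    using add[OF that(1) Schwartz_cmult[OF that(2), of "-1"]] cmult[OF that(2), of "-1"] by simp
  have "continuous_map Schwartz_topology euclidean u"
    unfolding continuous_map_def
  proof (intro conjI allI impI)
    fix U :: "complex set" assume "openin euclidean U"
    then have U: "open U" by simp
    show "openin Schwartz_topology {x \<in> topspace Schwartz_topology. u x \<in> U}"
    proof (subst openin_subopen, intro ballI)
      fix f assume "f \<in> {x \<in> topspace Schwartz_topology. u x \<in> U}"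
      then have f: "f \<in> Schwartz" "u f \<in> U" by (auto simp: topspace_Schwartz_topology)
      obtain e where e: "0 < e" "\<And>z. dist z (u f) < e \<Longrightarrow> z \<in> U" using U f(2) open_dist by blast
      let ?d = "e / (\<bar>C\<bar> + 1)"
      let ?T = "{g \<in> Schwartz. Schwartz_seminorm m js (\<lambda>x. g x - f x) < ?d}"
      have d: "0 < ?d" using e(1) by (simp add: add_nonneg_pos)
      have "openin Schwartz_topology ?T" unfolding Schwartz_topology_def
        by (rule topology_generated_by_Basis) (use f(1) d in blast)
      moreover have "f \<in> ?T"
      proof -
        have "Schwartz_seminorm m js (\<lambda>x. f x - f x) \<le> cmod 0 * Schwartz_seminorm m js f"
          using Schwartz_seminorm_cmult_le[OF f(1), of m js 0] by simp
        then show ?thesis using f(1) d by simp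
      qed
      moreover have "?T \<subseteq> {x \<in> topspace Schwartz_topology. u x \<in> U}"
      proof
        fix g assume g: "g \<in> ?T"
        then have S: "(\<lambda>x. g x - f x) \<in> Schwartz" using f(1) Schwartz_diff by blast
        have "dist (u g) (u f) = cmod (u (\<lambda>x. g x - f x))" using g f(1) diff by (simp add: dist_norm)
        also have "\<dots> \<le> C * Schwartz_seminorm m js (\<lambda>x. g x - f x)" by (rule C[OF S])
        also have "\<dots> \<le> \<bar>C\<bar> * Schwartz_seminorm m js (\<lambda>x. g x - f x)"
          by (intro mult_right_mono Schwartz_seminorm_nonneg[OF S]) auto
        also have "\<dots> \<le> \<bar>C\<bar> * ?d" using g by (intro mult_left_mono) auto
        also have "\<dots> < e" using e(1) by (simp add: field_simps)
        finally show "g \<in> {x \<in> topspace Schwartz_topology. u x \<in> U}"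
          using g e(2) by (auto simp: topspace_Schwartz_topology)
      qed
      ultimately show "\<exists>T. openin Schwartz_topology T \<and> f \<in> T \<and> T \<subseteq> {x \<in> topspace Schwartz_topology. u x \<in> U}"
        by blast
    qed
  qed auto
  then show ?thesis using assms by (auto simp: tempered_distributions_def)
qed

lemma tempered_tendsto:
  assumes u: "u \<in> tempered_distributions" and f: "\<And>i. f i \<in> Schwartz" and g: "g \<in> Schwartz"
    and lim: "\<And>m js. (\<lambda>i. Schwartz_seminorm m js (\<lambda>x. f i x - g x)) \<longlonglongrightarrow> 0"
  shows "(\<lambda>i. u (f i)) \<longlonglongrightarrow> u g"
proof -
  obtain M C where M: "finite M" "0 < C"
    "\<And>f. f \<in> Schwartz \<Longrightarrow> cmod (u f) \<le> C * (\<Sum>(m, js)\<in>M. Schwartz_seminorm m js f)"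
    using tempered_bound[OF u] by blast
  have "(\<lambda>i. C * (\<Sum>(m, js)\<in>M. Schwartz_seminorm m js (\<lambda>x. f i x - g x))) \<longlonglongrightarrow> C * (\<Sum>(m, js)\<in>M. 0)"
    by (intro tendsto_intros tendsto_sum) (auto simp: split_def intro: lim)
  then have "(\<lambda>i. C * (\<Sum>(m, js)\<in>M. Schwartz_seminorm m js (\<lambda>x. f i x - g x))) \<longlonglongrightarrow> 0"
    by (simp add: split_def)
  then have "(\<lambda>i. u (f i) - u g) \<longlonglongrightarrow> 0"
    by (rule Lim_null_comparison[rotated])
      (use M(3)[OF Schwartz_diff[OF f g]] in \<open>simp add: tempered_diff[OF u f g, symmetric]\<close>)
  then show ?thesis by (simp add: LIM_zero_iff)
qed

section \<open>Convolution of a distribution with a Schwartz function\<close>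

lemma tempered_conv_bound:
  fixes u :: "(real^'n \<Rightarrow> complex) \<Rightarrow> complex"
  assumes u: "u \<in> tempered_distributions" and \<phi>: "\<phi> \<in> Schwartz"
  obtains C m where "0 < C" "\<And>x. cmod (u (\<lambda>y. \<phi> (x - y))) \<le> C * (1 + norm x) ^ m"
proof -
  obtain M C where M: "finite M" "0 < C"
    "\<And>f. f \<in> Schwartz \<Longrightarrow> cmod (u f) \<le> C * (\<Sum>(m, js)\<in>M. Schwartz_seminorm m js f)"
    using tempered_bound[OF u] by blast
  have "\<exists>K>0. \<forall>x. Schwartz_seminorm m js (\<lambda>y. \<phi> (x - y)) \<le> K * (1 + norm x) ^ m" for m js
  proof -
    obtain K where K: "0 < K" "\<And>x y. (1 + norm y) ^ m * cmod (iter_partial js \<phi> (x + (- 1) *\<^sub>R y)) \<le> K * (1 + norm x) ^ m"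
      using Schwartz_conv_bound[OF Schwartz_iter_partial[OF \<phi>], of "-1"] by auto
    have "Schwartz_seminorm m js (\<lambda>y. \<phi> (x - y)) \<le> K * (1 + norm x) ^ m" for x
      using K(2)[of _ x] by (intro Schwartz_seminorm_leI) (simp add: iter_partial_reflect[OF \<phi>] norm_mult norm_power)
    then show ?thesis using K(1) by blast
  qed
  then obtain K where K: "\<And>m js. 0 < K m js" "\<And>m js x. Schwartz_seminorm m js (\<lambda>y. \<phi> (x - y)) \<le> K m js * (1 + norm x) ^ m"
    by metis
  \<comment> \<open>The largest power among the finitely many seminorms; inserting 0 makes
    \<open>Max\<close> meaningful when there are none.\<close>
  define N where "N = Max (insert 0 (fst ` M))"
  have N: "m \<le> N" if "(m, js) \<in> M" for m js
    unfolding N_def using that M(1) by (intro Max_ge) force+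
  have "cmod (u (\<lambda>y. \<phi> (x - y))) \<le> (C * (1 + (\<Sum>(m, js)\<in>M. K m js))) * (1 + norm x) ^ N" for x
  proof -
    have "cmod (u (\<lambda>y. \<phi> (x - y))) \<le> C * (\<Sum>(m, js)\<in>M. Schwartz_seminorm m js (\<lambda>y. \<phi> (x - y)))"
      by (rule M(3)[OF Schwartz_reflect[OF \<phi>]])
    also have "\<dots> \<le> C * (\<Sum>(m, js)\<in>M. K m js * (1 + norm x) ^ N)"
    proof (intro mult_left_mono sum_mono, clarify)
      fix m js assume "(m, js) \<in> M"
      then show "Schwartz_seminorm m js (\<lambda>y. \<phi> (x - y)) \<le> K m js * (1 + norm x) ^ N"
        using K(1)[of m js] N by (intro order_trans[OF K(2)] mult_left_mono power_increasing) auto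
    qed (use M in auto)
    also have "\<dots> = C * (\<Sum>(m, js)\<in>M. K m js) * (1 + norm x) ^ N"
      by (simp add: sum_distrib_right split_def mult.assoc)
    also have "\<dots> \<le> (C * (1 + (\<Sum>(m, js)\<in>M. K m js))) * (1 + norm x) ^ N"
      using M(2) by (intro mult_right_mono mult_left_mono) auto
    finally show ?thesis .
  qed
  moreover have "0 < C * (1 + (\<Sum>(m, js)\<in>M. K m js))"
    using M(2) K(1) by (intro mult_pos_pos add_pos_nonneg sum_nonneg) (auto intro: less_imp_le)
  ultimately show ?thesis by (rule that[rotated])
qed

text \<open>Used twice: for the continuity of the convolution with u and for the error of its
  approximating sums. In the latter the growth in x is absorbed by the decay of the other
  factor.\<close>

lemma Schwartz_translate_Lipschitz:
  fixes k :: "real^'n \<Rightarrow> complex"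
  assumes "k \<in> Schwartz"
  obtains C where "0 < C" "\<And>x h y. (1 + norm y) ^ m * cmod (k (x + h - y) - k (x - y)) \<le>
    C * ((1 + norm x) ^ m * (norm h * (1 + norm h) ^ m))"
proof -
  obtain C where C: "0 < C" "\<And>y h. (1 + norm y) ^ m * cmod (k (y + h) - k y) \<le> C * (norm h * (1 + norm h) ^ m)"
    using Schwartz_Lipschitz[OF assms] by metis
  have "(1 + norm y) ^ m * cmod (k (x + h - y) - k (x - y)) \<le> C * ((1 + norm x) ^ m * (norm h * (1 + norm h) ^ m))" for x h y
  proof -
    have "(1 + norm y) ^ m \<le> (1 + norm (x - y)) ^ m * (1 + norm x) ^ m"
      using one_plus_norm_power[of "y - x" x m] by (simp add: norm_minus_commute)
    then have "(1 + norm y) ^ m * cmod (k (x + h - y) - k (x - y)) \<le>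
        ((1 + norm (x - y)) ^ m * (1 + norm x) ^ m) * cmod (k ((x - y) + h) - k (x - y))"
      unfolding diff_add_eq[symmetric] by (intro mult_right_mono) (auto simp: mult.commute)
    also have "\<dots> = (1 + norm x) ^ m * ((1 + norm (x - y)) ^ m * cmod (k ((x - y) + h) - k (x - y)))"
      by (simp only: mult_ac)
    also have "\<dots> \<le> (1 + norm x) ^ m * (C * (norm h * (1 + norm h) ^ m))"
      by (intro mult_left_mono C) auto
    finally show ?thesis by (simp only: mult_ac)
  qed
  with C(1) show ?thesis by (rule that)
qed

lemma tempered_conv_continuous:
  fixes u :: "(real^'n \<Rightarrow> complex) \<Rightarrow> complex"
  assumes u: "u \<in> tempered_distributions" and \<phi>: "\<phi> \<in> Schwartz"
  shows "continuous_on UNIV (\<lambda>x. u (\<lambda>y. \<phi> (x - y)))"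
  unfolding continuous_on_sequentially comp_def
proof (intro allI ballI impI, elim conjE)
  fix a :: "real^'n" and s assume s: "s \<longlonglongrightarrow> a"
  show "(\<lambda>n. u (\<lambda>y. \<phi> (s n - y))) \<longlonglongrightarrow> u (\<lambda>y. \<phi> (a - y))"
  proof (rule tempered_tendsto[OF u Schwartz_reflect[OF \<phi>] Schwartz_reflect[OF \<phi>]])
    fix m and js :: "'n list"
    obtain C where C: "0 < C" "\<And>x h y. (1 + norm y) ^ m * cmod (iter_partial js \<phi> (x + h - y) - iter_partial js \<phi> (x - y)) \<le>
      C * ((1 + norm x) ^ m * (norm h * (1 + norm h) ^ m))"
      using Schwartz_translate_Lipschitz[OF Schwartz_iter_partial[OF \<phi>]] by metis
    have b: "Schwartz_seminorm m js (\<lambda>y. \<phi> (s n - y) - \<phi> (a - y)) \<le>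
        C * ((1 + norm a) ^ m * (norm (s n - a) * (1 + norm (s n - a)) ^ m))" for n
    proof (rule Schwartz_seminorm_leI)
      fix y
      have "iter_partial js (\<lambda>y. \<phi> (s n - y) - \<phi> (a - y)) y =
          (-1) ^ length js * (iter_partial js \<phi> (a + (s n - a) - y) - iter_partial js \<phi> (a - y))"
        by (simp add: iter_partial_diff Schwartz_reflect \<phi> iter_partial_reflect algebra_simps)
      then show "(1 + norm y) ^ m * cmod (iter_partial js (\<lambda>y. \<phi> (s n - y) - \<phi> (a - y)) y) \<le>
        C * ((1 + norm a) ^ m * (norm (s n - a) * (1 + norm (s n - a)) ^ m))"
        using C(2)[of y a "s n - a"] by (simp add: norm_mult norm_power)
    qed
    have "(\<lambda>n. norm (s n - a)) \<longlonglongrightarrow> 0" using s by (simp add: LIM_zero_iff tendsto_norm_zero_iff)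
    then have "(\<lambda>n. C * ((1 + norm a) ^ m * (norm (s n - a) * (1 + norm (s n - a)) ^ m))) \<longlonglongrightarrow>
       C * ((1 + norm a) ^ m * (0 * (1 + 0) ^ m))"
      by (intro tendsto_intros)
    then have *: "(\<lambda>n. C * ((1 + norm a) ^ m * (norm (s n - a) * (1 + norm (s n - a)) ^ m))) \<longlonglongrightarrow> 0" by simp
    show "(\<lambda>n. Schwartz_seminorm m js (\<lambda>y. \<phi> (s n - y) - \<phi> (a - y))) \<longlonglongrightarrow> 0"
      by (rule Lim_null_comparison[OF _ *], intro always_eventually allI)
        (use b Schwartz_seminorm_nonneg[OF Schwartz_diff[OF Schwartz_reflect[OF \<phi>] Schwartz_reflect[OF \<phi>]]] in simp)
  qed
qed

text \<open>The coefficients do not involve \<open>k\<close>. The same finite sum therefore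
  represents the convolution, all its derivatives, and the values of the convolution with u.\<close>

lemma integral_simple_compose:
  fixes w :: "'a \<Rightarrow> complex"
  assumes w: "integrable M w" and s: "simple_function M s"
  shows "(\<integral>x. w x * k (s x) \<partial>M) = (\<Sum>v\<in>s ` space M. (\<integral>x. indicator (s -` {v} \<inter> space M) x *\<^sub>R w x \<partial>M) * k v)"
    (is "_ = (\<Sum>v\<in>_. ?c v * k v)")
proof -
  have A: "s -` {v} \<inter> space M \<in> sets M" for v
    by (rule simple_functionD(2)[OF s])
  have "(\<integral>x. w x * k (s x) \<partial>M) = (\<integral>x. (\<Sum>v\<in>s ` space M. (indicator (s -` {v} \<inter> space M) x *\<^sub>R w x) * k v) \<partial>M)"
  proof (rule Bochner_Integration.integral_cong[OF refl])
    fix x assume x: "x \<in> space M"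
    have "(\<Sum>v\<in>s ` space M. (indicator (s -` {v} \<inter> space M) x *\<^sub>R w x) * k v) = (\<Sum>v\<in>s ` space M. if v = s x then w x * k v else 0)"
      using x by (intro sum.cong) (auto simp: indicator_def)
    also have "\<dots> = w x * k (s x)" using x simple_functionD(1)[OF s] by (simp add: sum.delta)
    finally show "w x * k (s x) = (\<Sum>v\<in>s ` space M. (indicator (s -` {v} \<inter> space M) x *\<^sub>R w x) * k v)" by simp
  qed
  also have "\<dots> = (\<Sum>v\<in>s ` space M. (\<integral>x. (indicator (s -` {v} \<inter> space M) x *\<^sub>R w x) * k v \<partial>M))"
    by (intro Bochner_Integration.integral_sum integrable_mult_left integrable_mult_indicator A w)
  also have "\<dots> = (\<Sum>v\<in>s ` space M. ?c v * k v)"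
    by (intro sum.cong refl Bochner_Integration.integral_mult_left_zero)
  finally show ?thesis .
qed

text \<open>A tempered distribution commutes with convolution integrals: the integrals are approximated in
  the Schwartz seminorms by finite sums, obtained by replacing the integration variable in the
  convolution kernel by simple functions.\<close>

lemma tempered_conv_integral:
  fixes u :: "(real^'n \<Rightarrow> complex) \<Rightarrow> complex"
  assumes u: "u \<in> tempered_distributions" and \<phi>: "\<phi> \<in> Schwartz" and \<psi>: "\<psi> \<in> Schwartz"
  shows "(\<integral>x. \<psi> x * u (\<lambda>y. \<phi> (x - y)) \<partial>lborel) = u (\<lambda>y. \<integral>x. \<psi> x * \<phi> (x - y) \<partial>lborel)"
proof -
  define g where "g x = u (\<lambda>y. \<phi> (x - y))" for x
  have \<psi>i: "integrable lborel \<psi>" by (rule Schwartz_integrable[OF \<psi>])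
  have [measurable]: "g \<in> borel_measurable borel" unfolding g_def[abs_def]
    by (rule borel_measurable_continuous_onI[OF tempered_conv_continuous[OF u \<phi>]])
  have [measurable]: "\<psi> \<in> borel_measurable borel" by (rule Schwartz_borel[OF \<psi>])
  obtain C m where C: "0 < C" "\<And>x. cmod (g x) \<le> C * (1 + norm x) ^ m"
    using tempered_conv_bound[OF u \<phi>] unfolding g_def by metis
  \<comment> \<open>Simple functions converging to the identity; the bound by 2 norm x lets the
    decay of \<psi> dominate all integrands.\<close>
  obtain s :: "nat \<Rightarrow> real^'n \<Rightarrow> real^'n" where s: "\<And>i. simple_function lborel (s i)"
      "\<And>x. (\<lambda>i. s i x) \<longlonglongrightarrow> x" "\<And>i x. norm (s i x) \<le> 2 * norm x"
    using borel_measurable_implies_sequence_metric[of "\<lambda>x. x" "lborel :: (real^'n) measure" 0] by auto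
  have sm [measurable]: "s i \<in> borel_measurable borel" for i
    using borel_measurable_simple_function[OF s(1)] by simp
  define c where "c i v = (\<integral>x. indicator (s i -` {v} \<inter> space lborel) x *\<^sub>R \<psi> x \<partial>lborel)" for i v
  have int_s: "(\<integral>x. \<psi> x * k (s i x) \<partial>lborel) = (\<Sum>v\<in>range (s i). c i v * k v)" for k i
    using integral_simple_compose[OF \<psi>i s(1), of k i] unfolding c_def by simp
  have fin: "finite (range (s i))" "range (s i) \<noteq> {}" for i
    using simple_functionD(1)[OF s(1)[of i]] by auto
  define F where "F i y = (\<Sum>v\<in>range (s i). c i v * \<phi> (v - y))" for i y
  have F: "F i \<in> Schwartz" "iter_partial js (F i) = (\<lambda>y. \<integral>x. \<psi> x * ((-1) ^ length js * iter_partial js \<phi> (s i x - y)) \<partial>lborel)" for i js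
    using Schwartz_sum[OF fin, of i "\<lambda>v y. \<phi> (v - y)" "c i" js] Schwartz_reflect[OF \<phi>]
    using int_s[of "\<lambda>v. (-1) ^ length js * iter_partial js \<phi> (v - y)" i for y]
    by (simp_all add: F_def[abs_def] iter_partial_reflect[OF \<phi>])
  have uF: "u (F i) = (\<integral>x. \<psi> x * g (s i x) \<partial>lborel)" for i
  proof -
    have "u (\<lambda>y. \<Sum>v\<in>range (s i). c i v * \<phi> (v - y)) = (\<Sum>v\<in>range (s i). c i v * u (\<lambda>y. \<phi> (v - y)))"
      by (rule tempered_sum[OF u fin]) (rule Schwartz_reflect[OF \<phi>])
    then show ?thesis using int_s[of g i] by (simp add: F_def[abs_def] g_def)
  qed
  define T where "T y = (\<integral>x. \<psi> x * \<phi> (x - y) \<partial>lborel)" for y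
  have T: "T \<in> Schwartz" "iter_partial js T = (\<lambda>y. (-1) ^ length js * (\<integral>x. \<psi> x * iter_partial js \<phi> (x - y) \<partial>lborel))" for js
    using Schwartz_conv[OF \<psi> \<phi>, of "-1"] by (simp_all add: T_def[abs_def])
  have "(\<lambda>i. u (F i)) \<longlonglongrightarrow> u T"
  proof (rule tempered_tendsto[OF u F(1) T(1)])
    fix m and js :: "'n list"
    let ?k = "iter_partial js \<phi>"
    have kS: "?k \<in> Schwartz" by (rule Schwartz_iter_partial[OF \<phi>])
    have [measurable]: "?k \<in> borel_measurable borel" by (rule Schwartz_borel[OF kS])
    obtain D where D: "0 < D" "\<And>x h y. (1 + norm y) ^ m * cmod (?k (x + h - y) - ?k (x - y)) \<le>
      D * ((1 + norm x) ^ m * (norm h * (1 + norm h) ^ m))"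
      using Schwartz_translate_Lipschitz[OF kS] by metis
    obtain E where E: "\<And>x. (1 + norm x) ^ 0 * cmod (?k x) \<le> E"
      using rapidly_decreasing_bound[OF Schwartz_rapidly_decreasing[OF kS]] by metis
    define H where "H i x = cmod (\<psi> x) * ((1 + norm x) ^ m * (norm (s i x - x) * (1 + norm (s i x - x)) ^ m))" for i x
    \<comment> \<open>The powers of 3 come from the bound norm (s i x - x) <= 3 norm x.\<close>
    define B where "B x = 3 ^ (m + 1) * ((1 + norm x) ^ (2 * m + 1) * cmod (\<psi> x))" for x
    have HB: "norm (H i x) \<le> B x" for i x
    proof -
      have h: "norm (s i x - x) \<le> 3 * (1 + norm x)"
        using norm_triangle_ineq4[of "s i x" x] s(3)[of i x] by simp
      have h': "1 + norm (s i x - x) \<le> 3 * (1 + norm x)"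
        using norm_triangle_ineq4[of "s i x" x] s(3)[of i x] by simp
      have "norm (H i x) = cmod (\<psi> x) * ((1 + norm x) ^ m * (norm (s i x - x) * (1 + norm (s i x - x)) ^ m))"
        unfolding H_def by simp
      also have "\<dots> \<le> cmod (\<psi> x) * ((1 + norm x) ^ m * ((3 * (1 + norm x)) * (3 * (1 + norm x)) ^ m))"
        by (intro mult_left_mono mult_mono power_mono h h') auto
      also have "\<dots> = B x"
      proof -
        have "a * (b ^ m * ((3 * b) * (3 * b) ^ m)) = 3 ^ (m + 1) * (b ^ (2 * m + 1) * a)" for a b :: real
          unfolding mult_2[of m] by (simp only: power_mult_distrib power_add power_one_right mult_ac)
        then show ?thesis unfolding B_def by blast
      qed
      finally show ?thesis .
    qed
    have Bi: "integrable lborel B" unfolding B_def[abs_def]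
      by (intro integrable_mult_right Schwartz_integrable_weight \<psi>)
    have H0: "(\<lambda>i. H i x) \<longlonglongrightarrow> 0" for x
    proof -
      have "(\<lambda>i. norm (s i x - x)) \<longlonglongrightarrow> 0" using s(2)[of x] by (simp add: LIM_zero_iff tendsto_norm_zero_iff)
      then have "(\<lambda>i. H i x) \<longlonglongrightarrow> cmod (\<psi> x) * ((1 + norm x) ^ m * (0 * (1 + 0) ^ m))"
        unfolding H_def by (intro tendsto_intros)
      then show ?thesis by simp
    qed
    have "(\<lambda>i. \<integral>x. H i x \<partial>lborel) \<longlonglongrightarrow> (\<integral>x. 0 \<partial>(lborel :: (real^'n) measure))"
    proof (rule integral_dominated_convergence[OF _ _ Bi])
      show "H i \<in> borel_measurable lborel" for i unfolding H_def[abs_def] by measurable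
    qed (use HB H0 in auto)
    then have lim: "(\<lambda>i. D * (\<integral>x. H i x \<partial>lborel)) \<longlonglongrightarrow> 0" by (auto intro: tendsto_mult_right_zero)
    have Hi: "integrable lborel (H i)" for i
    proof (rule Bochner_Integration.integrable_bound[OF Bi])
      show "H i \<in> borel_measurable lborel" unfolding H_def[abs_def] by measurable
      show "AE x in lborel. norm (H i x) \<le> norm (B x)" using HB[of i] by (auto intro: order_trans[OF _ abs_ge_self])
    qed
    have b: "Schwartz_seminorm m js (\<lambda>x. F i x - T x) \<le> D * (\<integral>x. H i x \<partial>lborel)" for i
    proof (rule Schwartz_seminorm_leI)
      fix y
      have i1: "integrable lborel (\<lambda>x. \<psi> x * ?k (s i x - y))" "integrable lborel (\<lambda>x. \<psi> x * ?k (x - y))"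
        using E by (auto intro!: integrable_mult_bounded[OF \<psi>i])
      have "iter_partial js (\<lambda>x. F i x - T x) y =
          (-1) ^ length js * (\<integral>x. \<psi> x * ?k (s i x - y) \<partial>lborel) - (-1) ^ length js * (\<integral>x. \<psi> x * ?k (x - y) \<partial>lborel)"
        unfolding iter_partial_diff[OF F(1) T(1)] F(2) T(2)
        by (simp only: mult.left_commute[of "\<psi> _"] Bochner_Integration.integral_mult_right_zero)
      also have "\<dots> = (-1) ^ length js * ((\<integral>x. \<psi> x * ?k (s i x - y) \<partial>lborel) - (\<integral>x. \<psi> x * ?k (x - y) \<partial>lborel))"
        by (simp add: algebra_simps)
      also have "\<dots> = (-1) ^ length js * (\<integral>x. \<psi> x * ?k (s i x - y) - \<psi> x * ?k (x - y) \<partial>lborel)"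
        by (simp only: Bochner_Integration.integral_diff[OF i1])
      finally have "cmod (iter_partial js (\<lambda>x. F i x - T x) y) = cmod (\<integral>x. \<psi> x * ?k (s i x - y) - \<psi> x * ?k (x - y) \<partial>lborel)"
        by (simp add: norm_mult norm_power)
      then have "(1 + norm y) ^ m * cmod (iter_partial js (\<lambda>x. F i x - T x) y) \<le>
          (1 + norm y) ^ m * (\<integral>x. cmod (\<psi> x * ?k (s i x - y) - \<psi> x * ?k (x - y)) \<partial>lborel)"
        by (simp add: mult_left_mono integral_norm_bound)
      also have "\<dots> = (\<integral>x. (1 + norm y) ^ m * cmod (\<psi> x * ?k (s i x - y) - \<psi> x * ?k (x - y)) \<partial>lborel)" by simp
      also have "\<dots> \<le> (\<integral>x. D * H i x \<partial>lborel)"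
      proof (intro integral_mono integrable_mult_right integrable_norm Bochner_Integration.integrable_diff i1 Hi)
        fix x
        have "(1 + norm y) ^ m * cmod (\<psi> x * ?k (s i x - y) - \<psi> x * ?k (x - y)) =
           cmod (\<psi> x) * ((1 + norm y) ^ m * cmod (?k (x + (s i x - x) - y) - ?k (x - y)))"
          by (simp add: right_diff_distrib[symmetric] norm_mult)
        also have "\<dots> \<le> cmod (\<psi> x) * (D * ((1 + norm x) ^ m * (norm (s i x - x) * (1 + norm (s i x - x)) ^ m)))"
          by (intro mult_left_mono D) auto
        finally show "(1 + norm y) ^ m * cmod (\<psi> x * ?k (s i x - y) - \<psi> x * ?k (x - y)) \<le> D * H i x"
          by (simp only: H_def mult_ac)
      qed
      finally show "(1 + norm y) ^ m * cmod (iter_partial js (\<lambda>x. F i x - T x) y) \<le> D * (\<integral>x. H i x \<partial>lborel)"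
        by simp
    qed
    show "(\<lambda>i. Schwartz_seminorm m js (\<lambda>x. F i x - T x)) \<longlonglongrightarrow> 0"
      by (rule Lim_null_comparison[OF _ lim], intro always_eventually allI)
        (use b Schwartz_seminorm_nonneg[OF Schwartz_diff[OF F(1) T(1)]] in simp)
  qed
  moreover have "(\<lambda>i. \<integral>x. \<psi> x * g (s i x) \<partial>lborel) \<longlonglongrightarrow> (\<integral>x. \<psi> x * g x \<partial>lborel)"
  proof (rule integral_dominated_convergence)
    show "integrable lborel (\<lambda>x. C * 2 ^ m * ((1 + norm x) ^ m * cmod (\<psi> x)))"
      by (intro integrable_mult_right Schwartz_integrable_weight \<psi>)
    show "AE x in lborel. (\<lambda>i. \<psi> x * g (s i x)) \<longlonglongrightarrow> \<psi> x * g x"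
    proof (intro AE_I2 tendsto_intros)
      fix x show "(\<lambda>i. g (s i x)) \<longlonglongrightarrow> g x"
        using tempered_conv_continuous[OF u \<phi>] s(2)[of x]
        unfolding g_def[symmetric] by (auto simp: continuous_on_sequentially comp_def)
    qed
    show "AE x in lborel. norm (\<psi> x * g (s i x)) \<le> C * 2 ^ m * ((1 + norm x) ^ m * cmod (\<psi> x))" for i
    proof (intro AE_I2)
      fix x
      have "1 + norm (s i x) \<le> 2 * (1 + norm x)" using s(3)[of i x] by simp
      then have "(1 + norm (s i x)) ^ m \<le> (2 * (1 + norm x)) ^ m" by (intro power_mono) auto
      then have "cmod (g (s i x)) \<le> C * (2 * (1 + norm x)) ^ m"
        using C by (intro order_trans[OF C(2)] mult_left_mono) auto
      then have "cmod (\<psi> x) * cmod (g (s i x)) \<le> cmod (\<psi> x) * (C * (2 * (1 + norm x)) ^ m)"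
        by (intro mult_left_mono) auto
      then show "norm (\<psi> x * g (s i x)) \<le> C * 2 ^ m * ((1 + norm x) ^ m * cmod (\<psi> x))"
        by (simp only: norm_mult power_mult_distrib mult_ac)
    qed
  qed measurable
  ultimately have "(\<integral>x. \<psi> x * g x \<partial>lborel) = u T"
    unfolding uF by (intro LIMSEQ_unique)
  then show ?thesis unfolding g_def T_def[abs_def] .
qed

lemma lborel_integral_translate:
  fixes f :: "'a::euclidean_space \<Rightarrow> complex"
  assumes "f \<in> borel_measurable borel"
  shows "(\<integral>x. f (x + c) \<partial>lborel) = (\<integral>x. f x \<partial>lborel)"
proof -
  have "(\<integral>x. f x \<partial>lborel) = (\<integral>x. f x \<partial>distr lborel borel ((+) c))" by (simp add: lborel_distr_plus)
  also have "\<dots> = (\<integral>x. f (c + x) \<partial>lborel)" using assms by (intro integral_distr) auto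
  finally show ?thesis by (simp add: add.commute)
qed

text \<open>Taking \<open>u\<close> out of the integral leaves u applied to the correlation
  \<open>T j\<close> of \<open>w j\<close> with \<psi>. The difference of \<open>T j\<close> and c
  \<psi> is the integral of \<open>w j\<close> against increments of \<psi>, so the weighted
  Lipschitz estimate reduces convergence in every seminorm to the moment condition
  \<open>lim\<close>.\<close>

lemma tempered_approximate_identity:
  fixes u :: "(real^'n \<Rightarrow> complex) \<Rightarrow> complex"
  assumes u: "u \<in> tempered_distributions" and \<psi>: "\<psi> \<in> Schwartz"
    and w: "\<And>j. w j \<in> Schwartz" and c: "\<And>j. (\<integral>x. w j x \<partial>lborel) = c"
    and lim: "\<And>m. (\<lambda>j. \<integral>x. cmod (w j x) * (norm x * (1 + norm x) ^ m) \<partial>lborel) \<longlonglongrightarrow> 0"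
  shows "(\<lambda>j. \<integral>x. \<psi> x * u (\<lambda>y. w j (x - y)) \<partial>lborel) \<longlonglongrightarrow> c * u \<psi>"
proof -
  define T where "T j y = (\<integral>x. w j x * \<psi> (x + y) \<partial>lborel)" for j y
  have T: "T j \<in> Schwartz" "iter_partial js (T j) = (\<lambda>y. \<integral>x. w j x * iter_partial js \<psi> (x + y) \<partial>lborel)" for j js
    using Schwartz_conv[OF w[of j] \<psi>, of 1] by (simp_all add: T_def[abs_def])
  have [measurable]: "\<psi> \<in> borel_measurable borel" "w j \<in> borel_measurable borel" for j
    by (auto intro: Schwartz_borel w \<psi>)
  have "(\<integral>x. \<psi> x * u (\<lambda>y. w j (x - y)) \<partial>lborel) = u (T j)" for j
  proof -
    have "(\<integral>x. \<psi> x * w j (x - y) \<partial>lborel) = T j y" for y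
      using lborel_integral_translate[of "\<lambda>x. \<psi> x * w j (x - y)" y] unfolding T_def by (simp add: mult.commute)
    then show ?thesis using tempered_conv_integral[OF u w[of j] \<psi>] by presburger
  qed
  moreover have "(\<lambda>j. u (T j)) \<longlonglongrightarrow> u (\<lambda>x. c * \<psi> x)"
  proof (rule tempered_tendsto[OF u T(1) Schwartz_cmult[OF \<psi>]])
    fix m and js :: "'n list"
    let ?k = "iter_partial js \<psi>"
    have kS: "?k \<in> Schwartz" by (rule Schwartz_iter_partial[OF \<psi>])
    have wi: "integrable lborel (w j)" for j by (rule Schwartz_integrable[OF w])
    obtain D where D: "0 < D" "\<And>y h. (1 + norm y) ^ m * cmod (?k (y + h) - ?k y) \<le> D * (norm h * (1 + norm h) ^ m)"
      using Schwartz_Lipschitz[OF kS] by metis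
    define I where "I j = (\<integral>x. cmod (w j x) * (norm x * (1 + norm x) ^ m) \<partial>lborel)" for j
    have i2: "integrable lborel (\<lambda>x. cmod (w j x) * (norm x * (1 + norm x) ^ m))" for j
    proof (rule Bochner_Integration.integrable_bound[OF Schwartz_integrable_weight[OF w[of j], of "m + 1"]])
      show "AE x in lborel. norm (cmod (w j x) * (norm x * (1 + norm x) ^ m)) \<le> norm ((1 + norm x) ^ (m + 1) * cmod (w j x))"
      proof (intro AE_I2)
        fix x :: "real^'n"
        have "norm x * (1 + norm x) ^ m \<le> (1 + norm x) * (1 + norm x) ^ m" by (intro mult_right_mono) auto
        then have "(norm x * (1 + norm x) ^ m) * cmod (w j x) \<le> ((1 + norm x) * (1 + norm x) ^ m) * cmod (w j x)"
          by (rule mult_right_mono) simp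
        then show "norm (cmod (w j x) * (norm x * (1 + norm x) ^ m)) \<le> norm ((1 + norm x) ^ (m + 1) * cmod (w j x))"
          by (simp add: abs_mult mult_ac)
      qed
    qed measurable
    have b: "Schwartz_seminorm m js (\<lambda>x. T j x - c * \<psi> x) \<le> D * I j" for j
    proof (rule Schwartz_seminorm_leI)
      fix y
      have i1: "integrable lborel (\<lambda>x. w j x * ?k (x + y))" "integrable lborel (\<lambda>x. w j x * ?k y)"
        using Schwartz_conv_integrable[OF wi[of j] kS, of 1 y] wi by auto
      have "iter_partial js (\<lambda>x. T j x - c * \<psi> x) y = (\<integral>x. w j x * ?k (x + y) \<partial>lborel) - (\<integral>x. w j x * ?k y \<partial>lborel)"
        by (simp add: iter_partial_diff T Schwartz_cmult \<psi> iter_partial_cmult c Bochner_Integration.integral_mult_left_zero)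
      also have "\<dots> = (\<integral>x. w j x * ?k (x + y) - w j x * ?k y \<partial>lborel)"
        by (rule Bochner_Integration.integral_diff[OF i1, symmetric])
      finally have "(1 + norm y) ^ m * cmod (iter_partial js (\<lambda>x. T j x - c * \<psi> x) y) \<le>
          (1 + norm y) ^ m * (\<integral>x. cmod (w j x * ?k (x + y) - w j x * ?k y) \<partial>lborel)"
        by (simp add: mult_left_mono integral_norm_bound)
      also have "\<dots> = (\<integral>x. (1 + norm y) ^ m * cmod (w j x * ?k (x + y) - w j x * ?k y) \<partial>lborel)" by simp
      also have "\<dots> \<le> (\<integral>x. D * (cmod (w j x) * (norm x * (1 + norm x) ^ m)) \<partial>lborel)"
      proof (intro integral_mono integrable_mult_right integrable_norm Bochner_Integration.integrable_diff i1 i2)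
        fix x
        have "(1 + norm y) ^ m * cmod (w j x * ?k (x + y) - w j x * ?k y) =
           cmod (w j x) * ((1 + norm y) ^ m * cmod (?k (y + x) - ?k y))"
          by (simp add: right_diff_distrib[symmetric] norm_mult add.commute)
        also have "\<dots> \<le> cmod (w j x) * (D * (norm x * (1 + norm x) ^ m))"
          by (intro mult_left_mono D) auto
        finally show "(1 + norm y) ^ m * cmod (w j x * ?k (x + y) - w j x * ?k y) \<le> D * (cmod (w j x) * (norm x * (1 + norm x) ^ m))"
          by (simp only: mult_ac)
      qed
      finally show "(1 + norm y) ^ m * cmod (iter_partial js (\<lambda>x. T j x - c * \<psi> x) y) \<le> D * I j"
        unfolding I_def by simp
    qed
    have l: "(\<lambda>j. D * I j) \<longlonglongrightarrow> 0" using lim[of m] unfolding I_def by (auto intro: tendsto_mult_right_zero)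
    show "(\<lambda>j. Schwartz_seminorm m js (\<lambda>x. T j x - c * \<psi> x)) \<longlonglongrightarrow> 0"
      by (rule Lim_null_comparison[OF _ l], intro always_eventually allI)
        (use b Schwartz_seminorm_nonneg[OF Schwartz_diff[OF T(1) Schwartz_cmult[OF \<psi>]]] in simp)
  qed
  ultimately show ?thesis by (simp add: tempered_cmult[OF u \<psi>])
qed

section \<open>Uniqueness of the represented function\<close>

text \<open>The measures with the positive and the negative part as densities agree on boxes, a
  generator stable under intersection, hence everywhere. Since \<open>ennreal\<close> truncates at
  0, equal densities at a point force the value 0 there.\<close>

lemma AE_zero_of_box_integrals:
  fixes \<kappa> :: "'a::euclidean_space \<Rightarrow> real"
  assumes \<kappa>: "integrable lborel \<kappa>"
    and box: "\<And>l u. (\<integral>x. indicator (box l u) x * \<kappa> x \<partial>lborel) = 0"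
  shows "AE x in lborel. \<kappa> x = 0"
proof -
  let ?M = "density lborel (\<lambda>x. ennreal (\<kappa> x))" and ?N = "density lborel (\<lambda>x. ennreal (- \<kappa> x))"
  have [measurable]: "\<kappa> \<in> borel_measurable borel" using \<kappa> by simp
  have fin: "(\<integral>\<^sup>+x. ennreal (\<kappa> x) \<partial>lborel) < \<infinity>" and fin': "(\<integral>\<^sup>+x. ennreal (- \<kappa> x) \<partial>lborel) < \<infinity>"
    using \<kappa> by (auto simp: real_integrable_def top.not_eq_extremum)
  have "?M = ?N"
  proof (rule measure_eqI_generator_eq)
    let ?E = "range (\<lambda>(a, b). box a b::'a set)"
    let ?A = "\<lambda>n::nat. box (- (real n *\<^sub>R One)) (real n *\<^sub>R One) :: 'a set"
    show "Int_stable ?E" by (auto simp: Int_stable_def box_Int_box)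
    show "?E \<subseteq> Pow UNIV" "sets ?M = sigma_sets UNIV ?E" "sets ?N = sigma_sets UNIV ?E"
      by (simp_all add: borel_eq_box)
    show "range ?A \<subseteq> ?E" "(\<Union>i. ?A i) = UNIV" unfolding UN_box_eq_UNIV by auto
    have le: "(\<integral>\<^sup>+x. ennreal (\<kappa> x) * indicator B x \<partial>lborel) \<le> (\<integral>\<^sup>+x. ennreal (\<kappa> x) \<partial>lborel)" for B
      by (intro nn_integral_mono) (auto simp: indicator_def)
    show "emeasure ?M (?A i) \<noteq> \<infinity>" for i
      using le[of "?A i"] fin by (simp add: emeasure_density top.not_eq_extremum le_less_trans)
    fix X assume "X \<in> ?E"
    then obtain l u where X: "X = box l u" by auto
    have [measurable]: "X \<in> sets borel" by (simp add: X)
    have i: "integrable lborel (\<lambda>x. indicator X x * \<kappa> x)"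
      using integrable_mult_indicator[OF _ \<kappa>, of X] by simp
    have "(\<integral>x. indicator X x * \<kappa> x \<partial>lborel) =
      enn2real (\<integral>\<^sup>+x. ennreal (indicator X x * \<kappa> x) \<partial>lborel) - enn2real (\<integral>\<^sup>+x. ennreal (- (indicator X x * \<kappa> x)) \<partial>lborel)"
      by (rule real_lebesgue_integral_def[OF i])
    then have "enn2real (\<integral>\<^sup>+x. ennreal (indicator X x * \<kappa> x) \<partial>lborel) = enn2real (\<integral>\<^sup>+x. ennreal (- (indicator X x * \<kappa> x)) \<partial>lborel)"
      using box X by simp
    then have "(\<integral>\<^sup>+x. ennreal (indicator X x * \<kappa> x) \<partial>lborel) = (\<integral>\<^sup>+x. ennreal (- (indicator X x * \<kappa> x)) \<partial>lborel)"
    proof -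
      assume "enn2real (\<integral>\<^sup>+x. ennreal (indicator X x * \<kappa> x) \<partial>lborel) = enn2real (\<integral>\<^sup>+x. ennreal (- (indicator X x * \<kappa> x)) \<partial>lborel)"
      moreover have "a = b" if "a \<noteq> \<infinity>" "b \<noteq> \<infinity>" "enn2real a = enn2real b" for a b :: ennreal
        using that by (metis ennreal_enn2real infinity_ennreal_def top.not_eq_extremum)
      ultimately show ?thesis using i unfolding real_integrable_def by blast
    qed
    moreover have "ennreal (\<kappa> x) * indicator X x = ennreal (indicator X x * \<kappa> x)"
      "ennreal (- \<kappa> x) * indicator X x = ennreal (- (indicator X x * \<kappa> x))" for x
      by (auto simp: indicator_def)
    ultimately show "emeasure ?M X = emeasure ?N X" by (simp add: emeasure_density)
  qed
  then have "AE x in lborel. ennreal (\<kappa> x) = ennreal (- \<kappa> x)"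
    by (subst (asm) finite_density_unique) (use fin in auto)
  then show ?thesis
  proof (rule AE_mp, intro AE_I2 impI)
    fix x assume "ennreal (\<kappa> x) = ennreal (- \<kappa> x)"
    then show "\<kappa> x = 0" by (cases "0 \<le> \<kappa> x") (auto simp: ennreal_neg ennreal_eq_0_iff)
  qed
qed

section \<open>Smooth approximation of indicators of boxes\<close>

lemma logistic_mono: "s \<le> t \<Longrightarrow> logistic s \<le> logistic t"
  unfolding logistic_def by (intro divide_left_mono add_mono mult_pos_pos add_pos_pos) auto

text \<open>For t > 0 the term k^2 t beats k, while at t = 0 the shift by -k forces the limit 0. The
  limit is thus the indicator of the open half-line, without the value 1/2 that an unshifted
  logistic has at the end point.\<close>

lemma logistic_indicator_tendsto:
  "(\<lambda>k. logistic ((real k)\<^sup>2 * t - real k)) \<longlonglongrightarrow> (if 0 < t then 1 else 0)"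
proof (cases "0 < t")
  case True
  have 1: "(\<lambda>k. logistic (real k * 1)) \<longlonglongrightarrow> 1" using logistic_tendsto[of 1] by simp
  have 2: "\<forall>\<^sub>F k in sequentially. logistic (real k * 1) \<le> logistic ((real k)\<^sup>2 * t - real k)"
  proof -
    obtain K :: nat where K: "2 / t \<le> real K" using real_arch_simple by blast
    have "logistic (real k * 1) \<le> logistic ((real k)\<^sup>2 * t - real k)" if "k \<ge> K" for k
    proof (rule logistic_mono)
      have "2 / t \<le> real k" using K that by linarith
      then have "2 \<le> real k * t" using True by (simp add: field_simps)
      then have "real k * 2 \<le> real k * (real k * t)" by (rule mult_left_mono) simp
      then show "real k * 1 \<le> (real k)\<^sup>2 * t - real k" by (simp add: power2_eq_square mult_ac)
    qed
    then show ?thesis using eventually_sequentially by blast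
  qed
  have 3: "\<forall>\<^sub>F k in sequentially. logistic ((real k)\<^sup>2 * t - real k) \<le> 1"
    using logistic_bounds(2) by (simp add: less_imp_le)
  show ?thesis using tendsto_sandwich[OF 2 3 1 tendsto_const] True by simp
next
  case False
  have 1: "(\<lambda>k. logistic (real k * (- 1))) \<longlonglongrightarrow> 0" using logistic_tendsto[of "-1"] by simp
  have "logistic ((real k)\<^sup>2 * t - real k) \<le> logistic (real k * (- 1))" for k
    using False by (intro logistic_mono) (simp add: mult_nonneg_nonpos)
  then have 2: "\<forall>\<^sub>F k in sequentially. logistic ((real k)\<^sup>2 * t - real k) \<le> logistic (real k * (- 1))"
    by simp
  have 3: "\<forall>\<^sub>F k in sequentially. 0 \<le> logistic ((real k)\<^sup>2 * t - real k)"
    using logistic_bounds(1) by (simp add: less_imp_le)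
  show ?thesis using tendsto_sandwich[OF 3 2 tendsto_const 1] False by simp
qed

text \<open>The product runs over a set \<open>I\<close> of coordinates so that membership in
  \<open>gauss_class\<close> can be proved by induction; the cutoff for the full box has
  \<open>I = UNIV\<close>.\<close>

definition box_cutoff :: "real^'n \<Rightarrow> real^'n \<Rightarrow> 'n set \<Rightarrow> nat \<Rightarrow> real^'n \<Rightarrow> real" where
  "box_cutoff l u I k x = (\<Prod>i\<in>I. logistic ((real k)\<^sup>2 * (x $ i - l $ i) - real k) *
     logistic ((real k)\<^sup>2 * (u $ i - x $ i) - real k))"

lemma box_cutoff_gauss_class:
  fixes l u :: "real^'n"
  assumes "finite I"
  shows "(\<lambda>x. box_cutoff l u I k x * exp (- (x \<bullet> x))) \<in> gauss_class"
  using assms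
proof (induction I rule: finite_induct)
  case empty then show ?case by (simp add: box_cutoff_def gauss_class.gauss)
next
  case (insert i I)
  have "(\<lambda>x. logistic ((real k)\<^sup>2 * x $ i + (- (real k)\<^sup>2 * l $ i - real k)) *
     (logistic ((- (real k)\<^sup>2) * x $ i + ((real k)\<^sup>2 * u $ i - real k)) * (box_cutoff l u I k x * exp (- (x \<bullet> x))))) \<in> gauss_class"
    by (intro gauss_class.logistic insert.IH)
  moreover have e: "(real k)\<^sup>2 * x $ i + (- (real k)\<^sup>2 * l $ i - real k) = (real k)\<^sup>2 * (x $ i - l $ i) - real k"
    "(- (real k)\<^sup>2) * x $ i + ((real k)\<^sup>2 * u $ i - real k) = (real k)\<^sup>2 * (u $ i - x $ i) - real k" for x
    by (simp_all add: algebra_simps)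
  moreover have "box_cutoff l u (insert i I) k x = logistic ((real k)\<^sup>2 * (x $ i - l $ i) - real k) *
     (logistic ((real k)\<^sup>2 * (u $ i - x $ i) - real k) * box_cutoff l u I k x)" for x
    using insert by (simp add: box_cutoff_def)
  ultimately show ?case unfolding e by (simp only: mult.assoc)
qed

lemma box_cutoff_bounds: "0 \<le> box_cutoff l u I k x" "box_cutoff l u I k x \<le> 1"
  unfolding box_cutoff_def
  by (auto intro!: prod_nonneg prod_le_1 mult_le_one mult_nonneg_nonneg simp: less_imp_le logistic_bounds)

lemma box_cutoff_tendsto: "(\<lambda>k. box_cutoff l u UNIV k x) \<longlonglongrightarrow> indicator (box l u) x"
proof -
  have "(\<lambda>k. box_cutoff l u UNIV k x) \<longlonglongrightarrow>
     (\<Prod>i\<in>UNIV. (if 0 < x $ i - l $ i then 1 else 0) * (if 0 < u $ i - x $ i then 1 else 0))"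
    unfolding box_cutoff_def by (intro tendsto_prod tendsto_mult logistic_indicator_tendsto)
  also have "(\<Prod>i\<in>UNIV. (if 0 < x $ i - l $ i then 1 else 0) * (if 0 < u $ i - x $ i then 1 else 0)) = (indicator (box l u) x :: real)"
  proof (cases "x \<in> box l u")
    case True then show ?thesis by (simp add: mem_box_cart)
  next
    case False
    then obtain i where i: "\<not> (l $ i < x $ i \<and> x $ i < u $ i)" by (auto simp: mem_box_cart)
    then have "(\<Prod>i\<in>UNIV. (if 0 < x $ i - l $ i then 1 else 0) * (if 0 < u $ i - x $ i then 1 else 0)) = (0::real)"
      by (intro prod_zero bexI[of _ i]) auto
    then show ?thesis using False by simp
  qed
  finally show ?thesis .
qed

text \<open>Multiplication by a Gaussian, itself a test function, makes h integrable. Cutoffs times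
  the Gaussian then show that all integrals of the product over boxes vanish.\<close>

lemma Schwartz_test_zero:
  fixes h :: "real^'n \<Rightarrow> complex"
  assumes h [measurable]: "h \<in> borel_measurable lebesgue"
    and int: "\<And>\<psi>. \<psi> \<in> Schwartz \<Longrightarrow> integrable lebesgue (\<lambda>x. h x * \<psi> x)"
    and zero: "\<And>\<psi>. \<psi> \<in> Schwartz \<Longrightarrow> (\<integral>x. h x * \<psi> x \<partial>lebesgue) = 0"
  shows "AE x in lebesgue. h x = 0"
proof -
  define G where "G x = exp (- (x \<bullet> x))" for x :: "real^'n"
  define k where "k x = h x * complex_of_real (G x)" for x
  have GS: "(\<lambda>x. complex_of_real (G x)) \<in> Schwartz"
    unfolding G_def by (rule gauss_class_Schwartz[OF gauss_class.gauss])
  have ki: "integrable lebesgue k" unfolding k_def[abs_def] by (rule int[OF GS])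
  have box0: "(\<integral>x. complex_of_real (indicator (box l u) x) * k x \<partial>lebesgue) = 0" for l u
  proof -
    define \<psi> where "\<psi> n x = complex_of_real (box_cutoff l u UNIV n x * G x)" for n x
    have \<psi>S: "\<psi> n \<in> Schwartz" for n
      unfolding \<psi>_def[abs_def] G_def by (intro gauss_class_Schwartz box_cutoff_gauss_class) simp
    have "(\<lambda>n. \<integral>x. h x * \<psi> n x \<partial>lebesgue) \<longlonglongrightarrow> (\<integral>x. complex_of_real (indicator (box l u) x) * k x \<partial>lebesgue)"
    proof (rule integral_dominated_convergence)
      show "integrable lebesgue (\<lambda>x. norm (k x))" using ki by simp
      show "(\<lambda>x. h x * \<psi> n x) \<in> borel_measurable lebesgue" for n using int[OF \<psi>S] by simp
      have [measurable]: "indicat_real (box l u) \<in> borel_measurable lebesgue"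
        by (rule borel_measurable_indicator) simp
      have [measurable]: "k \<in> borel_measurable lebesgue" using ki by simp
      show "(\<lambda>x. complex_of_real (indicator (box l u) x) * k x) \<in> borel_measurable lebesgue"
        by measurable
      show "AE x in lebesgue. (\<lambda>n. h x * \<psi> n x) \<longlonglongrightarrow> complex_of_real (indicator (box l u) x) * k x"
      proof (intro AE_I2)
        fix x
        have "(\<lambda>n. complex_of_real (box_cutoff l u UNIV n x) * k x) \<longlonglongrightarrow> complex_of_real (indicator (box l u) x) * k x"
          by (intro tendsto_intros box_cutoff_tendsto)
        then show "(\<lambda>n. h x * \<psi> n x) \<longlonglongrightarrow> complex_of_real (indicator (box l u) x) * k x"
          by (simp add: \<psi>_def k_def mult_ac)
      qed
      show "AE x in lebesgue. norm (h x * \<psi> n x) \<le> norm (k x)" for n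
      proof (intro AE_I2)
        fix x
        have "norm (h x * \<psi> n x) = box_cutoff l u UNIV n x * norm (k x)"
          using box_cutoff_bounds(1)[of l u UNIV n x] by (simp add: \<psi>_def k_def norm_mult)
        also have "\<dots> \<le> 1 * norm (k x)" by (intro mult_right_mono box_cutoff_bounds) auto
        finally show "norm (h x * \<psi> n x) \<le> norm (k x)" by simp
      qed
    qed
    then show ?thesis by (simp add: zero[OF \<psi>S] LIMSEQ_const_iff)
  qed
  \<comment> \<open>\<open>\<kappa>\<close> is replaced by a Borel representative because the result
    on box integrals concerns \<open>lborel\<close>.\<close>
  have part: "AE x in lebesgue. \<kappa> x = 0"
    if \<kappa>: "integrable lebesgue \<kappa>" and \<kappa>0: "\<And>l u. (\<integral>x. indicator (box l u) x * \<kappa> x \<partial>lebesgue) = 0"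
    for \<kappa> :: "real^'n \<Rightarrow> real"
  proof -
    obtain \<kappa>' where \<kappa>': "\<kappa>' \<in> borel_measurable lborel" "AE x in lborel. \<kappa> x = \<kappa>' x"
      using completion_ex_borel_measurable_real[of \<kappa> lborel] \<kappa> by auto
    have ae: "AE x in lebesgue. \<kappa> x = \<kappa>' x" using AE_completion[OF \<kappa>'(2)] .
    have m: "\<kappa>' \<in> borel_measurable lebesgue" by (rule measurable_completion[OF \<kappa>'(1)])
    have "integrable lebesgue \<kappa>'" using integrable_cong_AE_imp[OF \<kappa> m] ae by auto
    then have i': "integrable lborel \<kappa>'" using integrable_completion[OF \<kappa>'(1)] by simp
    have "AE x in lborel. \<kappa>' x = 0"
    proof (rule AE_zero_of_box_integrals[OF i'])
      fix l u :: "real^'n"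
      have b: "box l u \<in> sets lborel" "box l u \<in> sets lebesgue" by auto
      have mm: "(\<lambda>x. indicator (box l u) x * \<kappa>' x) \<in> borel_measurable lborel"
        using \<kappa>'(1) b(1) by (intro borel_measurable_times borel_measurable_indicator) auto
      have "(\<integral>x. indicator (box l u) x * \<kappa>' x \<partial>lborel) = (\<integral>x. indicator (box l u) x * \<kappa>' x \<partial>lebesgue)"
        by (rule integral_completion[OF mm, symmetric])
      also have "\<dots> = (\<integral>x. indicator (box l u) x * \<kappa> x \<partial>lebesgue)"
        using ae \<kappa> m b by (intro integral_cong_AE borel_measurable_times borel_measurable_indicator) auto
      finally show "(\<integral>x. indicator (box l u) x * \<kappa>' x \<partial>lborel) = 0" using \<kappa>0 by simp
    qed
    then have "AE x in lebesgue. \<kappa>' x = 0" by (rule AE_completion)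
    with ae show ?thesis by eventually_elim simp
  qed
  have bi: "integrable lebesgue (\<lambda>x. complex_of_real (indicator (box l u) x) * k x)" for l u
    using integrable_mult_indicator[OF _ ki, of "box l u"] by (simp add: scaleR_conv_of_real)
  have "AE x in lebesgue. Re (k x) = 0"
  proof (rule part)
    show "integrable lebesgue (\<lambda>x. Re (k x))" using ki by simp
    show "(\<integral>x. indicator (box l u) x * Re (k x) \<partial>lebesgue) = 0" for l u
      using integral_Re[OF bi[of l u]] box0[of l u] by simp
  qed
  moreover have "AE x in lebesgue. Im (k x) = 0"
  proof (rule part)
    show "integrable lebesgue (\<lambda>x. Im (k x))" using ki by simp
    show "(\<integral>x. indicator (box l u) x * Im (k x) \<partial>lebesgue) = 0" for l u
      using integral_Im[OF bi[of l u]] box0[of l u] by simp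
  qed
  ultimately show ?thesis
    by eventually_elim (auto simp: k_def G_def complex_eq_iff)
qed

section \<open>Convex combinations of a dominated sequence\<close>

inductive_set midpoint_hull :: "('a \<Rightarrow> complex) set \<Rightarrow> ('a \<Rightarrow> complex) set" for X where
  incl: "f \<in> X \<Longrightarrow> f \<in> midpoint_hull X"
| mid: "f \<in> midpoint_hull X \<Longrightarrow> g \<in> midpoint_hull X \<Longrightarrow> (\<lambda>x. (f x + g x) / 2) \<in> midpoint_hull X"

lemma midpoint_hull_mono: "f \<in> midpoint_hull X \<Longrightarrow> X \<subseteq> Y \<Longrightarrow> f \<in> midpoint_hull Y"
  by (induction rule: midpoint_hull.induct) (auto intro: midpoint_hull.intros)

lemma midpoint_hull_measurable:
  "f \<in> midpoint_hull X \<Longrightarrow> (\<And>g. g \<in> X \<Longrightarrow> g \<in> borel_measurable M) \<Longrightarrow> f \<in> borel_measurable M"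
  by (induction rule: midpoint_hull.induct) auto

lemma norm_midpoint_diff_le:
  fixes a b c :: complex
  assumes "cmod (a - c) \<le> e" "cmod (b - c) \<le> e"
  shows "cmod ((a + b) / 2 - c) \<le> e"
proof -
  have "(a + b) / 2 - c = ((a - c) + (b - c)) / 2" by (simp add: field_simps)
  then have "cmod ((a + b) / 2 - c) = cmod ((a - c) + (b - c)) / 2" by (simp only: norm_divide) simp
  also have "\<dots> \<le> (e + e) / 2" using assms norm_triangle_ineq[of "a - c" "b - c"] by (intro divide_right_mono) linarith+
  finally show ?thesis by simp
qed

lemma midpoint_hull_bound:
  "f \<in> midpoint_hull X \<Longrightarrow> (\<And>g. g \<in> X \<Longrightarrow> cmod (g x) \<le> B) \<Longrightarrow> cmod (f x) \<le> B"
proof (induction rule: midpoint_hull.induct)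
  case (mid f g)
  then show ?case using norm_midpoint_diff_le[of "f x" 0 B "g x"] by simp
qed auto

text \<open>The argument of Mazur's lemma: almost minimizers of the \<open>L\<^sup>2\<close> norm over the convex hulls of
  the tails form a Cauchy sequence by the parallelogram law. Midpoints are all the convexity that
  this needs.\<close>

lemma (in finite_measure) midpoint_hull_AE_convergent:
  fixes g :: "nat \<Rightarrow> 'a \<Rightarrow> complex"
  assumes meas: "\<And>k. g k \<in> borel_measurable M" and bdd: "\<And>k x. cmod (g k x) \<le> 1"
  obtains h where "\<And>m. h m \<in> midpoint_hull (g ` {m..})" "AE x in M. convergent (\<lambda>m. h m x)"
proof -
  define C where "C m = midpoint_hull (g ` {m..})" for m
  define Q where "Q f = (\<integral>x. (cmod (f x))\<^sup>2 \<partial>M)" for f :: "'a \<Rightarrow> complex"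
  have Cmono: "C m \<subseteq> C n" if "n \<le> m" for m n
    unfolding C_def using that by (intro subsetI, elim midpoint_hull_mono) auto
  have Cm: "f \<in> borel_measurable M" if "f \<in> C m" for f m
    using that unfolding C_def by (rule midpoint_hull_measurable) (use meas in auto)
  have Cb: "cmod (f x) \<le> 1" if "f \<in> C m" for f m x
    using that unfolding C_def by (rule midpoint_hull_bound) (use bdd in auto)
  have int: "integrable M (\<lambda>x. (cmod (f x))\<^sup>2)" if f: "f \<in> C m" for f m
  proof (rule integrable_const_bound[where B = 1])
    show "AE x in M. norm ((cmod (f x))\<^sup>2) \<le> 1" using Cb[OF f] by (simp add: power_le_one)
    show "(\<lambda>x. (cmod (f x))\<^sup>2) \<in> borel_measurable M" using Cm[OF f] by measurable
  qed
  have Q0: "0 \<le> Q f" for f unfolding Q_def by simp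
  have gC: "g m \<in> C m" for m unfolding C_def by (intro midpoint_hull.incl) auto
  have Qg: "Q f \<le> measure M (space M)" if f: "f \<in> C m" for f m
  proof -
    have "Q f \<le> (\<integral>x. 1 \<partial>M)" unfolding Q_def
      by (intro integral_mono int[OF f]) (auto simp: power_le_one Cb[OF f])
    then show ?thesis by simp
  qed
  \<comment> \<open>The hulls of the tails shrink, so these infima increase, and they are bounded by
    the total mass. Below, \<open>n m\<close> is an index at which the infimum is within 4^-m of its
    limit \<open>L\<close>.\<close>
  define D where "D m = (INF f\<in>C m. Q f)" for m
  have bb: "bdd_below (Q ` C m)" for m using Q0 by (auto simp: bdd_below_def)
  have Dle: "D m \<le> Q f" if "f \<in> C m" for f m unfolding D_def by (rule cINF_lower[OF bb that])
  have Dmono: "D m \<le> D n" if "m \<le> n" for m n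
    unfolding D_def by (rule cINF_superset_mono[OF _ bb Cmono[OF that]]) (use gC in auto)
  have Dub: "D m \<le> measure M (space M)" for m using Dle[OF gC] Qg[OF gC] order_trans by blast
  define L where "L = (SUP m. D m)"
  have bd: "bdd_above (range D)" using Dub by (auto simp: bdd_above_def)
  have DL: "D m \<le> L" for m unfolding L_def by (rule cSUP_upper[OF _ bd]) simp
  have "\<exists>n\<ge>m. L - (1/4) ^ m \<le> D n" for m
  proof -
    have "L - (1/4) ^ m < L" by simp
    then obtain n where "L - (1/4) ^ m < D n" unfolding L_def using less_cSUP_iff[OF _ bd] by auto
    then show ?thesis using Dmono[of n "max m n"] by (intro exI[of _ "max m n"]) auto
  qed
  then obtain n where n: "\<And>m. m \<le> n m" "\<And>m. L - (1/4) ^ m \<le> D (n m)" by metis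
  have "\<exists>f\<in>C (n m). Q f < D (n m) + (1/4) ^ m" for m
  proof -
    have "(INF f\<in>C (n m). Q f) < D (n m) + (1/4) ^ m" unfolding D_def by simp
    then show ?thesis using cINF_less_iff[OF _ bb, of "n m"] gC by blast
  qed
  then obtain h where h: "\<And>m. h m \<in> C (n m)" "\<And>m. Q (h m) < D (n m) + (1/4) ^ m" by metis
  define d where "d m x = cmod (h m x - h (Suc m) x)" for m x
  have hm [measurable]: "h m \<in> borel_measurable M" for m by (rule Cm[OF h(1)])
  have dm [measurable]: "d m \<in> borel_measurable M" for m unfolding d_def[abs_def] by measurable
  have d2: "d m x \<le> 2" for m x
    unfolding d_def using norm_triangle_ineq4[of "h m x" "h (Suc m) x"] Cb[OF h(1)[of m]] Cb[OF h(1)[of "Suc m"]]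
    by (smt (verit))
  have dint: "integrable M (d m)" and d2int: "integrable M (\<lambda>x. (d m x)\<^sup>2)" for m
  proof -
    show "integrable M (d m)"
      by (rule integrable_const_bound[where B = 2]) (use d2 in \<open>auto simp: d_def\<close>)
    have "(d m x)\<^sup>2 \<le> 2\<^sup>2" for x by (rule power_mono[OF d2]) (simp add: d_def)
    then show "integrable M (\<lambda>x. (d m x)\<^sup>2)"
      by (intro integrable_const_bound[where B = "2\<^sup>2"]) auto
  qed
  have Qd: "(\<integral>x. (d m x)\<^sup>2 \<partial>M) \<le> 8 * (1/4) ^ m" for m
  proof -
    let ?N = "min (n m) (n (Suc m))"
    \<comment> \<open>Both functions lie in the hull of the larger tail, hence so does their
      midpoint, whose squared norm cannot fall below \<open>L\<close> by more than 4^-m.\<close>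
    have hN: "h m \<in> C ?N" "h (Suc m) \<in> C ?N" using h(1) Cmono by (meson min.cobounded1 min.cobounded2 subsetD)+
    have mid: "(\<lambda>x. (h m x + h (Suc m) x) / 2) \<in> C ?N"
      using hN unfolding C_def by (rule midpoint_hull.mid)
    have "(1/4) ^ Suc m \<le> (1/4 :: real) ^ m" by simp
    then have "L - (1/4) ^ m \<le> D (n (Suc m))" using n(2)[of "Suc m"] by linarith
    then have "L - (1/4) ^ m \<le> D ?N" using n(2)[of m] by (auto simp: min_def)
    then have Qmid: "L - (1/4) ^ m \<le> Q (\<lambda>x. (h m x + h (Suc m) x) / 2)" using Dle[OF mid] by linarith
    have Qh: "Q (h m) \<le> L + (1/4) ^ m" "Q (h (Suc m)) \<le> L + (1/4) ^ m"
      using h(2)[of m] h(2)[of "Suc m"] DL[of "n m"] DL[of "n (Suc m)"] \<open>(1/4) ^ Suc m \<le> (1/4 :: real) ^ m\<close> by linarith+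
    \<comment> \<open>The parallelogram identity.\<close>
    have "(d m x)\<^sup>2 = 2 * (cmod (h m x))\<^sup>2 + 2 * (cmod (h (Suc m) x))\<^sup>2 - 4 * (cmod ((h m x + h (Suc m) x) / 2))\<^sup>2" for x
      unfolding d_def norm_divide cmod_power2 power_divide
      by (simp add: cmod_power2 power2_eq_square field_simps)
    then have "(\<integral>x. (d m x)\<^sup>2 \<partial>M) = (\<integral>x. 2 * (cmod (h m x))\<^sup>2 + 2 * (cmod (h (Suc m) x))\<^sup>2 - 4 * (cmod ((h m x + h (Suc m) x) / 2))\<^sup>2 \<partial>M)"
      by simp
    also have "\<dots> = 2 * Q (h m) + 2 * Q (h (Suc m)) - 4 * Q (\<lambda>x. (h m x + h (Suc m) x) / 2)"
      unfolding Q_def using int[OF hN(1)] int[OF hN(2)] int[OF mid] by simp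
    also have "\<dots> \<le> 8 * (1/4) ^ m" using Qmid Qh by linarith
    finally show ?thesis .
  qed
  define V where "V = (measure M (space M) + 8) / 2"
  have dm1: "(\<integral>x. d m x \<partial>M) \<le> V * (1/2) ^ m" for m
  proof -
    let ?a = "(1/2 :: real) ^ m"
    \<comment> \<open>The inequality between arithmetic and geometric mean with weight 2^-m turns an
      L^2 bound of order 4^-m for the squares into an L^1 bound of order 2^-m, which is
      summable.\<close>
    have "d m x \<le> (?a + (d m x)\<^sup>2 / ?a) / 2" for x
    proof -
      have "0 \<le> (d m x - ?a)\<^sup>2" by simp
      then have "2 * d m x * ?a \<le> (d m x)\<^sup>2 + ?a\<^sup>2" by (simp add: power2_diff)
      then show ?thesis by (simp add: field_simps power2_eq_square)
    qed
    moreover have "integrable M (\<lambda>x. (a + (d m x)\<^sup>2 / a) / 2)" for a :: real using d2int[of m] by simp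
    ultimately have "(\<integral>x. d m x \<partial>M) \<le> (\<integral>x. (?a + (d m x)\<^sup>2 / ?a) / 2 \<partial>M)"
      by (intro integral_mono dint)
    also have "\<dots> = (?a * measure M (space M) + (\<integral>x. (d m x)\<^sup>2 \<partial>M) / ?a) / 2"
      using d2int by (simp add: mult.commute)
    also have "\<dots> \<le> (?a * measure M (space M) + (8 * (1/4) ^ m) / ?a) / 2"
      using Qd[of m] by (intro divide_right_mono add_mono) auto
    also have "(8 * (1/4 :: real) ^ m) / ?a = 8 * ?a"
    proof -
      have "(1/4 :: real) ^ m = ?a * ?a" by (simp add: power_mult_distrib[symmetric])
      then show ?thesis by simp
    qed
    also have "(?a * measure M (space M) + 8 * ?a) / 2 = V * ?a" by (simp add: V_def field_simps)
    finally show ?thesis .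
  qed
  have "(\<integral>\<^sup>+x. (\<Sum>m. ennreal (d m x)) \<partial>M) = (\<Sum>m. \<integral>\<^sup>+x. ennreal (d m x) \<partial>M)"
    by (rule nn_integral_suminf) measurable
  also have "\<dots> = (\<Sum>m. ennreal (\<integral>x. d m x \<partial>M))"
    by (intro suminf_cong nn_integral_eq_integral dint) (auto simp: d_def)
  also have "\<dots> \<le> (\<Sum>m. ennreal (V * (1/2) ^ m))"
    by (intro suminf_le ennreal_leI dm1) auto
  also have "\<dots> < \<infinity>"
  proof -
    have V0: "0 \<le> V" by (simp add: V_def)
    have "summable (\<lambda>m. V * (1/2) ^ m)" by (intro summable_mult summable_geometric) simp
    moreover have "0 \<le> V * (1/2) ^ m" for m using V0 by simp
    ultimately have "(\<Sum>m. ennreal (V * (1/2) ^ m)) = ennreal (\<Sum>m. V * (1/2) ^ m)"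
      by (intro suminf_ennreal2)
    then show ?thesis by (simp only: ennreal_less_top infinity_ennreal_def)
  qed
  finally have "(\<integral>\<^sup>+x. (\<Sum>m. ennreal (d m x)) \<partial>M) \<noteq> \<infinity>" by simp
  then have "AE x in M. (\<Sum>m. ennreal (d m x)) \<noteq> \<infinity>"
    by (intro nn_integral_noteq_infinite) measurable
  then have "AE x in M. convergent (\<lambda>m. h m x)"
  proof (rule AE_mp, intro AE_I2 impI)
    fix x assume "(\<Sum>m. ennreal (d m x)) \<noteq> \<infinity>"
    then have "summable (\<lambda>m. d m x)"
      using summable_suminf_not_top[of "\<lambda>m. d m x"] by (simp add: d_def)
    then have "summable (\<lambda>m. norm (h (Suc m) x - h m x))" by (simp add: d_def norm_minus_commute)
    then have "summable (\<lambda>m. h (Suc m) x - h m x)" by (rule summable_norm_cancel)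
    then have "convergent (\<lambda>k. \<Sum>m<k. h (Suc m) x - h m x)" by (simp add: summable_iff_convergent)
    then have "convergent (\<lambda>k. h k x - h 0 x)" by (simp only: sum_lessThan_telescope[of "\<lambda>m. h m x"])
    then have "convergent (\<lambda>k. (h k x - h 0 x) + h 0 x)" by (intro convergent_add convergent_const)
    then show "convergent (\<lambda>m. h m x)" by simp
  qed
  moreover have "h m \<in> midpoint_hull (g ` {m..})" for m
    using h(1)[of m] Cmono[OF n(1)[of m]] unfolding C_def by blast
  ultimately show ?thesis using that by blast
qed

text \<open>The majorant \<open>H\<close> need not be square integrable. Division by 1 + H makes the
  sequence bounded by 1, and a Gaussian density makes the measure finite with the same null sets, so
  that convex combinations converge almost everywhere. Such combinations preserve the limit of every
  functional that converges along the sequence. One function f therefore serves all \<psi>, and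
  domination by \<open>H\<close> survives pointwise.\<close>

lemma dominated_weak_limit:
  fixes g :: "nat \<Rightarrow> real^'n \<Rightarrow> complex" and H :: "real^'n \<Rightarrow> real"
  assumes g [measurable]: "\<And>k. g k \<in> borel_measurable lebesgue"
    and H [measurable]: "H \<in> borel_measurable lebesgue" and H0: "\<And>x. 0 \<le> H x"
    and dom: "\<And>k. AE x in lebesgue. cmod (g k x) \<le> H x"
  obtains f where "f \<in> borel_measurable lebesgue" "\<And>x. cmod (f x) \<le> H x"
    "\<And>\<psi> l. \<psi> \<in> borel_measurable lebesgue \<Longrightarrow> integrable lebesgue (\<lambda>x. H x * cmod (\<psi> x)) \<Longrightarrow>
      (\<lambda>k. \<integral>x. \<psi> x * g k x \<partial>lebesgue) \<longlonglongrightarrow> l \<Longrightarrow> (\<integral>x. f x * \<psi> x \<partial>lebesgue) = l"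
proof -
  define G where "G x = exp (- (x \<bullet> x))" for x :: "real^'n"
  have GS: "(\<lambda>x. complex_of_real (G x)) \<in> Schwartz"
    unfolding G_def by (rule gauss_class_Schwartz[OF gauss_class.gauss])
  have Gb [measurable]: "G \<in> borel_measurable lborel" unfolding G_def[abs_def] by measurable
  have Gm [measurable]: "G \<in> borel_measurable lebesgue" using measurable_completion[OF Gb] .
  have Gi: "integrable lebesgue G"
    using Schwartz_integrable_weight[OF GS, of 0] integrable_completion[OF Gb] by (simp add: G_def[abs_def])
  have G0: "0 < G x" for x by (simp add: G_def)
  let ?M = "density lebesgue (\<lambda>x. ennreal (G x))"
  interpret M: finite_measure ?M
  proof (rule finite_measureI)
    have "emeasure ?M (space ?M) = (\<integral>\<^sup>+x. ennreal (G x) \<partial>lebesgue)"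
      by (subst emeasure_density) (auto intro!: nn_integral_cong)
    also have "\<dots> < \<infinity>" using Gi by (simp add: real_integrable_def top.not_eq_extremum)
    finally show "emeasure ?M (space ?M) \<noteq> \<infinity>" by simp
  qed
  have AEM: "(AE x in ?M. P x) \<longleftrightarrow> (AE x in lebesgue. P x)" for P
    by (subst AE_density) (auto simp: G0)
  \<comment> \<open>Values violating the bound, which occur on a null set only, are set to 0 so that
    the bound holds everywhere and passes to the hull.\<close>
  define g' where "g' k x = (if cmod (g k x) \<le> H x then g k x / complex_of_real (1 + H x) else 0)" for k x
  have g'm: "g' k \<in> borel_measurable lebesgue" for k unfolding g'_def[abs_def] by measurable
  have g'H: "cmod (g' k x) \<le> H x / (1 + H x)" for k x
  proof -
    have "cmod (complex_of_real (1 + H x)) = 1 + H x" using H0[of x] by (simp only: norm_of_real)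
    then have "cmod (g k x / complex_of_real (1 + H x)) = cmod (g k x) / (1 + H x)" by (simp only: norm_divide)
    then show ?thesis using H0[of x] unfolding g'_def by (auto intro!: divide_right_mono)
  qed
  have g'1: "cmod (g' k x) \<le> 1" for k x
    by (rule order_trans[OF g'H]) (use H0[of x] in \<open>simp add: divide_le_eq\<close>)
  obtain h where h: "\<And>m. h m \<in> midpoint_hull (g' ` {m..})" "AE x in ?M. convergent (\<lambda>m. h m x)"
    using M.midpoint_hull_AE_convergent[of g'] g'm g'1 by auto
  have hm [measurable]: "h m \<in> borel_measurable lebesgue" for m
    by (rule midpoint_hull_measurable[OF h(1)]) (use g'm in auto)
  have hH: "cmod (h m x) \<le> H x / (1 + H x)" for m x
    by (rule midpoint_hull_bound[OF h(1)]) (use g'H in auto)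
  have conv: "AE x in lebesgue. convergent (\<lambda>m. h m x)" using h(2) AEM by blast
  define f where "f x = (if convergent (\<lambda>m. h m x) then complex_of_real (1 + H x) * lim (\<lambda>m. h m x) else 0)" for x
  have [measurable]: "f \<in> borel_measurable lebesgue"
    unfolding f_def[abs_def]
  proof (rule measurable_If)
    show "{x \<in> space lebesgue. convergent (\<lambda>m. h m x)} \<in> sets lebesgue"
      using sets_Collect_Cauchy[of h lebesgue] hm by (simp add: Cauchy_convergent_iff)
    have "(\<lambda>x. lim (\<lambda>m. h m x)) \<in> borel_measurable lebesgue"
      by (rule borel_measurable_lim_metric[OF hm])
    then show "(\<lambda>x. complex_of_real (1 + H x) * lim (\<lambda>m. h m x)) \<in> borel_measurable lebesgue"
      by measurable
  qed simp
  have lim: "(\<lambda>m. complex_of_real (1 + H x) * h m x) \<longlonglongrightarrow> f x" if "convergent (\<lambda>m. h m x)" for x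
    using that unfolding f_def by (auto intro!: tendsto_intros simp: convergent_LIMSEQ_iff)
  have bH: "cmod (complex_of_real (1 + H x) * h m x) \<le> H x" for m x
  proof -
    have p: "0 < 1 + H x" using H0[of x] by simp
    have "cmod (complex_of_real (1 + H x) * h m x) = (1 + H x) * cmod (h m x)" using p by (simp only: norm_mult norm_of_real abs_of_pos)
    also have "\<dots> \<le> (1 + H x) * (H x / (1 + H x))" using p by (intro mult_left_mono hH) auto
    finally show ?thesis using p by simp
  qed
  have fH: "cmod (f x) \<le> H x" for x
  proof (cases "convergent (\<lambda>m. h m x)")
    case True
    from lim[OF this] have "(\<lambda>m. cmod (complex_of_real (1 + H x) * h m x)) \<longlonglongrightarrow> cmod (f x)" by (rule tendsto_norm)
    then show ?thesis by (rule LIMSEQ_le_const2) (use bH in blast)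
  qed (use H0 in \<open>simp add: f_def\<close>)
  have "(\<integral>x. f x * \<psi> x \<partial>lebesgue) = l"
    if \<psi> [measurable]: "\<psi> \<in> borel_measurable lebesgue" and i: "integrable lebesgue (\<lambda>x. H x * cmod (\<psi> x))"
      and l: "(\<lambda>k. \<integral>x. \<psi> x * g k x \<partial>lebesgue) \<longlonglongrightarrow> l" for \<psi> l
  proof -
    define J where "J q = (\<integral>x. \<psi> x * (complex_of_real (1 + H x) * q x) \<partial>lebesgue)" for q :: "real^'n \<Rightarrow> complex"
    let ?A = "{q. q \<in> borel_measurable lebesgue \<and> (\<forall>x. cmod (q x) \<le> H x / (1 + H x))}"
    have qi: "integrable lebesgue (\<lambda>x. \<psi> x * (complex_of_real (1 + H x) * q x))" if q: "q \<in> ?A" for q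
    proof (rule Bochner_Integration.integrable_bound[OF i])
      show "(\<lambda>x. \<psi> x * (complex_of_real (1 + H x) * q x)) \<in> borel_measurable lebesgue"
      proof -
        have [measurable]: "q \<in> borel_measurable lebesgue" using q by simp
        show ?thesis by measurable
      qed
      show "AE x in lebesgue. norm (\<psi> x * (complex_of_real (1 + H x) * q x)) \<le> norm (H x * cmod (\<psi> x))"
      proof (intro AE_I2)
        fix x
        have p: "0 < 1 + H x" using H0[of x] by simp
        have "cmod (complex_of_real (1 + H x) * q x) = (1 + H x) * cmod (q x)" using p by (simp only: norm_mult norm_of_real abs_of_pos)
        also have "\<dots> \<le> (1 + H x) * (H x / (1 + H x))" using p q by (intro mult_left_mono) auto
        also have "\<dots> = H x" using p by simp
        finally have "cmod (\<psi> x) * cmod (complex_of_real (1 + H x) * q x) \<le> cmod (\<psi> x) * H x" by (rule mult_left_mono) simp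
        then show "norm (\<psi> x * (complex_of_real (1 + H x) * q x)) \<le> norm (H x * cmod (\<psi> x))"
          using H0[of x] by (simp add: norm_mult[of "\<psi> x"] mult.commute)
      qed
    qed
    have Jg: "J (g' k) = (\<integral>x. \<psi> x * g k x \<partial>lebesgue)" for k
      unfolding J_def
    proof (rule integral_cong_AE)
      show "(\<lambda>x. \<psi> x * (complex_of_real (1 + H x) * g' k x)) \<in> borel_measurable lebesgue"
        using g'm[of k] by measurable
      show "AE x in lebesgue. \<psi> x * (complex_of_real (1 + H x) * g' k x) = \<psi> x * g k x"
        using dom[of k]
      proof (rule AE_mp, intro AE_I2 impI)
        fix x assume "cmod (g k x) \<le> H x"
        moreover have "complex_of_real (1 + H x) \<noteq> 0" using H0[of x] by (simp only: of_real_eq_0_iff)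
        ultimately show "\<psi> x * (complex_of_real (1 + H x) * g' k x) = \<psi> x * g k x" by (simp add: g'_def)
      qed
    qed measurable
    have "(\<lambda>m. J (h m)) \<longlonglongrightarrow> l"
    proof (rule LIMSEQ_I)
      fix e :: real assume "0 < e"
      then have "0 < e / 2" by simp
      from LIMSEQ_D[OF l this] obtain K where K: "\<And>k. k \<ge> K \<Longrightarrow> cmod ((\<integral>x. \<psi> x * g k x \<partial>lebesgue) - l) < e / 2" by blast
      \<comment> \<open>A disc around \<open>l\<close> is convex, so the estimate for the terms from
        \<open>K\<close> on holds throughout their hull; the combinations \<open>h m\<close> inherit
        the limit.\<close>
      have "q \<in> ?A \<and> cmod (J q - l) \<le> e / 2" if "q \<in> midpoint_hull (g' ` {K..})" for q
        using that
      proof induction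
        case (incl q)
        then obtain k where "k \<ge> K" "q = g' k" by auto
        then show ?case using K[of k] g'm[of k] g'H[of k] by (auto simp: Jg)
      next
        case (mid q r)
        then have A: "q \<in> ?A" "r \<in> ?A" by auto
        have "J (\<lambda>x. (q x + r x) / 2) = (\<integral>x. (\<psi> x * (complex_of_real (1 + H x) * q x) + \<psi> x * (complex_of_real (1 + H x) * r x)) / 2 \<partial>lebesgue)"
          unfolding J_def by (intro Bochner_Integration.integral_cong) (auto simp: field_simps)
        also have "\<dots> = (J q + J r) / 2"
          unfolding J_def using qi[OF A(1)] qi[OF A(2)] by simp
        finally have "cmod (J (\<lambda>x. (q x + r x) / 2) - l) \<le> e / 2"
          using mid.IH by (simp only:) (intro norm_midpoint_diff_le, auto)
        moreover have "cmod ((q x + r x) / 2) \<le> H x / (1 + H x)" for x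
          using A norm_midpoint_diff_le[of "q x" 0 "H x / (1 + H x)" "r x"] unfolding diff_0_right by blast
        ultimately show ?case using A by auto
      qed
      then have *: "cmod (J q - l) \<le> e / 2" if "q \<in> midpoint_hull (g' ` {K..})" for q using that by blast
      have "cmod (J (h m) - l) < e" if "m \<ge> K" for m
      proof -
        have "h m \<in> midpoint_hull (g' ` {K..})" by (rule midpoint_hull_mono[OF h(1)[of m]]) (use that in auto)
        from *[OF this] show ?thesis using \<open>0 < e\<close> by linarith
      qed
      then show "\<exists>no. \<forall>n\<ge>no. norm (J (h n) - l) < e" by blast
    qed
    moreover have "(\<lambda>m. J (h m)) \<longlonglongrightarrow> (\<integral>x. f x * \<psi> x \<partial>lebesgue)"
      unfolding J_def
    proof (rule integral_dominated_convergence[OF _ _ i])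
      show "AE x in lebesgue. (\<lambda>m. \<psi> x * (complex_of_real (1 + H x) * h m x)) \<longlonglongrightarrow> f x * \<psi> x"
        using conv
      proof (rule AE_mp, intro AE_I2 impI)
        fix x assume "convergent (\<lambda>m. h m x)"
        from tendsto_mult_left[OF lim[OF this], of "\<psi> x"]
        show "(\<lambda>m. \<psi> x * (complex_of_real (1 + H x) * h m x)) \<longlonglongrightarrow> f x * \<psi> x" by (simp add: mult.commute)
      qed
      show "AE x in lebesgue. norm (\<psi> x * (complex_of_real (1 + H x) * h m x)) \<le> H x * cmod (\<psi> x)" for m
        unfolding norm_mult[of "\<psi> _"] mult.commute[of "H _"] by (intro AE_I2 mult_left_mono bH norm_ge_zero)
    qed measurable
    ultimately show ?thesis by (metis LIMSEQ_unique)
  qed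
  with \<open>f \<in> borel_measurable lebesgue\<close> fH show ?thesis by (rule that)
qed

section \<open>Linear changes of variables\<close>

text \<open>The library states these facts only for well-ordered index types.\<close>

lemma measure_stretch_det:
  fixes S :: "(real^'n) set"
  assumes "S \<in> lmeasurable"
  shows "(\<lambda>x. \<chi> i. c i * x $ i) ` S \<in> lmeasurable"
    and "measure lebesgue ((\<lambda>x. \<chi> i. c i * x $ i) ` S) = \<bar>det (matrix (\<lambda>x :: real^'n. \<chi> i. c i * x $ i))\<bar> * measure lebesgue S"
proof -
  show "(\<lambda>x. \<chi> i. c i * x $ i) ` S \<in> lmeasurable" by (rule measurable_stretch[OF assms])
  have "det (matrix (\<lambda>x :: real^'n. \<chi> i. c i * x $ i)) = prod c UNIV"
    by (subst det_diagonal) (auto simp: matrix_def axis_def)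
  then show "measure lebesgue ((\<lambda>x. \<chi> i. c i * x $ i) ` S) = \<bar>det (matrix (\<lambda>x :: real^'n. \<chi> i. c i * x $ i))\<bar> * measure lebesgue S"
    by (simp add: measure_stretch[OF assms])
qed

text \<open>A shear has determinant 1, so it suffices that volumes of boxes are preserved.\<close>

lemma measure_shear_det:
  fixes S :: "(real^'n) set"
  assumes "m \<noteq> n" "S \<in> lmeasurable"
  defines "h \<equiv> \<lambda>x :: real^'n. \<chi> i. if i = m then x $ m + x $ n else x $ i"
  shows "h ` S \<in> lmeasurable" and "measure lebesgue (h ` S) = \<bar>det (matrix h)\<bar> * measure lebesgue S"
proof -
  have lin: "linear h" unfolding h_def
    by (rule linearI) (auto simp: algebra_simps vec_eq_iff)
  have "matrix h = (\<chi> k. if k = m then row m (mat 1) + 1 *s row n (mat 1) else row k (mat 1))"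
    by (auto simp: h_def matrix_def row_def mat_def axis_def vec_eq_iff)
  then have det1: "det (matrix h) = 1" using det_row_operation[OF assms(1), of "mat 1" 1] by simp
  have box: "measure lebesgue (h ` cbox a b) = 1 * measure lebesgue (cbox a b)" for a b
  proof (cases "cbox a b = {}")
    case False
    \<comment> \<open>A translation moves the lower corner to n-th coordinate 0, as
      \<open>measure_shear_interval\<close> requires; measure does not notice translations.\<close>
    define t where "t = (- a $ n) *\<^sub>R (axis n 1 :: real^'n)"
    have ne: "cbox (t + a) (t + b) \<noteq> {}" using False cbox_translation[of t a b] by auto
    have "0 \<le> (t + a) $ n" by (simp add: t_def)
    have "measure lebesgue (h ` cbox a b) = measure lebesgue ((+) (h t) ` h ` cbox a b)"
      by (rule measure_translation[symmetric])
    also have "(+) (h t) ` h ` cbox a b = h ` cbox (t + a) (t + b)"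
      using linear_add[OF lin] unfolding cbox_translation by (auto simp: image_image)
    also have "measure lebesgue \<dots> = measure lebesgue (cbox (t + a) (t + b))"
      unfolding h_def by (rule measure_shear_interval[OF assms(1) ne]) fact
    also have "\<dots> = measure lebesgue (cbox a b)"
      unfolding cbox_translation by (rule measure_translation)
    finally show ?thesis by simp
  qed simp
  show "h ` S \<in> lmeasurable" "measure lebesgue (h ` S) = \<bar>det (matrix h)\<bar> * measure lebesgue S"
    using measure_linear_sufficient[OF lin assms(2) box] det1 by auto
qed

text \<open>The formula is stable under composition because determinants multiply, so elementary
  maps suffice. A map that kills a coordinate has a negligible image and determinant 0.\<close>

lemma
  fixes f :: "real^'n \<Rightarrow> real^'n"
  assumes "linear f" "S \<in> lmeasurable"
  shows lmeasurable_linear_image_cart: "f ` S \<in> lmeasurable"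
    and measure_linear_image_cart: "measure lebesgue (f ` S) = \<bar>det (matrix f)\<bar> * measure lebesgue S"
proof -
  define Q where "Q f \<longleftrightarrow> linear f \<and> (\<forall>S\<in>lmeasurable. f ` S \<in> lmeasurable \<and>
    measure lebesgue (f ` S) = \<bar>det (matrix f)\<bar> * measure lebesgue S)" for f :: "real^'n \<Rightarrow> real^'n"
  have comp: "Q (f \<circ> g)" if "Q f" "Q g" for f g
    unfolding Q_def
  proof (intro conjI ballI)
    have lin: "linear f" "linear g" using that by (auto simp: Q_def)
    show "linear (f \<circ> g)" by (rule linear_compose[OF lin(2,1)])
    fix S :: "(real^'n) set" assume "S \<in> lmeasurable"
    then have "g ` S \<in> lmeasurable" "measure lebesgue (g ` S) = \<bar>det (matrix g)\<bar> * measure lebesgue S"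
      using that by (auto simp: Q_def)
    moreover from this have "f ` g ` S \<in> lmeasurable"
      "measure lebesgue (f ` g ` S) = \<bar>det (matrix f)\<bar> * measure lebesgue (g ` S)"
      using that by (auto simp: Q_def)
    ultimately show "(f \<circ> g) ` S \<in> lmeasurable"
      "measure lebesgue ((f \<circ> g) ` S) = \<bar>det (matrix (f \<circ> g))\<bar> * measure lebesgue S"
      unfolding image_comp[symmetric] by (simp_all add: matrix_compose[OF lin(2,1)] det_mul abs_mult)
  qed
  have stretch: "Q (\<lambda>x. \<chi> i. c i * x $ i)" for c
    unfolding Q_def
  proof (intro conjI ballI)
    show "linear (\<lambda>x :: real^'n. \<chi> i. c i * x $ i)"
      by (rule linearI) (simp_all add: vec_eq_iff algebra_simps)
  qed (rule measure_stretch_det, assumption)+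
  have shear: "Q (\<lambda>x. \<chi> i. if i = m then x $ m + x $ n else x $ i)" if "m \<noteq> n" for m n
    unfolding Q_def
  proof (intro conjI ballI)
    show "linear (\<lambda>x :: real^'n. \<chi> i. if i = m then x $ m + x $ n else x $ i)"
      by (rule linearI) (simp_all add: vec_eq_iff algebra_simps)
  qed (rule measure_shear_det[OF that], assumption)+
  have "Q f"
  proof (rule induct_linear_elementary[OF assms(1)])
    fix f :: "real^'n \<Rightarrow> real^'n" and i assume f: "linear f" "\<And>x. f x $ i = 0"
    have "axis i 1 \<notin> range f" using f(2) by (metis axis_nth rangeE zero_neq_one)
    then have ninj: "\<not> inj f" using linear_injective_imp_surjective[OF f(1)] by blast
    have "f ` S \<in> lmeasurable \<and> measure lebesgue (f ` S) = 0" for S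
      using negligible_linear_singular_image[OF f(1) ninj] negligible_iff_measure by blast
    moreover have "det (matrix f) = 0" using det_nz_iff_inj[OF f(1)] ninj by blast
    ultimately show "Q f" unfolding Q_def using f(1) by simp
  next
    fix m n :: 'n assume mn: "m \<noteq> n"
    \<comment> \<open>a coordinate transposition is a product of shears and reflections\<close>
    let ?h = "\<lambda>m n (x :: real^'n). \<chi> i. if i = m then x $ m + x $ n else x $ i"
    let ?d = "\<lambda>x :: real^'n. \<chi> i. (if i = n then - 1 else 1) * x $ i"
    have "Q (?d \<circ> (?h m n \<circ> (?d \<circ> (?h n m \<circ> (?d \<circ> ?h m n)))))"
      by (intro comp stretch shear mn mn[symmetric])
    also have "?d \<circ> (?h m n \<circ> (?d \<circ> (?h n m \<circ> (?d \<circ> ?h m n)))) = (\<lambda>x. \<chi> i. x $ Transposition.transpose m n i)"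
      using mn by (auto simp: fun_eq_iff vec_eq_iff Transposition.transpose_def)
    finally show "Q (\<lambda>x. \<chi> i. x $ Transposition.transpose m n i)" .
  qed (assumption | rule comp stretch shear)+
  then show "f ` S \<in> lmeasurable" "measure lebesgue (f ` S) = \<bar>det (matrix f)\<bar> * measure lebesgue S"
    using assms(2) unfolding Q_def by blast+
qed

text \<open>Lebesgue measure is determined by boxes, and the preimage of a box is its image under
  the inverse map, with reciprocal determinant.\<close>

lemma lborel_density_linear:
  fixes f :: "real^'n \<Rightarrow> real^'n"
  assumes f: "linear f" and inj: "inj f"
  shows "lborel = density (distr lborel borel f) (\<lambda>_. ennreal \<bar>det (matrix f)\<bar>)"
proof (rule lborel_eqI)
  have [measurable]: "f \<in> borel \<rightarrow>\<^sub>M borel"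
    using f by (intro borel_measurable_continuous_onI linear_continuous_on) (simp add: linear_conv_bounded_linear)
  obtain g where g: "linear g" "g \<circ> f = id" "f \<circ> g = id"
    using linear_injective_left_inverse[OF f inj] left_inverse_linear linear_inverse_left f by metis
  have "matrix f ** matrix g = mat 1"
    using matrix_compose[OF g(1) f] g(3) by (simp add: matrix_id_mat_1)
  then have "det (matrix f) * det (matrix g) = 1" by (metis det_I det_mul)
  then have dets: "\<bar>det (matrix f)\<bar> * \<bar>det (matrix g)\<bar> = 1" by (metis abs_mult abs_one)
  fix l u :: "real^'n" assume lu: "\<And>b. b \<in> Basis \<Longrightarrow> l \<bullet> b \<le> u \<bullet> b"
  have pre: "f -` box l u = g ` box l u"
    using g(2,3) by (auto simp: fun_eq_iff image_iff) (metis)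
  have bm: "box l u \<in> lmeasurable" by simp
  have "emeasure lborel (f -` box l u) = emeasure lebesgue (g ` box l u)"
    using measurable_sets[of f borel borel "box l u"] by (simp add: pre)
  also have "\<dots> = ennreal (measure lebesgue (g ` box l u))"
    by (rule emeasure_eq_measure2[OF lmeasurable_linear_image_cart[OF g(1) bm]])
  also have "\<dots> = ennreal (\<bar>det (matrix g)\<bar> * (\<Prod>b\<in>Basis. (u - l) \<bullet> b))"
    using lu by (simp add: measure_linear_image_cart[OF g(1) bm] measure_completion)
  finally have e: "emeasure lborel (f -` box l u) = ennreal (\<bar>det (matrix g)\<bar> * (\<Prod>b\<in>Basis. (u - l) \<bullet> b))" .
  have "emeasure (density (distr lborel borel f) (\<lambda>_. ennreal \<bar>det (matrix f)\<bar>)) (box l u) =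
      ennreal \<bar>det (matrix f)\<bar> * emeasure lborel (f -` box l u)"
    by (subst emeasure_density) (auto simp: nn_integral_cmult emeasure_distr)
  also have "\<dots> = ennreal (\<bar>det (matrix f)\<bar> * (\<bar>det (matrix g)\<bar> * (\<Prod>b\<in>Basis. (u - l) \<bullet> b)))"
    unfolding e by (rule ennreal_mult'[symmetric]) simp
  also have "\<dots> = ennreal (\<Prod>b\<in>Basis. (u - l) \<bullet> b)"
    by (simp only: mult.assoc[symmetric] dets mult_1)
  finally show "emeasure (density (distr lborel borel f) (\<lambda>_. ennreal \<bar>det (matrix f)\<bar>)) (box l u) = ennreal (\<Prod>b\<in>Basis. (u - l) \<bullet> b)" .
qed simp

lemma lborel_integral_linear:
  fixes f :: "real^'n \<Rightarrow> real^'n" and k :: "real^'n \<Rightarrow> 'b::{banach, second_countable_topology}"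
  assumes f: "linear f" and inj: "inj f" and k [measurable]: "k \<in> borel_measurable borel"
  shows "(\<integral>x. \<bar>det (matrix f)\<bar> *\<^sub>R k (f x) \<partial>lborel) = (\<integral>x. k x \<partial>lborel)"
proof -
  have [measurable]: "f \<in> borel \<rightarrow>\<^sub>M borel"
    using f by (intro borel_measurable_continuous_onI linear_continuous_on) (simp add: linear_conv_bounded_linear)
  have "(\<integral>x. k x \<partial>lborel) = (\<integral>x. k x \<partial>density (distr lborel borel f) (\<lambda>_. ennreal \<bar>det (matrix f)\<bar>))"
    using lborel_density_linear[OF f inj] by simp
  also have "\<dots> = (\<integral>x. \<bar>det (matrix f)\<bar> *\<^sub>R k x \<partial>distr lborel borel f)"
    by (subst integral_density) auto
  also have "\<dots> = (\<integral>x. \<bar>det (matrix f)\<bar> *\<^sub>R k (f x) \<partial>lborel)"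
    by (subst integral_distr) auto
  finally show ?thesis by simp
qed

section \<open>The geometry of a dilation\<close>

locale ellipsoid_dilation =
  fixes A :: "real^'n^'n" and \<Delta> :: "(real^'n) set" and r :: real
  assumes ell: "dilation_ellipsoid A \<Delta> r"
begin

abbreviation b :: real where "b \<equiv> dilation_factor A"
abbreviation pw :: "int \<Rightarrow> real^'n \<Rightarrow> real^'n" where "pw \<equiv> matrix_powi_apply A"
abbreviation \<rho> :: "real^'n \<Rightarrow> real" where "\<rho> \<equiv> step_norm A \<Delta>"

definition shape :: "real^'n^'n" where
  "shape = (SOME P. invertible P \<and> \<Delta> = {x. norm (P *v x) < 1})"

text \<open>The Minkowski gauge of \<Delta>, a norm equivalent to the Euclidean one. Its triangle
  inequality and its growth under \<open>A\<close> carry the whole geometry of the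
  quasi-norm.\<close>

definition nrm :: "real^'n \<Rightarrow> real" where "nrm x = norm (shape *v x)"

lemma shape: "invertible shape" and mem_\<Delta>: "x \<in> \<Delta> \<longleftrightarrow> nrm x < 1"
proof -
  have "\<exists>P::real^'n^'n. invertible P \<and> \<Delta> = {x. norm (P *v x) < 1}"
    using conjunct1[OF ell[unfolded dilation_ellipsoid_def]] unfolding open_ellipsoid_def .
  from someI_ex[OF this, folded shape_def]
  have P: "invertible shape \<and> \<Delta> = {x. norm (shape *v x) < 1}" .
  show "invertible shape" by (rule conjunct1[OF P])
  have "\<Delta> = {x. nrm x < 1}" unfolding nrm_def by (rule conjunct2[OF P])
  then show "x \<in> \<Delta> \<longleftrightarrow> nrm x < 1" by blast
qed

lemma r1: "1 < r" using ell by (simp add: dilation_ellipsoid_def)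

lemma nrm_nonneg: "0 \<le> nrm x"
  and nrm_zero [simp]: "nrm 0 = 0"
  and nrm_minus [simp]: "nrm (- x) = nrm x"
  and nrm_add: "nrm (x + y) \<le> nrm x + nrm y"
  and nrm_scaleR: "nrm (c *\<^sub>R x) = \<bar>c\<bar> * nrm x"
  by (auto simp: nrm_def matrix_vector_right_distrib norm_triangle_ineq
      matrix_vector_mult_scaleR linear_neg[OF matrix_vector_mul_linear])

lemma nrm_bounds: obtains K where "0 < K" "\<And>x. norm x \<le> K * nrm x" "\<And>x. nrm x \<le> K * norm x"
proof -
  have inj: "inj ((*v) shape)"
    using shape by (simp add: inj_matrix_vector_mult)
  obtain B where B: "0 < B" "\<And>x. B * norm x \<le> norm (shape *v x)"
    using linear_inj_bounded_below_pos[OF matrix_vector_mul_linear inj] by metis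
  obtain C where C: "0 < C" "\<And>x. norm (shape *v x) \<le> C * norm x"
    using linear_bounded_pos[OF matrix_vector_mul_linear[of shape]] by blast
  show ?thesis
  proof (rule that[of "max (1 / B) C"])
    show "0 < max (1 / B) C" using C(1) by simp
    fix x
    have "norm x \<le> 1 / B * nrm x" using B(1) B(2)[of x] by (simp add: nrm_def field_simps)
    also have "\<dots> \<le> max (1 / B) C * nrm x" by (intro mult_right_mono nrm_nonneg) simp
    finally show "norm x \<le> max (1 / B) C * nrm x" .
    have "nrm x \<le> C * norm x" using C(2)[of x] by (simp add: nrm_def)
    also have "\<dots> \<le> max (1 / B) C * norm x" by (intro mult_right_mono) simp_all
    finally show "nrm x \<le> max (1 / B) C * norm x" .
  qed
qed

lemma nrm_pos: "x \<noteq> 0 \<Longrightarrow> 0 < nrm x"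
  by (metis nrm_bounds nrm_nonneg norm_le_zero_iff mult_zero_right order_le_less)

lemma continuous_nrm [continuous_intros]: "continuous_on S f \<Longrightarrow> continuous_on S (\<lambda>x. nrm (f x))"
  unfolding nrm_def
  by (intro continuous_intros continuous_on_compose2[OF linear_continuous_on[OF matrix_vector_mul_bounded_linear]]) auto

lemma \<Delta>_measure: "emeasure lebesgue \<Delta> = 1" "\<Delta> \<in> lmeasurable" "measure lebesgue \<Delta> = 1"
proof -
  show e: "emeasure lebesgue \<Delta> = 1" using ell by (simp add: dilation_ellipsoid_def)
  have "\<Delta> = {x. nrm x < 1}" by (auto simp: mem_\<Delta>)
  moreover have "open {x. nrm x < 1}" by (intro open_Collect_less continuous_intros)
  ultimately have "open \<Delta>" by metis
  then show "\<Delta> \<in> lmeasurable" using e by (auto simp: fmeasurable_def)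
  show "measure lebesgue \<Delta> = 1" using e by (simp add: measure_def)
qed

text \<open>Compare volumes in the inclusion of r \<Delta> in the image of \<Delta> under
  \<open>A\<close>: this gives r^n <= b.\<close>

lemma b1: "1 < b"
proof -
  have "r ^ CARD('n) = measure lebesgue ((*\<^sub>R) r ` \<Delta>)"
    using measure_stretch[OF \<Delta>_measure(2), of "\<lambda>_. r"] r1 \<Delta>_measure(3)
    by (simp add: scaleR_vec_def)
  also have "\<dots> \<le> measure lebesgue ((*v) A ` \<Delta>)"
  proof (rule measure_mono_fmeasurable)
    show "(*\<^sub>R) r ` \<Delta> \<subseteq> (*v) A ` \<Delta>" using ell by (simp add: dilation_ellipsoid_def)
    show "(*\<^sub>R) r ` \<Delta> \<in> sets lebesgue"
      using measurable_stretch[OF \<Delta>_measure(2), of "\<lambda>_. r"] by (simp add: scaleR_vec_def fmeasurableD)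
    show "(*v) A ` \<Delta> \<in> lmeasurable"
      by (rule lmeasurable_linear_image_cart[OF matrix_vector_mul_linear \<Delta>_measure(2)])
  qed
  also have "\<dots> = b"
    using measure_linear_image_cart[OF matrix_vector_mul_linear \<Delta>_measure(2), of A]
    by (simp add: \<Delta>_measure(3) dilation_factor_def)
  finally have "r ^ CARD('n) \<le> b" .
  moreover have "1 < r ^ CARD('n)" using r1 by (intro one_less_power) auto
  ultimately show ?thesis by linarith
qed

lemma b0: "0 < b" and b_nz: "b \<noteq> 0" using b1 by linarith+

lemma A_invertible: "invertible A"
  using b_nz by (auto simp: dilation_factor_def invertible_det_nz)

lemma matrix_inv_A: "A ** matrix_inv A = mat 1" "matrix_inv A ** A = mat 1"
  using someI_ex[OF A_invertible[unfolded invertible_def]] unfolding matrix_inv_def by blast+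

lemma A_inv [simp]: "A *v (matrix_inv A *v x) = x" "matrix_inv A *v (A *v x) = x"
  by (simp_all add: matrix_vector_mul_assoc matrix_inv_A)

section \<open>Integer powers of the dilation and their expansion\<close>

lemma pw_0 [simp]: "pw 0 x = x" by (simp add: matrix_powi_apply_def)

lemma pw_plus1: "pw (k + 1) x = A *v pw k x"
proof (cases "0 \<le> k")
  case True
  then have "nat (k + 1) = Suc (nat k)" by simp
  then show ?thesis using True by (simp add: matrix_powi_apply_def)
next
  case False
  define m where "m = nat (- k - 1)"
  have k: "k = - int (Suc m)" using False by (simp add: m_def)
  then have k1: "k + 1 = - int m" by simp
  have *: "pw (- int n) = ((*v) (matrix_inv A)) ^^ n" for n
    by (cases "n = 0") (simp_all add: matrix_powi_apply_def)
  show ?thesis unfolding k1 unfolding k * by simp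
qed

lemma pw_minus1: "pw (k - 1) x = matrix_inv A *v pw k x"
  using pw_plus1[of "k - 1" x] by simp

lemma pw_add: "pw (j + k) x = pw j (pw k x)"
proof (induction j rule: int_induct[where k = 0])
  case (step1 i)
  then show ?case using pw_plus1[of "i + k" x] pw_plus1[of i "pw k x"] by (simp add: algebra_simps)
next
  case (step2 i)
  then show ?case using pw_minus1[of "i + k" x] pw_minus1[of i "pw k x"] by (simp add: algebra_simps)
qed simp

lemma pw_minus_cancel [simp]: "pw k (pw (- k) x) = x" "pw (- k) (pw k x) = x"
  using pw_add[of k "- k" x] pw_add[of "- k" k x] by simp_all

lemma linear_pw: "linear (pw k)"
proof (induction k rule: int_induct[where k = 0])
  case base show ?case by (rule linearI) simp_all
next
  case (step1 i)
  have "pw (i + 1) = (*v) A \<circ> pw i" by (simp add: fun_eq_iff pw_plus1)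
  then show ?case using linear_compose[OF step1(2) matrix_vector_mul_linear[of A]] by (simp only:)
next
  case (step2 i)
  have "pw (i - 1) = (*v) (matrix_inv A) \<circ> pw i" by (simp add: fun_eq_iff pw_minus1)
  then show ?case using linear_compose[OF step2(2) matrix_vector_mul_linear[of "matrix_inv A"]] by (simp only:)
qed

lemma pw_simps [simp]: "pw k (x + y) = pw k x + pw k y" "pw k (x - y) = pw k x - pw k y"
  "pw k 0 = 0" "pw k (- x) = - pw k x"
  using linear_pw[of k] by (simp_all add: linear_add linear_diff linear_0 linear_neg)

lemma inj_pw: "inj (pw k)"
  by (rule injI) (metis pw_minus_cancel(2))

lemma continuous_pw [continuous_intros]: "continuous_on S f \<Longrightarrow> continuous_on S (\<lambda>x. pw k (f x))"
  using linear_pw[of k] linear_continuous_on continuous_on_compose2[of UNIV "pw k" S f]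
  by (metis linear_conv_bounded_linear subset_UNIV)

text \<open>The inclusion of r \<Delta> in the image of \<Delta>, read off on the unit sphere of the
  gauge. All later expansion and contraction estimates iterate this one.\<close>

lemma nrm_A: "r * nrm x \<le> nrm (A *v x)"
proof (rule ccontr)
  assume "\<not> r * nrm x \<le> nrm (A *v x)"
  then have lt: "nrm (A *v x) < r * nrm x" by simp
  then have t: "0 < nrm x" using nrm_nonneg[of "A *v x"] r1 by (metis less_le_trans nrm_nonneg not_le order_le_less mult_zero_right)
  define y where "y = (1 / nrm x) *\<^sub>R x"
  have ny: "nrm y = 1" using t by (simp add: y_def nrm_scaleR)
  have "nrm (A *v y) < r" using lt t by (simp add: y_def matrix_vector_mult_scaleR nrm_scaleR field_simps)
  then have "nrm ((1 / r) *\<^sub>R (A *v y)) < 1" using r1 by (simp add: nrm_scaleR)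
  then have "A *v y \<in> (*\<^sub>R) r ` \<Delta>"
    using r1 by (intro image_eqI[of _ _ "(1 / r) *\<^sub>R (A *v y)"]) (auto simp: mem_\<Delta>)
  then have "A *v y \<in> (*v) A ` \<Delta>" using ell by (auto simp: dilation_ellipsoid_def)
  then obtain z where "z \<in> \<Delta>" "A *v y = A *v z" by blast
  then have "y \<in> \<Delta>" by (metis A_inv(2))
  then show False using ny by (simp add: mem_\<Delta>)
qed

lemma nrm_pw_nat: "r ^ j * nrm x \<le> nrm (pw (int j) x)"
proof (induction j)
  case (Suc j)
  have "r ^ Suc j * nrm x = r * (r ^ j * nrm x)" by simp
  also have "\<dots> \<le> r * nrm (pw (int j) x)" using Suc r1 by (intro mult_left_mono) auto
  also have "\<dots> \<le> nrm (A *v pw (int j) x)" by (rule nrm_A)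
  finally show ?case using pw_plus1[of "int j" x] by (simp add: add.commute)
qed simp

lemma nrm_pw_neg: "nrm (pw (- int j) x) \<le> nrm x / r ^ j"
  using nrm_pw_nat[of j "pw (- int j) x"] r1 by (simp add: field_simps)

lemma nrm_pw_antimono: "k \<le> l \<Longrightarrow> nrm (pw (- l) x) \<le> nrm (pw (- k) x)"
proof -
  assume "k \<le> l"
  then obtain j where l: "l = k + int j" using zle_iff_zadd by blast
  have "- l = - int j + - k" by (simp add: l)
  then have "pw (- l) x = pw (- int j) (pw (- k) x)" by (simp only: pw_add)
  then have "nrm (pw (- l) x) \<le> nrm (pw (- k) x) / r ^ j" using nrm_pw_neg by simp
  also have "\<dots> \<le> nrm (pw (- k) x) / 1" using r1 nrm_nonneg by (intro divide_left_mono) auto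
  finally show ?thesis by simp
qed

text \<open>The translate of the k-th dilated ball to the centre z. It is given by a strict
  inequality for the gauge rather than as an image, so openness and membership are
  immediate.\<close>

definition qball :: "real^'n \<Rightarrow> int \<Rightarrow> (real^'n) set" where
  "qball z k = {y. nrm (pw (- k) (y - z)) < 1}"

lemma mem_qball: "y \<in> qball z k \<longleftrightarrow> nrm (pw (- k) (y - z)) < 1" by (simp add: qball_def)

lemma mem_qball_0: "y \<in> qball z k \<longleftrightarrow> y - z \<in> qball 0 k" by (simp add: mem_qball)

lemma mem_qball_sym: "y \<in> qball z k \<longleftrightarrow> z \<in> qball y k"
proof -
  have "pw (- k) (y - z) = - pw (- k) (z - y)" by simp
  then show ?thesis unfolding mem_qball by (metis nrm_minus)
qed

lemma center_mem_qball [simp]: "z \<in> qball z k" by (simp add: mem_qball)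

lemma open_qball: "open (qball z k)"
  unfolding qball_def by (intro open_Collect_less continuous_intros)

lemma qball_sets [measurable]: "qball z k \<in> sets lebesgue"
  using open_qball by auto

lemma dilated_ball_eq: "dilated_ball A \<Delta> k = qball 0 k"
proof -
  have "x \<in> pw k ` \<Delta>" if "nrm (pw (- k) x) < 1" for x
    using that by (intro image_eqI[of _ _ "pw (- k) x"]) (auto simp: mem_\<Delta>)
  then show ?thesis by (auto simp: dilated_ball_def qball_def mem_\<Delta>)
qed

lemma qball_mono: "k \<le> l \<Longrightarrow> qball z k \<subseteq> qball z l"
  unfolding subset_iff mem_qball using le_less_trans[OF nrm_pw_antimono] by blast

lemma emeasure_qball: "emeasure lebesgue (qball z k) = ennreal (b powi k)"
proof -
  have m0: "qball 0 k \<in> lmeasurable \<and> measure lebesgue (qball 0 k) = b powi k" for k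
  proof (induction k rule: int_induct[where k = 0])
    case base
    have "qball 0 0 = \<Delta>" by (auto simp: qball_def mem_\<Delta>)
    then show ?case using \<Delta>_measure by (simp only: power_int_0_right)
  next
    case (step1 i)
    have "qball 0 (i + 1) = (*v) A ` qball 0 i"
      unfolding dilated_ball_eq[symmetric] dilated_ball_def using pw_plus1 by (auto simp: image_iff)
    then show ?case
      using lmeasurable_linear_image_cart[OF matrix_vector_mul_linear, of "qball 0 i" A]
        measure_linear_image_cart[OF matrix_vector_mul_linear, of "qball 0 i" A] step1 b_nz
      by (simp add: dilation_factor_def power_int_add)
  next
    case (step2 i)
    have "qball 0 (i - 1) = (*v) (matrix_inv A) ` qball 0 i"
      unfolding dilated_ball_eq[symmetric] dilated_ball_def using pw_minus1 by (auto simp: image_iff)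
    moreover have "\<bar>det (matrix_inv A)\<bar> = 1 / b"
    proof -
      have "det A * det (matrix_inv A) = 1"
        using matrix_inv_A(1) by (metis det_I det_mul)
      then have "\<bar>det A\<bar> * \<bar>det (matrix_inv A)\<bar> = 1" by (metis abs_mult abs_one)
      then show ?thesis using b_nz by (simp add: dilation_factor_def field_simps)
    qed
    ultimately show ?case
      using lmeasurable_linear_image_cart[OF matrix_vector_mul_linear, of "qball 0 i" "matrix_inv A"]
        measure_linear_image_cart[OF matrix_vector_mul_linear, of "qball 0 i" "matrix_inv A"] step2 b_nz
      by (simp add: power_int_diff)
  qed
  have "y \<in> (+) z ` qball 0 k" if "y \<in> qball z k" for y
    using that by (intro image_eqI[of _ _ "y - z"]) (auto simp: mem_qball)
  then have "qball z k = (+) z ` qball 0 k" by (auto simp: mem_qball)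
  then have "qball z k \<in> lmeasurable" "measure lebesgue (qball z k) = b powi k"
    using m0[of k] measurable_translation[of "qball 0 k" z] measure_translation[of z "qball 0 k"] by auto
  then show ?thesis using emeasure_eq_measure2 by metis
qed

text \<open>The quasi-triangle constant in logarithmic scale: r^\<sigma> absorbs the factor 2 that
  arises from adding two vectors, so the sum of two balls of index k lies in the ball of index k +
  \<sigma>.\<close>

definition \<sigma> :: nat where "\<sigma> = (SOME n. 2 \<le> r ^ n)"

lemma \<sigma>: "2 \<le> r ^ \<sigma>"
  unfolding \<sigma>_def by (rule someI_ex) (use real_arch_pow[OF r1, of 2] less_imp_le in blast)

lemma qball_add:
  assumes "x \<in> qball 0 k" "y \<in> qball 0 k" shows "x + y \<in> qball 0 (k + int \<sigma>)"
proof -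
  have "- (k + int \<sigma>) = - int \<sigma> + - k" by simp
  then have "pw (- (k + int \<sigma>)) (x + y) = pw (- int \<sigma>) (pw (- k) (x + y))" by (simp only: pw_add)
  then have "nrm (pw (- (k + int \<sigma>)) (x + y)) \<le> nrm (pw (- k) (x + y)) / r ^ \<sigma>"
    by (simp only: nrm_pw_neg)
  also have "\<dots> \<le> nrm (pw (- k) (x + y)) / 2"
    using \<sigma> nrm_nonneg by (intro divide_left_mono) auto
  also have "\<dots> < 1"
    using assms nrm_add[of "pw (- k) x" "pw (- k) y"] by (simp add: mem_qball)
  finally show ?thesis by (simp only: mem_qball diff_zero)
qed

lemma qball_trans:
  assumes "x \<in> qball y k" "y \<in> qball z k" shows "x \<in> qball z (k + int \<sigma>)"
proof -
  have "x - y \<in> qball 0 k" "y - z \<in> qball 0 k" using assms mem_qball_0 by blast+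
  then have "(x - y) + (y - z) \<in> qball 0 (k + int \<sigma>)" by (rule qball_add)
  then show ?thesis unfolding mem_qball_0[of x z] by simp
qed

text \<open>Two uses of the quasi-triangle inequality through the common point w. This fixes the
  enlargement by 2 \<sigma> in the Vitali covering.\<close>

lemma qball_engulf:
  assumes "w \<in> qball z k" "w \<in> qball z' l" "l \<le> k"
  shows "qball z' l \<subseteq> qball z (k + 2 * int \<sigma>)"
proof
  fix x assume "x \<in> qball z' l"
  then have "x \<in> qball z' k" "z' \<in> qball w k"
    using qball_mono[OF assms(3)] assms(2) mem_qball_sym by blast+
  then have "x \<in> qball w (k + int \<sigma>)" by (rule qball_trans)
  moreover have "w \<in> qball z (k + int \<sigma>)" using assms(1) qball_mono[of k "k + int \<sigma>" z] by auto
  ultimately have "x \<in> qball z ((k + int \<sigma>) + int \<sigma>)" by (rule qball_trans)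
  then show "x \<in> qball z (k + 2 * int \<sigma>)" by (simp add: algebra_simps)
qed

section \<open>Shells and the step quasi-norm\<close>

lemma eventually_mem_qball: "\<exists>j. x \<in> qball z (int j)"
proof -
  obtain j where j: "nrm (x - z) < r ^ j" using real_arch_pow[OF r1] by blast
  have "nrm (pw (- int j) (x - z)) \<le> nrm (x - z) / r ^ j" by (rule nrm_pw_neg)
  also have "\<dots> < 1" using j r1 by (simp add: divide_less_eq)
  finally show ?thesis by (auto simp: mem_qball)
qed

text \<open>Expansion by r puts x inside some large ball and outside some small one; the least index
  in between locates the shell.\<close>

lemma shell_exists:
  assumes "x \<noteq> 0" obtains j where "x \<in> qball 0 (j + 1)" "x \<notin> qball 0 j"
proof -
  obtain J where J: "x \<in> qball 0 (int J)" using eventually_mem_qball by blast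
  obtain i where "1 / nrm x < r ^ i" using real_arch_pow[OF r1] by blast
  then have "1 < r ^ i * nrm x" using nrm_pos[OF assms] by (simp add: field_simps)
  also have "\<dots> \<le> nrm (pw (int i) x)" by (rule nrm_pw_nat)
  finally have i: "x \<notin> qball 0 (- int i)" by (simp add: mem_qball)
  define n where "n = (LEAST n. x \<in> qball 0 (- int i + int n))"
  have ex: "x \<in> qball 0 (- int i + int (i + J))" using J by simp
  have n: "x \<in> qball 0 (- int i + int n)" unfolding n_def by (rule LeastI[where P = "\<lambda>n. x \<in> qball 0 (- int i + int n)", OF ex])
  then have "n \<noteq> 0" using i by (intro notI) simp
  then obtain m where m: "n = Suc m" using not0_implies_Suc by blast
  have "x \<notin> qball 0 (- int i + int m)"
    using not_less_Least[of m "\<lambda>n. x \<in> qball 0 (- int i + int n)"] m by (simp add: n_def)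
  then show ?thesis using that[of "- int i + int m"] n m by (simp add: algebra_simps)
qed

lemma step_norm_eq:
  assumes "x \<in> qball 0 (j + 1)" "x \<notin> qball 0 j" shows "\<rho> x = b powi j"
proof -
  have "x \<noteq> 0" using assms(2) by auto
  have "x \<notin> qball 0 (i + 1) - qball 0 i" if "i \<noteq> j" for i
  proof (cases "i < j")
    case True
    then show ?thesis using assms(2) qball_mono[of "i + 1" j 0] by auto
  next
    case False
    then show ?thesis using that assms(1) qball_mono[of "j + 1" i 0] by auto
  qed
  then have "(\<Sum>\<^sub>\<infinity>i\<in>UNIV. b powi i * indicator (dilated_ball A \<Delta> (i + 1) - dilated_ball A \<Delta> i) x) =
    (\<Sum>\<^sub>\<infinity>i\<in>{j}. b powi i * indicator (dilated_ball A \<Delta> (i + 1) - dilated_ball A \<Delta> i) x)"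
    by (intro infsum_cong_neutral) (auto simp: dilated_ball_eq)
  then show ?thesis using \<open>x \<noteq> 0\<close> assms by (simp add: step_norm_def dilated_ball_eq)
qed

lemma step_norm_nonneg: "0 \<le> \<rho> x"
proof (cases "x = 0")
  case False
  then obtain j where "x \<in> qball 0 (j + 1)" "x \<notin> qball 0 j" by (rule shell_exists)
  then show ?thesis using b0 by (simp add: step_norm_eq)
qed (simp add: step_norm_def)

text \<open>The exponent is k - 1 because a shell takes its value from its inner ball.\<close>

lemma step_norm_le: assumes "x \<in> qball 0 k" shows "\<rho> x \<le> b powi (k - 1)"
proof (cases "x = 0")
  case False
  then obtain j where j: "x \<in> qball 0 (j + 1)" "x \<notin> qball 0 j" by (rule shell_exists)
  then have "j < k" using assms qball_mono[of k j 0] by (meson not_le subsetD)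
  then show ?thesis unfolding step_norm_eq[OF j] using b1 by (intro power_int_increasing) auto
qed (use b0 in \<open>simp add: step_norm_def\<close>)

lemma mem_shell_nat:
  assumes "x \<notin> qball 0 0" obtains j :: nat where "x \<in> qball 0 (int j + 1)" "x \<notin> qball 0 (int j)" "\<rho> x = b ^ j"
proof -
  have "x \<noteq> 0" using assms by auto
  then obtain j where j: "x \<in> qball 0 (j + 1)" "x \<notin> qball 0 j" by (rule shell_exists)
  then have "0 \<le> j" using assms qball_mono[of "j + 1" 0 0] by (meson not_le subsetD zless_imp_add1_zle)
  then obtain i where "j = int i" using nonneg_int_cases by blast
  then show ?thesis using that[of i] j step_norm_eq[OF j] by simp
qed

text \<open>An integrable majorant of min(1, rho^-2). Written through indicators of full balls, it
  has an integral that is a geometric series, and its dilates lead directly to integrals over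
  balls.\<close>

definition tail :: "real^'n \<Rightarrow> ennreal" where
  "tail x = indicator (qball 0 0) x + (\<Sum>j. ennreal (1 / b ^ (2 * j)) * indicator (qball 0 (int j + 1)) x)"

lemma tail_measurable [measurable]: "tail \<in> borel_measurable lebesgue"
  unfolding tail_def[abs_def] by measurable

lemma tail_ge:
  assumes "t \<le> 1" "t * (\<rho> x)\<^sup>2 \<le> 1" shows "ennreal t \<le> tail x"
proof (cases "x \<in> qball 0 0")
  case True
  have "ennreal t \<le> ennreal 1" using assms(1) by (rule ennreal_leI)
  also have "\<dots> \<le> tail x" using True by (simp add: tail_def)
  finally show ?thesis .
next
  case False
  then obtain j where j: "x \<in> qball 0 (int j + 1)" "\<rho> x = b ^ j" by (rule mem_shell_nat)
  have "(\<rho> x)\<^sup>2 = b ^ (2 * j)" unfolding j(2) by (simp add: power_mult[symmetric] mult.commute)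
  then have "t * b ^ (2 * j) \<le> 1" using assms(2) by simp
  then have "t \<le> 1 / b ^ (2 * j)" using b0 by (simp add: pos_le_divide_eq)
  then have "ennreal t \<le> (\<Sum>i\<in>{j}. ennreal (1 / b ^ (2 * i)) * indicator (qball 0 (int i + 1)) x)"
    using j(1) by (simp add: ennreal_leI)
  also have "\<dots> \<le> (\<Sum>i. ennreal (1 / b ^ (2 * i)) * indicator (qball 0 (int i + 1)) x)"
    by (rule sum_le_suminf) auto
  also have "\<dots> \<le> tail x" by (simp add: tail_def)
  finally show ?thesis .
qed

lemma b_geometric: "(\<Sum>j. ennreal (c * (1 / b) ^ j)) = ennreal (c * (1 / (1 - 1 / b)))" if "0 \<le> c"
proof -
  have s: "(\<lambda>j. c * (1 / b) ^ j) sums (c * (1 / (1 - 1 / b)))"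
    by (intro sums_mult geometric_sums) (use b1 in simp)
  have "0 \<le> c * (1 / b) ^ j" for j using that b0 by (intro mult_nonneg_nonneg zero_le_power) auto
  from suminf_ennreal2[OF this sums_summable[OF s]] show ?thesis
    unfolding sums_unique[OF s, symmetric] .
qed

lemma nn_integral_tail: "(\<integral>\<^sup>+x. tail x \<partial>lebesgue) < \<infinity>"
proof -
  have "(\<integral>\<^sup>+x. tail x \<partial>lebesgue) = (\<integral>\<^sup>+x. indicator (qball 0 0) x \<partial>lebesgue) +
      (\<integral>\<^sup>+x. (\<Sum>j. ennreal (1 / b ^ (2 * j)) * indicator (qball 0 (int j + 1)) x) \<partial>lebesgue)"
    unfolding tail_def by (rule nn_integral_add) measurable
  also have "(\<integral>\<^sup>+x. (\<Sum>j. ennreal (1 / b ^ (2 * j)) * indicator (qball 0 (int j + 1)) x) \<partial>lebesgue) =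
      (\<Sum>j. \<integral>\<^sup>+x. ennreal (1 / b ^ (2 * j)) * indicator (qball 0 (int j + 1)) x \<partial>lebesgue)"
    by (rule nn_integral_suminf) measurable
  also have "\<dots> = (\<Sum>j. ennreal (b * (1 / b) ^ j))"
  proof (intro suminf_cong)
    fix j
    have "(\<integral>\<^sup>+x. ennreal (1 / b ^ (2 * j)) * indicator (qball 0 (int j + 1)) x \<partial>lebesgue) =
       ennreal (1 / b ^ (2 * j)) * ennreal (b powi (int j + 1))"
      by (simp add: nn_integral_cmult_indicator emeasure_qball)
    also have "\<dots> = ennreal (1 / b ^ (2 * j) * (b powi (int j + 1)))"
      by (rule ennreal_mult'[symmetric]) (use b0 in simp)
    also have "1 / b ^ (2 * j) * (b powi (int j + 1)) = b * (1 / b) ^ j"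
      using b_nz unfolding mult_2 by (simp add: power_int_add power_one_over power_add)
    finally show "(\<integral>\<^sup>+x. ennreal (1 / b ^ (2 * j)) * indicator (qball 0 (int j + 1)) x \<partial>lebesgue) = ennreal (b * (1 / b) ^ j)" .
  qed
  also have "\<dots> = ennreal (b * (1 / (1 - 1 / b)))" by (rule b_geometric) (use b0 in simp)
  finally show ?thesis by (simp add: emeasure_qball)
qed

text \<open>On the shell with value b^j the Euclidean norm is at least of order r^j, and b < r^M for
  some M.\<close>

lemma step_norm_growth: obtains C M where "0 < C" "\<And>x. \<rho> x \<le> C * (1 + norm x) ^ M"
proof -
  obtain K where K: "0 < K" "\<And>x. nrm x \<le> K * norm x" using nrm_bounds by metis
  obtain M where M: "b < r ^ M" using real_arch_pow[OF r1] by blast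
  have "\<rho> x \<le> max 1 (K ^ M) * (1 + norm x) ^ M" for x
  proof (cases "x \<in> qball 0 0")
    case True
    have "\<rho> x \<le> b powi (-1)" using step_norm_le[OF True] by simp
    also have "\<dots> \<le> 1" using b1 by (simp add: power_int_minus field_simps)
    also have "\<dots> \<le> max 1 (K ^ M) * (1 + norm x) ^ M"
      using mult_mono[of 1 "max 1 (K ^ M)" 1 "(1 + norm x) ^ M"] by simp
    finally show ?thesis .
  next
    case False
    then obtain j where j: "x \<notin> qball 0 (int j)" "\<rho> x = b ^ j" by (rule mem_shell_nat)
    then have "1 \<le> nrm (pw (- int j) x)" by (simp add: mem_qball)
    also have "\<dots> \<le> nrm x / r ^ j" by (rule nrm_pw_neg)
    finally have "r ^ j \<le> nrm x" using r1 by (simp add: field_simps)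
    also have "\<dots> \<le> K * (1 + norm x)" using K(2)[of x] K(1) by (simp add: algebra_simps)
    finally have rj: "r ^ j \<le> K * (1 + norm x)" .
    have "\<rho> x = b ^ j" by (rule j)
    also have "\<dots> \<le> (r ^ M) ^ j" using M b0 by (intro power_mono) auto
    also have "\<dots> = (r ^ j) ^ M" by (simp add: power_mult[symmetric] mult.commute)
    also have "\<dots> \<le> (K * (1 + norm x)) ^ M" using rj r1 by (intro power_mono) auto
    also have "\<dots> \<le> max 1 (K ^ M) * (1 + norm x) ^ M"
      unfolding power_mult_distrib by (intro mult_right_mono) auto
    finally show ?thesis .
  qed
  then show ?thesis using that[of "max 1 (K ^ M)" M] by auto
qed

end

section \<open>The weak type estimate for the maximal operator\<close>

context ellipsoid_dilation
begin

text \<open>The Hardy-Littlewood operator of the dilated balls; b^-k is the reciprocal of their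
  measure. It is uncentred, so its level sets are unions of open balls.\<close>

definition maximal :: "(real^'n \<Rightarrow> ennreal) \<Rightarrow> real^'n \<Rightarrow> ennreal" where
  "maximal h x = (SUP (z, k)\<in>{(z, k). x \<in> qball z k}. ennreal (b powi (- k)) * (\<integral>\<^sup>+y\<in>qball z k. h y \<partial>lebesgue))"

lemma bpow_pos [simp]: "0 < b powi k" using b0 by simp

lemma bpow_cancel: "b powi (- k) * b powi k = 1"
  using b_nz by (simp add: power_int_minus)

lemma maximal_ge: "x \<in> qball z k \<Longrightarrow> ennreal (b powi (- k)) * (\<integral>\<^sup>+y\<in>qball z k. h y \<partial>lebesgue) \<le> maximal h x"
  unfolding maximal_def by (rule SUP_upper2[of "(z, k)"]) auto

lemma less_maximal_iff: "l < maximal h x \<longleftrightarrow>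
    (\<exists>z k. x \<in> qball z k \<and> l < ennreal (b powi (- k)) * (\<integral>\<^sup>+y\<in>qball z k. h y \<partial>lebesgue))"
  unfolding maximal_def less_SUP_iff by auto

lemma open_maximal: "open {x. l < maximal h x}"
proof -
  have "{x. l < maximal h x} = (\<Union>(z, k)\<in>{(z, k). l < ennreal (b powi (- k)) * (\<integral>\<^sup>+y\<in>qball z k. h y \<partial>lebesgue)}. qball z k)"
    by (auto simp: less_maximal_iff)
  also have "open \<dots>" by (intro open_UN) (auto simp: open_qball)
  finally show ?thesis .
qed

text \<open>Greedy selection: choose a ball of largest index, drop all balls meeting it, and repeat.
  Each dropped ball has no larger index, so it is engulfed by the enlargement of the chosen
  one.\<close>

lemma finite_Vitali_qball:
  fixes F :: "((real^'n) \<times> int) set"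
  assumes "finite F"
  obtains G where "G \<subseteq> F" "disjoint_family_on (\<lambda>(z, k). qball z k) G"
    "(\<Union>(z, k)\<in>F. qball z k) \<subseteq> (\<Union>(z, k)\<in>G. qball z (k + 2 * int \<sigma>))"
proof -
  have "\<exists>G\<subseteq>F. disjoint_family_on (\<lambda>(z, k). qball z k) G \<and>
    (\<Union>(z, k)\<in>F. qball z k) \<subseteq> (\<Union>(z, k)\<in>G. qball z (k + 2 * int \<sigma>))"
    using assms
  proof (induction F rule: finite_psubset_induct)
    case (psubset F)
    show ?case
    proof (cases "F = {}")
      case False
      then have "Max (snd ` F) \<in> snd ` F" using psubset.hyps by (intro Max_in) auto
      then obtain c where c: "c \<in> F" "snd c = Max (snd ` F)" by auto
      obtain z k where zk: "c = (z, k)" by (cases c)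
      have k: "l \<le> k" if "(z', l) \<in> F" for z' l
        using that psubset.hyps c zk by (metis Max_ge finite_imageI image_eqI snd_conv)
      define F' where "F' = {(z', l) \<in> F. qball z' l \<inter> qball z k = {}}"
      have "c \<notin> F'"
      proof
        assume "c \<in> F'"
        then have "qball z k = {}" by (simp add: zk F'_def)
        then show False using center_mem_qball[of z k] by blast
      qed
      then have "F' \<subset> F" using c by (auto simp: F'_def)
      from psubset.IH[OF this] obtain G where G: "G \<subseteq> F'" "disjoint_family_on (\<lambda>(z, k). qball z k) G"
        "(\<Union>(z, k)\<in>F'. qball z k) \<subseteq> (\<Union>(z, k)\<in>G. qball z (k + 2 * int \<sigma>))"
        by (elim exE conjE)
      have disj: "qball z k \<inter> qball z' l = {}" if "(z', l) \<in> G" for z' l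
        using that G(1) by (auto simp: F'_def)
      have "(case c of (z, k) \<Rightarrow> qball z k) \<inter> (\<Union>(z, k)\<in>G. qball z k) = {}"
      proof (intro equals0I)
        fix w assume "w \<in> (case c of (z, k) \<Rightarrow> qball z k) \<inter> (\<Union>(z, k)\<in>G. qball z k)"
        then obtain z' l where "(z', l) \<in> G" "w \<in> qball z k \<inter> qball z' l" by (auto simp: zk)
        then show False using disj[of z' l] by (metis empty_iff)
      qed
      then have "disjoint_family_on (\<lambda>(z, k). qball z k) (insert c G)"
        using disjoint_family_on_insert[of c G "\<lambda>(z, k). qball z k"] G(1,2) \<open>c \<notin> F'\<close> by blast
      moreover have "(\<Union>(z, k)\<in>F. qball z k) \<subseteq> (\<Union>(z, k)\<in>insert c G. qball z (k + 2 * int \<sigma>))"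
      proof
        fix x assume "x \<in> (\<Union>(z, k)\<in>F. qball z k)"
        then obtain z' l where zl: "(z', l) \<in> F" "x \<in> qball z' l" by auto
        show "x \<in> (\<Union>(z, k)\<in>insert c G. qball z (k + 2 * int \<sigma>))"
        proof (cases "(z', l) \<in> F'")
          case True
          then have "x \<in> (\<Union>(z, k)\<in>F'. qball z k)" using zl(2) by auto
          then show ?thesis using G(3) by auto
        next
          case False
          then obtain w where "w \<in> qball z' l" "w \<in> qball z k" using zl(1) by (auto simp: F'_def)
          then have "x \<in> qball z (k + 2 * int \<sigma>)" using qball_engulf[of w z k z' l] k[OF zl(1)] zl(2) by blast
          then show ?thesis by (auto simp: zk)
        qed
      qed
      moreover have "insert c G \<subseteq> F" using c G(1) by (auto simp: F'_def)
      ultimately show ?thesis by blast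
    qed (auto simp: disjoint_family_on_def)
  qed
  then show ?thesis using that by blast
qed

text \<open>The error term of the exchange of exponents. It is integrable, and its logarithm is -2
  ln(e + rho), exactly matched to the log-Hoelder condition at infinity.\<close>

definition wt :: "real^'n \<Rightarrow> real" where "wt x = 1 / (exp 1 + \<rho> x)\<^sup>2"

lemma wt_pos: "0 < wt x" and wt_le_1: "wt x \<le> 1" and wt_le_tail: "ennreal (wt x) \<le> tail x"
proof -
  have e: "1 < exp (1::real)" by simp
  have s: "1 \<le> exp 1 + \<rho> x" "\<rho> x \<le> exp 1 + \<rho> x" using step_norm_nonneg[of x] e by linarith+
  show "0 < wt x" unfolding wt_def using s by (intro divide_pos_pos) auto
  show 1: "wt x \<le> 1" unfolding wt_def using s(1) by (simp add: divide_le_eq one_le_power)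
  have "wt x * (\<rho> x)\<^sup>2 \<le> 1"
    unfolding wt_def using power_mono[OF s(2) step_norm_nonneg, of 2] s(1) by (simp add: divide_le_eq)
  with 1 show "ennreal (wt x) \<le> tail x" by (rule tail_ge)
qed

end

locale log_Holder_exponent = ellipsoid_dilation A \<Delta> r for A :: "real^'n^'n" and \<Delta> r +
  fixes e :: "real^'n \<Rightarrow> real" and C einf :: real
  assumes e_meas [measurable]: "e \<in> borel_measurable lebesgue"
    and e1: "\<And>x. 1 \<le> e x" and einf1: "1 \<le> einf" and C0: "0 < C"
    and e_local: "\<And>x y. \<bar>e x - e y\<bar> \<le> C / ln (exp 1 + 1 / \<rho> (x - y))"
    and e_infinity: "\<And>x. \<bar>e x - einf\<bar> \<le> C / ln (exp 1 + \<rho> x)"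
begin

section \<open>Exchanging variable exponents\<close>

lemma ln_exp1_ge: "0 \<le> t \<Longrightarrow> 1 \<le> ln (exp 1 + t)" for t :: real
  using ln_le_cancel_iff[of "exp 1" "exp 1 + t"] by (simp add: add_pos_nonneg)

text \<open>Points in a ball of scale k have quasi-distance at most of order b^k, so the exponents
  differ by at most a constant over ln(e + b^-k / D). A power of a number up to b^-k with such an
  exponent is bounded. For b^-k <= 1 only \<mu> = 1 remains.\<close>

lemma local_bound:
  obtains K where "1 \<le> K"
    "\<And>\<mu> x y z k. 1 \<le> \<mu> \<Longrightarrow> \<mu> \<le> max 1 (b powi (- k)) \<Longrightarrow> x \<in> qball z (k + 2 * int \<sigma>) \<Longrightarrow> y \<in> qball z k \<Longrightarrow>
      \<mu> powr (e x - e y) \<le> K"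
proof -
  \<comment> \<open>x is within scale k + 2 \<sigma> of z and z is within that scale of y, so the
    quasi-triangle inequality places x - y at scale k + 3 \<sigma>.\<close>
  define D where "D = b ^ (3 * \<sigma>)"
  have D1: "1 \<le> D" unfolding D_def using b1 by (intro one_le_power) auto
  define K where "K = exp (C * (ln D + 1))"
  have K1: "1 \<le> K" unfolding K_def using C0 D1 by simp
  have "\<mu> powr (e x - e y) \<le> K"
    if \<mu>: "1 \<le> \<mu>" "\<mu> \<le> max 1 (b powi (- k))" and x: "x \<in> qball z (k + 2 * int \<sigma>)" and y: "y \<in> qball z k" for \<mu> x y z k
  proof (cases "x = y \<or> \<mu> = 1")
    case True
    then show ?thesis using K1 \<mu> by auto
  next
    case False
    define s where "s = b powi (- k)"
    have s: "\<mu> \<le> s" "1 \<le> s" using \<mu> False by (auto simp: s_def max_def split: if_splits)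
    have "x - y \<noteq> 0" using False by simp
    then obtain j where j: "x - y \<in> qball 0 (j + 1)" "x - y \<notin> qball 0 j" by (rule shell_exists)
    have \<rho>0: "0 < \<rho> (x - y)" unfolding step_norm_eq[OF j] by simp
    have "z \<in> qball y (k + 2 * int \<sigma>)" using y qball_mono[of k "k + 2 * int \<sigma>" z] mem_qball_sym by auto
    from qball_trans[OF x this] have "x - y \<in> qball 0 (k + 3 * int \<sigma>)"
      unfolding mem_qball_0[of x y] by (simp add: algebra_simps)
    then have "\<rho> (x - y) \<le> b powi (k + 3 * int \<sigma> - 1)" by (rule step_norm_le)
    also have "\<dots> \<le> b powi (k + 3 * int \<sigma>)" using b1 by (intro power_int_increasing) auto
    also have "\<dots> = D / s" using b_nz unfolding s_def D_def
      by (simp add: power_int_add power_int_minus field_simps flip: power_int_of_nat)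
    finally have \<rho>: "\<rho> (x - y) \<le> D / s" .
    then have "s / D \<le> 1 / \<rho> (x - y)" using \<rho>0 s D1 by (simp add: field_simps)
    then have "ln (exp 1 + s / D) \<le> ln (exp 1 + 1 / \<rho> (x - y))"
      using s D1 by (intro ln_mono) (auto intro!: add_pos_nonneg)
    moreover have L1: "1 \<le> ln (exp 1 + s / D)" using s D1 by (intro ln_exp1_ge) auto
    ultimately have d: "\<bar>e x - e y\<bar> \<le> C / ln (exp 1 + s / D)"
      using e_local[of x y] C0 by (meson divide_left_mono less_imp_le order_trans mult_pos_pos less_le_trans zero_less_one)
    \<comment> \<open>The logarithm of s is compared with the one in the log-Hoelder bound, which
      contains s / D and an added e; this costs the factor ln D + 1.\<close>
    have "ln s = ln D + ln (s / D)" using s D1 by (simp add: ln_div)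
    also have "\<dots> \<le> ln D * ln (exp 1 + s / D) + ln (exp 1 + s / D)"
    proof (intro add_mono)
      show "ln D \<le> ln D * ln (exp 1 + s / D)" using L1 D1 by (simp add: mult_le_cancel_left1)
      show "ln (s / D) \<le> ln (exp 1 + s / D)" using s D1 by (intro ln_mono) auto
    qed
    also have "\<dots> = (ln D + 1) * ln (exp 1 + s / D)" by (simp add: algebra_simps)
    finally have lns: "ln s \<le> (ln D + 1) * ln (exp 1 + s / D)" .
    have "\<mu> powr (e x - e y) \<le> \<mu> powr \<bar>e x - e y\<bar>" using \<mu> by (intro powr_mono) auto
    also have "\<dots> \<le> s powr \<bar>e x - e y\<bar>" using s \<mu> by (intro powr_mono2) auto
    also have "\<dots> = exp (\<bar>e x - e y\<bar> * ln s)" using s by (simp add: powr_def)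
    also have "\<bar>e x - e y\<bar> * ln s \<le> (C / ln (exp 1 + s / D)) * ((ln D + 1) * ln (exp 1 + s / D))"
      using s L1 C0 by (intro mult_mono d lns) auto
    also have "\<dots> = C * (ln D + 1)" using L1 by simp
    finally show ?thesis by (simp add: K_def)
  qed
  then show ?thesis using that K1 by blast
qed

definition Kinf :: real where "Kinf = exp (2 * C)"

lemma Kinf_ge_1: "1 \<le> Kinf" using C0 by (simp add: Kinf_def)

text \<open>For v between wt x and 1 the modulus of ln v is at most 2 ln(e + rho x), while the
  exponent is at most C over the same logarithm; the product 2 C is the exponent in
  \<open>Kinf\<close>.\<close>

lemma infinity_bound:
  assumes "wt x \<le> v" "v \<le> 1" "\<bar>t\<bar> \<le> \<bar>e x - einf\<bar>"
  shows "v powr t \<le> Kinf"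
proof -
  have v: "0 < v" using wt_pos assms(1) by (rule less_le_trans)
  define L where "L = ln (exp 1 + \<rho> x)"
  have L: "1 \<le> L" unfolding L_def by (rule ln_exp1_ge[OF step_norm_nonneg])
  have pos: "0 < exp 1 + \<rho> x" using step_norm_nonneg[of x] by (intro add_pos_nonneg) auto
  have "- ln v \<le> - ln (wt x)" using assms(1) v wt_pos by simp
  also have "\<dots> = 2 * L" unfolding wt_def L_def using pos by (simp add: ln_div ln_realpow)
  finally have lv: "- ln v \<le> 2 * L" .
  have "v powr t = exp (t * ln v)" using v by (simp add: powr_def)
  also have "t * ln v \<le> \<bar>t\<bar> * (- ln v)"
    using assms(2) v by (simp add: abs_if mult_nonneg_nonpos mult_nonpos_nonpos)
  also have "\<dots> \<le> (C / L) * (2 * L)"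
    using e_infinity[of x] assms(3) lv L C0 assms(2) v unfolding L_def[symmetric] by (intro mult_mono) auto
  also have "\<dots> = 2 * C" using L by simp
  finally show ?thesis by (simp add: Kinf_def)
qed

text \<open>Above the threshold wt x the exponent may be exchanged for \<open>einf\<close>; below it
  the power is already dominated by wt x since e x >= 1.\<close>

lemma powr_exponent_le:
  assumes "0 < \<mu>" "\<mu> \<le> 1" shows "\<mu> powr e x \<le> Kinf * \<mu> powr einf + wt x"
proof (cases "wt x \<le> \<mu>")
  case True
  have "\<mu> powr e x = \<mu> powr (e x - einf) * \<mu> powr einf" using assms by (simp flip: powr_add)
  also have "\<dots> \<le> Kinf * \<mu> powr einf" by (intro mult_right_mono infinity_bound[OF True assms(2)]) auto
  finally show ?thesis using wt_pos[of x] by linarith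
next
  case False
  have "\<mu> powr e x \<le> \<mu> powr 1" using assms e1[of x] by (intro powr_mono') auto
  also have "\<dots> < wt x" using False assms by simp
  moreover have "0 \<le> Kinf * \<mu> powr einf" using Kinf_ge_1 by simp
  ultimately show ?thesis by linarith
qed

text \<open>The opposite exchange, for the function under the integral. If H is at least v = max
  \<mu> (wt y), the powers combine to v^(einf - e y), which is bounded; otherwise H < wt y.\<close>

lemma exponent_powr_le:
  assumes "0 < \<mu>" "\<mu> \<le> 1" "\<mu> \<le> H"
  shows "H * \<mu> powr (einf - 1) \<le> Kinf * H powr e y + wt y"
proof (cases "H < max \<mu> (wt y)")
  case True
  then have "H < wt y" using assms by auto
  moreover have "\<mu> powr (einf - 1) \<le> 1" using assms einf1 by (intro powr_le1) auto
  then have "H * \<mu> powr (einf - 1) \<le> H * 1" using assms by (intro mult_left_mono) auto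
  moreover have "0 \<le> Kinf * H powr e y" using Kinf_ge_1 by simp
  ultimately show ?thesis by linarith
next
  case False
  define v where "v = max \<mu> (wt y)"
  have v: "0 < v" "v \<le> 1" "wt y \<le> v" "\<mu> \<le> v" "v \<le> H" using assms wt_le_1[of y] False by (auto simp: v_def)
  have "H = H powr e y * H powr (1 - e y)" using assms v by (simp flip: powr_add)
  also have "\<dots> \<le> H powr e y * v powr (1 - e y)"
    using v e1[of y] by (intro mult_left_mono powr_mono2') auto
  finally have "H * \<mu> powr (einf - 1) \<le> (H powr e y * v powr (1 - e y)) * v powr (einf - 1)"
    using v assms einf1 by (intro mult_mono powr_mono2) auto
  also have "\<dots> = H powr e y * v powr (einf - e y)" using v by (simp flip: powr_add)
  also have "\<dots> \<le> H powr e y * Kinf" by (intro mult_left_mono infinity_bound[OF v(3,2)]) auto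
  finally show ?thesis using wt_pos[of y] by (simp add: mult.commute)
qed

lemma averaged_bound:
  obtains K where "1 \<le> K"
    "\<And>H \<mu> x z k. H \<in> borel_measurable lebesgue \<Longrightarrow> (\<And>y. 0 \<le> H y) \<Longrightarrow> (\<integral>\<^sup>+y. ennreal (H y powr e y) \<partial>lebesgue) \<le> 1 \<Longrightarrow>
      0 < \<mu> \<Longrightarrow> ennreal (2 * \<mu> * b powi k) \<le> (\<integral>\<^sup>+y\<in>qball z k. ennreal (H y) \<partial>lebesgue) \<Longrightarrow> x \<in> qball z (k + 2 * int \<sigma>) \<Longrightarrow>
      ennreal (\<mu> powr e x) \<le> ennreal (K * b powi (- k)) * (\<integral>\<^sup>+y\<in>qball z k. (ennreal (H y powr e y) + tail y) \<partial>lebesgue) + ennreal (wt x)"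
proof -
  obtain K1 where K1: "1 \<le> K1"
    "\<And>\<mu> x y z k. 1 \<le> \<mu> \<Longrightarrow> \<mu> \<le> max 1 (b powi (- k)) \<Longrightarrow> x \<in> qball z (k + 2 * int \<sigma>) \<Longrightarrow> y \<in> qball z k \<Longrightarrow>
      \<mu> powr (e x - e y) \<le> K1"
    using local_bound by blast
  define K where "K = K1 + Kinf * Kinf"
  have KK: "1 \<le> Kinf * Kinf" using Kinf_ge_1 mult_mono[of 1 "Kinf" 1 "Kinf"] by simp
  have K: "1 \<le> K" "K1 \<le> K" "Kinf * Kinf \<le> K" using K1(1) KK by (auto simp: K_def)
  have "ennreal (\<mu> powr e x) \<le> ennreal (K * b powi (- k)) * (\<integral>\<^sup>+y\<in>qball z k. (ennreal (H y powr e y) + tail y) \<partial>lebesgue) + ennreal (wt x)"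
    if H [measurable]: "H \<in> borel_measurable lebesgue" and H0: "\<And>y. 0 \<le> H y"
      and mod1: "(\<integral>\<^sup>+y. ennreal (H y powr e y) \<partial>lebesgue) \<le> 1"
      and \<mu>: "0 < \<mu>" and av: "ennreal (2 * \<mu> * b powi k) \<le> (\<integral>\<^sup>+y\<in>qball z k. ennreal (H y) \<partial>lebesgue)"
      and x: "x \<in> qball z (k + 2 * int \<sigma>)" for H \<mu> x z k
  proof -
    let ?B = "qball z k"
    let ?s = "b powi k"
    define I where "I = (\<integral>\<^sup>+y\<in>?B. (ennreal (H y powr e y) + tail y) \<partial>lebesgue)"
    have [measurable]: "{y. \<mu> < H y} \<in> sets lebesgue"
      using measurable_sets[OF H, of "{\<mu><..}"] by (simp add: vimage_def)
    let ?E = "?B \<inter> {y. \<mu> < H y}"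
    \<comment> \<open>The factor 2 in the hypothesis is spent here: where H <= \<mu> the integral is
      at most half of the assumed lower bound.\<close>
    have big: "ennreal (\<mu> * ?s) \<le> (\<integral>\<^sup>+y\<in>?E. ennreal (H y) \<partial>lebesgue)"
    proof -
      have "(\<integral>\<^sup>+y\<in>?B. ennreal (H y) \<partial>lebesgue) \<le> (\<integral>\<^sup>+y. ennreal (H y) * indicator ?E y + ennreal \<mu> * indicator ?B y \<partial>lebesgue)"
        by (intro nn_integral_mono) (auto simp: indicator_def intro!: ennreal_leI)
      also have "\<dots> = (\<integral>\<^sup>+y\<in>?E. ennreal (H y) \<partial>lebesgue) + (\<integral>\<^sup>+y. ennreal \<mu> * indicator ?B y \<partial>lebesgue)"
        by (rule nn_integral_add) measurable
      also have "(\<integral>\<^sup>+y. ennreal \<mu> * indicator ?B y \<partial>lebesgue) = ennreal (\<mu> * ?s)"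
        using \<mu> less_imp_le[OF bpow_pos] by (simp add: nn_integral_cmult_indicator emeasure_qball ennreal_mult)
      finally have "ennreal (2 * \<mu> * ?s) \<le> (\<integral>\<^sup>+y\<in>?E. ennreal (H y) \<partial>lebesgue) + ennreal (\<mu> * ?s)"
        using av by (rule order_trans[rotated])
      moreover have "ennreal (2 * \<mu> * ?s) = ennreal (\<mu> * ?s) + ennreal (\<mu> * ?s)"
      proof -
        have "0 \<le> \<mu> * ?s" using \<mu> less_imp_le[OF bpow_pos, of k] by simp
        moreover have "2 * \<mu> * ?s = \<mu> * ?s + \<mu> * ?s" by simp
        ultimately show ?thesis by (simp only: ennreal_plus)
      qed
      ultimately have "ennreal (\<mu> * ?s) + ennreal (\<mu> * ?s) \<le> ennreal (\<mu> * ?s) + (\<integral>\<^sup>+y\<in>?E. ennreal (H y) \<partial>lebesgue)"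
        by (simp only: add.commute)
      then show ?thesis unfolding ennreal_add_left_cancel_le by simp
    qed
    \<comment> \<open>Multiply the lower bound on the set {H > \<mu>} by \<mu>^(t-1) and compare
      pointwise; t is the exponent with which \<mu> reappears on the left.\<close>
    have mult: "ennreal (\<mu> powr t) \<le> ennreal (L * b powi (- k)) * I"
      if pt: "\<And>y. y \<in> ?B \<Longrightarrow> \<mu> < H y \<Longrightarrow> H y * \<mu> powr (t - 1) \<le> L * (H y powr e y) + L * wt y" and L: "0 \<le> L" for t L
    proof -
      have "ennreal (\<mu> powr t * ?s) = ennreal (\<mu> powr (t - 1)) * ennreal (\<mu> * ?s)"
      proof -
        have "\<mu> powr t * ?s = \<mu> powr (t - 1) * (\<mu> * ?s)" using \<mu> by (simp add: powr_diff)
        then show ?thesis by (simp only: ennreal_mult'[OF powr_ge_zero])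
      qed
      also have "\<dots> \<le> ennreal (\<mu> powr (t - 1)) * (\<integral>\<^sup>+y\<in>?E. ennreal (H y) \<partial>lebesgue)"
        by (intro mult_left_mono big) auto
      also have "\<dots> = (\<integral>\<^sup>+y. ennreal (\<mu> powr (t - 1)) * (ennreal (H y) * indicator ?E y) \<partial>lebesgue)"
        by (rule nn_integral_cmult[symmetric]) measurable
      also have "\<dots> \<le> (\<integral>\<^sup>+y. ennreal L * ((ennreal (H y powr e y) + tail y) * indicator ?B y) \<partial>lebesgue)"
      proof (intro nn_integral_mono)
        fix y
        show "ennreal (\<mu> powr (t - 1)) * (ennreal (H y) * indicator ?E y) \<le> ennreal L * ((ennreal (H y powr e y) + tail y) * indicator ?B y)"
        proof (cases "y \<in> ?E")
          case True
          then have "ennreal (\<mu> powr (t - 1)) * ennreal (H y) = ennreal (H y * \<mu> powr (t - 1))"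
            using H0[of y] by (simp add: ennreal_mult mult.commute)
          also have "\<dots> \<le> ennreal (L * (H y powr e y) + L * wt y)" using pt True by (intro ennreal_leI) auto
          also have "\<dots> = ennreal L * (ennreal (H y powr e y) + ennreal (wt y))"
            using L wt_pos[of y] by (simp add: ennreal_mult ennreal_plus distrib_left)
          also have "\<dots> \<le> ennreal L * (ennreal (H y powr e y) + tail y)"
            by (intro mult_left_mono add_left_mono wt_le_tail) auto
          finally show ?thesis using True by simp
        qed auto
      qed
      also have "\<dots> = ennreal L * I" unfolding I_def by (rule nn_integral_cmult) measurable
      finally have "ennreal (\<mu> powr t * ?s) \<le> ennreal L * I" .
      then have "ennreal (b powi (- k)) * ennreal (\<mu> powr t * ?s) \<le> ennreal (b powi (- k)) * (ennreal L * I)"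
        by (rule mult_left_mono) simp
      moreover have "ennreal (b powi (- k)) * ennreal (\<mu> powr t * ?s) = ennreal (\<mu> powr t)"
        using bpow_cancel[of k] less_imp_le[OF bpow_pos] by (simp add: ennreal_mult[symmetric] mult.left_commute)
      moreover have "ennreal (b powi (- k)) * (ennreal L * I) = ennreal (L * b powi (- k)) * I"
        using L less_imp_le[OF bpow_pos] by (simp add: ennreal_mult mult_ac)
      ultimately show ?thesis by simp
    qed
    have up: "ennreal (L * b powi (- k)) * I \<le> ennreal (K * b powi (- k)) * I" if "L \<le> K" for L
      using that less_imp_le[OF bpow_pos] by (intro mult_right_mono ennreal_leI) auto
    show ?thesis
    proof (cases "\<mu> \<le> 1")
      case True
      have "ennreal (\<mu> powr einf) \<le> ennreal (Kinf * b powi (- k)) * I"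
      proof (rule mult)
        fix y assume "y \<in> ?B" "\<mu> < H y"
        then have "H y * \<mu> powr (einf - 1) \<le> Kinf * H y powr e y + wt y"
          by (intro exponent_powr_le \<mu> True) auto
        also have "\<dots> \<le> Kinf * H y powr e y + Kinf * wt y"
          using Kinf_ge_1 wt_pos[of y] by (simp add: mult_le_cancel_right1)
        finally show "H y * \<mu> powr (einf - 1) \<le> Kinf * (H y powr e y) + Kinf * wt y" .
      qed (use Kinf_ge_1 in auto)
      \<comment> \<open>A second factor \<open>Kinf\<close>: the exponent at infinity has to be
        exchanged back for e x.\<close>
      then have "ennreal Kinf * ennreal (\<mu> powr einf) \<le> ennreal Kinf * (ennreal (Kinf * b powi (- k)) * I)"
        by (rule mult_left_mono) simp
      also have "\<dots> = ennreal ((Kinf * Kinf) * b powi (- k)) * I"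
        using Kinf_ge_1 less_imp_le[OF bpow_pos] by (simp add: ennreal_mult mult_ac)
      also have "\<dots> \<le> ennreal (K * b powi (- k)) * I" by (rule up[OF K(3)])
      finally have *: "ennreal Kinf * ennreal (\<mu> powr einf) \<le> ennreal (K * b powi (- k)) * I" .
      have "ennreal (\<mu> powr e x) \<le> ennreal (Kinf * \<mu> powr einf + wt x)"
        by (intro ennreal_leI powr_exponent_le \<mu> True)
      also have "\<dots> = ennreal Kinf * ennreal (\<mu> powr einf) + ennreal (wt x)"
        using Kinf_ge_1 wt_pos[of x] by (simp add: ennreal_mult ennreal_plus)
      also have "\<dots> \<le> ennreal (K * b powi (- k)) * I + ennreal (wt x)"
        by (intro add_right_mono *)
      finally show ?thesis unfolding I_def .
    next
      case False
      \<comment> \<open>From H <= H^e + 1 and modular at most 1, the average over the ball is at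
        most b^-k + 1. This keeps \<mu> in the range where the local log-Hoelder bound
        applies.\<close>
      have "\<mu> \<le> max 1 (b powi (- k))"
      proof -
        have "(\<integral>\<^sup>+y\<in>?B. ennreal (H y) \<partial>lebesgue) \<le> (\<integral>\<^sup>+y. ennreal (H y powr e y) + indicator ?B y \<partial>lebesgue)"
        proof (intro nn_integral_mono)
          fix y
          have "H y \<le> H y powr e y + 1"
          proof (cases "H y \<le> 1")
            case False
            then have "H y powr 1 \<le> H y powr e y" using e1[of y] by (intro powr_mono) auto
            then show ?thesis using False by simp
          qed (simp add: add_increasing)
          then have "ennreal (H y) \<le> ennreal (H y powr e y) + 1"
            by (metis ennreal_1 ennreal_leI ennreal_plus powr_ge_zero zero_le_one)
          then show "ennreal (H y) * indicator ?B y \<le> ennreal (H y powr e y) + indicator ?B y"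
            by (auto simp: indicator_def)
        qed
        also have "\<dots> = (\<integral>\<^sup>+y. ennreal (H y powr e y) \<partial>lebesgue) + ennreal ?s"
          by (subst nn_integral_add) (auto simp: emeasure_qball)
        also have "\<dots> \<le> 1 + ennreal ?s" by (intro add_right_mono mod1)
        also have "\<dots> = ennreal (1 + ?s)" using less_imp_le[OF bpow_pos] by (simp add: ennreal_plus)
        finally have "ennreal (2 * \<mu> * ?s) \<le> ennreal (1 + ?s)" using av by (rule order_trans[rotated])
        then have "2 * \<mu> * ?s \<le> 1 + ?s" using less_imp_le[OF bpow_pos, of k] by (subst (asm) ennreal_le_iff) auto
        then have "(2 * \<mu> * ?s) * b powi (- k) \<le> (1 + ?s) * b powi (- k)" by (intro mult_right_mono) (auto simp: less_imp_le)
        then have "2 * \<mu> * (b powi (- k) * ?s) \<le> b powi (- k) + b powi (- k) * ?s" by (simp only: algebra_simps)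
        then show ?thesis unfolding bpow_cancel by auto
      qed
      then have pt: "\<mu> powr (e x - e y) \<le> K1" if "y \<in> ?B" for y
        using False by (intro K1(2)[OF _ _ x that]) auto
      have "ennreal (\<mu> powr e x) \<le> ennreal (K1 * b powi (- k)) * I"
      proof (rule mult)
        fix y assume y: "y \<in> ?B" "\<mu> < H y"
        have Hy: "0 < H y" using y \<mu> by linarith
        have "H y = H y powr e y * H y powr (1 - e y)" using Hy by (simp flip: powr_add)
        also have "\<dots> \<le> H y powr e y * \<mu> powr (1 - e y)"
          using y \<mu> e1[of y] by (intro mult_left_mono powr_mono2') auto
        finally have "H y * \<mu> powr (e x - 1) \<le> (H y powr e y * \<mu> powr (1 - e y)) * \<mu> powr (e x - 1)"
          by (intro mult_right_mono) auto
        also have "\<dots> = H y powr e y * \<mu> powr (e x - e y)" using \<mu> by (simp flip: powr_add)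
        also have "\<dots> \<le> H y powr e y * K1" by (intro mult_left_mono pt y) auto
        also have "\<dots> \<le> K1 * H y powr e y + K1 * wt y"
          using K1(1) wt_pos[of y] by (simp add: mult.commute)
        finally show "H y * \<mu> powr (e x - 1) \<le> K1 * (H y powr e y) + K1 * wt y" .
      qed (use K1(1) in auto)
      also have "\<dots> \<le> ennreal (K * b powi (- k)) * I" by (rule up[OF K(2)])
      also have "\<dots> \<le> ennreal (K * b powi (- k)) * I + ennreal (wt x)" by simp
      finally show ?thesis unfolding I_def .
    qed
  qed
  then show ?thesis using that[of K] K(1) by blast
qed

text \<open>Cover a compact part of the level set by finitely many balls with large average, select
  disjoint ones, and sum the averaged bound over them.\<close>

lemma weak_type:
  obtains K :: real where "1 \<le> K"
    "\<And>H l. H \<in> borel_measurable lebesgue \<Longrightarrow> (\<And>y. 0 \<le> H y) \<Longrightarrow> (\<integral>\<^sup>+y. ennreal (H y powr e y) \<partial>lebesgue) \<le> 1 \<Longrightarrow>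
      0 < l \<Longrightarrow> (\<integral>\<^sup>+x\<in>{x. ennreal l < maximal (\<lambda>y. ennreal (H y)) x}. ennreal ((l / 2) powr e x) \<partial>lebesgue) \<le> ennreal K"
proof -
  obtain K where K: "1 \<le> K"
    "\<And>H \<mu> x z k. H \<in> borel_measurable lebesgue \<Longrightarrow> (\<And>y. 0 \<le> H y) \<Longrightarrow> (\<integral>\<^sup>+y. ennreal (H y powr e y) \<partial>lebesgue) \<le> 1 \<Longrightarrow>
      0 < \<mu> \<Longrightarrow> ennreal (2 * \<mu> * b powi k) \<le> (\<integral>\<^sup>+y\<in>qball z k. ennreal (H y) \<partial>lebesgue) \<Longrightarrow> x \<in> qball z (k + 2 * int \<sigma>) \<Longrightarrow>
      ennreal (\<mu> powr e x) \<le> ennreal (K * b powi (- k)) * (\<integral>\<^sup>+y\<in>qball z k. (ennreal (H y powr e y) + tail y) \<partial>lebesgue) + ennreal (wt x)"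
    using averaged_bound by blast
  define T where "T = enn2real (\<integral>\<^sup>+x. tail x \<partial>lebesgue)"
  have T: "(\<integral>\<^sup>+x. tail x \<partial>lebesgue) = ennreal T" "0 \<le> T"
    using nn_integral_tail by (auto simp: T_def)
  define D where "D = b ^ (2 * \<sigma>)"
  have D0: "0 < D" using b0 by (simp add: D_def)
  \<comment> \<open>D is the volume ratio of an enlarged ball to the selected one. Disjointness
    bounds the sum over the selected balls by 1 + T, and the pointwise error contributes another T.
    The final 1 ensures K' >= 1.\<close>
  define K' where "K' = K * D * (1 + T) + T + 1"
  have K'1: "1 \<le> K'" using K(1) D0 T(2) by (simp add: K'_def)
  have "(\<integral>\<^sup>+x\<in>{x. ennreal l < maximal (\<lambda>y. ennreal (H y)) x}. ennreal ((l / 2) powr e x) \<partial>lebesgue) \<le> ennreal K'"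
    if H [measurable]: "H \<in> borel_measurable lebesgue" and H0: "\<And>y. 0 \<le> H y"
      and mod1: "(\<integral>\<^sup>+y. ennreal (H y powr e y) \<partial>lebesgue) \<le> 1" and l: "0 < l" for H l
  proof -
    let ?h = "\<lambda>y. ennreal (H y)"
    define g where "g x = ennreal ((l / 2) powr e x)" for x
    have [measurable]: "g \<in> borel_measurable lebesgue" unfolding g_def[abs_def] by measurable
    define E where "E = {x. ennreal l < maximal ?h x}"
    have oE: "open E" unfolding E_def by (rule open_maximal)
    define I where "I z k = (\<integral>\<^sup>+y\<in>qball z k. (ennreal (H y powr e y) + tail y) \<partial>lebesgue)" for z k
    have cpt: "(\<integral>\<^sup>+x\<in>Q. g x \<partial>lebesgue) \<le> ennreal K'" if Q: "compact Q" "Q \<subseteq> E" for Q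
    proof -
      define F where "F = {(z, k). ennreal l < ennreal (b powi (- k)) * (\<integral>\<^sup>+y\<in>qball z k. ?h y \<partial>lebesgue)}"
      have "Q \<subseteq> (\<Union>c\<in>F. qball (fst c) (snd c))"
        using Q(2) by (fastforce simp: E_def F_def less_maximal_iff)
      then obtain F' where F': "F' \<subseteq> F" "finite F'" "Q \<subseteq> (\<Union>c\<in>F'. qball (fst c) (snd c))"
        using compactE_image[OF Q(1), of F "\<lambda>c. qball (fst c) (snd c)"] open_qball by metis
      obtain G where G: "G \<subseteq> F'" "disjoint_family_on (\<lambda>(z, k). qball z k) G"
        "(\<Union>(z, k)\<in>F'. qball z k) \<subseteq> (\<Union>(z, k)\<in>G. qball z (k + 2 * int \<sigma>))"
        using finite_Vitali_qball[OF F'(2)] by blast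
      have finG: "finite G" using G(1) F'(2) finite_subset by blast
      have QG: "Q \<subseteq> (\<Union>(z, k)\<in>G. qball z (k + 2 * int \<sigma>))"
        using F'(3) G(3) by (auto simp: split_def)
      have pt: "g x * indicator Q x \<le> (\<Sum>(z, k)\<in>G. ennreal (K * b powi (- k)) * I z k * indicator (qball z (k + 2 * int \<sigma>)) x) + tail x" for x
      proof (cases "x \<in> Q")
        case True
        then obtain z k where zk: "(z, k) \<in> G" "x \<in> qball z (k + 2 * int \<sigma>)" using QG by auto
        have "ennreal l < ennreal (b powi (- k)) * (\<integral>\<^sup>+y\<in>qball z k. ?h y \<partial>lebesgue)"
          using zk(1) G(1) F'(1) by (auto simp: F_def)
        then have "ennreal (b powi k) * ennreal l \<le> ennreal (b powi k) * (ennreal (b powi (- k)) * (\<integral>\<^sup>+y\<in>qball z k. ?h y \<partial>lebesgue))"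
          by (intro mult_left_mono) auto
        also have "\<dots> = (ennreal (b powi k) * ennreal (b powi (- k))) * (\<integral>\<^sup>+y\<in>qball z k. ?h y \<partial>lebesgue)"
          by (simp only: mult.assoc)
        also have "ennreal (b powi k) * ennreal (b powi (- k)) = 1"
          using bpow_cancel[of k] less_imp_le[OF bpow_pos] by (simp add: ennreal_mult[symmetric] mult.commute)
        finally have "ennreal (2 * (l / 2) * b powi k) \<le> (\<integral>\<^sup>+y\<in>qball z k. ?h y \<partial>lebesgue)"
          using l less_imp_le[OF bpow_pos] by (simp add: ennreal_mult mult.commute)
        then have "g x \<le> ennreal (K * b powi (- k)) * I z k + ennreal (wt x)"
          unfolding g_def I_def using l by (intro K(2)[OF H H0 mod1 _ _ zk(2)]) auto
        also have "\<dots> \<le> (\<Sum>(z, k)\<in>G. ennreal (K * b powi (- k)) * I z k * indicator (qball z (k + 2 * int \<sigma>)) x) + tail x"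
        proof (intro add_mono wt_le_tail)
          show "ennreal (K * b powi (- k)) * I z k \<le> (\<Sum>(z, k)\<in>G. ennreal (K * b powi (- k)) * I z k * indicator (qball z (k + 2 * int \<sigma>)) x)"
            using member_le_sum[OF zk(1) _ finG, of "\<lambda>(z, k). ennreal (K * b powi (- k)) * I z k * indicator (qball z (k + 2 * int \<sigma>)) x"] zk(2)
            by auto
        qed
        finally show ?thesis using True by simp
      qed simp
      have "(\<integral>\<^sup>+x\<in>Q. g x \<partial>lebesgue) \<le> (\<integral>\<^sup>+x. (\<Sum>(z, k)\<in>G. ennreal (K * b powi (- k)) * I z k * indicator (qball z (k + 2 * int \<sigma>)) x) + tail x \<partial>lebesgue)"
        by (intro nn_integral_mono pt)
      also have "\<dots> = (\<integral>\<^sup>+x. (\<Sum>(z, k)\<in>G. ennreal (K * b powi (- k)) * I z k * indicator (qball z (k + 2 * int \<sigma>)) x) \<partial>lebesgue) + ennreal T"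
        unfolding split_def T(1)[symmetric] by (rule nn_integral_add) measurable
      also have "(\<integral>\<^sup>+x. (\<Sum>(z, k)\<in>G. ennreal (K * b powi (- k)) * I z k * indicator (qball z (k + 2 * int \<sigma>)) x) \<partial>lebesgue) =
         (\<Sum>(z, k)\<in>G. \<integral>\<^sup>+x. ennreal (K * b powi (- k)) * I z k * indicator (qball z (k + 2 * int \<sigma>)) x \<partial>lebesgue)"
        unfolding split_def by (rule nn_integral_sum) measurable
      also have "\<dots> = (\<Sum>(z, k)\<in>G. ennreal (K * D) * I z k)"
      proof (intro sum.cong refl, clarify)
        fix z k
        have "(\<integral>\<^sup>+x. ennreal (K * b powi (- k)) * I z k * indicator (qball z (k + 2 * int \<sigma>)) x \<partial>lebesgue) =
           ennreal (K * b powi (- k)) * I z k * ennreal (b powi (k + 2 * int \<sigma>))"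
          by (simp add: nn_integral_cmult_indicator emeasure_qball)
        also have "\<dots> = (ennreal (K * b powi (- k)) * ennreal (b powi (k + 2 * int \<sigma>))) * I z k"
          by (simp only: mult_ac)
        also have "ennreal (K * b powi (- k)) * ennreal (b powi (k + 2 * int \<sigma>)) = ennreal (K * b powi (- k) * b powi (k + 2 * int \<sigma>))"
          by (rule ennreal_mult'[symmetric]) (use K(1) less_imp_le[OF bpow_pos] in simp)
        also have "K * b powi (- k) * b powi (k + 2 * int \<sigma>) = K * D"
        proof -
          have "b powi (- k) * b powi (k + 2 * int \<sigma>) = b powi (int (2 * \<sigma>))"
            using b_nz by (subst power_int_add[symmetric]) auto
          then show ?thesis by (simp only: mult.assoc D_def power_int_of_nat)
        qed
        finally show "(\<integral>\<^sup>+x. ennreal (K * b powi (- k)) * I z k * indicator (qball z (k + 2 * int \<sigma>)) x \<partial>lebesgue) = ennreal (K * D) * I z k" .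
      qed
      also have "\<dots> = ennreal (K * D) * (\<Sum>(z, k)\<in>G. I z k)" by (simp add: sum_distrib_left split_def)
      also have "(\<Sum>(z, k)\<in>G. I z k) \<le> ennreal (1 + T)"
      proof -
        have "(\<Sum>(z, k)\<in>G. I z k) = (\<integral>\<^sup>+y. (\<Sum>(z, k)\<in>G. (ennreal (H y powr e y) + tail y) * indicator (qball z k) y) \<partial>lebesgue)"
          unfolding I_def split_def by (rule nn_integral_sum[symmetric]) measurable
        also have "\<dots> \<le> (\<integral>\<^sup>+y. ennreal (H y powr e y) + tail y \<partial>lebesgue)"
        proof (intro nn_integral_mono)
          fix y
          \<comment> \<open>Disjointness of the selected balls enters here.\<close>
          have "(\<Sum>(z, k)\<in>G. (indicator (qball z k) y :: ennreal)) \<le> 1"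
          proof (cases "\<exists>c\<in>G. y \<in> qball (fst c) (snd c)")
            case True
            then obtain c where c: "c \<in> G" "y \<in> qball (fst c) (snd c)" by blast
            have "(\<Sum>(z, k)\<in>G. (indicator (qball z k) y :: ennreal)) = (\<Sum>d\<in>G. if d = c then 1 else 0)"
              using G(2) c by (intro sum.cong) (auto simp: disjoint_family_on_def indicator_def split_def)
            also have "\<dots> = 1" using finG c(1) by (simp add: sum.delta)
            finally show ?thesis by simp
          qed (auto simp: indicator_def split_def sum.neutral)
          then have "(ennreal (H y powr e y) + tail y) * (\<Sum>(z, k)\<in>G. (indicator (qball z k) y :: ennreal)) \<le> (ennreal (H y powr e y) + tail y) * 1"
            by (rule mult_left_mono) simp
          then show "(\<Sum>(z, k)\<in>G. (ennreal (H y powr e y) + tail y) * indicator (qball z k) y) \<le> ennreal (H y powr e y) + tail y"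
            by (simp add: sum_distrib_left split_def)
        qed
        also have "\<dots> = (\<integral>\<^sup>+y. ennreal (H y powr e y) \<partial>lebesgue) + ennreal T"
          unfolding T(1)[symmetric] by (rule nn_integral_add) measurable
        also have "\<dots> \<le> 1 + ennreal T" by (intro add_right_mono mod1)
        finally show ?thesis using T(2) by (simp add: ennreal_plus)
      qed
      finally have "(\<integral>\<^sup>+x\<in>Q. g x \<partial>lebesgue) \<le> ennreal (K * D) * ennreal (1 + T) + ennreal T"
        by (simp add: mult_left_mono add_right_mono)
      also have "\<dots> = ennreal (K * D * (1 + T) + T)"
        using K(1) D0 T(2) by (simp add: ennreal_mult ennreal_plus)
      also have "\<dots> \<le> ennreal K'" by (intro ennreal_leI) (simp add: K'_def)
      finally show ?thesis .
    qed
    \<comment> \<open>The level set is open, hence a countable increasing union of compact sets, and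
      the bound on these is uniform.\<close>
    obtain Q :: "nat \<Rightarrow> (real^'n) set" where Q: "\<And>n. compact (Q n)" "\<And>n. Q n \<subseteq> E" "\<And>n. Q n \<subseteq> interior (Q (Suc n))" "(\<Union>n. Q n) = E"
      using open_Union_compact_subsets[OF oE] by metis
    have Qs: "range Q \<subseteq> sets (density lebesgue g)" using fmeasurableD[OF lmeasurable_compact[OF Q(1)]] by auto
    have inc: "incseq Q" by (rule incseq_SucI) (use Q(3) interior_subset in blast)
    have "emeasure (density lebesgue g) E = (SUP n. emeasure (density lebesgue g) (Q n))"
      using SUP_emeasure_incseq[OF Qs inc] Q(4) by simp
    also have "\<dots> \<le> ennreal K'"
    proof (intro SUP_least)
      fix n
      have "Q n \<in> sets lebesgue" using Qs by auto
      then show "emeasure (density lebesgue g) (Q n) \<le> ennreal K'"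
        using cpt[OF Q(1,2)] by (simp add: emeasure_density)
    qed
    finally show ?thesis
      using oE unfolding g_def[symmetric] E_def[symmetric] by (simp add: emeasure_density borel_open)
  qed
  then show ?thesis using that K'1 by blast
qed

end

section \<open>Quasi-norms of level functions\<close>

lemma ennreal_powr_mono: "x \<le> y \<Longrightarrow> 0 \<le> a \<Longrightarrow> ennreal_powr x a \<le> ennreal_powr y a"
  by (cases x rule: ennreal_cases; cases y rule: ennreal_cases)
    (auto simp: ennreal_powr_def top_unique intro!: ennreal_leI powr_mono2)

lemma ennreal_powr_ennreal: "0 \<le> x \<Longrightarrow> ennreal_powr (ennreal x) a = ennreal (x powr a)"
  by (simp add: ennreal_powr_def)

lemma ennreal_powr_cmult: "0 < c \<Longrightarrow> ennreal_powr (ennreal c * x) a = ennreal (c powr a) * ennreal_powr x a"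
  by (cases x rule: ennreal_cases)
    (auto simp: ennreal_powr_def ennreal_mult[symmetric] ennreal_mult_top powr_mult)

lemma ennreal_powr_powr: "0 < a \<Longrightarrow> ennreal_powr (ennreal_powr x a) (1 / a) = x"
  by (cases x rule: ennreal_cases) (auto simp: ennreal_powr_def powr_powr)

lemma ennreal_powr_measurable [measurable]:
  "f \<in> borel_measurable M \<Longrightarrow> (\<lambda>x. ennreal_powr (f x) a) \<in> borel_measurable M"
proof -
  assume f [measurable]: "f \<in> borel_measurable M"
  have "f -` {\<infinity>} \<inter> space M \<in> sets M" by (rule measurable_sets[OF f]) simp
  moreover have "f -` {\<infinity>} \<inter> space M = {x \<in> space M. f x = \<infinity>}" by auto
  moreover have "(\<lambda>x. ennreal (enn2real (f x) powr a)) \<in> borel_measurable M"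
    by measurable
  ultimately show ?thesis unfolding ennreal_powr_def by (intro measurable_If) auto
qed

text \<open>The Lorentz quasi-norm as a functional of the distribution function alone. Every norm
  comparison becomes an inequality between decreasing functions on the half-line.\<close>

definition level_qnorm :: "ennreal \<Rightarrow> (real \<Rightarrow> ennreal) \<Rightarrow> ennreal" where
  "level_qnorm q \<phi> = (if q = \<infinity> then (SUP l\<in>{0<..}. ennreal l * \<phi> l)
     else ennreal_powr
       (\<integral>\<^sup>+l\<in>{0<..}. (ennreal (l powr enn2real q) * ennreal_powr (\<phi> l) (enn2real q) / ennreal l) \<partial>lborel)
       (1 / enn2real q))"

definition level :: "(real^'n \<Rightarrow> real) \<Rightarrow> (real^'n \<Rightarrow> ennreal) \<Rightarrow> real \<Rightarrow> ennreal" where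
  "level p F l = var_Lebesgue_norm p (indicator {x. ennreal l < F x} :: real^'n \<Rightarrow> real)"

lemma var_Lorentz_qnorm_level: "var_Lorentz_qnorm p q F = level_qnorm q (level p F)"
  by (simp add: var_Lorentz_qnorm_def level_qnorm_def level_def Let_def)

definition antimono_pos :: "(real \<Rightarrow> ennreal) \<Rightarrow> bool" where
  "antimono_pos \<phi> \<longleftrightarrow> (\<forall>l m. 0 < l \<longrightarrow> l \<le> m \<longrightarrow> \<phi> m \<le> \<phi> l)"

text \<open>Superlevel sets of a monotone function are intervals; the indicator removes arguments on
  which nothing is known.\<close>

lemma antimono_pos_measurable:
  assumes "antimono_pos \<phi>"
  shows "(\<lambda>l. \<phi> l * indicator {0<..} l) \<in> borel_measurable borel"
proof (rule borel_measurableI_greater)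
  fix y :: ennreal
  have "is_interval {l. y < \<phi> l * indicator {0<..} l}"
    unfolding is_interval_1
  proof (intro ballI allI impI, elim conjE)
    fix a b x assume a: "a \<in> {l. y < \<phi> l * indicator {0<..} l}" and b: "b \<in> {l. y < \<phi> l * indicator {0<..} l}"
      and x: "a \<le> x" "x \<le> b"
    have "0 < a" using a by (cases "0 < a") auto
    then have "\<phi> b \<le> \<phi> x" "0 < x" "0 < b" using assms x by (auto simp: antimono_pos_def)
    then show "x \<in> {l. y < \<phi> l * indicator {0<..} l}" using b by (auto intro: less_le_trans)
  qed
  then show "{x \<in> space borel. y < \<phi> x * indicator {0<..} x} \<in> sets borel"
    using real_interval_borel_measurable by simp
qed

text \<open>The q-th power of the quasi-norm for finite q, with the measure dl / l merged into the
  power of l.\<close>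

definition level_integral :: "real \<Rightarrow> (real \<Rightarrow> ennreal) \<Rightarrow> ennreal" where
  "level_integral Q \<phi> = (\<integral>\<^sup>+l\<in>{0<..}. (ennreal (l powr (Q - 1)) * ennreal_powr (\<phi> l) Q) \<partial>lborel)"

lemma level_qnorm_integral:
  assumes "q \<noteq> \<infinity>"
  shows "level_qnorm q \<phi> = ennreal_powr (level_integral (enn2real q) \<phi>) (1 / enn2real q)"
proof -
  have "ennreal (l powr Q) * X / ennreal l = ennreal (l powr (Q - 1)) * X" if "0 < l" for l Q X
  proof -
    have "ennreal (l powr Q) * X / ennreal l = ennreal (l powr Q) * inverse (ennreal l) * X"
      by (simp add: divide_ennreal_def mult_ac)
    also have "ennreal (l powr Q) * inverse (ennreal l) = ennreal (l powr (Q - 1))"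
      using that by (simp add: inverse_ennreal ennreal_mult'[symmetric] powr_diff divide_inverse)
    finally show ?thesis .
  qed
  then have "(\<integral>\<^sup>+l\<in>{0<..}. (ennreal (l powr Q) * ennreal_powr (\<phi> l) Q / ennreal l) \<partial>lborel) = level_integral Q \<phi>" for Q
    unfolding level_integral_def by (intro nn_integral_cong) (simp add: indicator_def)
  then show ?thesis using assms by (simp add: level_qnorm_def)
qed

lemma level_integrand_measurable:
  assumes "antimono_pos \<phi>" "0 < Q"
  shows "(\<lambda>l. ennreal (l powr (Q - 1)) * ennreal_powr (\<phi> l) Q * indicator {0<..} l) \<in> borel_measurable borel"
proof -
  note [measurable] = antimono_pos_measurable[OF assms(1)]
  have "(\<lambda>l. ennreal (l powr (Q - 1)) * ennreal_powr (\<phi> l * indicator {0<..} l) Q) \<in> borel_measurable borel"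
    by measurable
  also have "(\<lambda>l. ennreal (l powr (Q - 1)) * ennreal_powr (\<phi> l * indicator {0<..} l) Q) =
     (\<lambda>l. ennreal (l powr (Q - 1)) * ennreal_powr (\<phi> l) Q * indicator {0<..} l)"
    using assms(2) by (auto simp: fun_eq_iff indicator_def ennreal_powr_def)
  finally show ?thesis .
qed

lemma level_integral_scale:
  assumes "antimono_pos \<phi>" "0 < Q" "0 < c"
  shows "level_integral Q \<phi> = ennreal (c powr Q) * level_integral Q (\<lambda>l. \<phi> (c * l))"
proof -
  have c': "antimono_pos (\<lambda>l. \<phi> (c * l))" using assms by (simp add: antimono_pos_def)
  have "level_integral Q \<phi> = ennreal \<bar>c\<bar> * (\<integral>\<^sup>+l. ennreal ((0 + c * l) powr (Q - 1)) * ennreal_powr (\<phi> (0 + c * l)) Q * indicator {0<..} (0 + c * l) \<partial>lborel)"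
    unfolding level_integral_def
    by (rule nn_integral_real_affine[OF level_integrand_measurable[OF assms(1,2)]]) (use assms in simp)
  also have "(\<integral>\<^sup>+l. ennreal ((0 + c * l) powr (Q - 1)) * ennreal_powr (\<phi> (0 + c * l)) Q * indicator {0<..} (0 + c * l) \<partial>lborel) =
      (\<integral>\<^sup>+l. ennreal (c powr (Q - 1)) * (ennreal (l powr (Q - 1)) * ennreal_powr (\<phi> (c * l)) Q * indicator {0<..} l) \<partial>lborel)"
  proof (intro nn_integral_cong)
    fix l :: real
    show "ennreal ((0 + c * l) powr (Q - 1)) * ennreal_powr (\<phi> (0 + c * l)) Q * indicator {0<..} (0 + c * l) =
      ennreal (c powr (Q - 1)) * (ennreal (l powr (Q - 1)) * ennreal_powr (\<phi> (c * l)) Q * indicator {0<..} l)"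
      using assms(3) by (cases "0 < l") (simp_all add: powr_mult ennreal_mult mult_ac zero_less_mult_iff)
  qed
  also have "\<dots> = ennreal (c powr (Q - 1)) * level_integral Q (\<lambda>l. \<phi> (c * l))"
    unfolding level_integral_def using level_integrand_measurable[OF c' assms(2)] by (intro nn_integral_cmult) simp
  also have "ennreal \<bar>c\<bar> * (ennreal (c powr (Q - 1)) * level_integral Q (\<lambda>l. \<phi> (c * l))) =
     ennreal (\<bar>c\<bar> * c powr (Q - 1)) * level_integral Q (\<lambda>l. \<phi> (c * l))"
    by (simp add: ennreal_mult mult.assoc)
  also have "\<bar>c\<bar> * c powr (Q - 1) = c powr Q" using assms(3) by (simp add: powr_diff)
  finally show ?thesis .
qed

text \<open>The hypothesis says \<open>\<gamma> (c l) \<le> K sup\<^sub>k 2\<^bsup>k \<theta>\<^esup> \<phi> (2\<^sup>k l)\<close>. Bounding the supremum by the sum of the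
  \<open>q\<close>-th powers leaves, by scale invariance of \<open>dl / l\<close>, a geometric series of ratio \<open>2\<^bsup>(\<theta> - 1) q\<^esup>\<close>.\<close>

lemma level_qnorm_le:
  fixes c K \<theta> :: real
  assumes q: "0 < q" and c: "0 < c" and K: "0 < K" and \<theta>: "0 \<le> \<theta>" "\<theta> < 1"
  obtains D :: real where "0 < D"
    "\<And>\<phi> \<gamma>. antimono_pos \<phi> \<Longrightarrow> antimono_pos \<gamma> \<Longrightarrow>
      (\<And>l t. 0 < l \<Longrightarrow> 0 < t \<Longrightarrow> (\<And>k::nat. ennreal (2 powr (real k * \<theta>)) * \<phi> (2 ^ k * l) \<le> ennreal t) \<Longrightarrow> \<gamma> (c * l) \<le> ennreal (K * t)) \<Longrightarrow>
      level_qnorm q \<gamma> \<le> ennreal D * level_qnorm q \<phi>"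
proof (cases "q = \<infinity>")
  case True
  have "level_qnorm q \<gamma> \<le> ennreal (K * c) * level_qnorm q \<phi>"
    if \<phi>: "antimono_pos \<phi>" and H: "\<And>l t. 0 < l \<Longrightarrow> 0 < t \<Longrightarrow> (\<And>k::nat. ennreal (2 powr (real k * \<theta>)) * \<phi> (2 ^ k * l) \<le> ennreal t) \<Longrightarrow> \<gamma> (c * l) \<le> ennreal (K * t)"
    for \<phi> \<gamma>
  proof (cases "level_qnorm q \<phi> = \<infinity>")
    case True
    then show ?thesis using K c by (simp add: ennreal_mult_top)
  next
    case False
    then obtain S where S: "level_qnorm q \<phi> = ennreal S" "0 \<le> S" by (cases "level_qnorm q \<phi>" rule: ennreal_cases) auto
    have le: "ennreal l * \<phi> l \<le> ennreal S" if "0 < l" for l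
    proof -
      have "ennreal l * \<phi> l \<le> (SUP l\<in>{0<..}. ennreal l * \<phi> l)" using that by (intro SUP_upper) auto
      then show ?thesis using S(1) \<open>q = \<infinity>\<close> by (simp add: level_qnorm_def)
    qed
    have step: "ennreal m * \<gamma> m \<le> ennreal (K * c * S) + ennreal \<delta>" if m: "0 < m" and \<delta>: "0 < \<delta>" for m \<delta>
    proof -
      \<comment> \<open>The slack makes t positive even when S = 0; it contributes exactly \<delta>
        to the final bound.\<close>
      define \<epsilon> where "\<epsilon> = \<delta> / (K * c)"
      have \<epsilon>: "0 < \<epsilon>" using \<delta> K c by (simp add: \<epsilon>_def)
      define l where "l = m / c"
      have l: "0 < l" "m = c * l" using m c by (auto simp: l_def)
      define t where "t = (S + \<epsilon>) / l"
      have t: "0 < t" using S(2) \<epsilon> l by (simp add: t_def add_nonneg_pos)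
      have "ennreal (2 powr (real k * \<theta>)) * \<phi> (2 ^ k * l) \<le> ennreal t" for k :: nat
      proof -
        \<comment> \<open>The supremum bounds \<phi> at 2^k l by S / (2^k l), and this decay absorbs
          2^(k \<theta>) because \<theta> < 1.\<close>
        have "2 powr (real k * \<theta>) \<le> 2 powr (k * 1)" using \<theta> mult_left_mono[of \<theta> 1 "real k"] by (intro powr_mono) simp_all
        then have "2 powr (real k * \<theta>) \<le> (1 / l) * (2 ^ k * l)" using l by (simp add: powr_realpow)
        then have "ennreal (2 powr (real k * \<theta>)) * \<phi> (2 ^ k * l) \<le> ennreal ((1 / l) * (2 ^ k * l)) * \<phi> (2 ^ k * l)"
          by (intro mult_right_mono ennreal_leI) auto
        also have "\<dots> = ennreal (1 / l) * (ennreal (2 ^ k * l) * \<phi> (2 ^ k * l))"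
          using l by (simp only: ennreal_mult' divide_nonneg_pos zero_le_one mult.assoc)
        also have "\<dots> \<le> ennreal (1 / l) * ennreal S" using l by (intro mult_left_mono le) auto
        also have "\<dots> = ennreal (1 / l * S)" using l by (intro ennreal_mult'[symmetric]) auto
        also have "\<dots> \<le> ennreal t" using l \<epsilon> by (intro ennreal_leI) (simp add: t_def divide_right_mono)
        finally show ?thesis .
      qed
      then have "\<gamma> m \<le> ennreal (K * t)" unfolding l(2) by (rule H[OF l(1) t])
      then have "ennreal m * \<gamma> m \<le> ennreal m * ennreal (K * t)" by (rule mult_left_mono) simp
      also have "\<dots> = ennreal (m * (K * t))" using m by (intro ennreal_mult'[symmetric]) simp
      also have "m * (K * t) = K * c * S + \<delta>" using l c K by (simp add: t_def \<epsilon>_def field_simps)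
      also have "ennreal (K * c * S + \<delta>) = ennreal (K * c * S) + ennreal \<delta>" using K c S \<delta> by (intro ennreal_plus) auto
      finally show ?thesis .
    qed
    have "ennreal m * \<gamma> m \<le> ennreal (K * c * S)" if "0 < m" for m
      by (rule ennreal_le_epsilon) (rule step[OF that])
    then have "level_qnorm q \<gamma> \<le> ennreal (K * c * S)"
      using \<open>q = \<infinity>\<close> by (auto simp: level_qnorm_def intro!: SUP_least)
    then show ?thesis using S K c by (simp add: ennreal_mult)
  qed
  then show ?thesis using that[of "K * c"] K c by auto
next
  case False
  define Q where "Q = enn2real q"
  have Q: "0 < Q" using q False by (auto simp: Q_def enn2real_positive_iff top.not_eq_extremum)
  define \<eta> where "\<eta> = 2 powr ((\<theta> - 1) * Q)"
  have "(\<theta> - 1) * Q < 0" using \<theta>(2) Q by (intro mult_neg_pos) auto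
  then have "(2::real) powr ((\<theta> - 1) * Q) < 2 powr 0" by (rule powr_less_mono) simp
  then have \<eta>: "0 < \<eta>" "\<eta> < 1" unfolding \<eta>_def by simp_all
  define D where "D = (c * K) powr Q * (1 / (1 - \<eta>))"
  have D: "0 < D" using c K \<eta> by (simp add: D_def)
  have "level_qnorm q \<gamma> \<le> ennreal (D powr (1 / Q)) * level_qnorm q \<phi>"
    if \<phi>: "antimono_pos \<phi>" and \<gamma>: "antimono_pos \<gamma>"
      and H: "\<And>l t. 0 < l \<Longrightarrow> 0 < t \<Longrightarrow> (\<And>k::nat. ennreal (2 powr (real k * \<theta>)) * \<phi> (2 ^ k * l) \<le> ennreal t) \<Longrightarrow> \<gamma> (c * l) \<le> ennreal (K * t)"
    for \<phi> \<gamma>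
  proof -
    define S where "S l = (\<Sum>k. ennreal (2 powr (real k * \<theta> * Q)) * ennreal_powr (\<phi> (2 ^ k * l)) Q)" for l :: real
    have pt: "ennreal_powr (\<gamma> (c * l)) Q \<le> ennreal (K powr Q) * S l" if l: "0 < l" for l
    proof (cases "S l = \<infinity>")
      case True
      then show ?thesis using K by (simp add: ennreal_mult_top)
    next
      case False
      then obtain x where x: "S l = ennreal x" "0 \<le> x" by (cases "S l" rule: ennreal_cases) auto
      have term_le: "ennreal_powr (ennreal (2 powr (real k * \<theta>)) * \<phi> (2 ^ k * l)) Q \<le> ennreal x" for k :: nat
      proof -
        have "ennreal_powr (ennreal (2 powr (real k * \<theta>)) * \<phi> (2 ^ k * l)) Q = ennreal (2 powr (real k * \<theta> * Q)) * ennreal_powr (\<phi> (2 ^ k * l)) Q"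
          by (simp add: ennreal_powr_cmult powr_powr)
        also have "\<dots> \<le> S l"
          using sum_le_suminf[of "\<lambda>k. ennreal (2 powr (real k * \<theta> * Q)) * ennreal_powr (\<phi> (2 ^ k * l)) Q" "{k}"]
          unfolding S_def by simp
        finally show ?thesis using x by simp
      qed
      have step: "ennreal_powr (\<gamma> (c * l)) Q \<le> ennreal (K powr Q * x) + ennreal \<delta>" if \<delta>: "0 < \<delta>" for \<delta>
      proof -
        \<comment> \<open>As before, the slack keeps the argument t of the hypothesis positive;
          multiplied by K^Q it returns \<delta>.\<close>
        define y where "y = x + \<delta> / K powr Q"
        have y: "0 < y" using x \<delta> K by (simp add: y_def add_nonneg_pos)
        have "ennreal (2 powr (real k * \<theta>)) * \<phi> (2 ^ k * l) \<le> ennreal (y powr (1 / Q))" for k :: nat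
        proof -
          have "ennreal x \<le> ennreal y" using \<delta> K by (intro ennreal_leI) (simp add: y_def)
          then have "ennreal_powr (ennreal_powr (ennreal (2 powr (real k * \<theta>)) * \<phi> (2 ^ k * l)) Q) (1 / Q) \<le> ennreal_powr (ennreal y) (1 / Q)"
            using Q by (intro ennreal_powr_mono order_trans[OF term_le]) auto
          then show ?thesis using Q y by (simp add: ennreal_powr_powr ennreal_powr_ennreal)
        qed
        then have "\<gamma> (c * l) \<le> ennreal (K * y powr (1 / Q))" using y by (intro H[OF l]) auto
        then have "ennreal_powr (\<gamma> (c * l)) Q \<le> ennreal_powr (ennreal (K * y powr (1 / Q))) Q"
          using Q by (intro ennreal_powr_mono) auto
        also have "\<dots> = ennreal (K powr Q * y)"
          using K Q y by (simp add: ennreal_powr_ennreal powr_mult powr_powr)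
        also have "K powr Q * y = K powr Q * x + \<delta>" using K by (simp add: y_def field_simps)
        also have "ennreal (K powr Q * x + \<delta>) = ennreal (K powr Q * x) + ennreal \<delta>" using x \<delta> by (intro ennreal_plus) auto
        finally show ?thesis .
      qed
      have "ennreal_powr (\<gamma> (c * l)) Q \<le> ennreal (K powr Q * x)" by (rule ennreal_le_epsilon) (rule step)
      then show ?thesis using x by (simp add: ennreal_mult)
    qed
    have \<phi>k: "antimono_pos (\<lambda>l. \<phi> (2 ^ k * l))" for k :: nat using \<phi> by (simp add: antimono_pos_def)
    let ?g = "\<lambda>k l. ennreal (l powr (Q - 1)) * ennreal_powr (\<phi> (2 ^ k * l)) Q * indicator {0<..} l"
    have gm [measurable]: "?g k \<in> borel_measurable borel" for k :: nat
      by (rule level_integrand_measurable[OF \<phi>k Q])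
    have "level_integral Q (\<lambda>l. \<gamma> (c * l)) \<le>
        (\<integral>\<^sup>+l. ennreal (K powr Q) * (\<Sum>k. ennreal (2 powr (real k * \<theta> * Q)) * ?g k l) \<partial>lborel)"
      unfolding level_integral_def
    proof (intro nn_integral_mono)
      fix l :: real
      show "ennreal (l powr (Q - 1)) * ennreal_powr (\<gamma> (c * l)) Q * indicator {0<..} l \<le>
        ennreal (K powr Q) * (\<Sum>k. ennreal (2 powr (real k * \<theta> * Q)) * ?g k l)"
      proof (cases "0 < l")
        case True
        have "ennreal (l powr (Q - 1)) * ennreal_powr (\<gamma> (c * l)) Q \<le> ennreal (l powr (Q - 1)) * (ennreal (K powr Q) * S l)"
          by (intro mult_left_mono pt True) auto
        also have "\<dots> = ennreal (K powr Q) * (ennreal (l powr (Q - 1)) * S l)" by (simp only: mult_ac)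
        also have "ennreal (l powr (Q - 1)) * S l = (\<Sum>k. ennreal (2 powr (real k * \<theta> * Q)) * ?g k l)"
          unfolding S_def ennreal_suminf_cmult[symmetric] using True
          by (intro suminf_cong) (simp add: mult.left_commute)
        finally show ?thesis using True by simp
      qed simp
    qed
    also have "\<dots> = ennreal (K powr Q) * (\<Sum>k. ennreal (2 powr (real k * \<theta> * Q)) * level_integral Q (\<lambda>l. \<phi> (2 ^ k * l)))"
    proof -
      have "(\<integral>\<^sup>+l. ennreal (K powr Q) * (\<Sum>k. ennreal (2 powr (real k * \<theta> * Q)) * ?g k l) \<partial>lborel) =
          ennreal (K powr Q) * (\<integral>\<^sup>+l. (\<Sum>k. ennreal (2 powr (real k * \<theta> * Q)) * ?g k l) \<partial>lborel)"
        using gm by (intro nn_integral_cmult borel_measurable_suminf borel_measurable_times borel_measurable_const) simp_all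
      also have "(\<integral>\<^sup>+l. (\<Sum>k. ennreal (2 powr (real k * \<theta> * Q)) * ?g k l) \<partial>lborel) =
          (\<Sum>k. \<integral>\<^sup>+l. ennreal (2 powr (real k * \<theta> * Q)) * ?g k l \<partial>lborel)"
        using gm by (intro nn_integral_suminf borel_measurable_times borel_measurable_const) simp_all
      also have "\<dots> = (\<Sum>k. ennreal (2 powr (real k * \<theta> * Q)) * (\<integral>\<^sup>+l. ?g k l \<partial>lborel))"
        using gm by (intro suminf_cong nn_integral_cmult) simp_all
      finally show ?thesis unfolding level_integral_def .
    qed
    also have "(\<Sum>k. ennreal (2 powr (real k * \<theta> * Q)) * level_integral Q (\<lambda>l. \<phi> (2 ^ k * l))) = (\<Sum>k. ennreal (\<eta> ^ k) * level_integral Q \<phi>)"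
    proof (intro suminf_cong)
      fix k :: nat
      have e: "2 powr (real k * \<theta> * Q) = \<eta> ^ k * (2 ^ k) powr Q"
        by (simp add: \<eta>_def powr_realpow[symmetric] powr_powr powr_add[symmetric] algebra_simps)
      have "level_integral Q \<phi> = ennreal ((2 ^ k) powr Q) * level_integral Q (\<lambda>l. \<phi> (2 ^ k * l))"
        by (rule level_integral_scale[OF \<phi> Q]) simp
      then show "ennreal (2 powr (real k * \<theta> * Q)) * level_integral Q (\<lambda>l. \<phi> (2 ^ k * l)) = ennreal (\<eta> ^ k) * level_integral Q \<phi>"
        unfolding e using \<eta> by (simp add: ennreal_mult mult.assoc)
    qed
    also have "\<dots> = (\<Sum>k. ennreal (\<eta> ^ k)) * level_integral Q \<phi>" by (rule ennreal_suminf_multc)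
    also have "(\<Sum>k. ennreal (\<eta> ^ k)) = ennreal (1 / (1 - \<eta>))"
    proof -
      have s: "(\<lambda>k. \<eta> ^ k) sums (1 / (1 - \<eta>))" by (rule geometric_sums) (use \<eta> in simp)
      have "0 \<le> \<eta> ^ k" for k using \<eta> by simp
      from suminf_ennreal2[OF this sums_summable[OF s]] show ?thesis unfolding sums_unique[OF s, symmetric] .
    qed
    finally have "level_integral Q (\<lambda>l. \<gamma> (c * l)) \<le> ennreal (K powr Q) * (ennreal (1 / (1 - \<eta>)) * level_integral Q \<phi>)" .
    then have "ennreal (c powr Q) * level_integral Q (\<lambda>l. \<gamma> (c * l)) \<le> ennreal (c powr Q) * (ennreal (K powr Q) * (ennreal (1 / (1 - \<eta>)) * level_integral Q \<phi>))"
      by (rule mult_left_mono) simp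
    also have "\<dots> = ennreal D * level_integral Q \<phi>"
    proof -
      have "ennreal (c powr Q) * (ennreal (K powr Q) * ennreal (1 / (1 - \<eta>))) = ennreal (c powr Q * (K powr Q * (1 / (1 - \<eta>))))"
        by (simp only: ennreal_mult'[OF powr_ge_zero])
      also have "c powr Q * (K powr Q * (1 / (1 - \<eta>))) = D" by (simp add: D_def powr_mult)
      finally show ?thesis by (simp only: mult.assoc[symmetric])
    qed
    finally have "level_integral Q \<gamma> \<le> ennreal D * level_integral Q \<phi>"
      using level_integral_scale[OF \<gamma> Q c] by simp
    then have "ennreal_powr (level_integral Q \<gamma>) (1 / Q) \<le> ennreal_powr (ennreal D * level_integral Q \<phi>) (1 / Q)"
      using Q by (intro ennreal_powr_mono) auto
    then show ?thesis
      using D False by (simp add: level_qnorm_integral Q_def ennreal_powr_cmult)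
  qed
  then show ?thesis using that[of "D powr (1 / Q)"] D by auto
qed

text \<open>Embedding into the weak space: by monotonicity \<phi> is at least \<phi> l on the
  interval from l / 2 to l, and that interval alone already contributes a multiple of (l \<phi> l)^q
  to the integral.\<close>

lemma level_qnorm_weak:
  assumes q: "0 < q" and \<phi>: "antimono_pos \<phi>" and fin: "level_qnorm q \<phi> < \<infinity>"
  obtains B :: real where "0 < B" "\<And>l. 0 < l \<Longrightarrow> \<phi> l \<le> ennreal (B / l)"
proof (cases "q = \<infinity>")
  case True
  obtain S where S: "level_qnorm q \<phi> = ennreal S" "0 \<le> S"
    using fin by (cases "level_qnorm q \<phi>" rule: ennreal_cases) auto
  have "\<phi> l \<le> ennreal ((S + 1) / l)" if l: "0 < l" for l
  proof -
    have "ennreal l * \<phi> l \<le> (SUP l\<in>{0<..}. ennreal l * \<phi> l)" using l by (intro SUP_upper) auto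
    then have "ennreal l * \<phi> l \<le> ennreal S" using S(1) True by (simp add: level_qnorm_def)
    then have "ennreal (1 / l) * (ennreal l * \<phi> l) \<le> ennreal (1 / l) * ennreal S" by (rule mult_left_mono) simp
    moreover have "ennreal (1 / l) * (ennreal l * \<phi> l) = \<phi> l"
      using l by (simp add: mult.assoc[symmetric] ennreal_mult[symmetric])
    moreover have "ennreal (1 / l) * ennreal S = ennreal (1 / l * S)" using l by (intro ennreal_mult'[symmetric]) auto
    ultimately have "\<phi> l \<le> ennreal (1 / l * S)" by simp
    also have "\<dots> \<le> ennreal ((S + 1) / l)" using l by (intro ennreal_leI) (simp add: divide_right_mono)
    finally show ?thesis .
  qed
  then show ?thesis using that[of "S + 1"] S(2) by auto
next
  case False
  define Q where "Q = enn2real q"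
  have Q: "0 < Q" using q False by (auto simp: Q_def enn2real_positive_iff top.not_eq_extremum)
  have "level_integral Q \<phi> \<noteq> \<infinity>"
    using fin unfolding level_qnorm_integral[OF False] Q_def[symmetric] by (auto simp: ennreal_powr_def)
  then obtain J where J: "level_integral Q \<phi> = ennreal J" "0 \<le> J" by (cases "level_integral Q \<phi>" rule: ennreal_cases) auto
  define B where "B = (2 powr (Q + 1) * (J + 1)) powr (1 / Q)"
  have B: "0 < B" using J by (simp add: B_def)
  have "\<phi> l \<le> ennreal (B / l)" if l: "0 < l" for l
  proof -
    \<comment> \<open>A lower bound of x^(Q-1) on that interval, valid for either sign of Q - 1: the
      numerator of x^Q / x is taken at l / 2 and the denominator at l.\<close>
    let ?m = "(l / 2) powr Q / l"
    have m: "0 < ?m" using l by simp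
    have "(\<integral>\<^sup>+x. ennreal ?m * ennreal_powr (\<phi> l) Q * indicator {l / 2..l} x \<partial>lborel) \<le> level_integral Q \<phi>"
      unfolding level_integral_def
    proof (intro nn_integral_mono)
      fix x :: real
      show "ennreal ?m * ennreal_powr (\<phi> l) Q * indicator {l / 2..l} x \<le> ennreal (x powr (Q - 1)) * ennreal_powr (\<phi> x) Q * indicator {0<..} x"
      proof (cases "x \<in> {l / 2..l}")
        case True
        then have x: "0 < x" "l / 2 \<le> x" "x \<le> l" using l by auto
        have "?m \<le> x powr Q / x" using x l Q by (intro frac_le powr_mono2) auto
        also have "\<dots> = x powr (Q - 1)" using x by (simp add: powr_diff)
        finally have "?m \<le> x powr (Q - 1)" .
        moreover have "\<phi> l \<le> \<phi> x" using \<phi> x by (simp add: antimono_pos_def)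
        ultimately have "ennreal ?m * ennreal_powr (\<phi> l) Q \<le> ennreal (x powr (Q - 1)) * ennreal_powr (\<phi> x) Q"
          using Q by (intro mult_mono ennreal_leI ennreal_powr_mono) auto
        then show ?thesis using True x by simp
      qed simp
    qed
    also have "(\<integral>\<^sup>+x. ennreal ?m * ennreal_powr (\<phi> l) Q * indicator {l / 2..l} x \<partial>lborel) = ennreal ?m * ennreal_powr (\<phi> l) Q * ennreal (l / 2)"
      using l by (simp add: nn_integral_cmult_indicator)
    finally have "ennreal ?m * ennreal_powr (\<phi> l) Q * ennreal (l / 2) \<le> ennreal J" using J by simp
    moreover have "ennreal ?m * ennreal_powr (\<phi> l) Q * ennreal (l / 2) = ennreal ((l / 2) powr Q / 2) * ennreal_powr (\<phi> l) Q"
    proof -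
      have "ennreal ?m * ennreal (l / 2) = ennreal (?m * (l / 2))" using m by (intro ennreal_mult'[symmetric]) auto
      also have "?m * (l / 2) = (l / 2) powr Q / 2" using l by simp
      finally show ?thesis by (simp only: mult_ac)
    qed
    ultimately have le: "ennreal ((l / 2) powr Q / 2) * ennreal_powr (\<phi> l) Q \<le> ennreal J" by simp
    have "\<phi> l \<noteq> \<infinity>"
    proof
      assume "\<phi> l = \<infinity>"
      then have "ennreal ((l / 2) powr Q / 2) * ennreal_powr (\<phi> l) Q = \<infinity>"
        using l by (simp add: ennreal_powr_def ennreal_mult_top)
      then show False using le by (simp add: top_unique)
    qed
    then obtain y where y: "\<phi> l = ennreal y" "0 \<le> y" by (cases "\<phi> l" rule: ennreal_cases) auto
    have "(l / 2) powr Q / 2 * y powr Q \<le> J"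
      using le y J(2) by (simp add: ennreal_powr_ennreal ennreal_mult'[symmetric])
    moreover have "(l / 2) powr Q = l powr Q / 2 powr Q" using l by (simp add: powr_divide)
    moreover have "(l * y) powr Q = l powr Q * y powr Q" by (rule powr_mult)
    ultimately have "(l * y) powr Q \<le> 2 powr (Q + 1) * J" by (simp add: powr_add field_simps)
    also have "\<dots> \<le> 2 powr (Q + 1) * (J + 1)" by (intro mult_left_mono) auto
    finally have "((l * y) powr Q) powr (1 / Q) \<le> B" unfolding B_def using Q by (intro powr_mono2) auto
    then have "l * y \<le> B" using l y Q by (simp add: powr_powr)
    then show ?thesis using l by (simp add: y field_simps ennreal_leI)
  qed
  then show ?thesis using that B by blast
qed

section \<open>Level sets in variable Lebesgue spaces\<close>

abbreviation set_norm :: "(real^'n \<Rightarrow> real) \<Rightarrow> (real^'n) set \<Rightarrow> ennreal" where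
  "set_norm p E \<equiv> var_Lebesgue_norm p (indicator E :: real^'n \<Rightarrow> real)"

lemma set_norm_eq:
  "set_norm p E = Inf {ennreal l | l. 0 < l \<and> (\<integral>\<^sup>+x\<in>E. ennreal ((1 / l) powr p x) \<partial>lebesgue) \<le> 1}"
proof -
  have "ennreal ((norm (indicator E x :: real) / l) powr p x) = ennreal ((1 / l) powr p x) * indicator E x" for l x
    by (simp add: indicator_def)
  then show ?thesis unfolding var_Lebesgue_norm_def by simp
qed

lemma set_norm_leI:
  "0 < l \<Longrightarrow> (\<integral>\<^sup>+x\<in>E. ennreal ((1 / l) powr p x) \<partial>lebesgue) \<le> 1 \<Longrightarrow> set_norm p E \<le> ennreal l"
  unfolding set_norm_eq by (rule Inf_lower) blast

lemma set_norm_lessD: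
  assumes "set_norm p E < ennreal l" and p: "\<And>x. 0 \<le> p x"
  shows "(\<integral>\<^sup>+x\<in>E. ennreal ((1 / l) powr p x) \<partial>lebesgue) \<le> 1"
proof -
  obtain m where m: "0 < m" "ennreal m < ennreal l" "(\<integral>\<^sup>+x\<in>E. ennreal ((1 / m) powr p x) \<partial>lebesgue) \<le> 1"
    using assms(1) unfolding set_norm_eq Inf_less_iff by auto
  have "m < l" using m(1,2) by (simp add: ennreal_less_iff)
  then have "(\<integral>\<^sup>+x\<in>E. ennreal ((1 / l) powr p x) \<partial>lebesgue) \<le> (\<integral>\<^sup>+x\<in>E. ennreal ((1 / m) powr p x) \<partial>lebesgue)"
    using m(1) p by (intro nn_integral_mono mult_right_mono ennreal_leI powr_mono2) (auto intro!: divide_left_mono)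
  then show ?thesis using m(3) by (rule order_trans)
qed

lemma set_norm_AE_mono:
  assumes "AE x in lebesgue. x \<in> E \<longrightarrow> x \<in> F"
  shows "set_norm p E \<le> set_norm p F"
  unfolding set_norm_eq
proof (rule Inf_superset_mono, safe)
  fix l :: real assume l: "0 < l" "(\<integral>\<^sup>+x\<in>F. ennreal ((1 / l) powr p x) \<partial>lebesgue) \<le> 1"
  have "(\<integral>\<^sup>+x\<in>E. ennreal ((1 / l) powr p x) \<partial>lebesgue) \<le> (\<integral>\<^sup>+x\<in>F. ennreal ((1 / l) powr p x) \<partial>lebesgue)"
    using assms by (intro nn_integral_mono_AE) (auto simp: indicator_def elim!: eventually_mono)
  then show "\<exists>m. ennreal l = ennreal m \<and> 0 < m \<and> (\<integral>\<^sup>+x\<in>E. ennreal ((1 / m) powr p x) \<partial>lebesgue) \<le> 1"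
    using l by (auto intro: order_trans)
qed

lemma antimono_pos_level: "antimono_pos (level p F)"
  unfolding antimono_pos_def level_def
proof (intro allI impI)
  fix l m :: real assume "0 < l" "l \<le> m"
  then have "ennreal l \<le> ennreal m" by (simp add: ennreal_leI)
  then show "set_norm p {x. ennreal m < F x} \<le> set_norm p {x. ennreal l < F x}"
    by (intro set_norm_AE_mono AE_I2) auto
qed

text \<open>The inclusion of level sets at heights c l and l is the case k = 0 of the hypothesis of
  \<open>level_qnorm_le\<close>; 1/2 is one choice of its parameter.\<close>

lemma level_qnorm_AE_mono:
  assumes q: "0 < q" and c: "0 < c"
  obtains D :: real where "0 < D"
    "\<And>F G :: real^'n \<Rightarrow> ennreal. AE x in lebesgue. F x \<le> ennreal c * G x \<Longrightarrow>
      level_qnorm q (level p F) \<le> ennreal D * level_qnorm q (level p G)"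
proof -
  obtain D where D: "0 < D"
    "\<And>\<phi> \<gamma>. antimono_pos \<phi> \<Longrightarrow> antimono_pos \<gamma> \<Longrightarrow>
      (\<And>l t. 0 < l \<Longrightarrow> 0 < t \<Longrightarrow> (\<And>k::nat. ennreal (2 powr (real k * (1/2))) * \<phi> (2 ^ k * l) \<le> ennreal t) \<Longrightarrow> \<gamma> (c * l) \<le> ennreal (1 * t)) \<Longrightarrow>
      level_qnorm q \<gamma> \<le> ennreal D * level_qnorm q \<phi>"
    using level_qnorm_le[OF q c, of 1 "1/2"] by (metis (no_types, lifting) half_gt_zero_iff less_imp_le zero_less_one field_sum_of_halves less_add_same_cancel1 half_gt_zero)
  show ?thesis
  proof (rule that[OF D(1)])
    fix F G :: "real^'n \<Rightarrow> ennreal" assume FG: "AE x in lebesgue. F x \<le> ennreal c * G x"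
    show "level_qnorm q (level p F) \<le> ennreal D * level_qnorm q (level p G)"
    proof (rule D(2)[OF antimono_pos_level antimono_pos_level])
      fix l t :: real assume l: "0 < l"
        and H: "\<And>k::nat. ennreal (2 powr (real k * (1/2))) * level p G (2 ^ k * l) \<le> ennreal t"
      have "level p F (c * l) \<le> level p G l"
        unfolding level_def
      proof (rule set_norm_AE_mono, rule AE_mp[OF FG], intro AE_I2 impI, elim CollectE, intro CollectI)
        fix x assume 1: "F x \<le> ennreal c * G x" and 2: "ennreal (c * l) < F x"
        show "ennreal l < G x"
        proof (rule ccontr)
          assume "\<not> ennreal l < G x"
          then have "ennreal c * G x \<le> ennreal c * ennreal l" by (intro mult_left_mono) auto
          also have "\<dots> = ennreal (c * l)" using c by (intro ennreal_mult'[symmetric]) simp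
          finally show False using 1 2 by simp
        qed
      qed
      also have "level p G l \<le> ennreal t" using H[of 0] by simp
      finally show "level p F (c * l) \<le> ennreal (1 * t)" by simp
    qed
  qed
qed

locale Lorentz_exponent = log_Holder_exponent A \<Delta> r e C einf
  for A :: "real^'n^'n" and \<Delta> r e C einf +
  fixes p :: "real^'n \<Rightarrow> real" and s :: real
  assumes s1: "1 < s" and p_eq: "\<And>x. p x = s * e x"
begin

lemma p_meas [measurable]: "p \<in> borel_measurable lebesgue"
proof -
  have "p = (\<lambda>x. s * e x)" using p_eq by auto
  then show ?thesis by simp
qed

lemma p_ge: "s \<le> p x" using s1 e1[of x] by (simp add: p_eq)
lemma p_nonneg: "0 \<le> p x" using p_ge[of x] s1 by simp

text \<open>A point strictly between 1/s and 1. Being above 1/s makes the modular of the upper part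
  of the function summable; being below 1 makes the series in \<open>level_qnorm_le\<close>
  converge.\<close>

definition \<theta> :: real where "\<theta> = 1 / sqrt s"

lemma \<theta>: "0 \<le> \<theta>" "\<theta> < 1" "1 < \<theta> * s"
proof -
  have sq: "1 < sqrt s" using s1 by simp
  then show "0 \<le> \<theta>" "\<theta> < 1" by (auto simp: \<theta>_def)
  have "\<theta> * s = sqrt s" using s1 by (simp add: \<theta>_def real_div_sqrt)
  then show "1 < \<theta> * s" using sq by simp
qed

text \<open>Interpolation: \<open>F\<close> is split at height \<open>l\<close>; the upper part, rescaled, has modular at most one
  with respect to the smaller exponent \<open>e = p / s\<close>, so that the weak type estimate applies to it.\<close>

lemma level_maximal_le:
  obtains K :: real where "0 < K"
    "\<And>F l t. F \<in> borel_measurable lebesgue \<Longrightarrow> (\<And>x. 0 \<le> F x) \<Longrightarrow> 0 < l \<Longrightarrow> 0 < t \<Longrightarrow>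
      (\<And>k::nat. ennreal (2 powr (real k * \<theta>)) * level p (\<lambda>x. ennreal (F x)) (2 ^ k * l) \<le> ennreal t) \<Longrightarrow>
      level p (maximal (\<lambda>x. ennreal (F x))) (2 * l) \<le> ennreal (K * t)"
proof -
  obtain K0 where K0: "1 \<le> K0"
    "\<And>H l. H \<in> borel_measurable lebesgue \<Longrightarrow> (\<And>y. 0 \<le> H y) \<Longrightarrow> (\<integral>\<^sup>+y. ennreal (H y powr e y) \<partial>lebesgue) \<le> 1 \<Longrightarrow>
      0 < l \<Longrightarrow> (\<integral>\<^sup>+x\<in>{x. ennreal l < maximal (\<lambda>y. ennreal (H y)) x}. ennreal ((l / 2) powr e x) \<partial>lebesgue) \<le> ennreal K0"
    using weak_type by blast
  define \<delta> where "\<delta> = \<theta> * s - 1"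
  have \<delta>: "0 < \<delta>" using \<theta>(3) by (simp add: \<delta>_def)
  define \<eta> where "\<eta> = 2 powr (- \<delta>)"
  have "(2::real) powr (- \<delta>) < 2 powr 0" using \<delta> by (intro powr_less_mono) auto
  then have \<eta>: "0 < \<eta>" "\<eta> < 1" by (simp_all add: \<eta>_def)
  \<comment> \<open>Chosen so that 2^(k+1) / (M t^s) equals (1 / \<nu> k)^s times the k-th of the
    weights (1 - \<eta>) \<eta>^k.\<close>
  define M where "M = 2 powr (s + 1) / (1 - \<eta>)"
  have M: "0 < M" using \<eta> by (simp add: M_def)
  \<comment> \<open>Chosen so that (1 / (K t))^s is the height l' / 2 of the weak type estimate
    divided by its constant \<open>K0\<close>.\<close>
  define K where "K = (2 * K0 * M) powr (1 / s)"
  have K: "0 < K" using K0 M by (simp add: K_def)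
  have Ks: "K powr s = 2 * K0 * M" using K0 M s1 by (simp add: K_def powr_powr)
  have "level p (maximal (\<lambda>x. ennreal (F x))) (2 * l) \<le> ennreal (K * t)"
    if F [measurable]: "F \<in> borel_measurable lebesgue" and F0: "\<And>x. 0 \<le> F x" and l: "0 < l" and t: "0 < t"
      and hyp: "\<And>k::nat. ennreal (2 powr (real k * \<theta>)) * level p (\<lambda>x. ennreal (F x)) (2 ^ k * l) \<le> ennreal t" for F l t
  proof -
    define E where "E k = {x. 2 ^ k * l < F x}" for k :: nat
    have E_meas [measurable]: "E k \<in> sets lebesgue" for k
      using measurable_sets[OF F, of "{2 ^ k * l<..}"] by (simp add: vimage_def E_def)
    \<comment> \<open>Twice the bound given by the hypothesis: the strict inequality is what makes
      the modular of the k-th level set at most 1.\<close>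
    define \<nu> where "\<nu> k = 2 * t / 2 powr (real k * \<theta>)" for k :: nat
    have \<nu>: "0 < \<nu> k" for k using t by (simp add: \<nu>_def)
    have modE: "(\<integral>\<^sup>+x\<in>E k. ennreal ((1 / \<nu> k) powr p x) \<partial>lebesgue) \<le> 1" for k
    proof (rule set_norm_lessD[OF _ p_nonneg])
      let ?a = "2 powr (real k * \<theta>)"
      have "level p (\<lambda>x. ennreal (F x)) (2 ^ k * l) = set_norm p (E k)"
        using l by (simp add: level_def E_def ennreal_less_iff)
      then have "ennreal (1 / ?a) * (ennreal ?a * set_norm p (E k)) \<le> ennreal (1 / ?a) * ennreal t"
        using hyp[of k] by (intro mult_left_mono) simp_all
      also have "\<dots> = ennreal (1 / ?a * t)" by (intro ennreal_mult'[symmetric]) simp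
      also have "\<dots> < ennreal (\<nu> k)" using t by (simp add: \<nu>_def ennreal_less_iff divide_strict_right_mono)
      also have "ennreal (1 / ?a) * (ennreal ?a * set_norm p (E k)) = (ennreal (1 / ?a) * ennreal ?a) * set_norm p (E k)"
        by (simp only: mult.assoc)
      also have "ennreal (1 / ?a) * ennreal ?a = ennreal (1 / ?a * ?a)" by (intro ennreal_mult'[symmetric]) simp
      finally show "set_norm p (E k) < ennreal (\<nu> k)" by simp
    qed
    \<comment> \<open>This normalization gives the upper part of F modular at most 1 for the
      exponent \<open>e\<close>.\<close>
    define c where "c = l * (M * t powr s)"
    have c: "0 < c" using l M t by (simp add: c_def)
    define H where "H x = (if l < F x then F x / c else 0)" for x
    have [measurable]: "H \<in> borel_measurable lebesgue" unfolding H_def[abs_def] by measurable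
    have H0: "0 \<le> H x" for x using F0[of x] c by (simp add: H_def)
    \<comment> \<open>Geometric weights with sum 1, so that a sum of modulars each at most 1 stays
      at most 1.\<close>
    let ?a = "\<lambda>k::nat. (1 - \<eta>) * \<eta> ^ k"
    have a: "0 < ?a k" "?a k \<le> 1" for k
      using \<eta> by (auto intro!: mult_le_one power_le_one)
    have bound: "ennreal (H x powr e x) \<le> (\<Sum>k. ennreal (?a k) * (ennreal ((1 / \<nu> k) powr p x) * indicator (E k) x))" for x
    proof (cases "l < F x")
      case True
      \<comment> \<open>Locates the dyadic height of F x: it exceeds 2^k l but not 2^(k+1) l with n
        = k + 1.\<close>
      define n where "n = (LEAST n. F x \<le> 2 ^ n * l)"
      obtain n0 where "F x / l < 2 ^ n0" using real_arch_pow[of 2 "F x / l"] by auto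
      then have ex: "F x \<le> 2 ^ n0 * l" using l by (simp add: field_simps)
      have n: "F x \<le> 2 ^ n * l" unfolding n_def by (rule LeastI[where P = "\<lambda>n. F x \<le> 2 ^ n * l", OF ex])
      then have "n \<noteq> 0" using True by (intro notI) simp
      then obtain k where k: "n = Suc k" using not0_implies_Suc by blast
      have "\<not> F x \<le> 2 ^ k * l" using not_less_Least[of k "\<lambda>n. F x \<le> 2 ^ n * l"] k by (simp add: n_def)
      then have xE: "x \<in> E k" by (simp add: E_def)
      have "H x \<le> 2 ^ Suc k * l / c" using True n c unfolding k by (simp add: H_def divide_right_mono)
      also have "\<dots> = 2 ^ Suc k / (M * t powr s)" using l by (simp add: c_def)
      also have "\<dots> = (1 / \<nu> k) powr s * ?a k"
      proof -
        have "(1 / \<nu> k) powr s = (2 powr (real k * \<theta>)) powr s / (2 * t) powr s"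
          using t by (simp add: \<nu>_def powr_divide)
        also have "(2 powr (real k * \<theta>)) powr s = 2 powr (real k + real k * \<delta>)"
          by (simp add: powr_powr \<delta>_def algebra_simps)
        also have "\<dots> = 2 ^ k * 2 powr (real k * \<delta>)" by (simp add: powr_add powr_realpow)
        also have "(2 * t) powr s = 2 powr s * t powr s" using t by (simp add: powr_mult)
        finally have 1: "(1 / \<nu> k) powr s = 2 ^ k * 2 powr (real k * \<delta>) / (2 powr s * t powr s)" .
        have "\<eta> ^ k = 2 powr (- (real k * \<delta>))"
          by (simp add: \<eta>_def powr_realpow[symmetric] powr_powr mult.commute)
        then have 2: "2 powr (real k * \<delta>) * \<eta> ^ k = 1" by (simp add: powr_minus)
        have "(1 / \<nu> k) powr s * ?a k = (2 ^ k * (1 - \<eta>) / (2 powr s * t powr s)) * (2 powr (real k * \<delta>) * \<eta> ^ k)"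
          unfolding 1 by (simp add: mult_ac)
        also have "\<dots> = 2 ^ Suc k / (M * t powr s)"
        proof -
          have "2 * x / (2 * y / d * z) = x * d / (y * z)" for x y z d :: real by simp
          from this[of "2 ^ k" "2 powr s" "1 - \<eta>" "t powr s"] show ?thesis
            unfolding 2 M_def by (simp add: powr_add mult.commute)
        qed
        finally show ?thesis by simp
      qed
      finally have "H x powr e x \<le> ((1 / \<nu> k) powr s * ?a k) powr e x"
        using H0[of x] e1[of x] by (intro powr_mono2) auto
      also have "\<dots> = (1 / \<nu> k) powr p x * ?a k powr e x" by (simp add: powr_mult powr_powr p_eq)
      \<comment> \<open>The weight is at most 1 and e x >= 1, so the weight may be pulled out of the
        power.\<close>
      also have "\<dots> \<le> (1 / \<nu> k) powr p x * ?a k powr 1"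
        using a[of k] e1[of x] by (intro mult_left_mono powr_mono') auto
      finally have "H x powr e x \<le> ?a k * (1 / \<nu> k) powr p x"
        using a(1)[of k] by (simp only: powr_one mult.commute less_imp_le)
      then have "ennreal (H x powr e x) \<le> ennreal (?a k * (1 / \<nu> k) powr p x)" by (rule ennreal_leI)
      also have "\<dots> = ennreal (?a k) * ennreal ((1 / \<nu> k) powr p x)" using a(1)[of k] by (intro ennreal_mult') simp
      also have "\<dots> = (\<Sum>k\<in>{k}. ennreal (?a k) * (ennreal ((1 / \<nu> k) powr p x) * indicator (E k) x))"
        using xE by simp
      also have "\<dots> \<le> (\<Sum>k. ennreal (?a k) * (ennreal ((1 / \<nu> k) powr p x) * indicator (E k) x))"
        by (rule sum_le_suminf) auto
      finally show ?thesis .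
    qed (simp add: H_def)
    have mod1: "(\<integral>\<^sup>+x. ennreal (H x powr e x) \<partial>lebesgue) \<le> 1"
    proof -
      have "(\<integral>\<^sup>+x. ennreal (H x powr e x) \<partial>lebesgue) \<le>
          (\<integral>\<^sup>+x. (\<Sum>k. ennreal (?a k) * (ennreal ((1 / \<nu> k) powr p x) * indicator (E k) x)) \<partial>lebesgue)"
        by (intro nn_integral_mono bound)
      also have "\<dots> = (\<Sum>k. \<integral>\<^sup>+x. ennreal (?a k) * (ennreal ((1 / \<nu> k) powr p x) * indicator (E k) x) \<partial>lebesgue)"
        by (rule nn_integral_suminf) measurable
      also have "\<dots> = (\<Sum>k. ennreal (?a k) * (\<integral>\<^sup>+x\<in>E k. ennreal ((1 / \<nu> k) powr p x) \<partial>lebesgue))"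
        by (intro suminf_cong nn_integral_cmult) measurable
      also have "\<dots> \<le> (\<Sum>k. ennreal (?a k) * 1)" by (intro suminf_le mult_left_mono modE) auto
      also have "\<dots> = 1"
      proof -
        have sm: "?a sums ((1 - \<eta>) * (1 / (1 - \<eta>)))" by (intro sums_mult geometric_sums) (use \<eta> in simp)
        from suminf_ennreal2[OF less_imp_le[OF a(1)] sums_summable[OF sm]]
        show ?thesis unfolding sums_unique[OF sm, symmetric] mult_1_right using \<eta> by simp
      qed
      finally show ?thesis .
    qed
    \<comment> \<open>The lower part of F contributes at most l to an average, and c l' = l. An
      average of F above 2 l therefore forces an average of H above l'.\<close>
    define l' where "l' = 1 / (M * t powr s)"
    have l': "0 < l'" using M t by (simp add: l'_def)
    define X where "X = {x. ennreal l' < maximal (\<lambda>y. ennreal (H y)) x}"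
    have Xm [measurable]: "X \<in> sets lebesgue" unfolding X_def using open_maximal by (simp add: borel_open)
    have sub: "{x. ennreal (2 * l) < maximal (\<lambda>x. ennreal (F x)) x} \<subseteq> X"
    proof
      fix x assume "x \<in> {x. ennreal (2 * l) < maximal (\<lambda>x. ennreal (F x)) x}"
      then obtain z k where zk: "x \<in> qball z k" and big: "ennreal (2 * l) < ennreal (b powi (- k)) * (\<integral>\<^sup>+y\<in>qball z k. ennreal (F y) \<partial>lebesgue)"
        by (auto simp: less_maximal_iff)
      let ?av = "\<lambda>h. ennreal (b powi (- k)) * (\<integral>\<^sup>+y\<in>qball z k. h y \<partial>lebesgue)"
      have "ennreal l' < ?av (\<lambda>y. ennreal (H y))"
      proof (rule ccontr)
        assume "\<not> ennreal l' < ?av (\<lambda>y. ennreal (H y))"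
        then have small: "?av (\<lambda>y. ennreal (H y)) \<le> ennreal l'" by simp
        have "(\<integral>\<^sup>+y\<in>qball z k. ennreal (F y) \<partial>lebesgue) \<le> (\<integral>\<^sup>+y. ennreal l * indicator (qball z k) y + ennreal c * (ennreal (H y) * indicator (qball z k) y) \<partial>lebesgue)"
        proof (intro nn_integral_mono)
          fix y
          have "F y \<le> l + c * H y" using c l H0[of y] by (auto simp: H_def)
          then have "ennreal (F y) \<le> ennreal (l + c * H y)" by (rule ennreal_leI)
          also have "\<dots> = ennreal l + ennreal c * ennreal (H y)"
            using l c H0[of y] by (simp add: ennreal_plus ennreal_mult')
          finally show "ennreal (F y) * indicator (qball z k) y \<le> ennreal l * indicator (qball z k) y + ennreal c * (ennreal (H y) * indicator (qball z k) y)"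
            by (simp add: indicator_def)
        qed
        also have "\<dots> = (\<integral>\<^sup>+y. ennreal l * indicator (qball z k) y \<partial>lebesgue) + (\<integral>\<^sup>+y. ennreal c * (ennreal (H y) * indicator (qball z k) y) \<partial>lebesgue)"
          by (rule nn_integral_add) measurable
        also have "(\<integral>\<^sup>+y. ennreal l * indicator (qball z k) y \<partial>lebesgue) = ennreal l * ennreal (b powi k)"
          by (simp add: nn_integral_cmult_indicator emeasure_qball)
        also have "(\<integral>\<^sup>+y. ennreal c * (ennreal (H y) * indicator (qball z k) y) \<partial>lebesgue) = ennreal c * (\<integral>\<^sup>+y\<in>qball z k. ennreal (H y) \<partial>lebesgue)"
          by (rule nn_integral_cmult) measurable
        finally have "?av (\<lambda>y. ennreal (F y)) \<le> ennreal (b powi (- k)) * (ennreal l * ennreal (b powi k) + ennreal c * (\<integral>\<^sup>+y\<in>qball z k. ennreal (H y) \<partial>lebesgue))"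
          by (rule mult_left_mono) simp
        also have "\<dots> = (ennreal (b powi (- k)) * ennreal (b powi k)) * ennreal l + ennreal c * ?av (\<lambda>y. ennreal (H y))"
          by (simp only: distrib_left mult_ac)
        also have "ennreal (b powi (- k)) * ennreal (b powi k) = 1"
        proof -
          have "ennreal (b powi (- k)) * ennreal (b powi k) = ennreal (b powi (- k) * b powi k)"
            by (intro ennreal_mult'[symmetric] less_imp_le) simp
          then show ?thesis by (simp only: bpow_cancel ennreal_1)
        qed
        also have "1 * ennreal l + ennreal c * ?av (\<lambda>y. ennreal (H y)) \<le> ennreal l + ennreal c * ennreal l'"
          using small by (simp add: add_left_mono mult_left_mono)
        also have "\<dots> = ennreal (l + c * l')" using l c l' by (simp add: ennreal_plus ennreal_mult')
        also have "l + c * l' = 2 * l" using M t by (simp add: c_def l'_def)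
        finally show False using big by simp
      qed
      then show "x \<in> X" unfolding X_def using zk by (auto simp: less_maximal_iff)
    qed
    have "(\<integral>\<^sup>+x\<in>{x. ennreal (2 * l) < maximal (\<lambda>x. ennreal (F x)) x}. ennreal ((1 / (K * t)) powr p x) \<partial>lebesgue) \<le>
       (\<integral>\<^sup>+x. ennreal (1 / K0) * (ennreal ((l' / 2) powr e x) * indicator X x) \<partial>lebesgue)"
    proof (intro nn_integral_mono)
      fix x
      show "ennreal ((1 / (K * t)) powr p x) * indicator {x. ennreal (2 * l) < maximal (\<lambda>x. ennreal (F x)) x} x \<le>
        ennreal (1 / K0) * (ennreal ((l' / 2) powr e x) * indicator X x)"
      proof (cases "ennreal (2 * l) < maximal (\<lambda>x. ennreal (F x)) x")
        case True
        have "(1 / (K * t)) powr p x = ((1 / (K * t)) powr s) powr e x" by (simp add: powr_powr p_eq)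
        also have "(1 / (K * t)) powr s = 1 / (2 * K0 * M * t powr s)"
          using K t by (simp add: powr_divide powr_mult Ks)
        also have "\<dots> = (l' / 2) * (1 / K0)" by (simp add: l'_def)
        also have "((l' / 2) * (1 / K0)) powr e x = (l' / 2) powr e x * (1 / K0) powr e x" by (rule powr_mult)
        \<comment> \<open>K0 >= 1 and e x >= 1 allow a full factor 1 / K0 to be extracted, which
          cancels the weak type constant.\<close>
        also have "\<dots> \<le> (l' / 2) powr e x * (1 / K0) powr 1"
          using K0(1) e1[of x] by (intro mult_left_mono powr_mono') auto
        finally have "(1 / (K * t)) powr p x \<le> (1 / K0) * (l' / 2) powr e x" using K0(1) by (simp add: mult.commute)
        then have "ennreal ((1 / (K * t)) powr p x) \<le> ennreal (1 / K0) * ennreal ((l' / 2) powr e x)"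
          using K0(1) by (subst ennreal_mult'[symmetric]) (auto intro: ennreal_leI)
        moreover have "x \<in> X" using True sub by auto
        ultimately show ?thesis using True by simp
      qed simp
    qed
    also have "\<dots> = ennreal (1 / K0) * (\<integral>\<^sup>+x\<in>X. ennreal ((l' / 2) powr e x) \<partial>lebesgue)"
      by (rule nn_integral_cmult) measurable
    also have "\<dots> \<le> ennreal (1 / K0) * ennreal K0"
      unfolding X_def by (intro mult_left_mono K0(2) H0 mod1 l') auto
    also have "\<dots> = ennreal (1 / K0 * K0)" using K0(1) by (intro ennreal_mult'[symmetric]) simp
    also have "1 / K0 * K0 = 1" using K0(1) by simp
    finally show ?thesis
      unfolding level_def using K t by (intro set_norm_leI) auto
  qed
  then show ?thesis using that K by blast
qed

lemma level_qnorm_maximal: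
  assumes q: "0 < q"
  obtains D :: real where "0 < D"
    "\<And>F. F \<in> borel_measurable lebesgue \<Longrightarrow> (\<And>x. 0 \<le> F x) \<Longrightarrow>
      level_qnorm q (level p (maximal (\<lambda>x. ennreal (F x)))) \<le> ennreal D * level_qnorm q (level p (\<lambda>x. ennreal (F x)))"
proof -
  obtain K where K: "0 < K"
    "\<And>F l t. F \<in> borel_measurable lebesgue \<Longrightarrow> (\<And>x. 0 \<le> F x) \<Longrightarrow> 0 < l \<Longrightarrow> 0 < t \<Longrightarrow>
      (\<And>k::nat. ennreal (2 powr (real k * \<theta>)) * level p (\<lambda>x. ennreal (F x)) (2 ^ k * l) \<le> ennreal t) \<Longrightarrow>
      level p (maximal (\<lambda>x. ennreal (F x))) (2 * l) \<le> ennreal (K * t)"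
    using level_maximal_le by blast
  obtain D where D: "0 < D"
    "\<And>\<phi> \<gamma>. antimono_pos \<phi> \<Longrightarrow> antimono_pos \<gamma> \<Longrightarrow>
      (\<And>l t. 0 < l \<Longrightarrow> 0 < t \<Longrightarrow> (\<And>k::nat. ennreal (2 powr (real k * \<theta>)) * \<phi> (2 ^ k * l) \<le> ennreal t) \<Longrightarrow> \<gamma> (2 * l) \<le> ennreal (K * t)) \<Longrightarrow>
      level_qnorm q \<gamma> \<le> ennreal D * level_qnorm q \<phi>"
    using level_qnorm_le[OF q _ K(1) \<theta>(1,2), of 2] zero_less_numeral by blast
  show ?thesis
    by (rule that[OF D(1)], rule D(2)[OF antimono_pos_level antimono_pos_level], rule K(2))
qed

text \<open>The weak bound and p >= s make the measure of {F > 2^k L} at most 2^(-k s), and s > 1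
  makes the sum of 2^(k+1) L times these measures finite. Here p_- > 1 yields local
  integrability.\<close>

lemma level_qnorm_finite_integral:
  assumes F [measurable]: "F \<in> borel_measurable lebesgue" and q: "0 < q" and fin: "level_qnorm q (level p F) < \<infinity>"
  obtains L :: real where "0 < L" "(\<integral>\<^sup>+x\<in>{x. ennreal L < F x}. F x \<partial>lebesgue) < \<infinity>"
proof -
  obtain B where B: "0 < B" "\<And>l. 0 < l \<Longrightarrow> level p F l \<le> ennreal (B / l)"
    using level_qnorm_weak[OF q antimono_pos_level fin] by blast
  \<comment> \<open>With this choice the norm of the k-th level set is at most half of 2^-k, hence
    strictly below 2^-k.\<close>
  define L where "L = 2 * B"
  have L: "0 < L" using B by (simp add: L_def)
  define E where "E k = {x. ennreal (2 ^ k * L) < F x}" for k :: nat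
  have E_meas [measurable]: "E k \<in> sets lebesgue" for k
    using measurable_sets[OF F, of "{ennreal (2 ^ k * L)<..}"] by (simp add: vimage_def E_def)
  define \<eta> where "\<eta> = 2 powr (1 - s)"
  have "(2::real) powr (1 - s) < 2 powr 0" using s1 by (intro powr_less_mono) auto
  then have \<eta>: "0 < \<eta>" "\<eta> < 1" by (simp_all add: \<eta>_def)
  have mE: "emeasure lebesgue (E k) \<le> ennreal ((1 / 2 ^ k) powr s)" for k
  proof -
    have l: "0 < 2 ^ k * L" using L by simp
    let ?\<nu> = "1 / 2 ^ k :: real"
    have "set_norm p (E k) \<le> ennreal (B / (2 ^ k * L))"
      using B(2)[OF l] by (simp add: level_def E_def)
    also have "\<dots> < ennreal ?\<nu>" using B(1) by (simp add: L_def ennreal_less_iff field_simps)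
    finally have "(\<integral>\<^sup>+x\<in>E k. ennreal ((1 / ?\<nu>) powr p x) \<partial>lebesgue) \<le> 1"
      by (rule set_norm_lessD) (rule p_nonneg)
    moreover have "(\<integral>\<^sup>+x. ennreal ((1 / ?\<nu>) powr s) * indicator (E k) x \<partial>lebesgue) \<le> (\<integral>\<^sup>+x\<in>E k. ennreal ((1 / ?\<nu>) powr p x) \<partial>lebesgue)"
      by (intro nn_integral_mono mult_right_mono ennreal_leI powr_mono p_ge) auto
    ultimately have "ennreal ((1 / ?\<nu>) powr s) * emeasure lebesgue (E k) \<le> 1"
      by (simp add: nn_integral_cmult_indicator)
    then have "ennreal (?\<nu> powr s) * (ennreal ((1 / ?\<nu>) powr s) * emeasure lebesgue (E k)) \<le> ennreal (?\<nu> powr s) * 1"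
      by (rule mult_left_mono) simp
    moreover have "ennreal (?\<nu> powr s) * ennreal ((1 / ?\<nu>) powr s) = 1"
    proof -
      have "ennreal (?\<nu> powr s) * ennreal ((1 / ?\<nu>) powr s) = ennreal (?\<nu> powr s * (1 / ?\<nu>) powr s)"
        by (intro ennreal_mult'[symmetric]) simp
      also have "?\<nu> powr s * (1 / ?\<nu>) powr s = (?\<nu> * (1 / ?\<nu>)) powr s" by (rule powr_mult[symmetric])
      finally show ?thesis by simp
    qed
    ultimately show ?thesis by (simp add: mult.assoc[symmetric])
  qed
  have bound: "F x * indicator {x. ennreal L < F x} x \<le> (\<Sum>k. ennreal (2 ^ (k + 1) * L) * indicator (E k) x)" for x
  proof (cases "ennreal L < F x")
    case True
    let ?S = "\<Sum>k. ennreal (2 ^ (k + 1) * L) * indicator (E k) x"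
    have ge: "ennreal (2 ^ (k + 1) * L) \<le> ?S" if "x \<in> E k" for k
      using sum_le_suminf[of "\<lambda>k. ennreal (2 ^ (k + 1) * L) * indicator (E k) x" "{k}"] that by simp
    have "F x \<le> ?S"
    proof (cases "F x = \<infinity>")
      case True
      \<comment> \<open>An infinite value lies in every level set, so the terms of the series are
        unbounded.\<close>
      have "?S = \<infinity>"
      proof (rule ccontr)
        assume "?S \<noteq> \<infinity>"
        then obtain y where y: "?S = ennreal y" "0 \<le> y" by (cases ?S rule: ennreal_cases) auto
        obtain k where "y / L < 2 ^ k" using real_arch_pow[of 2 "y / L"] by auto
        then have "y < 2 ^ k * L" using L by (simp add: field_simps)
        also have "\<dots> \<le> 2 ^ (k + 1) * L" using L by simp
        finally have "y < 2 ^ (k + 1) * L" .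
        moreover have "x \<in> E k" using True by (simp add: E_def)
        ultimately show False using ge[of k] y L by (simp add: ennreal_le_iff)
      qed
      then show ?thesis by simp
    next
      case False
      then obtain y where y: "F x = ennreal y" "0 \<le> y" by (cases "F x" rule: ennreal_cases) auto
      have Ly: "L < y" using True y L by (simp add: ennreal_less_iff)
      define n where "n = (LEAST n. y \<le> 2 ^ n * L)"
      obtain n0 where "y / L < 2 ^ n0" using real_arch_pow[of 2 "y / L"] by auto
      then have ex: "y \<le> 2 ^ n0 * L" using L by (simp add: field_simps)
      have n: "y \<le> 2 ^ n * L" unfolding n_def by (rule LeastI[where P = "\<lambda>n. y \<le> 2 ^ n * L", OF ex])
      then have "n \<noteq> 0" using Ly by (intro notI) simp
      then obtain k where k: "n = Suc k" using not0_implies_Suc by blast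
      have "\<not> y \<le> 2 ^ k * L" using not_less_Least[of k "\<lambda>n. y \<le> 2 ^ n * L"] k by (simp add: n_def)
      then have "x \<in> E k" using L y by (simp add: E_def ennreal_less_iff)
      moreover have "F x \<le> ennreal (2 ^ (k + 1) * L)" using n k unfolding y(1) by (intro ennreal_leI) simp
      ultimately show ?thesis using ge order_trans by blast
    qed
    then show ?thesis using True by simp
  qed simp
  have "(\<integral>\<^sup>+x\<in>{x. ennreal L < F x}. F x \<partial>lebesgue) \<le> (\<integral>\<^sup>+x. (\<Sum>k. ennreal (2 ^ (k + 1) * L) * indicator (E k) x) \<partial>lebesgue)"
    by (intro nn_integral_mono bound)
  also have "\<dots> = (\<Sum>k. \<integral>\<^sup>+x. ennreal (2 ^ (k + 1) * L) * indicator (E k) x \<partial>lebesgue)"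
    by (rule nn_integral_suminf) measurable
  also have "\<dots> = (\<Sum>k. ennreal (2 ^ (k + 1) * L) * emeasure lebesgue (E k))"
    by (intro suminf_cong nn_integral_cmult_indicator) simp
  also have "\<dots> \<le> (\<Sum>k. ennreal (2 * L * \<eta> ^ k))"
  proof (intro suminf_le)
    fix k :: nat
    have "ennreal (2 ^ (k + 1) * L) * emeasure lebesgue (E k) \<le> ennreal (2 ^ (k + 1) * L) * ennreal ((1 / 2 ^ k) powr s)"
      by (intro mult_left_mono mE) simp
    also have "\<dots> = ennreal (2 ^ (k + 1) * L * (1 / 2 ^ k) powr s)" using L by (intro ennreal_mult'[symmetric]) simp
    also have "2 ^ (k + 1) * L * (1 / 2 ^ k) powr s = 2 * L * (2 ^ k * (1 / 2 ^ k) powr s)" by simp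
    also have "(2::real) ^ k * (1 / 2 ^ k) powr s = \<eta> ^ k"
      by (simp add: \<eta>_def powr_realpow[symmetric] powr_powr powr_divide powr_diff[symmetric] algebra_simps)
    finally show "ennreal (2 ^ (k + 1) * L) * emeasure lebesgue (E k) \<le> ennreal (2 * L * \<eta> ^ k)" .
  qed auto
  also have "\<dots> < \<infinity>"
  proof -
    have sm: "(\<lambda>k. 2 * L * \<eta> ^ k) sums (2 * L * (1 / (1 - \<eta>)))" by (intro sums_mult geometric_sums) (use \<eta> in simp)
    have "0 \<le> 2 * L * \<eta> ^ k" for k using L \<eta> by simp
    from suminf_ennreal2[OF this sums_summable[OF sm]] show ?thesis by (simp only: ennreal_less_top infinity_ennreal_def)
  qed
  finally show ?thesis using that L by blast
qed

end

section \<open>The radial grand maximal function\<close>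

definition decay_const :: "'a::euclidean_space itself \<Rightarrow> real" where
  "decay_const _ = enn2real (\<integral>\<^sup>+x. ennreal (1 / (1 + norm (x::'a)) ^ (DIM('a) + 1)) \<partial>lebesgue)"

lemma nn_integral_decay:
  "(\<integral>\<^sup>+x. ennreal (1 / (1 + norm (x::'a::euclidean_space)) ^ (DIM('a) + 1)) \<partial>lebesgue) = ennreal (decay_const TYPE('a))"
proof -
  have "(\<integral>\<^sup>+x. ennreal (1 / (1 + norm (x::'a)) ^ (DIM('a) + 1)) \<partial>lebesgue) =
      (\<integral>\<^sup>+x. ennreal (1 / (1 + norm (x::'a)) ^ (DIM('a) + 1)) \<partial>lborel)"
    by (rule nn_integral_completion) 
  then show ?thesis using nn_integral_inverse_norm_power[where 'a = 'a] by (simp add: decay_const_def)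
qed

text \<open>Where F is at most L the decay of \<psi> is integrated, and where F is larger its
  integral is paired with the supremum of \<psi>. One seminorm controls both parts, with a constant
  that depends on F only.\<close>

lemma nn_integral_mult_Schwartz_le:
  fixes F :: "real^'n \<Rightarrow> ennreal"
  assumes F [measurable]: "F \<in> borel_measurable lebesgue" and L: "0 < L"
    and T: "(\<integral>\<^sup>+x\<in>{x. ennreal L < F x}. F x \<partial>lebesgue) < \<infinity>"
  obtains B where "0 \<le> B" "\<And>\<psi>. \<psi> \<in> Schwartz \<Longrightarrow>
    (\<integral>\<^sup>+x. F x * ennreal (cmod (\<psi> x)) \<partial>lebesgue) \<le> ennreal (B * Schwartz_seminorm (DIM(real^'n) + 1) [] \<psi>)"
proof -
  let ?d = "DIM(real^'n) + 1"
  have [measurable]: "{x. ennreal L < F x} \<in> sets lebesgue"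
    using measurable_sets[OF F, of "{ennreal L<..}"] by (simp add: vimage_def)
  define t where "t = enn2real (\<integral>\<^sup>+x\<in>{x. ennreal L < F x}. F x \<partial>lebesgue)"
  have t: "(\<integral>\<^sup>+x\<in>{x. ennreal L < F x}. F x \<partial>lebesgue) = ennreal t" "0 \<le> t" using T by (auto simp: t_def)
  let ?I = "decay_const TYPE(real^'n)"
  have I0: "0 \<le> ?I" by (simp add: decay_const_def)
  have "(\<integral>\<^sup>+x. F x * ennreal (cmod (\<psi> x)) \<partial>lebesgue) \<le> ennreal ((L * ?I + t) * Schwartz_seminorm ?d [] \<psi>)"
    if \<psi>: "\<psi> \<in> Schwartz" for \<psi>
  proof -
    let ?S = "Schwartz_seminorm ?d [] \<psi>"
    have S0: "0 \<le> ?S" by (rule Schwartz_seminorm_nonneg[OF \<psi>])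
    have le: "cmod (\<psi> x) \<le> ?S * (1 / (1 + norm x) ^ ?d)" for x
    proof -
      have "0 < (1 + norm x) ^ ?d" by (intro zero_less_power add_pos_nonneg) auto
      then show ?thesis using Schwartz_seminorm_ge[OF \<psi>, of x ?d "[]"] by (simp only: iter_partial_Nil times_divide_eq_right mult_1_right pos_le_divide_eq mult.commute)
    qed
    have le': "cmod (\<psi> x) \<le> ?S" for x
    proof -
      have "1 / (1 + norm x) ^ ?d \<le> 1" by (simp add: divide_le_eq_1 one_le_power add_pos_nonneg del: power_Suc)
      then have "?S * (1 / (1 + norm x) ^ ?d) \<le> ?S * 1" using S0 by (rule mult_left_mono)
      then show ?thesis using le[of x] by simp
    qed
    have m1: "(\<lambda>x::real^'n. ennreal (1 / (1 + norm x) ^ ?d)) \<in> borel_measurable lebesgue"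
      by (rule measurable_completion) measurable
    have m2: "(\<lambda>x. F x * indicator {x. ennreal L < F x} x) \<in> borel_measurable lebesgue"
      by (rule borel_measurable_times_ennreal[OF F borel_measurable_indicator]) fact
    have "(\<integral>\<^sup>+x. F x * ennreal (cmod (\<psi> x)) \<partial>lebesgue) \<le>
      (\<integral>\<^sup>+x. ennreal (L * ?S) * ennreal (1 / (1 + norm x) ^ ?d) + ennreal ?S * (F x * indicator {x. ennreal L < F x} x) \<partial>lebesgue)"
    proof (intro nn_integral_mono)
      fix x
      show "F x * ennreal (cmod (\<psi> x)) \<le> ennreal (L * ?S) * ennreal (1 / (1 + norm x) ^ ?d) + ennreal ?S * (F x * indicator {x. ennreal L < F x} x)"
      proof (cases "ennreal L < F x")
        case True
        have "F x * ennreal (cmod (\<psi> x)) \<le> F x * ennreal ?S" by (intro mult_left_mono ennreal_leI le') auto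
        also have "\<dots> \<le> ennreal (L * ?S) * ennreal (1 / (1 + norm x) ^ ?d) + ennreal ?S * (F x * indicator {x. ennreal L < F x} x)"
          using True by (simp add: mult.commute)
        finally show ?thesis .
      next
        case False
        then have "F x * ennreal (cmod (\<psi> x)) \<le> ennreal L * ennreal (?S * (1 / (1 + norm x) ^ ?d))"
          by (intro mult_mono ennreal_leI le) auto
        also have "\<dots> = ennreal (L * ?S) * ennreal (1 / (1 + norm x) ^ ?d)"
          using L S0 by (simp only: ennreal_mult' less_imp_le mult.assoc)
        finally show ?thesis by (simp add: add_increasing2)
      qed
    qed
    also have "\<dots> = (\<integral>\<^sup>+x. ennreal (L * ?S) * ennreal (1 / (1 + norm (x::real^'n)) ^ ?d) \<partial>lebesgue) +
        (\<integral>\<^sup>+x. ennreal ?S * (F x * indicator {x. ennreal L < F x} x) \<partial>lebesgue)"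
      by (intro nn_integral_add borel_measurable_times_ennreal borel_measurable_const m1 m2)
    also have "(\<integral>\<^sup>+x. ennreal (L * ?S) * ennreal (1 / (1 + norm (x::real^'n)) ^ ?d) \<partial>lebesgue) = ennreal (L * ?S) * ennreal ?I"
      unfolding nn_integral_decay[symmetric] by (rule nn_integral_cmult[OF m1])
    also have "(\<integral>\<^sup>+x. ennreal ?S * (F x * indicator {x. ennreal L < F x} x) \<partial>lebesgue) = ennreal ?S * ennreal t"
      unfolding t(1)[symmetric] by (rule nn_integral_cmult[OF m2])
    also have "ennreal (L * ?S) * ennreal ?I + ennreal ?S * ennreal t = ennreal ((L * ?I + t) * ?S)"
    proof -
      have "ennreal (L * ?S) * ennreal ?I = ennreal (L * ?S * ?I)" using L S0 by (intro ennreal_mult'[symmetric]) simp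
      moreover have "ennreal ?S * ennreal t = ennreal (?S * t)" using S0 by (intro ennreal_mult'[symmetric]) simp
      moreover have "ennreal (L * ?S * ?I) + ennreal (?S * t) = ennreal (L * ?S * ?I + ?S * t)"
        using L S0 I0 t(2) by (intro ennreal_plus[symmetric]) auto
      moreover have "L * ?S * ?I + ?S * t = (L * ?I + t) * ?S" by (simp only: algebra_simps)
      ultimately show ?thesis by simp
    qed
    finally show ?thesis .
  qed
  moreover have "0 \<le> L * ?I + t" using L I0 t(2) by simp
  ultimately show ?thesis using that by blast
qed

lemma defines_tempered_distributionI:
  fixes f :: "real^'n \<Rightarrow> complex"
  assumes f [measurable]: "f \<in> borel_measurable lebesgue" and L: "0 < L"
    and T: "(\<integral>\<^sup>+x\<in>{x. ennreal L < ennreal (cmod (f x))}. ennreal (cmod (f x)) \<partial>lebesgue) < \<infinity>"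
  shows "defines_tempered_distribution f"
proof -
  have "(\<lambda>x. ennreal (cmod (f x))) \<in> borel_measurable lebesgue" by measurable
  from nn_integral_mult_Schwartz_le[OF this L T] obtain B where B: "0 \<le> B"
    "\<And>\<psi>. \<psi> \<in> Schwartz \<Longrightarrow> (\<integral>\<^sup>+x. ennreal (cmod (f x)) * ennreal (cmod (\<psi> x)) \<partial>lebesgue) \<le> ennreal (B * Schwartz_seminorm (DIM(real^'n) + 1) [] \<psi>)"
    by blast
  have nn: "(\<integral>\<^sup>+x. ennreal (norm (f x * \<psi> x)) \<partial>lebesgue) \<le> ennreal (B * Schwartz_seminorm (DIM(real^'n) + 1) [] \<psi>)" if "\<psi> \<in> Schwartz" for \<psi>
    using B(2)[OF that] by (simp add: norm_mult ennreal_mult)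
  have int: "integrable lebesgue (\<lambda>x. f x * \<psi> x)" if \<psi>: "\<psi> \<in> Schwartz" for \<psi>
  proof (rule integrableI_bounded)
    have [measurable]: "\<psi> \<in> borel_measurable lebesgue" by (rule Schwartz_lebesgue[OF \<psi>])
    show "(\<lambda>x. f x * \<psi> x) \<in> borel_measurable lebesgue" by measurable
    show "(\<integral>\<^sup>+x. ennreal (norm (f x * \<psi> x)) \<partial>lebesgue) < \<infinity>"
      by (rule le_less_trans[OF nn[OF \<psi>]]) simp
  qed
  have "distribution_of f \<in> tempered_distributions"
  proof (rule tempered_distributionI[where C = B])
    show "distribution_of f \<in> extensional Schwartz" by (simp add: distribution_of_def)
    show "distribution_of f (\<lambda>x. \<phi> x + \<psi> x) = distribution_of f \<phi> + distribution_of f \<psi>"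
      if "\<phi> \<in> Schwartz" "\<psi> \<in> Schwartz" for \<phi> \<psi>
    proof -
      have "(\<integral>x. f x * (\<phi> x + \<psi> x) \<partial>lebesgue) = (\<integral>x. f x * \<phi> x \<partial>lebesgue) + (\<integral>x. f x * \<psi> x \<partial>lebesgue)"
        unfolding distrib_left by (rule Bochner_Integration.integral_add[OF int[OF that(1)] int[OF that(2)]])
      then show ?thesis using Schwartz_add[OF that] that by (simp only: distribution_of_def restrict_apply' )
    qed
    show "distribution_of f (\<lambda>x. c * \<phi> x) = c * distribution_of f \<phi>" if "\<phi> \<in> Schwartz" for c \<phi>
    proof -
      have "(\<integral>x. f x * (c * \<phi> x) \<partial>lebesgue) = (\<integral>x. c * (f x * \<phi> x) \<partial>lebesgue)" by (simp add: mult_ac)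
      also have "\<dots> = c * (\<integral>x. f x * \<phi> x \<partial>lebesgue)" by (rule Bochner_Integration.integral_mult_right_zero)
      finally show ?thesis using Schwartz_cmult[OF that] that by (simp add: distribution_of_def)
    qed
    fix \<psi> :: "real^'n \<Rightarrow> complex" assume \<psi>: "\<psi> \<in> Schwartz"
    have "ennreal (cmod (\<integral>x. f x * \<psi> x \<partial>lebesgue)) \<le> ennreal (B * Schwartz_seminorm (DIM(real^'n) + 1) [] \<psi>)"
      by (rule order_trans[OF integral_norm_bound_ennreal[OF int[OF \<psi>]] nn[OF \<psi>]])
    then show "cmod (distribution_of f \<psi>) \<le> B * Schwartz_seminorm (DIM(real^'n) + 1) [] \<psi>"
      using B(1) Schwartz_seminorm_nonneg[OF \<psi>] \<psi> by (simp add: distribution_of_def)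
  qed
  with int show ?thesis by (simp add: defines_tempered_distribution_def)
qed

context ellipsoid_dilation
begin

section \<open>Domination by the maximal operator\<close>

lemma dilate_fun_eq: "dilate_fun A k \<phi> = (\<lambda>x. complex_of_real (b powi (- k)) * \<phi> (pw (- k) x))"
  by (simp add: fun_eq_iff dilate_fun_def)

lemma dilate_fun_Schwartz: "\<phi> \<in> Schwartz \<Longrightarrow> dilate_fun A k \<phi> \<in> Schwartz"
  unfolding dilate_fun_eq by (rule Schwartz_cmult[OF Schwartz_linear_compose[OF _ linear_pw inj_pw]])

lemma Schwartz_N_D: "\<phi> \<in> Schwartz_N A \<Delta> N \<Longrightarrow> \<phi> \<in> Schwartz"
  by (simp add: Schwartz_N_def)

text \<open>The supremum ranges over an uncountable family, so measurability comes from lower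
  semicontinuity: each convolution is continuous and superlevel sets are unions of open
  sets.\<close>

lemma radial_grand_maximal_measurable:
  assumes u: "u \<in> tempered_distributions"
  shows "radial_grand_maximal A \<Delta> N u \<in> borel_measurable lebesgue"
proof -
  let ?g = "\<lambda>\<phi> k x. ennreal (cmod (convolve_distribution u (dilate_fun A k \<phi>) x))"
  have "radial_grand_maximal A \<Delta> N u \<in> borel_measurable borel"
  proof (rule borel_measurableI_greater)
    fix l
    have "{x. l < radial_grand_maximal A \<Delta> N u x} = (\<Union>\<phi>\<in>Schwartz_N A \<Delta> N. \<Union>k. {x. l < ?g \<phi> k x})"
      by (auto simp: radial_grand_maximal_def less_SUP_iff)
    also have "open \<dots>"
    proof (intro open_UN ballI)
      fix \<phi> k assume "\<phi> \<in> Schwartz_N A \<Delta> N"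
      then have "continuous_on UNIV (\<lambda>x. convolve_distribution u (dilate_fun A k \<phi>) x)"
        unfolding convolve_distribution_def
        by (intro tempered_conv_continuous u dilate_fun_Schwartz Schwartz_N_D)
      then show "open {x. l < ?g \<phi> k x}"
        by (intro open_Collect_less continuous_on_const continuous_on_ennreal continuous_on_norm)
    qed
    finally show "{x \<in> space borel. l < radial_grand_maximal A \<Delta> N u x} \<in> sets borel" by simp
  qed
  then show ?thesis by (intro measurable_completion) simp
qed

lemma radial_grand_maximal_ge:
  "\<phi> \<in> Schwartz_N A \<Delta> N \<Longrightarrow> ennreal (cmod (convolve_distribution u (dilate_fun A k \<phi>) x)) \<le> radial_grand_maximal A \<Delta> N u x"
  unfolding radial_grand_maximal_def by (intro SUP_upper2[of \<phi>] SUP_upper2[of k]) auto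

lemma tail_dilate:
  "tail (pw (- k) (x - y)) = indicator (qball x k) y + (\<Sum>j. ennreal (1 / b ^ (2 * j)) * indicator (qball x (k + (int j + 1))) y)"
proof -
  have "(pw (- k) (x - y) \<in> qball 0 i) = (y \<in> qball x (k + i))" for i
  proof -
    have "pw (- (k + i)) (x - y) = pw (- i) (pw (- k) (x - y))" by (simp only: pw_add[symmetric]) (simp add: add.commute)
    then have "(pw (- k) (x - y) \<in> qball 0 i) = (x \<in> qball y (k + i))" by (simp only: mem_qball diff_zero)
    then show ?thesis using mem_qball_sym by blast
  qed
  then show ?thesis unfolding tail_def indicator_def by simp
qed

text \<open>N >= 2 bounds a test function by min(1, rho^-2), hence by \<open>tail\<close>. A dilate
  of \<open>tail\<close> is a weighted sum of indicators of balls around x, each controlled by the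
  maximal function.\<close>

lemma radial_grand_maximal_le_maximal:
  assumes f [measurable]: "f \<in> borel_measurable lebesgue" and N: "2 \<le> N"
  shows "radial_grand_maximal A \<Delta> N (distribution_of f) x \<le> ennreal (1 + b * (1 / (1 - 1 / b))) * maximal (\<lambda>y. ennreal (cmod (f y))) x"
proof -
  let ?F = "\<lambda>y. ennreal (cmod (f y))"
  let ?M = "maximal ?F x"
  have "ennreal (cmod (convolve_distribution (distribution_of f) (dilate_fun A k \<phi>) x)) \<le> ennreal (1 + b * (1 / (1 - 1 / b))) * ?M"
    if \<phi>: "\<phi> \<in> Schwartz_N A \<Delta> N" for \<phi> k
  proof -
    let ?w = "dilate_fun A k \<phi>"
    have wS: "(\<lambda>y. ?w (x - y)) \<in> Schwartz" by (intro Schwartz_reflect dilate_fun_Schwartz Schwartz_N_D[OF \<phi>])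
    have "ennreal (cmod (convolve_distribution (distribution_of f) ?w x)) = ennreal (cmod (\<integral>y. f y * ?w (x - y) \<partial>lebesgue))"
      using wS by (simp add: convolve_distribution_def distribution_of_def)
    \<comment> \<open>Without integrability the Bochner integral is 0, so the inequality holds in
      either case.\<close>
    also have "\<dots> \<le> (\<integral>\<^sup>+y. ennreal (norm (f y * ?w (x - y))) \<partial>lebesgue)"
    proof (cases "integrable lebesgue (\<lambda>y. f y * ?w (x - y))")
      case True then show ?thesis by (rule integral_norm_bound_ennreal)
    qed (simp add: not_integrable_integral_eq)
    also have "\<dots> \<le> (\<integral>\<^sup>+y. ennreal (b powi (- k)) * (?F y * indicator (qball x k) y +
        (\<Sum>j. ennreal (1 / b ^ (2 * j)) * (?F y * indicator (qball x (k + (int j + 1))) y))) \<partial>lebesgue)"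
    proof (intro nn_integral_mono)
      fix y
      let ?v = "pw (- k) (x - y)"
      have 0: "step_norm A \<Delta> z ^ l * cmod (\<phi> z) \<le> 1" if "l \<le> N" for l z
      proof -
        have "\<forall>js l z. length js \<le> N \<longrightarrow> l \<le> N \<longrightarrow> step_norm A \<Delta> z ^ l * cmod (iter_partial js \<phi> z) \<le> 1"
          using \<phi> by (simp add: Schwartz_N_def)
        from this[rule_format, of "[]" l z] that show ?thesis by simp
      qed
      have "ennreal (cmod (\<phi> ?v)) \<le> tail ?v"
        using 0[of 0 ?v] 0[of 2 ?v] N by (intro tail_ge) (simp_all add: mult.commute)
      then have "ennreal (b powi (- k)) * (?F y * ennreal (cmod (\<phi> ?v))) \<le> ennreal (b powi (- k)) * (?F y * tail ?v)"
        by (intro mult_left_mono) auto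
      moreover have "ennreal (norm (f y * ?w (x - y))) = ennreal (b powi (- k)) * (?F y * ennreal (cmod (\<phi> ?v)))"
      proof -
        have "norm (f y * ?w (x - y)) = b powi (- k) * (cmod (f y) * cmod (\<phi> ?v))"
          using less_imp_le[OF bpow_pos, of "- k"] unfolding dilate_fun_eq by (simp only: norm_mult norm_of_real abs_of_nonneg mult_ac)
        then show ?thesis using less_imp_le[OF bpow_pos, of "- k"] by (simp only: ennreal_mult' norm_ge_zero)
      qed
      moreover have "?F y * tail ?v = ?F y * indicator (qball x k) y +
        (\<Sum>j. ennreal (1 / b ^ (2 * j)) * (?F y * indicator (qball x (k + (int j + 1))) y))"
        unfolding tail_dilate distrib_left ennreal_suminf_cmult[symmetric] by (simp only: mult.left_commute)
      ultimately show "ennreal (norm (f y * ?w (x - y))) \<le> ennreal (b powi (- k)) * (?F y * indicator (qball x k) y +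
        (\<Sum>j. ennreal (1 / b ^ (2 * j)) * (?F y * indicator (qball x (k + (int j + 1))) y)))" by simp
    qed
    also have "\<dots> = ennreal (b powi (- k)) * ((\<integral>\<^sup>+y\<in>qball x k. ?F y \<partial>lebesgue) +
        (\<Sum>j. ennreal (1 / b ^ (2 * j)) * (\<integral>\<^sup>+y\<in>qball x (k + (int j + 1)). ?F y \<partial>lebesgue)))"
    proof -
      have 1: "(\<integral>\<^sup>+y. (\<Sum>j. ennreal (1 / b ^ (2 * j)) * (?F y * indicator (qball x (k + (int j + 1))) y)) \<partial>lebesgue) =
         (\<Sum>j. \<integral>\<^sup>+y. ennreal (1 / b ^ (2 * j)) * (?F y * indicator (qball x (k + (int j + 1))) y) \<partial>lebesgue)"
        by (rule nn_integral_suminf) measurable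
      also have "\<dots> = (\<Sum>j. ennreal (1 / b ^ (2 * j)) * (\<integral>\<^sup>+y\<in>qball x (k + (int j + 1)). ?F y \<partial>lebesgue))"
        by (intro suminf_cong nn_integral_cmult) measurable
      finally have 2: "(\<integral>\<^sup>+y. ?F y * indicator (qball x k) y + (\<Sum>j. ennreal (1 / b ^ (2 * j)) * (?F y * indicator (qball x (k + (int j + 1))) y)) \<partial>lebesgue) =
        (\<integral>\<^sup>+y\<in>qball x k. ?F y \<partial>lebesgue) + (\<Sum>j. ennreal (1 / b ^ (2 * j)) * (\<integral>\<^sup>+y\<in>qball x (k + (int j + 1)). ?F y \<partial>lebesgue))"
        by (subst nn_integral_add) (simp, measurable)
      show ?thesis unfolding 2[symmetric] by (rule nn_integral_cmult) measurable
    qed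
    also have "\<dots> = ennreal (b powi (- k)) * (\<integral>\<^sup>+y\<in>qball x k. ?F y \<partial>lebesgue) +
        (\<Sum>j. ennreal (b powi (- k)) * (ennreal (1 / b ^ (2 * j)) * (\<integral>\<^sup>+y\<in>qball x (k + (int j + 1)). ?F y \<partial>lebesgue)))"
      unfolding distrib_left ennreal_suminf_cmult ..
    \<comment> \<open>The ball of index j is j + 1 scales above k, so its average enters with the
      factor b^(j+1) b^(-2j) = b b^(-j).\<close>
    also have "\<dots> \<le> ?M + (\<Sum>j. ennreal (b * (1 / b) ^ j) * ?M)"
    proof (intro add_mono suminf_le allI summableI)
      show "ennreal (b powi (- k)) * (\<integral>\<^sup>+y\<in>qball x k. ?F y \<partial>lebesgue) \<le> ?M"
        by (rule maximal_ge) simp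
      fix j
      let ?i = "k + (int j + 1)"
      have "b powi (- k) * (1 / b ^ (2 * j)) = (b * (1 / b) ^ j) * b powi (- ?i)"
      proof -
        have "b powi (- ?i) = b powi (- k) * b powi (- int j) * b powi (- 1)"
        proof -
          have "- ?i = (- k + - int j) + - 1" by simp
          then show ?thesis by (simp only: power_int_add[OF disjI1[OF b_nz]])
        qed
        also have "b powi (- int j) = (1 / b) ^ j" by (simp add: power_int_minus power_one_over inverse_eq_divide)
        finally have "(b * (1 / b) ^ j) * b powi (- ?i) = b powi (- k) * ((1 / b) ^ j * (1 / b) ^ j) * (b * b powi (- 1))"
          by (simp only: mult_ac)
        also have "b * b powi (- 1) = 1" using b_nz by (simp add: power_int_minus)
        also have "(1 / b) ^ j * (1 / b) ^ j = 1 / b ^ (2 * j)" by (simp add: power_add[symmetric] power_one_over mult_2)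
        finally show ?thesis by simp
      qed
      then have "ennreal (b powi (- k)) * ennreal (1 / b ^ (2 * j)) = ennreal (b * (1 / b) ^ j) * ennreal (b powi (- ?i))"
        using less_imp_le[OF bpow_pos, of "- k"] b0
        by (metis (no_types, opaque_lifting) ennreal_mult' less_imp_le zero_le_divide_1_iff zero_le_power mult_nonneg_nonneg)
      then have "ennreal (b powi (- k)) * (ennreal (1 / b ^ (2 * j)) * (\<integral>\<^sup>+y\<in>qball x ?i. ?F y \<partial>lebesgue)) =
          ennreal (b * (1 / b) ^ j) * (ennreal (b powi (- ?i)) * (\<integral>\<^sup>+y\<in>qball x ?i. ?F y \<partial>lebesgue))"
        by (simp only: mult.assoc[symmetric])
      also have "\<dots> \<le> ennreal (b * (1 / b) ^ j) * ?M" by (intro mult_left_mono maximal_ge) auto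
      finally show "ennreal (b powi (- k)) * (ennreal (1 / b ^ (2 * j)) * (\<integral>\<^sup>+y\<in>qball x ?i. ?F y \<partial>lebesgue)) \<le> ennreal (b * (1 / b) ^ j) * ?M" .
    qed
    also have "(\<Sum>j. ennreal (b * (1 / b) ^ j) * ?M) = ennreal (b * (1 / (1 - 1 / b))) * ?M"
      unfolding ennreal_suminf_multc using b0 by (simp only: b_geometric less_imp_le)
    also have "?M + ennreal (b * (1 / (1 - 1 / b))) * ?M = (1 + ennreal (b * (1 / (1 - 1 / b)))) * ?M"
      by (simp only: distrib_right mult_1_left)
    also have "1 + ennreal (b * (1 / (1 - 1 / b))) = ennreal (1 + b * (1 / (1 - 1 / b)))"
      using b1 by (subst ennreal_plus) auto
    finally show ?thesis .
  qed
  then show ?thesis unfolding radial_grand_maximal_def by (intro SUP_least)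
qed

section \<open>Approximate identities and representation by a function\<close>

lemma Schwartz_N_multiple:
  assumes \<phi>: "\<phi> \<in> Schwartz"
  obtains c :: real where "0 < c" "(\<lambda>x. complex_of_real c * \<phi> x) \<in> Schwartz_N A \<Delta> N"
proof -
  obtain C M where C: "0 < C" "\<And>x. \<rho> x \<le> C * (1 + norm x) ^ M" using step_norm_growth by blast
  let ?B = "\<lambda>js l. C ^ l * Schwartz_seminorm (M * l) js \<phi>"
  define J where "J = {js :: 'n list. set js \<subseteq> UNIV \<and> length js \<le> N} \<times> {..N}"
  have finJ: "finite J" unfolding J_def by (intro finite_cartesian_product finite_lists_length_le) auto
  \<comment> \<open>A bound for all the finitely many quantities that define
    \<open>Schwartz_N\<close> at once; polynomial growth of the quasi-norm turns each into a
    Schwartz seminorm. The summand 1 permits division.\<close>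
  define T where "T = 1 + (\<Sum>(js, l)\<in>J. ?B js l)"
  have B0: "0 \<le> ?B js l" for js l using C(1) Schwartz_seminorm_nonneg[OF \<phi>] by simp
  have S0: "0 \<le> (\<Sum>(js, l)\<in>J. ?B js l)" using B0 by (intro sum_nonneg) auto
  then have T: "0 < T" by (simp add: T_def)
  have "\<rho> x ^ l * cmod (iter_partial js (\<lambda>x. complex_of_real (1 / T) * \<phi> x) x) \<le> 1" if "length js \<le> N" "l \<le> N" for js l x
  proof -
    have "\<rho> x ^ l \<le> (C * (1 + norm x) ^ M) ^ l" by (intro power_mono C step_norm_nonneg)
    also have "\<dots> = C ^ l * (1 + norm x) ^ (M * l)" by (simp add: power_mult_distrib power_mult)
    finally have "\<rho> x ^ l * cmod (iter_partial js \<phi> x) \<le> (C ^ l * (1 + norm x) ^ (M * l)) * cmod (iter_partial js \<phi> x)"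
      by (intro mult_right_mono) auto
    also have "\<dots> = C ^ l * ((1 + norm x) ^ (M * l) * cmod (iter_partial js \<phi> x))" by (simp only: mult.assoc)
    also have "\<dots> \<le> ?B js l" using C(1) by (intro mult_left_mono Schwartz_seminorm_ge \<phi>) auto
    also have "\<dots> \<le> (\<Sum>(js, l)\<in>J. ?B js l)"
      using member_le_sum[of "(js, l)" J "\<lambda>(js, l). ?B js l"] that finJ B0 by (auto simp: J_def)
    also have "\<dots> \<le> T" by (simp add: T_def)
    finally have "\<rho> x ^ l * cmod (iter_partial js \<phi> x) \<le> T" .
    then have "(1 / T) * (\<rho> x ^ l * cmod (iter_partial js \<phi> x)) \<le> 1" using T by (simp add: field_simps)
    moreover have "cmod (iter_partial js (\<lambda>x. complex_of_real (1 / T) * \<phi> x) x) = (1 / T) * cmod (iter_partial js \<phi> x)"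
      using T unfolding iter_partial_cmult[OF \<phi>] norm_mult norm_of_real by simp
    ultimately show ?thesis by (simp only: mult.left_commute)
  qed
  then have "(\<lambda>x. complex_of_real (1 / T) * \<phi> x) \<in> Schwartz_N A \<Delta> N"
    unfolding Schwartz_N_def by (intro CollectI conjI allI impI Schwartz_cmult \<phi>)
  then show ?thesis using that[of "1 / T"] T by simp
qed

lemma integral_pw:
  fixes h :: "real^'n \<Rightarrow> 'b::{banach, second_countable_topology}"
  assumes "h \<in> borel_measurable borel"
  shows "(\<integral>x. b ^ j *\<^sub>R h (pw (int j) x) \<partial>lborel) = (\<integral>x. h x \<partial>lborel)"
proof (induction j)
  case (Suc j)
  have [measurable]: "pw (int j) \<in> borel \<rightarrow>\<^sub>M borel"
    by (intro borel_measurable_continuous_onI continuous_pw continuous_on_id)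
  have m: "(\<lambda>x. b ^ j *\<^sub>R h (pw (int j) x)) \<in> borel_measurable borel" using assms by measurable
  have inj: "inj ((*v) A)" by (rule injI) (metis A_inv(2))
  have "pw (int (Suc j)) x = pw (int j) (A *v x)" for x
    using pw_add[of "int j" 1 x] pw_plus1[of 0 x] by (simp add: add.commute)
  then have "(\<integral>x. b ^ Suc j *\<^sub>R h (pw (int (Suc j)) x) \<partial>lborel) =
     (\<integral>x. \<bar>det (matrix ((*v) A))\<bar> *\<^sub>R (b ^ j *\<^sub>R h (pw (int j) (A *v x))) \<partial>lborel)"
    by (simp add: dilation_factor_def)
  also have "\<dots> = (\<integral>x. b ^ j *\<^sub>R h (pw (int j) x) \<partial>lborel)"
    by (rule lborel_integral_linear[OF matrix_vector_mul_linear inj m])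
  finally show ?case using Suc by simp
qed simp

text \<open>Negative indices contract the kernel towards 0. After the change of variables the
  inverse powers of \<open>A\<close> act on the weight, and contraction by r makes the first moment
  decay like r^-j.\<close>

lemma dilated_approximate_identity:
  fixes u :: "(real^'n \<Rightarrow> complex) \<Rightarrow> complex"
  assumes u: "u \<in> tempered_distributions" and \<phi>: "\<phi> \<in> Schwartz" and \<psi>: "\<psi> \<in> Schwartz"
  shows "(\<lambda>j. \<integral>x. \<psi> x * convolve_distribution u (dilate_fun A (- int j) \<phi>) x \<partial>lborel) \<longlonglongrightarrow> (\<integral>x. \<phi> x \<partial>lborel) * u \<psi>"
  unfolding convolve_distribution_def
proof (rule tempered_approximate_identity[OF u \<psi>])
  let ?w = "\<lambda>j. dilate_fun A (- int j) \<phi>"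
  have [measurable]: "\<phi> \<in> borel_measurable borel" by (rule Schwartz_borel[OF \<phi>])
  have w: "?w j x = b ^ j *\<^sub>R \<phi> (pw (int j) x)" for j x
    unfolding dilate_fun_eq by (simp add: scaleR_conv_of_real)
  show "?w j \<in> Schwartz" for j by (rule dilate_fun_Schwartz[OF \<phi>])
  show "(\<integral>x. ?w j x \<partial>lborel) = (\<integral>x. \<phi> x \<partial>lborel)" for j
    unfolding w by (rule integral_pw) measurable
  fix m
  obtain K where K: "0 < K" "\<And>x. norm x \<le> K * nrm x" "\<And>x. nrm x \<le> K * norm x" using nrm_bounds by metis
  \<comment> \<open>K * K accounts for passing from the Euclidean norm to the gauge and back; L >= 1
    also covers the summand 1 of the weight.\<close>
  define L where "L = max 1 (K * K)"
  have L: "1 \<le> L" "K * K \<le> L" by (auto simp: L_def)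
  have npw: "norm (pw (- int j) x) \<le> (1 / r) ^ j * (L * norm x)" for j x
  proof -
    have "norm (pw (- int j) x) \<le> K * (nrm x / r ^ j)"
      using K(1) by (intro order_trans[OF K(2)] mult_left_mono nrm_pw_neg) auto
    also have "\<dots> \<le> K * ((K * norm x) / r ^ j)"
      using K(1) r1 by (intro mult_left_mono divide_right_mono K(3)) auto
    also have "\<dots> = (1 / r) ^ j * ((K * K) * norm x)" by (simp add: power_one_over)
    also have "\<dots> \<le> (1 / r) ^ j * (L * norm x)" using r1 L by (intro mult_left_mono mult_right_mono) auto
    finally show ?thesis .
  qed
  have r0: "0 \<le> (1 / r) ^ j" "(1 / r) ^ j \<le> 1" for j using r1 by (auto intro!: power_le_one)
  define I where "I = (\<integral>x. (1 + norm x) ^ (m + 1) * cmod (\<phi> x) \<partial>lborel)"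
  have bd: "(\<integral>x. cmod (?w j x) * (norm x * (1 + norm x) ^ m) \<partial>lborel) \<le> (1 / r) ^ j * (L ^ (m + 1) * I)" for j
  proof -
    let ?h = "\<lambda>x. cmod (\<phi> x) * (norm (pw (- int j) x) * (1 + norm (pw (- int j) x)) ^ m)"
    have [measurable]: "pw (- int j) \<in> borel \<rightarrow>\<^sub>M borel"
      by (intro borel_measurable_continuous_onI continuous_pw continuous_on_id)
    have hm: "?h \<in> borel_measurable borel" by measurable
    have hb: "?h x \<le> (1 / r) ^ j * L ^ (m + 1) * ((1 + norm x) ^ (m + 1) * cmod (\<phi> x))" for x
    proof -
      have 1: "norm (pw (- int j) x) \<le> (1 / r) ^ j * (L * (1 + norm x))"
        using L(1) r0 by (intro order_trans[OF npw] mult_left_mono) auto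
      have "(1 / r) ^ j * (L * norm x) \<le> 1 * (L * norm x)" using L(1) r0 by (intro mult_right_mono) auto
      then have "norm (pw (- int j) x) \<le> L * norm x" using npw[of j x] by linarith
      then have 2: "1 + norm (pw (- int j) x) \<le> L * (1 + norm x)"
        using L(1) by (simp add: distrib_left)
      have "norm (pw (- int j) x) * (1 + norm (pw (- int j) x)) ^ m \<le> ((1 / r) ^ j * (L * (1 + norm x))) * (L * (1 + norm x)) ^ m"
        using 1 2 L(1) r0 by (intro mult_mono power_mono) auto
      then have "?h x \<le> cmod (\<phi> x) * (((1 / r) ^ j * (L * (1 + norm x))) * (L * (1 + norm x)) ^ m)"
        by (rule mult_left_mono) simp
      also have "\<dots> = (1 / r) ^ j * L ^ (m + 1) * ((1 + norm x) ^ (m + 1) * cmod (\<phi> x))"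
        by (simp only: power_add power_one_right power_mult_distrib mult_ac)
      finally show ?thesis .
    qed
    have hi: "integrable lborel (\<lambda>x. (1 / r) ^ j * L ^ (m + 1) * ((1 + norm x) ^ (m + 1) * cmod (\<phi> x)))"
      by (intro integrable_mult_right Schwartz_integrable_weight \<phi>)
    have hint: "integrable lborel ?h"
    proof (rule Bochner_Integration.integrable_bound[OF hi])
      show "?h \<in> borel_measurable lborel" using hm by simp
      show "AE x in lborel. norm (?h x) \<le> norm ((1 / r) ^ j * L ^ (m + 1) * ((1 + norm x) ^ (m + 1) * cmod (\<phi> x)))"
      proof (intro AE_I2)
        fix x
        have "norm (?h x) = ?h x" by simp
        then show "norm (?h x) \<le> norm ((1 / r) ^ j * L ^ (m + 1) * ((1 + norm x) ^ (m + 1) * cmod (\<phi> x)))"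
          using order_trans[OF hb[of x] abs_ge_self] by (simp only: real_norm_def)
      qed
    qed
    have "(\<integral>x. cmod (?w j x) * (norm x * (1 + norm x) ^ m) \<partial>lborel) = (\<integral>x. b ^ j *\<^sub>R ?h (pw (int j) x) \<partial>lborel)"
      using b0 by (simp add: w mult.assoc)
    also have "\<dots> = (\<integral>x. ?h x \<partial>lborel)" by (rule integral_pw[OF hm])
    also have "\<dots> \<le> (\<integral>x. (1 / r) ^ j * L ^ (m + 1) * ((1 + norm x) ^ (m + 1) * cmod (\<phi> x)) \<partial>lborel)"
      by (intro integral_mono hint hi hb)
    also have "\<dots> = (1 / r) ^ j * L ^ (m + 1) * I"
      unfolding I_def by (rule Bochner_Integration.integral_mult_right_zero)
    finally show ?thesis by (simp only: mult.assoc)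
  qed
  have "(\<lambda>j. (1 / r) ^ j * (L ^ (m + 1) * I)) \<longlonglongrightarrow> 0 * (L ^ (m + 1) * I)"
    by (intro tendsto_mult LIMSEQ_power_zero tendsto_const) (use r1 in simp)
  then have lim: "(\<lambda>j. (1 / r) ^ j * (L ^ (m + 1) * I)) \<longlonglongrightarrow> 0" by simp
  show "(\<lambda>j. \<integral>x. cmod (?w j x) * (norm x * (1 + norm x) ^ m) \<partial>lborel) \<longlonglongrightarrow> 0"
    by (rule Lim_null_comparison[OF _ lim], intro always_eventually allI) (use bd in simp)
qed

text \<open>The smooth approximations \<open>u * \<phi>\<^sub>k\<close> of \<open>u\<close> are dominated by the grand maximal function,
  and so is their weak limit.\<close>

lemma radial_grand_maximal_represents:
  obtains c :: real where "0 < c"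
    "\<And>u L. u \<in> tempered_distributions \<Longrightarrow> 0 < L \<Longrightarrow>
      (\<integral>\<^sup>+x\<in>{x. ennreal L < radial_grand_maximal A \<Delta> N u x}. radial_grand_maximal A \<Delta> N u x \<partial>lebesgue) < \<infinity> \<Longrightarrow>
      \<exists>f. f \<in> borel_measurable lebesgue \<and> u = distribution_of f \<and>
        (AE x in lebesgue. ennreal (cmod (f x)) \<le> ennreal c * radial_grand_maximal A \<Delta> N u x)"
proof -
  define G where "G x = exp (- (x \<bullet> x))" for x :: "real^'n"
  have GS: "(\<lambda>x. complex_of_real (G x)) \<in> Schwartz"
    unfolding G_def by (rule gauss_class_Schwartz[OF gauss_class.gauss])
  obtain a where a: "0 < a" "(\<lambda>x. complex_of_real a * complex_of_real (G x)) \<in> Schwartz_N A \<Delta> N"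
    using Schwartz_N_multiple[OF GS] by metis
  define \<phi> where "\<phi> x = complex_of_real a * complex_of_real (G x)" for x
  have \<phi>N: "\<phi> \<in> Schwartz_N A \<Delta> N" using a(2) unfolding \<phi>_def .
  have \<phi>: "\<phi> \<in> Schwartz" by (rule Schwartz_N_D[OF \<phi>N])
  \<comment> \<open>The total mass of the kernel, which scales the limit of the approximate
    identity.\<close>
  define c0 where "c0 = (\<integral>x. a * G x \<partial>lborel)"
  have Gi: "integrable lborel (\<lambda>x. a * G x)"
  proof -
    have "cmod (complex_of_real (G x)) = G x" for x by (simp add: G_def)
    then show ?thesis using Schwartz_integrable_weight[OF GS, of 0] by simp
  qed
  have c\<phi>: "(\<integral>x. \<phi> x \<partial>lborel) = complex_of_real c0"
    unfolding \<phi>_def c0_def by (simp only: of_real_mult[symmetric] integral_complex_of_real)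
  have c0: "0 < c0"
  proof -
    have pos: "0 < a * G x" for x using a(1) by (simp add: G_def)
    have "0 \<le> c0" unfolding c0_def by (rule Bochner_Integration.integral_nonneg) (rule less_imp_le[OF pos])
    moreover have "c0 \<noteq> 0"
    proof
      assume "c0 = 0"
      then have "AE x in lborel. a * G x = 0"
        using integral_nonneg_eq_0_iff_AE[OF Gi] less_imp_le[OF pos] unfolding c0_def by simp
      \<comment> \<open>The integrand is positive everywhere, so a vanishing integral would make the
        whole space a null set.\<close>
      then have "AE x in (lborel :: (real^'n) measure). False"
        by (rule AE_mp) (use pos in \<open>auto simp: less_le intro!: AE_I2\<close>)
      then show False
        using AE_iff_measurable[of UNIV "lborel :: (real^'n) measure" "\<lambda>_. False"] by (simp add: emeasure_lborel_UNIV)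
    qed
    ultimately show ?thesis by simp
  qed
  have "\<exists>f. f \<in> borel_measurable lebesgue \<and> u = distribution_of f \<and>
        (AE x in lebesgue. ennreal (cmod (f x)) \<le> ennreal (1 / c0) * radial_grand_maximal A \<Delta> N u x)"
    if u: "u \<in> tempered_distributions" and L: "0 < L"
      and T: "(\<integral>\<^sup>+x\<in>{x. ennreal L < radial_grand_maximal A \<Delta> N u x}. radial_grand_maximal A \<Delta> N u x \<partial>lebesgue) < \<infinity>" for u L
  proof -
    define F where "F = radial_grand_maximal A \<Delta> N u"
    have Fm [measurable]: "F \<in> borel_measurable lebesgue"
      unfolding F_def by (rule radial_grand_maximal_measurable[OF u])
    note TF = T[folded F_def]
    have S: "{x. ennreal L < F x} \<in> sets lebesgue"
      using measurable_sets[OF Fm, of "{ennreal L<..}"] by (simp add: vimage_def)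
    \<comment> \<open>Above \<open>L\<close> the function is integrable, and elsewhere it is
      bounded, so it is finite almost everywhere.\<close>
    have "AE x in lebesgue. F x * indicator {x. ennreal L < F x} x \<noteq> \<infinity>"
      by (rule nn_integral_noteq_infinite[OF borel_measurable_times_ennreal[OF Fm borel_measurable_indicator[OF S]]])
        (use TF in simp)
    then have fin: "AE x in lebesgue. F x \<noteq> \<infinity>"
      by (rule AE_mp) (auto intro!: AE_I2 simp: indicator_def)
    define H where "H x = enn2real (F x)" for x
    have Hm: "H \<in> borel_measurable lebesgue" unfolding H_def[abs_def] by measurable
    have FH: "AE x in lebesgue. F x = ennreal (H x)"
      using fin by (rule AE_mp) (auto intro!: AE_I2 simp: H_def top.not_eq_extremum)
    define g where "g j = convolve_distribution u (dilate_fun A (- int j) \<phi>)" for j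
    have gb: "g j \<in> borel_measurable borel" for j
      unfolding g_def convolve_distribution_def
      by (intro borel_measurable_continuous_onI tempered_conv_continuous u dilate_fun_Schwartz \<phi>)
    then have gm: "g j \<in> borel_measurable lebesgue" for j by (intro measurable_completion) simp
    have gH: "AE x in lebesgue. cmod (g j x) \<le> H x" for j
      using FH
    proof (rule AE_mp, intro AE_I2 impI)
      fix x assume "F x = ennreal (H x)"
      moreover have "ennreal (cmod (g j x)) \<le> F x" unfolding g_def F_def by (rule radial_grand_maximal_ge[OF \<phi>N])
      ultimately have "ennreal (cmod (g j x)) \<le> ennreal (H x)" by (simp only:)
      then show "cmod (g j x) \<le> H x" by (simp add: H_def)
    qed
    have H0: "0 \<le> H x" for x by (simp add: H_def)
    obtain f where f: "f \<in> borel_measurable lebesgue" "\<And>x. cmod (f x) \<le> H x"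
      "\<And>\<psi> l. \<psi> \<in> borel_measurable lebesgue \<Longrightarrow> integrable lebesgue (\<lambda>x. H x * cmod (\<psi> x)) \<Longrightarrow>
        (\<lambda>k. \<integral>x. \<psi> x * g k x \<partial>lebesgue) \<longlonglongrightarrow> l \<Longrightarrow> (\<integral>x. f x * \<psi> x \<partial>lebesgue) = l"
      using dominated_weak_limit[of g H, OF gm Hm H0 gH] by blast
    obtain B where B: "\<And>\<psi>. \<psi> \<in> Schwartz \<Longrightarrow>
      (\<integral>\<^sup>+x. F x * ennreal (cmod (\<psi> x)) \<partial>lebesgue) \<le> ennreal (B * Schwartz_seminorm (DIM(real^'n) + 1) [] \<psi>)"
      using nn_integral_mult_Schwartz_le[OF Fm L TF] by blast
    have rep: "(\<integral>x. f x * \<psi> x \<partial>lebesgue) = complex_of_real c0 * u \<psi>" if \<psi>: "\<psi> \<in> Schwartz" for \<psi>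
    proof (rule f(3))
      show \<psi>m [measurable]: "\<psi> \<in> borel_measurable lebesgue" by (rule Schwartz_lebesgue[OF \<psi>])
      show "integrable lebesgue (\<lambda>x. H x * cmod (\<psi> x))"
      proof (rule integrableI_nonneg)
        show "(\<lambda>x. H x * cmod (\<psi> x)) \<in> borel_measurable lebesgue" using Hm by measurable
        have "(\<integral>\<^sup>+x. ennreal (H x * cmod (\<psi> x)) \<partial>lebesgue) = (\<integral>\<^sup>+x. F x * ennreal (cmod (\<psi> x)) \<partial>lebesgue)"
          by (rule nn_integral_cong_AE, rule AE_mp[OF FH]) (auto intro!: AE_I2 simp: ennreal_mult H0)
        also have "\<dots> < \<infinity>" by (rule le_less_trans[OF B[OF \<psi>]]) simp
        finally show "(\<integral>\<^sup>+x. ennreal (H x * cmod (\<psi> x)) \<partial>lebesgue) < \<infinity>" .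
      qed (auto simp: H0)
      have "(\<integral>x. \<psi> x * g j x \<partial>lebesgue) = (\<integral>x. \<psi> x * g j x \<partial>lborel)" for j
        using gb[of j] Schwartz_borel[OF \<psi>] by (intro integral_completion) simp
      then show "(\<lambda>k. \<integral>x. \<psi> x * g k x \<partial>lebesgue) \<longlonglongrightarrow> complex_of_real c0 * u \<psi>"
        using dilated_approximate_identity[OF u \<phi> \<psi>] unfolding g_def c\<phi> by simp
    qed
    \<comment> \<open>The weak limit represents c0 u, so it has to be divided by the mass of the
      kernel.\<close>
    define f' where "f' x = complex_of_real (1 / c0) * f x" for x
    have "f' \<in> borel_measurable lebesgue" unfolding f'_def[abs_def] using f(1) by measurable
    moreover have "u = distribution_of f'"
    proof
      fix \<psi>
      show "u \<psi> = distribution_of f' \<psi>"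
      proof (cases "\<psi> \<in> Schwartz")
        case True
        have "(\<integral>x. f' x * \<psi> x \<partial>lebesgue) = complex_of_real (1 / c0) * (\<integral>x. f x * \<psi> x \<partial>lebesgue)"
          unfolding f'_def mult.assoc by (rule Bochner_Integration.integral_mult_right_zero)
        also have "\<dots> = u \<psi>" using c0 by (simp add: rep[OF True])
        finally show ?thesis using True by (simp add: distribution_of_def)
      next
        case False
        then show ?thesis using u by (simp add: tempered_distributions_def extensional_def distribution_of_def)
      qed
    qed
    moreover have "AE x in lebesgue. ennreal (cmod (f' x)) \<le> ennreal (1 / c0) * F x"
      using FH
    proof (rule AE_mp, intro AE_I2 impI)
      fix x assume F: "F x = ennreal (H x)"
      have "cmod (f' x) = (1 / c0) * cmod (f x)" using c0 unfolding f'_def norm_mult norm_of_real by simp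
      also have "\<dots> \<le> (1 / c0) * H x" using c0 by (intro mult_left_mono f(2)) auto
      finally have "ennreal (cmod (f' x)) \<le> ennreal ((1 / c0) * H x)" by (rule ennreal_leI)
      also have "\<dots> = ennreal (1 / c0) * F x" unfolding F using c0 by (intro ennreal_mult') simp
      finally show "ennreal (cmod (f' x)) \<le> ennreal (1 / c0) * F x" .
    qed
    ultimately show ?thesis unfolding F_def by blast
  qed
  then show ?thesis using that[of "1 / c0"] c0 by simp
qed

end

section \<open>Equality of the two spaces\<close>

context ellipsoid_dilation
begin

text \<open>The local log-Hoelder condition makes p continuous, which upgrades the essential lower
  bound to every point: a small ball around x has positive measure and hence contains some y with p
  y > s.\<close>

lemma C_log_ge_of_p_minus:
  assumes p: "p \<in> C_log A \<Delta>" and s: "ereal s < p_minus p"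
  shows "s \<le> p x"
proof (rule ccontr)
  assume "\<not> s \<le> p x"
  define d where "d = s - p x"
  have d: "0 < d" using \<open>\<not> s \<le> p x\<close> by (simp add: d_def)
  obtain C where C: "0 < C" "\<And>x y. \<bar>p x - p y\<bar> \<le> C / ln (exp 1 + 1 / \<rho> (x - y))"
    using p unfolding C_log_def by blast
  have lnb: "0 < ln b" using b1 by simp
  \<comment> \<open>On the ball of index -J around x the log-Hoelder bound is at most C / (J ln b),
    here made smaller than the gap d.\<close>
  obtain J :: nat where J: "C / (d * ln b) < real J" using reals_Archimedean2 by blast
  have J0: "0 < real J" using J C(1) d lnb by (meson divide_pos_pos less_trans mult_pos_pos)
  have ae: "AE y in lebesgue. s < p y"
    using esssup_AE[of "\<lambda>x. - ereal (p x)" lebesgue]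
  proof (rule AE_mp, intro AE_I2 impI)
    fix y assume "- ereal (p y) \<le> esssup lebesgue (\<lambda>x. - ereal (p x))"
    then have "p_minus p \<le> ereal (p y)" unfolding p_minus_def by (simp add: ereal_uminus_le_reorder)
    then have "ereal s < ereal (p y)" by (rule less_le_trans[OF s])
    then show "s < p y" by simp
  qed
  have "\<exists>y\<in>qball x (- int J). s < p y"
  proof (rule ccontr)
    assume no: "\<not> (\<exists>y\<in>qball x (- int J). s < p y)"
    have "AE y in lebesgue. y \<notin> qball x (- int J)"
      using ae by (rule AE_mp) (use no in \<open>auto intro!: AE_I2\<close>)
    then have "qball x (- int J) \<in> null_sets lebesgue"
      using AE_iff_null_sets[OF qball_sets] by blast
    then have "ennreal (b powi - int J) = 0" using emeasure_qball[of x "- int J"] null_setsD1 by metis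
    then have "b powi - int J \<le> 0" by (simp only: ennreal_eq_0_iff)
    then show False using bpow_pos[of "- int J"] by linarith
  qed
  then obtain y where y: "y \<in> qball x (- int J)" "s < p y" by blast
  have "x - y \<noteq> 0" using y(2) \<open>\<not> s \<le> p x\<close> by auto
  then obtain i where i: "x - y \<in> qball 0 (i + 1)" "x - y \<notin> qball 0 i" by (rule shell_exists)
  have \<rho>0: "0 < \<rho> (x - y)" unfolding step_norm_eq[OF i] by simp
  have "x - y \<in> qball 0 (- int J)" using y(1) mem_qball_sym mem_qball_0 by blast
  then have "\<rho> (x - y) \<le> b powi (- int J - 1)" by (rule step_norm_le)
  also have "\<dots> \<le> b powi (- int J)" using b1 by (intro power_int_increasing) auto
  also have "\<dots> = 1 / b ^ J" by (simp add: power_int_minus inverse_eq_divide)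
  finally have "b ^ J \<le> 1 / \<rho> (x - y)" using \<rho>0 b0 by (simp add: field_simps)
  then have "b ^ J \<le> exp 1 + 1 / \<rho> (x - y)" by (simp add: add_increasing)
  then have "ln (b ^ J) \<le> ln (exp 1 + 1 / \<rho> (x - y))" using b0 by (intro ln_mono) auto
  then have "J * ln b \<le> ln (exp 1 + 1 / \<rho> (x - y))" using b0 by (simp add: ln_realpow)
  moreover have Jb: "0 < J * ln b" using J0 lnb by simp
  ultimately have "C / ln (exp 1 + 1 / \<rho> (x - y)) \<le> C / (J * ln b)"
    using C(1) by (intro divide_left_mono mult_pos_pos[of "ln (exp 1 + 1 / \<rho> (x - y))" "J * ln b"]) linarith+
  also have "\<dots> < d" using J Jb d lnb C(1) by (simp add: field_simps)
  finally have "\<bar>p x - p y\<bar> < d" using C(2)[of x y] by simp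
  then show False using y(2) by (simp add: d_def)
qed

text \<open>A number s strictly between 1 and the essential infimum leaves room for the weak type
  estimate with exponent p / s >= 1. Division by s > 1 does not enlarge the log-Hoelder
  constants.\<close>

lemma C_log_Lorentz_exponent:
  assumes p: "p \<in> C_log A \<Delta>" and p1: "1 < p_minus p"
  obtains e C einf s where "Lorentz_exponent A \<Delta> r e C einf p s"
proof -
  obtain s where s: "ereal 1 < ereal s" "ereal s < p_minus p"
    using ereal_dense2[of 1 "p_minus p"] p1 by (auto simp: one_ereal_def)
  then have s1: "1 < s" by simp
  obtain Clog Cinf pinf where C: "0 < Clog" "0 < Cinf"
    "\<And>x y. \<bar>p x - p y\<bar> \<le> Clog / ln (exp 1 + 1 / \<rho> (x - y))"
    "\<And>x. \<bar>p x - pinf\<bar> \<le> Cinf / ln (exp 1 + \<rho> x)"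
    using p unfolding C_log_def by blast
  define e where "e x = p x / s" for x
  define D where "D = max Clog Cinf"
  have pm: "p \<in> borel_measurable lebesgue" using p by (simp add: C_log_def variable_exponents_def)
  have e1: "1 \<le> e x" for x using C_log_ge_of_p_minus[OF p s(2), of x] s1 by (simp add: e_def)
  have ln0: "0 \<le> ln (exp 1 + t)" if "0 \<le> t" for t :: real
    using that by (intro ln_ge_zero) (smt (verit) exp_ge_add_one_self)
  have "Lorentz_exponent A \<Delta> r e D (max 1 (pinf / s)) p s"
  proof
    show "e \<in> borel_measurable lebesgue" unfolding e_def[abs_def] using pm by simp
    show "1 \<le> e x" for x by (rule e1)
    show "1 \<le> max 1 (pinf / s)" by simp
    show "0 < D" using C(1) by (simp add: D_def)
    show "1 < s" by (rule s1)
    show "p x = s * e x" for x using s1 by (simp add: e_def)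
    show "\<bar>e x - e y\<bar> \<le> D / ln (exp 1 + 1 / \<rho> (x - y))" for x y
    proof -
      have "\<bar>e x - e y\<bar> = \<bar>p x - p y\<bar> / s" using s1 by (simp add: e_def diff_divide_distrib[symmetric])
      also have "\<dots> \<le> \<bar>p x - p y\<bar> / 1" using s1 by (intro divide_left_mono) auto
      also have "\<dots> \<le> Clog / ln (exp 1 + 1 / \<rho> (x - y))" using C(3) by simp
      also have "\<dots> \<le> D / ln (exp 1 + 1 / \<rho> (x - y))"
        using step_norm_nonneg by (intro divide_right_mono ln0) (auto simp: D_def)
      finally show ?thesis .
    qed
    show "\<bar>e x - max 1 (pinf / s)\<bar> \<le> D / ln (exp 1 + \<rho> x)" for x
    proof -
      \<comment> \<open>Since e x >= 1, raising the limit exponent to at least 1 only brings it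
        closer to e x.\<close>
      have "\<bar>e x - max 1 (pinf / s)\<bar> \<le> \<bar>e x - pinf / s\<bar>" using e1[of x] by auto
      also have "\<dots> = \<bar>p x - pinf\<bar> / s" using s1 by (simp add: e_def diff_divide_distrib[symmetric])
      also have "\<dots> \<le> \<bar>p x - pinf\<bar> / 1" using s1 by (intro divide_left_mono) auto
      also have "\<dots> \<le> Cinf / ln (exp 1 + \<rho> x)" using C(4) by simp
      also have "\<dots> \<le> D / ln (exp 1 + \<rho> x)"
        using step_norm_nonneg by (intro divide_right_mono ln0) (auto simp: D_def)
      finally show ?thesis .
    qed
  qed
  then show ?thesis by (rule that)
qed

end

lemma var_Lorentz_norm_level: "var_Lorentz_norm p q f = level_qnorm q (level p (\<lambda>x. ennreal (cmod (f x))))"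
  by (simp add: var_Lorentz_norm_def var_Lorentz_qnorm_level)

lemma Hardy_Lorentz_norm_level:
  "Hardy_Lorentz_norm A \<Delta> N p q u = level_qnorm q (level p (radial_grand_maximal A \<Delta> N u))"
  by (simp add: Hardy_Lorentz_norm_def var_Lorentz_qnorm_level)

context Lorentz_exponent
begin

lemma var_Lorentz_defines:
  assumes q: "0 < q" and f: "f \<in> var_Lorentz p q"
  shows "defines_tempered_distribution f"
proof -
  have fm [measurable]: "f \<in> borel_measurable lebesgue" and fin: "var_Lorentz_norm p q f < \<infinity>"
    using f by (auto simp: var_Lorentz_def)
  have Fm: "(\<lambda>x. ennreal (cmod (f x))) \<in> borel_measurable lebesgue" by measurable
  obtain L where L: "0 < L" "(\<integral>\<^sup>+x\<in>{x. ennreal L < ennreal (cmod (f x))}. ennreal (cmod (f x)) \<partial>lebesgue) < \<infinity>"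
    using level_qnorm_finite_integral[OF Fm q fin[unfolded var_Lorentz_norm_level]] by blast
  show ?thesis by (rule defines_tempered_distributionI[OF fm L])
qed

text \<open>Two constants multiply: the pointwise domination by the maximal operator, then the bound
  of that operator on distribution functions.\<close>

lemma Hardy_Lorentz_norm_le:
  assumes q: "0 < q" and N: "2 \<le> N"
  obtains D :: real where "0 < D"
    "\<And>f. f \<in> borel_measurable lebesgue \<Longrightarrow>
      Hardy_Lorentz_norm A \<Delta> N p q (distribution_of f) \<le> ennreal D * var_Lorentz_norm p q f"
proof -
  define c where "c = 1 + b * (1 / (1 - 1 / b))"
  have c: "0 < c" using b1 by (simp add: c_def add_pos_pos)
  obtain D1 where D1: "0 < D1"
    "\<And>F G :: real^'n \<Rightarrow> ennreal. AE x in lebesgue. F x \<le> ennreal c * G x \<Longrightarrow>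
      level_qnorm q (level p F) \<le> ennreal D1 * level_qnorm q (level p G)"
    using level_qnorm_AE_mono[OF q c] by blast
  obtain D2 where D2: "0 < D2"
    "\<And>F. F \<in> borel_measurable lebesgue \<Longrightarrow> (\<And>x. 0 \<le> F x) \<Longrightarrow>
      level_qnorm q (level p (maximal (\<lambda>x. ennreal (F x)))) \<le> ennreal D2 * level_qnorm q (level p (\<lambda>x. ennreal (F x)))"
    using level_qnorm_maximal[OF q] by blast
  have "Hardy_Lorentz_norm A \<Delta> N p q (distribution_of f) \<le> ennreal (D1 * D2) * var_Lorentz_norm p q f"
    if f [measurable]: "f \<in> borel_measurable lebesgue" for f
  proof -
    have fm: "(\<lambda>x. cmod (f x)) \<in> borel_measurable lebesgue" by measurable
    have "level_qnorm q (level p (radial_grand_maximal A \<Delta> N (distribution_of f))) \<le>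
        ennreal D1 * level_qnorm q (level p (maximal (\<lambda>x. ennreal (cmod (f x)))))"
      using radial_grand_maximal_le_maximal[OF f N] by (intro D1(2) AE_I2) (simp add: c_def)
    also have "\<dots> \<le> ennreal D1 * (ennreal D2 * level_qnorm q (level p (\<lambda>x. ennreal (cmod (f x)))))"
      by (intro mult_left_mono D2(2) fm) auto
    also have "\<dots> = ennreal (D1 * D2) * level_qnorm q (level p (\<lambda>x. ennreal (cmod (f x))))"
      using D1(1) D2(1) by (simp only: ennreal_mult less_imp_le mult.assoc)
    finally show ?thesis unfolding Hardy_Lorentz_norm_level var_Lorentz_norm_level .
  qed
  then show ?thesis using that[of "D1 * D2"] D1(1) D2(1) by simp
qed

text \<open>A finite quasi-norm makes the grand maximal function integrable above some height, which
  is the hypothesis of the representation. The pointwise domination of the representing function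
  then bounds its quasi-norm.\<close>

lemma Hardy_Lorentz_represents:
  assumes q: "0 < q"
  obtains D :: real where "0 < D"
    "\<And>u. u \<in> tempered_distributions \<Longrightarrow> Hardy_Lorentz_norm A \<Delta> N p q u < \<infinity> \<Longrightarrow>
      \<exists>f\<in>var_Lorentz p q. u = distribution_of f \<and> var_Lorentz_norm p q f \<le> ennreal D * Hardy_Lorentz_norm A \<Delta> N p q u"
proof -
  obtain c where c: "0 < c"
    "\<And>u L. u \<in> tempered_distributions \<Longrightarrow> 0 < L \<Longrightarrow>
      (\<integral>\<^sup>+x\<in>{x. ennreal L < radial_grand_maximal A \<Delta> N u x}. radial_grand_maximal A \<Delta> N u x \<partial>lebesgue) < \<infinity> \<Longrightarrow>
      \<exists>f. f \<in> borel_measurable lebesgue \<and> u = distribution_of f \<and>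
        (AE x in lebesgue. ennreal (cmod (f x)) \<le> ennreal c * radial_grand_maximal A \<Delta> N u x)"
    using radial_grand_maximal_represents by blast
  obtain D where D: "0 < D"
    "\<And>F G :: real^'n \<Rightarrow> ennreal. AE x in lebesgue. F x \<le> ennreal c * G x \<Longrightarrow>
      level_qnorm q (level p F) \<le> ennreal D * level_qnorm q (level p G)"
    using level_qnorm_AE_mono[OF q c(1)] by blast
  have "\<exists>f\<in>var_Lorentz p q. u = distribution_of f \<and> var_Lorentz_norm p q f \<le> ennreal D * Hardy_Lorentz_norm A \<Delta> N p q u"
    if u: "u \<in> tempered_distributions" and fin: "Hardy_Lorentz_norm A \<Delta> N p q u < \<infinity>" for u
  proof -
    obtain L where L: "0 < L"
      "(\<integral>\<^sup>+x\<in>{x. ennreal L < radial_grand_maximal A \<Delta> N u x}. radial_grand_maximal A \<Delta> N u x \<partial>lebesgue) < \<infinity>"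
      using level_qnorm_finite_integral[OF radial_grand_maximal_measurable[OF u] q fin[unfolded Hardy_Lorentz_norm_level]] by blast
    obtain f where f: "f \<in> borel_measurable lebesgue" "u = distribution_of f"
      "AE x in lebesgue. ennreal (cmod (f x)) \<le> ennreal c * radial_grand_maximal A \<Delta> N u x"
      using c(2)[OF u L] by blast
    have le: "var_Lorentz_norm p q f \<le> ennreal D * Hardy_Lorentz_norm A \<Delta> N p q u"
      unfolding Hardy_Lorentz_norm_level var_Lorentz_norm_level by (rule D(2)[OF f(3)])
    also have "\<dots> < \<infinity>" using fin by (simp add: ennreal_mult_less_top)
    finally have "f \<in> var_Lorentz p q" using f(1) by (simp add: var_Lorentz_def)
    then show ?thesis using f(2) le by blast
  qed
  then show ?thesis using that D(1) by blast
qed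

text \<open>Identifies the function produced by the weak limit with the one that was given, so that
  a bound for the former is a bound for the latter.\<close>

lemma distribution_of_inj:
  assumes q: "0 < q" and f: "f \<in> var_Lorentz p q" and g: "g \<in> var_Lorentz p q"
    and eq: "distribution_of f = distribution_of g"
  shows "AE x in lebesgue. f x = g x"
proof -
  have int: "integrable lebesgue (\<lambda>x. f x * \<psi> x)" "integrable lebesgue (\<lambda>x. g x * \<psi> x)" if "\<psi> \<in> Schwartz" for \<psi>
    using var_Lorentz_defines[OF q f] var_Lorentz_defines[OF q g] that
    by (auto simp: defines_tempered_distribution_def)
  have "AE x in lebesgue. f x - g x = 0"
  proof (rule Schwartz_test_zero)
    have "f \<in> borel_measurable lebesgue" "g \<in> borel_measurable lebesgue"
      using f g by (auto simp: var_Lorentz_def)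
    then show "(\<lambda>x. f x - g x) \<in> borel_measurable lebesgue" by (rule borel_measurable_diff)
    fix \<psi> :: "real^'n \<Rightarrow> complex" assume \<psi>: "\<psi> \<in> Schwartz"
    show "integrable lebesgue (\<lambda>x. (f x - g x) * \<psi> x)"
      unfolding left_diff_distrib by (rule Bochner_Integration.integrable_diff[OF int[OF \<psi>]])
    have "(\<integral>x. (f x - g x) * \<psi> x \<partial>lebesgue) = (\<integral>x. f x * \<psi> x \<partial>lebesgue) - (\<integral>x. g x * \<psi> x \<partial>lebesgue)"
      unfolding left_diff_distrib by (rule Bochner_Integration.integral_diff[OF int[OF \<psi>]])
    also have "\<dots> = distribution_of f \<psi> - distribution_of g \<psi>" using \<psi> by (simp add: distribution_of_def)
    finally show "(\<integral>x. (f x - g x) * \<psi> x \<partial>lebesgue) = 0" using eq by simp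
  qed
  then show ?thesis by simp
qed

lemma var_Lorentz_norm_AE_cong:
  assumes "AE x in lebesgue. f x = g x"
  shows "var_Lorentz_norm p q f = var_Lorentz_norm p q g"
proof -
  have "level p (\<lambda>x. ennreal (cmod (f x))) = level p (\<lambda>x. ennreal (cmod (g x)))"
    unfolding level_def by (intro ext antisym set_norm_AE_mono; use assms in \<open>eventually_elim; simp\<close>)
  then show ?thesis by (simp add: var_Lorentz_norm_level)
qed

end

theorem corollary6p3:
  fixes A :: "real^'n^'n" and \<Delta> :: "(real^'n) set" and r lambda_minus :: real
    and p :: "real^'n \<Rightarrow> real" and q :: ennreal and N :: nat
  assumes "dilation A"
    and "dilation_ellipsoid A \<Delta> r"
    and "admissible_lambda_minus A lambda_minus"
    and "p \<in> C_log A \<Delta>"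
    and "1 < p_minus p" and "p_minus p < \<infinity>"
    and "0 < q"
    and "\<lfloor>(1 / p_underline p - 1) * (ln (dilation_factor A) / ln lambda_minus)\<rfloor> + 2 \<le> int N"
  shows "(\<forall>f\<in>var_Lorentz p q. defines_tempered_distribution f) \<and>
    Hardy_Lorentz A \<Delta> N p q = distribution_of ` var_Lorentz p q \<and>
    (\<exists>C1 C2::real. 0 < C1 \<and> 0 < C2 \<and>
      (\<forall>f\<in>var_Lorentz p q.
         ennreal C1 * var_Lorentz_norm p q f \<le> Hardy_Lorentz_norm A \<Delta> N p q (distribution_of f) \<and>
         Hardy_Lorentz_norm A \<Delta> N p q (distribution_of f) \<le> ennreal C2 * var_Lorentz_norm p q f))"
proof -
  interpret D: ellipsoid_dilation A \<Delta> r by unfold_locales (rule assms(2))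
  obtain e C einf s where "Lorentz_exponent A \<Delta> r e C einf p s"
    using D.C_log_Lorentz_exponent[OF assms(4,5)] by blast
  then interpret Lorentz_exponent A \<Delta> r e C einf p s .
  \<comment> \<open>The factor in front of the quotient of logarithms vanishes, so the required
    order is 2.\<close>
  have "p_underline p = 1" using assms(5) by (simp add: p_underline_def min_def)
  then have N: "2 \<le> N" using assms(8) by simp
  note q = assms(7)
  obtain D2 where D2: "0 < D2" "\<And>f. f \<in> borel_measurable lebesgue \<Longrightarrow>
      Hardy_Lorentz_norm A \<Delta> N p q (distribution_of f) \<le> ennreal D2 * var_Lorentz_norm p q f"
    using Hardy_Lorentz_norm_le[OF q N] by blast
  obtain D3 where D3: "0 < D3" "\<And>u. u \<in> tempered_distributions \<Longrightarrow> Hardy_Lorentz_norm A \<Delta> N p q u < \<infinity> \<Longrightarrow>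
      \<exists>f\<in>var_Lorentz p q. u = distribution_of f \<and> var_Lorentz_norm p q f \<le> ennreal D3 * Hardy_Lorentz_norm A \<Delta> N p q u"
    using Hardy_Lorentz_represents[OF q] by blast
  have def: "defines_tempered_distribution f" if "f \<in> var_Lorentz p q" for f
    by (rule var_Lorentz_defines[OF q that])
  then have temp: "distribution_of f \<in> tempered_distributions" if "f \<in> var_Lorentz p q" for f
    using that by (simp add: defines_tempered_distribution_def)
  have upper: "Hardy_Lorentz_norm A \<Delta> N p q (distribution_of f) \<le> ennreal D2 * var_Lorentz_norm p q f"
    if "f \<in> var_Lorentz p q" for f
    using that by (intro D2(2)) (simp add: var_Lorentz_def)
  have fin: "Hardy_Lorentz_norm A \<Delta> N p q (distribution_of f) < \<infinity>" if f: "f \<in> var_Lorentz p q" for f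
  proof -
    have "ennreal D2 * var_Lorentz_norm p q f < \<infinity>"
      using f by (simp add: var_Lorentz_def ennreal_mult_less_top)
    then show ?thesis by (rule le_less_trans[OF upper[OF f]])
  qed
  have mem: "u \<in> Hardy_Lorentz A \<Delta> N p q \<longleftrightarrow> u \<in> tempered_distributions \<and> Hardy_Lorentz_norm A \<Delta> N p q u < \<infinity>" for u
    using D.radial_grand_maximal_measurable[of u N]
    by (auto simp: Hardy_Lorentz_def var_Lorentz_finite_def Hardy_Lorentz_norm_def)
  have "Hardy_Lorentz A \<Delta> N p q = distribution_of ` var_Lorentz p q"
  proof (intro equalityI subsetI)
    fix u assume "u \<in> Hardy_Lorentz A \<Delta> N p q"
    then show "u \<in> distribution_of ` var_Lorentz p q" using D3(2)[of u] mem[of u] by blast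
  next
    fix u assume "u \<in> distribution_of ` var_Lorentz p q"
    then show "u \<in> Hardy_Lorentz A \<Delta> N p q" using temp fin mem by blast
  qed
  moreover have "ennreal (1 / D3) * var_Lorentz_norm p q f \<le> Hardy_Lorentz_norm A \<Delta> N p q (distribution_of f)"
    if f: "f \<in> var_Lorentz p q" for f
  proof -
    \<comment> \<open>The representation theorem yields some function with the same distribution;
      uniqueness transfers its norm bound to f.\<close>
    obtain g where g: "g \<in> var_Lorentz p q" "distribution_of f = distribution_of g"
      "var_Lorentz_norm p q g \<le> ennreal D3 * Hardy_Lorentz_norm A \<Delta> N p q (distribution_of f)"
      using D3(2)[OF temp[OF f] fin[OF f]] by blast
    have "var_Lorentz_norm p q f = var_Lorentz_norm p q g"
      by (rule var_Lorentz_norm_AE_cong[OF distribution_of_inj[OF q f g(1,2)]])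
    then have "ennreal (1 / D3) * var_Lorentz_norm p q f \<le> ennreal (1 / D3) * (ennreal D3 * Hardy_Lorentz_norm A \<Delta> N p q (distribution_of f))"
      using g(3) by (intro mult_left_mono) auto
    also have "\<dots> = (ennreal (1 / D3) * ennreal D3) * Hardy_Lorentz_norm A \<Delta> N p q (distribution_of f)"
      by (simp only: mult.assoc)
    also have "ennreal (1 / D3) * ennreal D3 = ennreal (1 / D3 * D3)"
      using D3(1) by (intro ennreal_mult'[symmetric]) simp
    also have "1 / D3 * D3 = 1" using D3(1) by simp
    finally show ?thesis by simp
  qed
  moreover have "0 < 1 / D3" using D3(1) by simp
  ultimately show ?thesis using def upper D2(1) by blast
qed

end
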